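(* Let $d\ge 2$ and let $P_n$ be the spherical convex hull of $n\ge d+1$ independent uniform random points on the closed halfsphere $\mathbb{S}_e^+\subset\mathbb{S}^d$. Then, as $n\to\infty$, $$\mathbb{E}\,\sigma(\mathbb{S}_e^+\setminus P_n)=C(d)\,\pi^{d+1}\left(\frac{2}{\omega_{d+1}}\right)^{d}\omega_d\,n^{-1}+O\left(n^{-2}\right),$$ where $$C(d)=\int_{(e^\perp\cap\mathbb{S}^+_{\bar e})^d}\nabla_d(u_1,\dots,u_d)\int_{\mathrm{conv}_s\{u_1,\dots,u_d\}}\langle x,\bar e\rangle\,\sigma_{d-1}(\mathrm{d}x)\,\sigma_{d-1}^d(\mathrm{d}(u_1,\dots,u_d))$$ for any unit vector $\bar e$ with $\bar e\perp e$ (the value depends only on $d$). Further, $$\lim_{n\to\infty}\mathbb{E}\, f_0(P_n)=C(d)\,\pi^{d+1}\left(\frac{2}{\omega_{d+1}}\right)^{d+1}\omega_d .$$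
   Context: $d\ge 2$ is an integer; $\mathbb{S}^d$ is the unit sphere of $\mathbb{R}^{d+1}$ with standard scalar product $\langle\cdot,\cdot\rangle$; $\sigma$ is the spherical Lebesgue measure on $\mathbb{S}^d$ and $\sigma_{d-1}$ the $(d-1)$-dimensional spherical Lebesgue measure on $(d-1)$-dimensional great subspheres (here on $e^\perp\cap\mathbb{S}^d$); $\sigma_{d-1}^d$ is its $d$-fold product. For $k\ge 1$, $\omega_k=2\pi^{k/2}/\Gamma(k/2)$ (so $\omega_{d+1}=\sigma(\mathbb{S}^d)$). For $v\in\mathbb{S}^d$, $\mathbb{S}_v^+=\{u\in\mathbb{S}^d:\langle u,v\rangle\ge 0\}$. Fix $e\in\mathbb{S}^d$; $\mu=\frac{2}{\omega_{d+1}}\,\sigma$ restricted to $\mathbb{S}_e^+$ is the uniform probability measure on $\mathbb{S}_e^+$. Let $X_1,\dots,X_n$ be independent random points in $\mathbb{S}_e^+$, each with distribution $\mu$, and $P_n=\mathrm{conv}_s\{X_1,\dots,X_n\}$, where $\mathrm{conv}_s(A)=\mathbb{S}^d\cap\mathrm{pos}\,A$ and $\mathrm{pos}$ denotes the positive hull in $\mathbb{R}^{d+1}$ (the set of all finite linear combinations with nonnegative coefficients). $\nabla_d(u_1,\dots,u_d)$ is the $d$-dimensional volume of the parallelepiped spanned by $u_1,\dots,u_d\in\mathbb{R}^{d+1}$. A spherical polytope is an intersection $C\cap\mathbb{S}^d$ with $C$ a pointed closed convex polyhedral cone in $\mathbb{R}^{d+1}$; $f_0(P)$ is the number of its vertices,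 i.e. of the one-dimensional faces (extreme rays) of $C$. Almost surely $P_n$ is a spherical polytope. *)

theory Defs
  imports "HOL-Analysis.Analysis" "HOL-Probability.Probability" "HOL-Library.Landau_Symbols"
begin

definition omega :: "nat \<Rightarrow> real" where
  "omega k = 2 * pi powr (real k / 2) / Gamma (real k / 2)"

(* Lebesgue measure of a linear subspace L, transported from coordinate space by an orthonormal
   basis of L, in the same way as lborel is built from Basis.  The result does not depend on the
   choice of the orthonormal basis. *)
definition orthonormal_basis :: "'a::euclidean_space set \<Rightarrow> 'a set" where
  "orthonormal_basis L = (SOME B. pairwise orthogonal B \<and> (\<forall>b\<in>B. norm b = 1) \<and> span B = L)"

definition subspace_lborel :: "'a::euclidean_space set \<Rightarrow> 'a measure" where
  "subspace_lborel L =
     distr (Pi\<^sub>M (orthonormal_basis L) (\<lambda>_. lborel)) borel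
       (\<lambda>f. \<Sum>b\<in>orthonormal_basis L. f b *\<^sub>R b)"

(* If N is Lebesgue measure of a k-dimensional linear space L, this is spherical Lebesgue measure
   on the unit sphere of L: a Borel set A of unit vectors receives the measure
   k * N {t *\<^sub>R x | t x. 0 < t \<and> t \<le> 1 \<and> x \<in> A}.  (Note that sgn x = x /\<^sub>R norm x.) *)
definition spherical_part :: "nat \<Rightarrow> 'a::euclidean_space measure \<Rightarrow> 'a measure" where
  "spherical_part k N = distr (density N (\<lambda>x. of_nat k * indicator (cball 0 1) x)) borel sgn"

definition sphere_measure :: "'a::euclidean_space measure" where
  "sphere_measure = spherical_part DIM('a) lborel"

definition hyperplane :: "'a::euclidean_space \<Rightarrow> 'a set" where
  "hyperplane e = {x. x \<bullet> e = 0}"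

definition subsphere_measure :: "'a::euclidean_space set \<Rightarrow> 'a measure" where
  "subsphere_measure L = spherical_part (dim L) (subspace_lborel L)"

definition halfsphere :: "'a::euclidean_space \<Rightarrow> 'a set" where
  "halfsphere v = {u \<in> sphere 0 1. 0 \<le> u \<bullet> v}"

definition halfsphere_uniform :: "'a::euclidean_space \<Rightarrow> 'a measure" where
  "halfsphere_uniform e =
     density sphere_measure (\<lambda>x. ennreal (2 / omega DIM('a)) * indicator (halfsphere e) x)"

definition pos :: "'a::euclidean_space set \<Rightarrow> 'a set" where
  "pos A = {\<Sum>a\<in>F. c a *\<^sub>R a | F c. finite F \<and> F \<subseteq> A \<and> (\<forall>a\<in>F. 0 \<le> c a)}"

definition conv_s :: "'a::euclidean_space set \<Rightarrow> 'a set" where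
  "conv_s A = sphere 0 1 \<inter> pos A"

(* For a pointed polyhedral cone C and P = C \<inter> sphere 0 1 one has C = pos P, so this is the number
   of extreme rays of C. *)
definition f0 :: "'a::euclidean_space set \<Rightarrow> nat" where
  "f0 P = card {F. F face_of pos P \<and> aff_dim F = 1}"

(* The d-dimensional volume of a parallelepiped, measured in a d-dimensional linear subspace L that
   contains u 1, ..., u d.  It is 0 if these vectors are linearly dependent. *)
definition parallelepiped :: "nat \<Rightarrow> (nat \<Rightarrow> 'a::euclidean_space) \<Rightarrow> 'a set" where
  "parallelepiped d u = {\<Sum>i=1..d. t i *\<^sub>R u i | t. \<forall>i\<in>{1..d}. 0 \<le> t i \<and> t i \<le> 1}"

definition nabla :: "'a::euclidean_space set \<Rightarrow> nat \<Rightarrow> (nat \<Rightarrow> 'a) \<Rightarrow> real" where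
  "nabla L d u = measure (subspace_lborel L) (parallelepiped d u)"

definition C_const :: "nat \<Rightarrow> 'a::euclidean_space \<Rightarrow> 'a \<Rightarrow> real" where
  "C_const d e ebar =
     (LINT u : Pi\<^sub>E {1..d} (\<lambda>_. hyperplane e \<inter> halfsphere ebar)
          | Pi\<^sub>M {1..d} (\<lambda>_. subsphere_measure (hyperplane e)).
        nabla (hyperplane e) d u *
        (LINT x : conv_s (u ` {1..d}) | subsphere_measure (hyperplane e). x \<bullet> ebar))"

lemma measurable_sgn_borel [measurable]:
  "(sgn :: 'a::euclidean_space \<Rightarrow> 'a) \<in> borel_measurable borel"
  unfolding sgn_div_norm by measurable

lemma measurable_ball_density [measurable]:
  "(\<lambda>x::'a::euclidean_space. of_nat k * indicator (cball 0 1) x :: ennreal) \<in> borel_measurable borel"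
  by (intro borel_measurable_times_ennreal borel_measurable_indicator) auto

lemma orthonormal_basis:
  fixes L :: "'a::euclidean_space set"
  assumes "subspace L"
  shows "pairwise orthogonal (orthonormal_basis L)"
    and "\<And>b. b \<in> orthonormal_basis L \<Longrightarrow> norm b = 1"
    and "span (orthonormal_basis L) = L"
proof -
  have "\<exists>B. pairwise orthogonal B \<and> (\<forall>b\<in>B. norm b = 1) \<and> span B = L"
    using orthonormal_basis_subspace[OF assms] by metis
  from someI_ex[OF this]
  show "pairwise orthogonal (orthonormal_basis L)"
    and "\<And>b. b \<in> orthonormal_basis L \<Longrightarrow> norm b = 1"
    and "span (orthonormal_basis L) = L"
    unfolding orthonormal_basis_def by auto
qed

lemma emeasure_sphere_measure:
  fixes A :: "'a::euclidean_space set"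
  assumes [measurable]: "A \<in> sets borel" and A: "A \<subseteq> sphere 0 1"
  shows "emeasure sphere_measure A =
    of_nat DIM('a) * emeasure lborel {t *\<^sub>R x | t x. 0 < t \<and> t \<le> 1 \<and> x \<in> A}"
proof -
  have eq: "{t *\<^sub>R x | t x. 0 < t \<and> t \<le> 1 \<and> x \<in> A} = cball 0 1 \<inter> sgn -` A"
    (is "?K = _")
  proof (intro equalityI subsetI)
    fix y assume "y \<in> ?K"
    then obtain t x where "y = t *\<^sub>R x" "0 < t" "t \<le> 1" "x \<in> A" by blast
    with A show "y \<in> cball 0 1 \<inter> sgn -` A" by (auto simp: sgn_div_norm)
  next
    fix y :: 'a assume y: "y \<in> cball 0 1 \<inter> sgn -` A"
    then have "sgn y \<in> A" by simp
    with A have "y \<noteq> 0" by auto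
    with y have "y = norm y *\<^sub>R sgn y" "0 < norm y" "norm y \<le> 1"
      by (auto simp: sgn_div_norm)
    with \<open>sgn y \<in> A\<close> show "y \<in> ?K" by blast
  qed
  have V [measurable]: "sgn -` A \<in> sets (borel :: 'a measure)"
    using measurable_sets[OF measurable_sgn_borel assms(1)] by simp
  have "emeasure sphere_measure A =
      (\<integral>\<^sup>+x. (of_nat DIM('a) * indicator (cball 0 1) x) * indicator (sgn -` A) x \<partial>lborel)"
    unfolding sphere_measure_def spherical_part_def
    by (subst emeasure_distr, simp, simp, subst emeasure_density) auto
  also have "\<dots> = (\<integral>\<^sup>+x. of_nat DIM('a) * indicator (cball 0 1 \<inter> sgn -` A) x \<partial>(lborel :: 'a measure))"
    by (intro nn_integral_cong) (auto simp: indicator_def)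
  also have "\<dots> = of_nat DIM('a) * emeasure lborel (cball 0 1 \<inter> sgn -` A)"
    by (subst nn_integral_cmult) (auto intro!: borel_measurable_indicator)
  finally show ?thesis unfolding eq .
qed

lemma emeasure_sphere_measure_total:
  "emeasure (sphere_measure :: 'a::euclidean_space measure) (space sphere_measure) =
     ennreal (omega DIM('a))"
proof -
  have "emeasure (sphere_measure :: 'a measure) (space sphere_measure) =
      (\<integral>\<^sup>+x. of_nat DIM('a) * indicator (cball 0 1) x \<partial>(lborel :: 'a measure))"
    unfolding sphere_measure_def spherical_part_def
    by (subst emeasure_distr, simp, simp, subst emeasure_density) auto
  also have "\<dots> = of_nat DIM('a) * emeasure lborel (cball (0::'a) 1)"
    by (subst nn_integral_cmult) (auto intro!: borel_measurable_indicator)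
  also have "\<dots> = ennreal (real DIM('a) * unit_ball_vol (real DIM('a)))"
    by (simp add: emeasure_cball ennreal_of_nat_eq_real_of_nat ennreal_mult)
  also have "real DIM('a) * unit_ball_vol (real DIM('a)) = omega DIM('a)"
  proof -
    have "real DIM('a) / 2 > 0" by simp
    then have n: "real DIM('a) / 2 \<notin> \<int>\<^sub>\<le>\<^sub>0" and g: "Gamma (real DIM('a) / 2) > 0"
      using nonpos_Ints_nonpos[of "real DIM('a) / 2"] by (linarith, intro Gamma_real_pos)
    show ?thesis using g
      unfolding unit_ball_vol_def omega_def Gamma_plus1[OF n] by (simp add: divide_simps)
  qed
  finally show ?thesis .
qed

end

(* Points of the halfsphere are represented by radial projections of points (y, t) of the upper half
   of the unit ball of R^d x R, where e becomes (0, 1).  Both expectations reduce to the probability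
   p_n that a further random point misses the cone generated by n random points: the expected missed
   volume is omega_(d+1) / 2 * p_n, and the expected number of vertices is n * p_(n-1), because in
   general position the vertices are the points that are not in the cone of the others.

   Up to an exponentially small probability the projections of the points to R^d meet every open
   orthant.  Then (y, t) misses the cone iff it lies below the facet over y.  A facet is the graph
   t = <a, y> over the cone of d of the points such that the other points lie above it.  The
   substitution t_i = <a, y_i> has Jacobian |det (y_1, ..., y_d)| and turns p_n into
   (n choose d) times the integral of (1 - arctan |a| / pi)^(n - d) J(a) over a in R^d, where
   J(a) = |a| J_0 (1 + O(|a|^2)).  In polar coordinates, with s = arctan |a| / pi, this is a Beta
   integral, and p_n = K / (n + 1) + O(n^-2).  Since the determinant is homogeneous, J_0 is the
   constant C(d) of the theorem up to the change from spherical to Lebesgue measure. *)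
theory Submission
  imports Defs
begin

section \<open>Lebesgue measure and linear isometries\<close>

lemma emeasure_translation_invariant:
  fixes M :: "'a::euclidean_space measure"
  assumes M: "sets M = sets borel" and inv: "\<And>c. distr M borel ((+) c) = M"
    and A: "A \<in> sets borel"
  shows "emeasure M {x. x + c \<in> A} = emeasure M A"
proof -
  have "emeasure M A = emeasure (distr M borel ((+) c)) A" using inv by simp
  also have "\<dots> = emeasure M ((+) c -` A \<inter> space M)"
    using A by (intro emeasure_distr) (auto simp: measurable_cong_sets[OF M refl])
  also have "(+) c -` A \<inter> space M = {x. x + c \<in> A}"
    using sets_eq_imp_space_eq[OF M] by (auto simp: add.commute)
  finally show ?thesis by simp
qed

text \<open>Both sides are iterated integrals of \<open>\<lambda>(x, y). indicator A x * indicator (ball 0 1) (x - y)\<close>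
  with respect to the product measure.\<close>
lemma translation_invariant_proportional:
  fixes M N :: "'a::euclidean_space measure"
  assumes M: "sets M = sets borel" "sigma_finite_measure M" "\<And>c. distr M borel ((+) c) = M"
    and N: "sets N = sets borel" "sigma_finite_measure N" "\<And>c. distr N borel ((+) c) = N"
    and A: "A \<in> sets borel"
  shows "emeasure M A * emeasure N (ball 0 1) = emeasure M (ball 0 1) * emeasure N A"
proof -
  interpret pair_sigma_finite M N using M(2) N(2) by (rule pair_sigma_finite.intro)
  note [measurable] = A
  have [measurable_cong]: "sets M = sets borel" "sets N = sets borel" by fact+
  let ?B = "ball (0::'a) 1"
  have [measurable]: "?B \<in> sets borel" by simp
  have "emeasure M A * emeasure N ?B = (\<integral>\<^sup>+x. indicator A x * emeasure N ?B \<partial>M)"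
    using A M(1) by (simp add: nn_integral_multc)
  also have "\<dots> = (\<integral>\<^sup>+x. (\<integral>\<^sup>+y. indicator A x * indicator ?B (x - y) \<partial>N) \<partial>M)"
  proof (rule nn_integral_cong)
    fix x
    have "(\<integral>\<^sup>+y. indicator ?B (x - y) \<partial>N) = (\<integral>\<^sup>+y. indicator {y. y + (-x) \<in> ?B} y \<partial>N)"
      by (intro nn_integral_cong) (auto simp: indicator_def norm_minus_commute)
    also have "\<dots> = emeasure N {y. y + (-x) \<in> ?B}"
    proof (rule nn_integral_indicator)
      have "{y. y + (-x) \<in> ?B} = ball x 1" by (auto simp: dist_norm norm_minus_commute)
      then show "{y. y + (-x) \<in> ?B} \<in> sets N" using N(1) by simp
    qed
    also have "\<dots> = emeasure N ?B" by (intro emeasure_translation_invariant N) simp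
    finally have eq: "(\<integral>\<^sup>+y. indicator ?B (x - y) \<partial>N) = emeasure N ?B" .
    have "(\<lambda>y. indicator ?B (x - y) :: ennreal) \<in> borel_measurable N" by measurable
    then show "indicator A x * emeasure N ?B = (\<integral>\<^sup>+y. indicator A x * indicator ?B (x - y) \<partial>N)"
      by (simp add: nn_integral_cmult eq)
  qed
  also have "\<dots> = (\<integral>\<^sup>+y. (\<integral>\<^sup>+x. indicator A x * indicator ?B (x - y) \<partial>M) \<partial>N)"
    by (rule Fubini'[symmetric]) measurable
  also have "\<dots> = (\<integral>\<^sup>+y. (\<integral>\<^sup>+x. indicator A (x + y) * indicator ?B x \<partial>M) \<partial>N)"
  proof (rule nn_integral_cong)
    fix y
    have "(\<integral>\<^sup>+x. indicator A x * indicator ?B (x - y) \<partial>M)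
        = (\<integral>\<^sup>+x. indicator A x * indicator ?B (x - y) \<partial>distr M borel ((+) y))"
      using M(3) by simp
    also have "\<dots> = (\<integral>\<^sup>+x. indicator A (y + x) * indicator ?B (y + x - y) \<partial>M)"
      by (rule nn_integral_distr) measurable
    finally show "(\<integral>\<^sup>+x. indicator A x * indicator ?B (x - y) \<partial>M)
        = (\<integral>\<^sup>+x. indicator A (x + y) * indicator ?B x \<partial>M)" by (simp add: add.commute)
  qed
  also have "\<dots> = (\<integral>\<^sup>+x. (\<integral>\<^sup>+y. indicator A (x + y) * indicator ?B x \<partial>N) \<partial>M)"
    by (rule Fubini') measurable
  also have "\<dots> = (\<integral>\<^sup>+x. indicator ?B x * emeasure N A \<partial>M)"
  proof (rule nn_integral_cong)
    fix x
    have "(\<integral>\<^sup>+y. indicator A (x + y) \<partial>N) = (\<integral>\<^sup>+y. indicator {y. y + x \<in> A} y \<partial>N)"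
      by (intro nn_integral_cong) (auto simp: indicator_def add.commute)
    also have "\<dots> = emeasure N {y. y + x \<in> A}" by (intro nn_integral_indicator) measurable
    also have "\<dots> = emeasure N A" by (intro emeasure_translation_invariant N A)
    finally show "(\<integral>\<^sup>+y. indicator A (x + y) * indicator ?B x \<partial>N) = indicator ?B x * emeasure N A"
      by (subst nn_integral_multc) (auto simp: mult.commute)
  qed
  also have "\<dots> = emeasure M ?B * emeasure N A"
    by (simp add: nn_integral_multc)
  finally show ?thesis .
qed

lemma sigma_finite_measure_balls:
  fixes M :: "'a::euclidean_space measure"
  assumes M: "sets M = sets borel" and fin: "\<And>n::nat. emeasure M (ball 0 (real n)) < \<infinity>"
  shows "sigma_finite_measure M"
proof
  show "\<exists>A. countable A \<and> A \<subseteq> sets M \<and> \<Union>A = space M \<and> (\<forall>a\<in>A. emeasure M a \<noteq> \<infinity>)"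
  proof (intro exI[of _ "range (\<lambda>n::nat. ball 0 (real n))"] conjI ballI)
    have "\<exists>n::nat. norm x < real n" for x :: 'a using reals_Archimedean2 by blast
    then show "\<Union> (range (\<lambda>n::nat. ball (0::'a) (real n))) = space M"
      using sets_eq_imp_space_eq[OF M] by auto
  qed (use fin in \<open>auto simp: M less_top\<close>)
qed

lemma distr_translation_linear:
  fixes f :: "'a::euclidean_space \<Rightarrow> 'b::euclidean_space"
  assumes "linear f" "surj f"
  shows "distr (distr lborel borel f) borel ((+) c) = distr lborel borel f"
proof -
  have [measurable]: "f \<in> borel_measurable borel"
    by (intro borel_measurable_continuous_onI linear_continuous_on linear_conv_bounded_linear[THEN iffD1]
        assms)
  obtain b where b: "f b = c" using assms(2) by (metis surjD)
  have "distr (distr lborel borel f) borel ((+) c) = distr lborel borel (\<lambda>x. c + f x)"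
    by (subst distr_distr) (auto simp: o_def)
  also have "(\<lambda>x. c + f x) = f \<circ> ((+) b)"
    using b linear_add[OF assms(1)] by (auto simp: fun_eq_iff)
  also have "distr lborel borel (f \<circ> ((+) b)) = distr (distr lborel borel ((+) b)) borel f"
    by (subst distr_distr) (auto simp: o_def)
  finally show ?thesis by (simp add: lborel_distr_plus)
qed

lemma distr_lborel_linear_scaled:
  fixes f :: "'a::euclidean_space \<Rightarrow> 'b::euclidean_space"
  assumes f: "linear f" "surj f"
    and fin: "\<And>n::nat. emeasure lborel (f -` ball 0 (real n)) < \<infinity>"
    and A: "A \<in> sets borel"
  shows "emeasure lborel (f -` A) * emeasure lborel (ball (0::'b) 1)
    = emeasure lborel (f -` ball 0 1) * emeasure lborel A"
proof -
  have [measurable]: "f \<in> borel_measurable borel"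
    by (intro borel_measurable_continuous_onI linear_continuous_on linear_conv_bounded_linear[THEN iffD1] f)
  have e: "emeasure (distr lborel borel f) B = emeasure lborel (f -` B)" if "B \<in> sets borel" for B
    using that by (subst emeasure_distr) auto
  have "emeasure (distr lborel borel f) A * emeasure lborel (ball (0::'b) 1)
    = emeasure (distr lborel borel f) (ball 0 1) * emeasure lborel A"
    by (rule translation_invariant_proportional)
      (use A fin in \<open>auto intro!: sigma_finite_measure_balls distr_translation_linear f
         simp: lborel_distr_plus e sigma_finite_lborel\<close>)
  then show ?thesis using A by (simp add: e)
qed

lemma emeasure_lborel_ball_pos_finite:
  "emeasure lborel (ball (0::'a::euclidean_space) 1) \<noteq> 0"
  "emeasure lborel (ball (0::'a::euclidean_space) r) < \<infinity>"
proof -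
  show "emeasure lborel (ball (0::'a::euclidean_space) 1) \<noteq> 0"
    using unit_ball_vol_pos[of "real DIM('a)"] by (simp add: emeasure_ball del: unit_ball_vol_pos)
  show "emeasure lborel (ball (0::'a::euclidean_space) r) < \<infinity>"
    by (cases "r \<ge> 0") (auto simp: emeasure_ball ball_empty)
qed

lemma lborel_isometry:
  fixes f :: "'a::euclidean_space \<Rightarrow> 'b::euclidean_space"
  assumes f: "linear f" "\<And>x. norm (f x) = norm x" and dim: "DIM('a) = DIM('b)"
  shows "distr lborel borel f = lborel"
proof (rule measure_eqI)
  have [measurable]: "f \<in> borel_measurable borel"
    by (intro borel_measurable_continuous_onI linear_continuous_on linear_conv_bounded_linear[THEN iffD1] f)
  fix A assume "A \<in> sets (distr lborel borel f)"
  then have A: "A \<in> sets borel" by simp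
  have "inj f"
    by (metis f linear_injective_0 norm_eq_zero)
  obtain g :: "'b \<Rightarrow> 'a" where g: "linear g" "\<And>y. norm (g y) = norm y"
    using isomorphisms_UNIV_UNIV[OF dim] by metis
  have "inj (f \<circ> g)" by (metis (no_types, lifting) comp_apply f g linear_compose linear_injective_0
      norm_eq_zero)
  then have "surj (f \<circ> g)"
    using linear_injective_imp_surjective[of "f \<circ> g"] linear_compose[OF g(1) f(1)] by auto
  then have "surj f" by (metis comp_surj fun.set_map image_comp surj_def comp_apply)
  have pre: "f -` ball 0 r = ball 0 r" for r using f(2) by auto
  have "emeasure lborel (f -` A) * emeasure lborel (ball (0::'b) 1)
    = emeasure lborel (f -` ball 0 1) * emeasure lborel A"
    by (rule distr_lborel_linear_scaled)
       (use f \<open>surj f\<close> A emeasure_lborel_ball_pos_finite(2)[where 'a='a] in \<open>auto simp: pre\<close>)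
  also have "emeasure lborel (f -` ball 0 1) = emeasure lborel (ball (0::'b) 1)"
    using dim by (simp add: pre emeasure_ball)
  finally have "emeasure lborel (f -` A) = emeasure lborel A"
    using emeasure_lborel_ball_pos_finite[where 'a='b]
    by (metis ennreal_mult_cancel_left infinity_ennreal_def less_irrefl mult.commute)
  then show "emeasure (distr lborel borel f) A = emeasure lborel A"
    using A by (subst emeasure_distr) auto
qed simp

lemma nn_integral_lborel_isometry:
  fixes f :: "'a::euclidean_space \<Rightarrow> 'b::euclidean_space"
  assumes f: "linear f" "\<And>x. norm (f x) = norm x" and dim: "DIM('a) = DIM('b)"
    and F: "F \<in> borel_measurable borel"
  shows "(\<integral>\<^sup>+x. F (f x) \<partial>lborel) = (\<integral>\<^sup>+x. F x \<partial>lborel)"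
proof -
  have [measurable]: "f \<in> borel_measurable borel"
    by (intro borel_measurable_continuous_onI linear_continuous_on linear_conv_bounded_linear[THEN iffD1] f)
  show ?thesis
    using F by (subst lborel_isometry[OF f dim, symmetric], subst nn_integral_distr) auto
qed

lemma nn_integral_lborel_scaleR:
  fixes F :: "'a::euclidean_space \<Rightarrow> ennreal"
  assumes c: "c > 0" and [measurable]: "F \<in> borel_measurable borel"
  shows "(\<integral>\<^sup>+x. F x \<partial>lborel) = ennreal (c ^ DIM('a)) * (\<integral>\<^sup>+x. F (c *\<^sub>R x) \<partial>lborel)"
proof -
  have "(\<integral>\<^sup>+x. F x \<partial>lborel) = (\<integral>\<^sup>+x. F x \<partial>density (distr lborel borel (\<lambda>x::'a. 0 + c *\<^sub>R x)) (\<lambda>_.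
      \<bar>c\<bar>^DIM('a)))"
    using lborel_affine[of c "0::'a"] c by simp
  also have "\<dots> = (\<integral>\<^sup>+x. ennreal (c ^ DIM('a)) * F (c *\<^sub>R x) \<partial>lborel)"
    using c by (subst nn_integral_density, simp, simp) (subst nn_integral_distr, auto)
  finally show ?thesis by (simp add: nn_integral_cmult)
qed

lemma distr_PiM_vec_lambda:
  "distr (Pi\<^sub>M UNIV (\<lambda>_::'m::finite. lborel)) borel vec_lambda
      = (lborel :: ('v::euclidean_space ^ 'm) measure)"
proof (rule lborel_eqI[symmetric])
  have meas [measurable]: "vec_lambda \<in> Pi\<^sub>M UNIV (\<lambda>_::'m. lborel :: 'v measure) \<rightarrow>\<^sub>M borel"
  proof (subst borel_measurable_euclidean_space, intro ballI)
    fix b :: "'v ^ 'm" assume "b \<in> Basis"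
    then obtain i u where b: "b = axis i u" by (auto simp: Basis_vec_def)
    show "(\<lambda>x. vec_lambda x \<bullet> b) \<in> borel_measurable (Pi\<^sub>M UNIV (\<lambda>_::'m. lborel))"
      by (simp add: b inner_axis)
  qed
  fix l u :: "'v ^ 'm"
  assume lu: "\<And>b. b \<in> Basis \<Longrightarrow> l \<bullet> b \<le> u \<bullet> b"
  interpret product_sigma_finite "\<lambda>_::'m. lborel :: 'v measure" ..
  have pre: "vec_lambda -` box l u \<inter> space (Pi\<^sub>M UNIV (\<lambda>_::'m. lborel))
      = Pi\<^sub>E UNIV (\<lambda>i. box (l $ i) (u $ i))"
    by (auto simp: space_PiM box_def Basis_vec_def inner_axis PiE_def Pi_def)
  have inj: "inj_on (\<lambda>(i, b). axis i b :: 'v ^ 'm) (UNIV \<times> Basis)"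
    by (auto simp: inj_on_def axis_eq_axis)
  have Bas: "(Basis :: ('v ^ 'm) set) = (\<lambda>(i, b). axis i b) ` (UNIV \<times> Basis)"
    by (auto simp: Basis_vec_def)
  have "emeasure (distr (Pi\<^sub>M UNIV (\<lambda>_::'m. lborel)) borel vec_lambda) (box l u)
      = emeasure (Pi\<^sub>M UNIV (\<lambda>_::'m. lborel)) (Pi\<^sub>E UNIV (\<lambda>i. box (l $ i) (u $ i)))"
    by (subst emeasure_distr) (auto simp: pre)
  also have "\<dots> = (\<Prod>i\<in>UNIV. emeasure lborel (box (l $ i) (u $ i)))"
    by (rule emeasure_PiM) auto
  also have "\<dots> = (\<Prod>i\<in>UNIV. ennreal (\<Prod>b\<in>Basis. (u - l) \<bullet> axis i b))"
  proof (intro prod.cong refl)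
    fix i :: 'm
    have "l $ i \<bullet> b \<le> u $ i \<bullet> b" if "b \<in> Basis" for b
      using lu[of "axis i b"] that by (auto simp: Basis_vec_def inner_axis)
    then show "emeasure lborel (box (l $ i) (u $ i)) = ennreal (\<Prod>b\<in>Basis. (u - l) \<bullet> axis i b)"
      by (subst emeasure_lborel_box) (auto simp: inner_axis)
  qed
  also have "\<dots> = ennreal (\<Prod>i\<in>UNIV. \<Prod>b\<in>Basis. (u - l) \<bullet> axis i b)"
  proof (rule prod_ennreal)
    fix i :: 'm
    have "axis i b \<in> Basis" if "b \<in> Basis" for b :: 'v using that by (auto simp: Basis_vec_def)
    then show "0 \<le> (\<Prod>b\<in>Basis. (u - l) \<bullet> axis i b)"
      using lu by (auto intro!: prod_nonneg simp: inner_diff_left)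
  qed
  also have "(\<Prod>i\<in>UNIV. \<Prod>b\<in>Basis. (u - l) \<bullet> axis i b) = (\<Prod>b\<in>Basis. (u - l) \<bullet> b)"
    unfolding Bas by (subst prod.reindex[OF inj]) (simp add: prod.cartesian_product o_def case_prod_unfold)
  finally show "emeasure (distr (Pi\<^sub>M UNIV (\<lambda>_::'m. lborel)) borel vec_lambda) (box l u)
      = (\<Prod>b\<in>Basis. (u - l) \<bullet> b)" .
qed simp

lemma measurable_vec_lambda [measurable]:
  "vec_lambda \<in> Pi\<^sub>M UNIV (\<lambda>_::'m::finite. borel :: 'v::euclidean_space measure) \<rightarrow>\<^sub>M borel"
proof (subst borel_measurable_euclidean_space, intro ballI)
  fix b :: "'v ^ 'm" assume "b \<in> Basis"
  then obtain i u where b: "b = axis i u" by (auto simp: Basis_vec_def)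
  show "(\<lambda>x. vec_lambda x \<bullet> b) \<in> borel_measurable (Pi\<^sub>M UNIV (\<lambda>_::'m. borel))"
    by (simp add: b inner_axis)
qed

lemma measurable_vec_nth [measurable]:
  "(\<lambda>x::'v::euclidean_space ^ 'm::finite. x $ i) \<in> borel_measurable borel"
  by (intro borel_measurable_continuous_onI continuous_intros)

lemma nn_integral_lborel_vec_prod:
  fixes h :: "'m::finite \<Rightarrow> 'v::euclidean_space \<Rightarrow> ennreal"
  assumes [measurable]: "\<And>i. h i \<in> borel_measurable borel"
  shows "(\<integral>\<^sup>+Y. (\<Prod>i\<in>UNIV. h i (Y $ i)) \<partial>(lborel :: ('v ^ 'm) measure)) = (\<Prod>i\<in>UNIV. \<integral>\<^sup>+y. h i y \<partial>lborel)"
proof -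
  interpret product_sigma_finite "\<lambda>_::'m. lborel :: 'v measure" ..
  have "vec_lambda \<in> Pi\<^sub>M UNIV (\<lambda>_::'m. lborel :: 'v measure) \<rightarrow>\<^sub>M borel"
    using measurable_vec_lambda by (simp cong: measurable_cong_sets sets_PiM_cong)
  then show ?thesis
    by (subst distr_PiM_vec_lambda[symmetric], subst nn_integral_distr)
      (auto intro!: product_nn_integral_prod)
qed

lemma nn_integral_PiM_density_vec:
  fixes g :: "'v::euclidean_space \<Rightarrow> ennreal" and \<beta> :: "'m::finite \<Rightarrow> 'i"
  assumes \<beta>: "bij_betw \<beta> UNIV I" and [measurable]: "g \<in> borel_measurable borel"
    and sf: "sigma_finite_measure (density lborel g)"
    and F [measurable]: "F \<in> borel_measurable (Pi\<^sub>M I (\<lambda>_. borel))"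
  shows "(\<integral>\<^sup>+z. F z \<partial>Pi\<^sub>M I (\<lambda>_. density lborel g))
    = (\<integral>\<^sup>+Y. (\<Prod>i\<in>UNIV. g (Y $ i)) * F (\<lambda>i\<in>I. Y $ inv_into UNIV \<beta> i) \<partial>(lborel :: ('v ^ 'm) measure))"
proof -
  let ?T = "\<lambda>Y::'v ^ 'm. \<lambda>i\<in>I. Y $ inv_into UNIV \<beta> i"
  let ?D = "density lborel (\<lambda>Y::'v ^ 'm. \<Prod>i\<in>UNIV. g (Y $ i))"
  interpret product_sigma_finite "\<lambda>_::'i. density lborel g"
    using sf by (simp add: product_sigma_finite_def)
  have finI: "finite I" using bij_betw_finite[OF \<beta>] by simp
  have [measurable]: "?T \<in> borel \<rightarrow>\<^sub>M Pi\<^sub>M I (\<lambda>_. borel)" by measurable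
  have "distr ?D (Pi\<^sub>M I (\<lambda>_. borel)) ?T = Pi\<^sub>M I (\<lambda>_. density lborel g)"
  proof (rule PiM_eqI[OF finI])
    show "sets (distr ?D (Pi\<^sub>M I (\<lambda>_. borel)) ?T) = sets (Pi\<^sub>M I (\<lambda>_. density lborel g))"
      by (simp cong: sets_PiM_cong)
    fix A :: "'i \<Rightarrow> 'v set" assume "\<And>i. i \<in> I \<Longrightarrow> A i \<in> sets (density lborel g)"
    then have A: "\<And>i. i \<in> I \<Longrightarrow> A i \<in> sets borel" by simp
    have [measurable]: "A (\<beta> i) \<in> sets borel" for i
      using A \<beta> by (auto simp: bij_betw_def)
    have inv: "inv_into UNIV \<beta> (\<beta> i) = i" for i
      using \<beta> by (auto simp: bij_betw_def)
    have AI: "Pi\<^sub>E I A \<in> sets (Pi\<^sub>M I (\<lambda>_. borel))" using A finI by auto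
    have ind: "(indicator (?T -` Pi\<^sub>E I A) Y :: ennreal) = (\<Prod>i\<in>UNIV. indicator (A (\<beta> i)) (Y $ i))" for Y
    proof -
      have "?T Y \<in> Pi\<^sub>E I A \<longleftrightarrow> (\<forall>i\<in>\<beta> ` UNIV. Y $ inv_into UNIV \<beta> i \<in> A i)"
        using \<beta> by (auto simp: bij_betw_def PiE_def Pi_def)
      also have "\<dots> \<longleftrightarrow> (\<forall>i. Y $ i \<in> A (\<beta> i))" by (auto simp: inv)
      finally have "?T Y \<in> Pi\<^sub>E I A \<longleftrightarrow> (\<forall>i. Y $ i \<in> A (\<beta> i))" .
      then show ?thesis
        by (auto simp: indicator_def prod_zero_iff)
    qed
    have "?T -` Pi\<^sub>E I A \<in> sets borel"
      using measurable_sets[OF _ AI, of ?T borel] by simp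
    then have "emeasure (distr ?D (Pi\<^sub>M I (\<lambda>_. borel)) ?T) (Pi\<^sub>E I A)
       = (\<integral>\<^sup>+Y. (\<Prod>i\<in>UNIV. g (Y $ i)) * indicator (?T -` Pi\<^sub>E I A) Y \<partial>lborel)"
      using AI by (subst emeasure_distr) (auto simp: emeasure_density)
    also have "\<dots> = (\<integral>\<^sup>+Y. (\<Prod>i\<in>UNIV. g (Y $ i) * indicator (A (\<beta> i)) (Y $ i)) \<partial>lborel)"
      by (simp add: ind prod.distrib)
    also have "\<dots> = (\<Prod>i\<in>UNIV. emeasure (density lborel g) (A (\<beta> i)))"
      by (subst nn_integral_lborel_vec_prod) (auto simp: emeasure_density)
    also have "\<dots> = (\<Prod>i\<in>I. emeasure (density lborel g) (A i))"
      using prod.reindex_bij_betw[OF \<beta>] .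
    finally show "emeasure (distr ?D (Pi\<^sub>M I (\<lambda>_. borel)) ?T) (Pi\<^sub>E I A)
      = (\<Prod>i\<in>I. emeasure (density lborel g) (A i))" .
  qed
  then have "(\<integral>\<^sup>+z. F z \<partial>Pi\<^sub>M I (\<lambda>_. density lborel g)) = (\<integral>\<^sup>+z. F z \<partial>distr ?D (Pi\<^sub>M I (\<lambda>_. borel)) ?T)"
    by simp
  also have "\<dots> = (\<integral>\<^sup>+Y. (\<Prod>i\<in>UNIV. g (Y $ i)) * F (?T Y) \<partial>lborel)"
    by (subst nn_integral_distr, simp, simp) (subst nn_integral_density, auto)
  finally show ?thesis .
qed

lemma distr_PiM_map:
  assumes I: "finite I" and f [measurable]: "f \<in> N \<rightarrow>\<^sub>M K"
    and sf: "sigma_finite_measure N" "sigma_finite_measure (distr N K f)"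
  shows "distr (Pi\<^sub>M I (\<lambda>_. N)) (Pi\<^sub>M I (\<lambda>_. K)) (\<lambda>z. \<lambda>i\<in>I. f (z i)) = Pi\<^sub>M I (\<lambda>_. distr N K f)"
proof -
  interpret K: product_sigma_finite "\<lambda>_. distr N K f" using sf by (simp add: product_sigma_finite_def)
  interpret N: product_sigma_finite "\<lambda>_. N" using sf by (simp add: product_sigma_finite_def)
  show ?thesis
  proof (rule K.PiM_eqI[OF I])
    show "sets (distr (Pi\<^sub>M I (\<lambda>_. N)) (Pi\<^sub>M I (\<lambda>_. K)) (\<lambda>z. \<lambda>i\<in>I. f (z i)))
        = sets (Pi\<^sub>M I (\<lambda>_. distr N K f))"
      by (simp cong: sets_PiM_cong)
    fix A assume "\<And>i. i \<in> I \<Longrightarrow> A i \<in> sets (distr N K f)"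
    then have A: "\<And>i. i \<in> I \<Longrightarrow> A i \<in> sets K" by simp
    have "emeasure (distr (Pi\<^sub>M I (\<lambda>_. N)) (Pi\<^sub>M I (\<lambda>_. K)) (\<lambda>z. \<lambda>i\<in>I. f (z i))) (Pi\<^sub>E I A)
        = emeasure (Pi\<^sub>M I (\<lambda>_. N)) ((\<lambda>z. \<lambda>i\<in>I. f (z i)) -` Pi\<^sub>E I A \<inter> space (Pi\<^sub>M I (\<lambda>_. N)))"
      using A I by (intro emeasure_distr) auto
    also have "(\<lambda>z. \<lambda>i\<in>I. f (z i)) -` Pi\<^sub>E I A \<inter> space (Pi\<^sub>M I (\<lambda>_. N)) = Pi\<^sub>E I (\<lambda>i. f -` A i \<inter> space N)"
      by (auto simp: space_PiM PiE_def Pi_def)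
    also have "emeasure (Pi\<^sub>M I (\<lambda>_. N)) \<dots> = (\<Prod>i\<in>I. emeasure N (f -` A i \<inter> space N))"
      using A I by (intro N.emeasure_PiM) auto
    also have "\<dots> = (\<Prod>i\<in>I. emeasure (distr N K f) (A i))"
      using A by (intro prod.cong refl emeasure_distr[symmetric]) auto
    finally show "emeasure (distr (Pi\<^sub>M I (\<lambda>_. N)) (Pi\<^sub>M I (\<lambda>_. K)) (\<lambda>z. \<lambda>i\<in>I. f (z i))) (Pi\<^sub>E I A)
       = (\<Prod>i\<in>I. emeasure (distr N K f) (A i))" .
  qed
qed

section \<open>Linear changes of variables\<close>

lemma borel_measurable_linear:
  fixes f :: "'a::euclidean_space \<Rightarrow> 'b::euclidean_space"
  assumes "linear f"
  shows "f \<in> borel_measurable borel"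
  by (intro borel_measurable_continuous_onI linear_continuous_on linear_conv_bounded_linear[THEN iffD1]
      assms)

lemma distr_lborel_matrix_vector_mult:
  fixes A :: "real ^ 'm::{finite,wellorder} ^ 'm::_"
  assumes A: "det A \<noteq> 0"
  shows "distr lborel borel ((*v) A) = density lborel (\<lambda>_. ennreal (1 / \<bar>det A\<bar>))"
proof (rule measure_eqI)
  have inv: "invertible A" using A invertible_det_nz by blast
  then obtain B where AB: "A ** B = mat 1" "B ** A = mat 1" by (auto simp: invertible_def)
  let ?f = "(*v) A" and ?g = "(*v) B"
  have [measurable]: "?f \<in> borel_measurable borel"
      by (intro borel_measurable_linear matrix_vector_mul_linear)
  have fg: "?f (?g x) = x" and gf: "?g (?f x) = x" for x
    by (simp_all add: matrix_vector_mul_assoc AB)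
  have det: "\<bar>det (B)\<bar> = 1 / \<bar>det A\<bar>"
  proof -
    have "det (B) * det A = 1" by (metis det_I det_mul AB(2))
    then have "\<bar>det (B)\<bar> * \<bar>det A\<bar> = 1" by (metis abs_mult abs_one)
    then show ?thesis using A by (simp add: field_simps)
  qed
  have ball: "emeasure lborel (?f -` ball 0 r)
      = ennreal (1 / \<bar>det A\<bar>) * emeasure lborel (ball (0::(real,'m) vec) r)" for r
  proof -
    have pre: "?f -` ball 0 r = ?g ` ball 0 r"
      by (metis bij_vimage_eq_inv_image bij_betw_def fg gf inv_equality surjI inj_on_inverseI)
    have lm: "?g ` ball 0 r \<in> lmeasurable" "ball (0::(real,'m) vec) r \<in> lmeasurable"
      by (auto intro!: measurable_linear_image matrix_vector_mul_linear)
    have b: "?g ` ball 0 r \<in> sets borel"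
      using measurable_sets[of ?f borel borel "ball 0 r"] by (simp add: pre)
    have "emeasure lborel (?g ` ball 0 r) = emeasure lebesgue (?g ` ball 0 r)" using b by simp
    also have "\<dots> = ennreal (measure lebesgue (?g ` ball 0 r))"
      by (rule emeasure_eq_ennreal_measure) (rule fmeasurableD2[OF lm(1)])
    also have "measure lebesgue (?g ` ball 0 r)
        = 1 / \<bar>det A\<bar> * measure lebesgue (ball (0::(real,'m) vec) r)"
      using lm(2) by (subst measure_linear_image) (auto simp: det)
    also have "ennreal \<dots> = ennreal (1 / \<bar>det A\<bar>) * ennreal (measure lebesgue (ball (0::(real,'m) vec) r))"
      by (rule ennreal_mult) auto
    also have "ennreal (measure lebesgue (ball (0::(real,'m) vec) r))
        = emeasure lebesgue (ball (0::(real,'m) vec) r)"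
      by (rule emeasure_eq_ennreal_measure[symmetric]) (rule fmeasurableD2[OF lm(2)])
    finally show ?thesis by (simp add: pre)
  qed
  fix S assume "S \<in> sets (distr lborel borel ?f)"
  then have S: "S \<in> sets borel" by simp
  have "emeasure lborel (?f -` S) * emeasure lborel (ball (0::(real,'m) vec) 1)
    = emeasure lborel (?f -` ball 0 1) * emeasure lborel S"
  proof (rule distr_lborel_linear_scaled)
    show "surj ?f" using fg by (metis surjI)
    show "emeasure lborel (?f -` ball 0 (real n)) < \<infinity>" for n
      using emeasure_lborel_ball_pos_finite(2)[where 'a="(real,'m) vec"]
      by (simp add: ball ennreal_mult_less_top)
  qed (use S in auto)
  also have "\<dots> = (ennreal (1 / \<bar>det A\<bar>) * emeasure lborel S) * emeasure lborel (ball (0::(real,'m) vec) 1)"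
    by (simp add: ball mult_ac)
  finally have "emeasure lborel (?f -` S) = ennreal (1 / \<bar>det A\<bar>) * emeasure lborel S"
    using emeasure_lborel_ball_pos_finite[where 'a="(real,'m) vec"]
    by (metis ennreal_mult_cancel_left infinity_ennreal_def less_irrefl mult.commute)
  then show "emeasure (distr lborel borel ?f) S = emeasure (density lborel (\<lambda>_. ennreal (1 / \<bar>det A\<bar>))) S"
    using S by (subst emeasure_distr) (auto simp: emeasure_density nn_integral_cmult)
qed simp

lemma nn_integral_matrix_vector_mult:
  fixes A :: "real ^ 'm::{finite,wellorder} ^ 'm::_"
  assumes A: "det A \<noteq> 0" and F [measurable]: "F \<in> borel_measurable borel"
  shows "(\<integral>\<^sup>+t. F t \<partial>lborel) = ennreal \<bar>det A\<bar> * (\<integral>\<^sup>+a. F (A *v a) \<partial>lborel)"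
proof -
  have [measurable]: "(*v) A \<in> borel_measurable borel"
      by (intro borel_measurable_linear matrix_vector_mul_linear)
  have "(\<integral>\<^sup>+a. F (A *v a) \<partial>lborel) = (\<integral>\<^sup>+t. F t \<partial>distr lborel borel ((*v) A))"
    by (subst nn_integral_distr) auto
  also have "\<dots> = ennreal (1 / \<bar>det A\<bar>) * (\<integral>\<^sup>+t. F t \<partial>lborel)"
    by (subst distr_lborel_matrix_vector_mult[OF A]) (simp add: nn_integral_density nn_integral_cmult)
  finally have "ennreal \<bar>det A\<bar> * (\<integral>\<^sup>+a. F (A *v a) \<partial>lborel)
      = (ennreal \<bar>det A\<bar> * ennreal (1 / \<bar>det A\<bar>)) * (\<integral>\<^sup>+t. F t \<partial>lborel)" by (simp add: mult_ac)
  also have "ennreal \<bar>det A\<bar> * ennreal (1 / \<bar>det A\<bar>) = 1"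
    using A by (simp add: ennreal_mult[symmetric])
  finally show ?thesis by simp
qed

lemma continuous_on_det:
  "continuous_on S (det :: real ^ 'm ^ 'm::finite \<Rightarrow> real)"
  unfolding det_def by (intro continuous_intros)

lemma borel_measurable_det [measurable (raw)]:
  assumes [measurable]: "\<And>i. (\<lambda>x. f x $ i) \<in> borel_measurable M"
  shows "(\<lambda>x. det (f x :: real ^ 'm ^ 'm::finite)) \<in> borel_measurable M"
proof -
  have [measurable]: "(\<lambda>x. f x $ i $ j) \<in> borel_measurable M" for i j
    using measurable_compose[OF assms measurable_vec_nth] by simp
  show ?thesis unfolding det_def by measurable
qed

text \<open>The coefficients of the linear functional that takes the values \<open>t\<close> on the rows of \<open>Y\<close>, by
  Cramer's rule so that measurability is evident; junk if the rows are linearly dependent.\<close>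
definition row_solution :: "real ^ 'm ^ 'm \<Rightarrow> real ^ 'm \<Rightarrow> real ^ 'm::finite" where
  "row_solution Y t = (\<chi> k. det (\<chi> i j. if j = k then t $ i else Y $ i $ j) / det Y)"

lemma row_solution_iff:
  assumes "det Y \<noteq> 0"
  shows "row_solution Y t = a \<longleftrightarrow> (\<forall>i. a \<bullet> (Y $ i) = t $ i)"
proof -
  have "Y *v a = t \<longleftrightarrow> a = row_solution Y t"
    using cramer[OF assms, of a t] by (simp add: row_solution_def)
  moreover have "Y *v a = t \<longleftrightarrow> (\<forall>i. a \<bullet> (Y $ i) = t $ i)"
    by (auto simp: vec_eq_iff matrix_vector_mult_def inner_vec_def mult.commute)
  ultimately show ?thesis by auto
qed

lemma borel_measurable_vecI:
  fixes f :: "'w \<Rightarrow> 'v::euclidean_space ^ 'm::finite"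
  assumes "\<And>i. (\<lambda>x. f x $ i) \<in> borel_measurable M"
  shows "f \<in> borel_measurable M"
proof (subst borel_measurable_euclidean_space, intro ballI)
  fix b :: "'v ^ 'm" assume "b \<in> Basis"
  then obtain i u where "b = axis i u" by (auto simp: Basis_vec_def)
  then show "(\<lambda>x. f x \<bullet> b) \<in> borel_measurable M" using assms by (simp add: inner_axis)
qed

lemma borel_measurable_row_solution [measurable (raw)]:
  assumes [measurable]: "\<And>i. (\<lambda>x. Y x $ i) \<in> borel_measurable M" "\<And>i. (\<lambda>x. t x $ i) \<in> borel_measurable M"
  shows "(\<lambda>x. row_solution (Y x) (t x) :: real ^ 'm::finite) \<in> borel_measurable M"
proof (rule borel_measurable_vecI)
  fix k
  have [measurable]: "(\<lambda>x. Y x $ i $ j) \<in> borel_measurable M" for i j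
    using measurable_compose[OF assms(1) measurable_vec_nth] by simp
  have "(\<lambda>x. (\<chi> i j. if j = k then t x $ i else Y x $ i $ j) $ i :: real ^ 'm) \<in> borel_measurable M" for i
    by (rule borel_measurable_vecI) simp
  then have "(\<lambda>x. det (\<chi> i j. if j = k then t x $ i else Y x $ i $ j)) \<in> borel_measurable M"
    by (rule borel_measurable_det)
  then show "(\<lambda>x. row_solution (Y x) (t x) $ k) \<in> borel_measurable M"
    unfolding row_solution_def by simp
qed

lemma det_eq_0_iff_row_relation:
  fixes Y :: "real ^ 'm ^ 'm::finite"
  shows "det Y = 0 \<longleftrightarrow> (\<exists>c. c \<noteq> 0 \<and> (\<Sum>i\<in>UNIV. c $ i *\<^sub>R Y $ i) = 0)"
proof -
  have "transpose Y *v c = (\<Sum>i\<in>UNIV. c $ i *\<^sub>R Y $ i)" for c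
    by (simp add: vec_eq_iff matrix_vector_mult_def transpose_def mult.commute)
  then show ?thesis
    using invertible_det_nz[of "transpose Y"] invertible_left_inverse[of "transpose Y"]
      matrix_left_invertible_ker[of "transpose Y"] by (auto simp: det_transpose)
qed

section \<open>Positive hulls and their extreme rays\<close>

lemma convex_cone_sum:
  assumes "convex_cone S" "finite K" "\<And>k. k \<in> K \<Longrightarrow> 0 \<le> c k" "\<And>k. k \<in> K \<Longrightarrow> x k \<in> S"
  shows "(\<Sum>k\<in>K. c k *\<^sub>R x k) \<in> S"
  using assms(2-)
proof (induction K rule: finite_induct)
  case (insert k K)
  then have "c k *\<^sub>R x k + (\<Sum>k\<in>K. c k *\<^sub>R x k) \<in> S"
    by (intro convex_cone_add[OF assms(1)] convex_cone_scaleR[OF assms(1)]) auto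
  then show ?case using insert by simp
qed (simp add: convex_cone_contains_0[OF assms(1)])

lemma pos_eq_convex_cone_hull: "pos A = convex_cone hull A"
proof
  show "pos A \<subseteq> convex_cone hull A"
  proof
    fix p assume "p \<in> pos A"
    then obtain F c where "p = (\<Sum>a\<in>F. c a *\<^sub>R a)" "finite F" "F \<subseteq> A" "\<forall>a\<in>F. 0 \<le> c a"
      by (auto simp: pos_def)
    moreover from this have "(\<Sum>a\<in>F. c a *\<^sub>R a) \<in> convex_cone hull A"
      by (intro convex_cone_sum[OF convex_cone_convex_cone_hull] hull_inc) auto
    ultimately show "p \<in> convex_cone hull A" by simp
  qed
  have zero: "0 \<in> pos A" unfolding pos_def by (auto intro!: exI[of _ "{}"])
  have add: "x + y \<in> pos A" if "x \<in> pos A" "y \<in> pos A" for x y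
  proof -
    obtain F c where F: "x = (\<Sum>a\<in>F. c a *\<^sub>R a)" "finite F" "F \<subseteq> A" "\<forall>a\<in>F. 0 \<le> c a"
      using \<open>x \<in> pos A\<close> by (auto simp: pos_def)
    obtain G d where G: "y = (\<Sum>a\<in>G. d a *\<^sub>R a)" "finite G" "G \<subseteq> A" "\<forall>a\<in>G. 0 \<le> d a"
      using \<open>y \<in> pos A\<close> by (auto simp: pos_def)
    let ?c = "\<lambda>a. if a \<in> F then c a else 0" and ?d = "\<lambda>a. if a \<in> G then d a else 0"
    have "x = (\<Sum>a\<in>F\<union>G. ?c a *\<^sub>R a)" "y = (\<Sum>a\<in>F\<union>G. ?d a *\<^sub>R a)"
      using F G by (auto intro!: sum.mono_neutral_cong_left)
    then have "x + y = (\<Sum>a\<in>F\<union>G. (?c a + ?d a) *\<^sub>R a)"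
      by (simp only: scaleR_add_left sum.distrib)
    moreover have "\<forall>a\<in>F\<union>G. 0 \<le> ?c a + ?d a" using F G by auto
    ultimately show ?thesis using F(2,3) G(2,3) unfolding pos_def
      by (intro CollectI exI[of _ "F \<union> G"] exI[of _ "\<lambda>a. ?c a + ?d a"]) auto
  qed
  have scale: "s *\<^sub>R x \<in> pos A" if "x \<in> pos A" "0 \<le> s" for x s
  proof -
    obtain F c where F: "x = (\<Sum>a\<in>F. c a *\<^sub>R a)" "finite F" "F \<subseteq> A" "\<forall>a\<in>F. 0 \<le> c a"
      using \<open>x \<in> pos A\<close> by (auto simp: pos_def)
    then show ?thesis using \<open>0 \<le> s\<close> unfolding pos_def
      by (intro CollectI exI[of _ F] exI[of _ "\<lambda>a. s * c a"]) (auto simp: scaleR_sum_right)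
  qed
  show "convex_cone hull A \<subseteq> pos A"
  proof (rule hull_minimal)
    show "A \<subseteq> pos A"
    proof
      fix a assume "a \<in> A"
      then show "a \<in> pos A" unfolding pos_def
        by (intro CollectI exI[of _ "{a}"] exI[of _ "\<lambda>_. 1"]) auto
    qed
    show "convex_cone (pos A)" using zero add scale by (auto simp: convex_cone_iff)
  qed
qed

lemma convex_cone_pos: "convex_cone (pos A)"
  by (simp add: pos_eq_convex_cone_hull convex_cone_convex_cone_hull)

lemma pos_superset: "A \<subseteq> pos A"
  by (simp add: pos_eq_convex_cone_hull hull_subset)

lemma pos_minimal: "A \<subseteq> S \<Longrightarrow> convex_cone S \<Longrightarrow> pos A \<subseteq> S"
  by (simp add: pos_eq_convex_cone_hull hull_minimal)

lemma pos_mono: "A \<subseteq> B \<Longrightarrow> pos A \<subseteq> pos B"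
  by (simp add: pos_eq_convex_cone_hull hull_mono)

lemma pos_zero: "0 \<in> pos A"
  by (simp add: convex_cone_contains_0 convex_cone_pos)

lemma pos_scaleR: "x \<in> pos A \<Longrightarrow> 0 \<le> c \<Longrightarrow> c *\<^sub>R x \<in> pos A"
  by (simp add: convex_cone_scaleR convex_cone_pos)

lemma pos_linear_image: "linear f \<Longrightarrow> pos (f ` A) = f ` pos A"
  by (simp add: pos_eq_convex_cone_hull convex_cone_hull_linear_image)

lemma closed_pos: "finite A \<Longrightarrow> closed (pos A)"
  by (simp add: pos_eq_convex_cone_hull closed_convex_cone_hull)

lemma pos_Un: "pos (S \<union> T) = {a + b | a b. a \<in> pos S \<and> b \<in> pos T}"
  unfolding pos_eq_convex_cone_hull convex_cone_hull_Un by blast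

lemma pos_subset_span: "pos A \<subseteq> span A"
  by (intro pos_minimal span_superset) (simp add: convex_cone_span)

lemma pos_image:
  assumes K: "finite K"
  shows "pos (x ` K) = {\<Sum>k\<in>K. c k *\<^sub>R x k | c. \<forall>k\<in>K. 0 \<le> c k}" (is "_ = ?R")
proof
  show "?R \<subseteq> pos (x ` K)"
  proof clarify
    fix c assume "\<forall>k\<in>K. 0 \<le> (c k :: real)"
    then show "(\<Sum>k\<in>K. c k *\<^sub>R x k) \<in> pos (x ` K)"
      using K by (intro convex_cone_sum[OF convex_cone_pos] subsetD[OF pos_superset]) auto
  qed
  show "pos (x ` K) \<subseteq> ?R"
  proof (rule pos_minimal)
    show "x ` K \<subseteq> ?R"
    proof clarify
      fix k assume "k \<in> K"
      then show "\<exists>c. x k = (\<Sum>k\<in>K. c k *\<^sub>R x k) \<and> (\<forall>k\<in>K. 0 \<le> c k)"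
        using K by (intro exI[of _ "\<lambda>j. if j = k then 1 else 0"]) (auto simp: if_distrib[of
            "\<lambda>c. c *\<^sub>R _"] cong: if_cong)
    qed
    show "convex_cone ?R" unfolding convex_cone_iff
    proof safe
      show "\<exists>c. 0 = (\<Sum>k\<in>K. c k *\<^sub>R x k) \<and> (\<forall>k\<in>K. 0 \<le> c k)"
        by (intro exI[of _ "\<lambda>_. 0"]) auto
    next
      fix c d assume "\<forall>k\<in>K. 0 \<le> (c k :: real)" "\<forall>k\<in>K. 0 \<le> (d k :: real)"
      then show "\<exists>b. (\<Sum>k\<in>K. c k *\<^sub>R x k) + (\<Sum>k\<in>K. d k *\<^sub>R x k) = (\<Sum>k\<in>K. b k *\<^sub>R x k) \<and> (\<forall>k\<in>K. 0 \<le> b k)"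
        by (intro exI[of _ "\<lambda>k. c k + d k"]) (auto simp: scaleR_add_left sum.distrib)
    next
      fix c s assume "\<forall>k\<in>K. 0 \<le> (c k :: real)" "(0::real) \<le> s"
      then show "\<exists>b. s *\<^sub>R (\<Sum>k\<in>K. c k *\<^sub>R x k) = (\<Sum>k\<in>K. b k *\<^sub>R x k) \<and> (\<forall>k\<in>K. 0 \<le> b k)"
        by (intro exI[of _ "\<lambda>k. s * c k"]) (auto simp: scaleR_sum_right)
    qed
  qed
qed

lemma pos_image_iff:
  assumes "finite K"
  shows "v \<in> pos (x ` K) \<longleftrightarrow> (\<exists>c. v = (\<Sum>k\<in>K. c k *\<^sub>R x k) \<and> (\<forall>k\<in>K. 0 \<le> c k))"
  by (simp add: pos_image[OF assms])

lemma pos_conv_s: "pos (conv_s A) = pos A"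
proof
  show "pos (conv_s A) \<subseteq> pos A"
    by (rule pos_minimal) (auto simp: conv_s_def convex_cone_pos)
  show "pos A \<subseteq> pos (conv_s A)"
  proof
    fix p assume p: "p \<in> pos A"
    show "p \<in> pos (conv_s A)"
    proof (cases "p = 0")
      case False
      then have "(1 / norm p) *\<^sub>R p \<in> conv_s A" using p by (auto simp: conv_s_def intro!: pos_scaleR)
      then have "norm p *\<^sub>R ((1 / norm p) *\<^sub>R p) \<in> pos (conv_s A)"
        by (intro pos_scaleR subsetD[OF pos_superset]) auto
      then show ?thesis using False by simp
    qed (simp add: pos_zero)
  qed
qed

text \<open>Membership in a finitely generated cone can be tested with rational coefficients because the
  cone is closed; this makes it a measurable condition on the generators.\<close>
lemma pos_image_iff_rational:
  fixes x :: "'i \<Rightarrow> 'a::euclidean_space"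
  assumes K: "finite K"
  shows "v \<in> pos (x ` K) \<longleftrightarrow>
    (\<forall>n::nat. \<exists>c\<in>(K \<rightarrow>\<^sub>E \<rat> \<inter> {0..}). norm (v - (\<Sum>k\<in>K. c k *\<^sub>R x k)) < 1 / Suc n)"
proof
  assume "v \<in> pos (x ` K)"
  then obtain c where c: "v = (\<Sum>k\<in>K. c k *\<^sub>R x k)" "\<forall>k\<in>K. 0 \<le> c k" by (auto simp: pos_image_iff K)
  show "\<forall>n::nat. \<exists>c\<in>(K \<rightarrow>\<^sub>E \<rat> \<inter> {0..}). norm (v - (\<Sum>k\<in>K. c k *\<^sub>R x k)) < 1 / Suc n"
  proof
    fix n :: nat
    define N where "N = (\<Sum>k\<in>K. norm (x k)) + 1"
    have N: "N > 0" by (auto simp: N_def intro!: add_nonneg_pos sum_nonneg)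
    define \<delta> where "\<delta> = 1 / (Suc n * N)"
    have \<delta>: "\<delta> > 0" using N by (auto simp: \<delta>_def)
    have "\<forall>k. \<exists>q\<in>\<rat>. c k < q \<and> q < c k + \<delta>" using \<delta> by (intro allI Rats_dense_in_real) auto
    then obtain q where q: "\<And>k. q k \<in> \<rat>" "\<And>k. c k < q k" "\<And>k. q k < c k + \<delta>" by metis
    have "norm (v - (\<Sum>k\<in>K. q k *\<^sub>R x k)) = norm (\<Sum>k\<in>K. (c k - q k) *\<^sub>R x k)"
      by (simp add: c(1) scaleR_diff_left sum_subtractf)
    also have "\<dots> \<le> (\<Sum>k\<in>K. \<delta> * norm (x k))"
    proof (rule sum_norm_le)
      fix k
      have "\<bar>c k - q k\<bar> \<le> \<delta>" using q(2,3)[of k] by linarith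
      then show "norm ((c k - q k) *\<^sub>R x k) \<le> \<delta> * norm (x k)" by (auto intro: mult_right_mono)
    qed
    also have "\<dots> = \<delta> * (N - 1)" by (simp add: N_def sum_distrib_left)
    also have "\<dots> < \<delta> * N" using \<delta> by simp
    also have "\<dots> = 1 / Suc n" using N by (simp add: \<delta>_def)
    finally have "norm (v - (\<Sum>k\<in>K. restrict q K k *\<^sub>R x k)) < 1 / Suc n" by simp
    moreover have "restrict q K \<in> K \<rightarrow>\<^sub>E \<rat> \<inter> {0..}"
    proof -
      have "0 \<le> q k" if "k \<in> K" for k using c(2) q(2)[of k] that by force
      then show ?thesis using q(1) by auto
    qed
    ultimately show "\<exists>c\<in>(K \<rightarrow>\<^sub>E \<rat> \<inter> {0..}). norm (v - (\<Sum>k\<in>K. c k *\<^sub>R x k)) < 1 / Suc n" by blast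
  qed
next
  assume *: "\<forall>n::nat. \<exists>c\<in>(K \<rightarrow>\<^sub>E \<rat> \<inter> {0..}). norm (v - (\<Sum>k\<in>K. c k *\<^sub>R x k)) < 1 / Suc n"
  have "v \<in> closure (pos (x ` K))" unfolding closure_approachable
  proof (intro allI impI)
    fix e :: real assume "e > 0"
    then obtain n where n: "1 / Suc n < e" using nat_approx_posE by blast
    from * obtain c where c: "c \<in> K \<rightarrow>\<^sub>E \<rat> \<inter> {0..}" "norm (v - (\<Sum>k\<in>K. c k *\<^sub>R x k)) < 1 / Suc n" by blast
    have "(\<Sum>k\<in>K. c k *\<^sub>R x k) \<in> pos (x ` K)" using c(1) by (auto simp: pos_image_iff K PiE_def Pi_def)
    moreover have "dist (\<Sum>k\<in>K. c k *\<^sub>R x k) v < e" using c(2) n by (simp add: dist_norm norm_minus_commute)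
    ultimately show "\<exists>y\<in>pos (x ` K). dist y v < e" by blast
  qed
  then show "v \<in> pos (x ` K)" using closed_pos[of "x ` K"] K by simp
qed

lemma pred_pos [measurable (raw)]:
  fixes x :: "'i \<Rightarrow> 'w \<Rightarrow> 'a::euclidean_space"
  assumes K: "finite K" and [measurable]: "v \<in> borel_measurable M" "\<And>k. k \<in> K \<Longrightarrow> x k \<in> borel_measurable M"
  shows "Measurable.pred M (\<lambda>w. v w \<in> pos ((\<lambda>k. x k w) ` K))"
proof -
  have "countable (K \<rightarrow>\<^sub>E \<rat> \<inter> {0::real..})" using K countable_rat by (intro countable_PiE) auto
  then show ?thesis unfolding pos_image_iff_rational[OF K]
    by (intro pred_intros_countable pred_intros_countable_bounded) measurable
qed

lemma pos_pair_uminus: "pos {a, -a} = span {a}"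
proof
  show "pos {a, -a} \<subseteq> span {a}"
    by (rule pos_minimal) (auto simp: convex_cone_span intro: span_base span_neg)
  have "s *\<^sub>R a \<in> pos {a, -a}" for s
  proof (cases "s \<ge> 0")
    case True
    then show ?thesis by (intro pos_scaleR subsetD[OF pos_superset]) auto
  next
    case False
    then have "(-s) *\<^sub>R (-a) \<in> pos {a, -a}" by (intro pos_scaleR subsetD[OF pos_superset]) auto
    then show ?thesis by simp
  qed
  then show "span {a} \<subseteq> pos {a, -a}" by (auto simp: span_singleton)
qed

lemma dim_eq_1_iff:
  fixes A :: "'a::euclidean_space set"
  shows "dim A = 1 \<longleftrightarrow> (\<exists>a\<in>A. a \<noteq> 0 \<and> A \<subseteq> span {a})"
proof
  assume d: "dim A = 1"
  have "\<not> A \<subseteq> {0}" using d by (metis dim_subset dim_singleton not_one_le_zero)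
  then obtain a where a: "a \<in> A" "a \<noteq> 0" by auto
  have "span {a} = span A"
    using a d by (intro subspace_dim_equal) (auto simp: span_mono dim_singleton)
  then show "\<exists>a\<in>A. a \<noteq> 0 \<and> A \<subseteq> span {a}" using a span_superset by blast
next
  assume "\<exists>a\<in>A. a \<noteq> 0 \<and> A \<subseteq> span {a}"
  then obtain a where a: "a \<in> A" "a \<noteq> 0" "A \<subseteq> span {a}" by blast
  have "dim {a} = 1" using a by simp
  moreover have "dim {a} \<le> dim A" using a by (intro dim_subset) auto
  moreover have "dim A \<le> dim {a}" using a(3) dim_subset dim_span by metis
  ultimately show "dim A = 1" by simp
qed

lemma aff_dim_pos: "aff_dim (pos A) = int (dim A)"
proof -
  have "aff_dim (pos A) = int (dim (pos A))"
    by (rule aff_dim_zero) (simp add: hull_inc pos_zero)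
  also have "dim (pos A) = dim A"
    by (metis dim_subset dim_span pos_subset_span pos_superset order.antisym)
  finally show ?thesis .
qed

lemma aff_dim_pos_eq_1_iff: "aff_dim (pos A) = 1 \<longleftrightarrow> (\<exists>a\<in>A. a \<noteq> 0 \<and> (\<forall>b\<in>A. b \<in> pos {a, -a}))"
  using dim_eq_1_iff[of A] by (auto simp: aff_dim_pos pos_pair_uminus subset_eq)

lemma face_of_cone_scaleR:
  assumes F: "F face_of C" and C: "convex_cone C" and p: "p \<in> F" and c: "0 \<le> c"
  shows "c *\<^sub>R p \<in> F"
proof (cases "p = 0 \<or> c = 1")
  case False
  have pC: "p \<in> C" using F p face_of_imp_subset by blast
  define b where "b = (if c < 1 then 2 else 0::real)"
  have "p \<in> open_segment (c *\<^sub>R p) (b *\<^sub>R p)"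
  proof -
    define u where "u = (1 - c) / (b - c)"
    have "0 < u" "u < 1" using False c by (auto simp: u_def b_def field_simps)
    moreover have "p = (1 - u) *\<^sub>R c *\<^sub>R p + u *\<^sub>R b *\<^sub>R p"
    proof -
      have "(1 - u) * c + u * b = 1"
      proof -
        have "u * (b - c) = 1 - c" using False c by (simp add: u_def b_def)
        then show ?thesis by (simp add: algebra_simps)
      qed
      then show ?thesis by (metis scaleR_scaleR scaleR_left_distrib scaleR_one)
    qed
    moreover have "c *\<^sub>R p \<noteq> b *\<^sub>R p" using False c by (auto simp: b_def)
    ultimately show ?thesis by (auto simp: in_segment)
  qed
  moreover have "c *\<^sub>R p \<in> C" "b *\<^sub>R p \<in> C"
      using C pC c by (auto simp: b_def convex_cone_scaleR convex_cone_contains_0)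
  ultimately show ?thesis using face_ofD[OF F] p by blast
qed (use p in auto)

lemma face_of_cone_add:
  assumes F: "F face_of C" and C: "convex_cone C" and ab: "a \<in> C" "b \<in> C" "a + b \<in> F"
  shows "a \<in> F"
proof (cases "a = b")
  case True
  have "(1/2) *\<^sub>R (a + b) \<in> F" using ab by (intro face_of_cone_scaleR[OF F C]) auto
  moreover have "(1/2) *\<^sub>R (a + b) = a" using True scaleR_half_double
      by (simp add: scaleR_add_right[symmetric])
  ultimately show ?thesis by (simp only:)
next
  case False
  have "a + b = (1 - 1/2) *\<^sub>R (2 *\<^sub>R a) + (1/2) *\<^sub>R (2 *\<^sub>R b)" by simp
  then have "a + b \<in> open_segment (2 *\<^sub>R a) (2 *\<^sub>R b)"
    using False unfolding in_segment by (intro conjI exI[of _ "1/2"]) auto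
  then have "2 *\<^sub>R a \<in> F" using face_ofD[OF F, of "a + b" "2 *\<^sub>R a" "2 *\<^sub>R b"] ab C
    by (auto simp: convex_cone_scaleR)
  then have "(1/2) *\<^sub>R (2 *\<^sub>R a) \<in> F" by (rule face_of_cone_scaleR[OF F C]) simp
  then show ?thesis by simp
qed

lemma face_of_pos_generator:
  assumes F: "F face_of pos (x ` K)" and K: "finite K" and c: "\<forall>k\<in>K. 0 \<le> c k"
    and sum: "(\<Sum>k\<in>K. c k *\<^sub>R x k) \<in> F" and k: "k \<in> K" "c k > 0"
  shows "x k \<in> F"
proof -
  have xC: "x j \<in> pos (x ` K)" if "j \<in> K" for j using that by (intro subsetD[OF pos_superset]) auto
  have "c k *\<^sub>R x k \<in> F"
  proof (rule face_of_cone_add[OF F convex_cone_pos])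
    show "c k *\<^sub>R x k \<in> pos (x ` K)" using k xC by (auto intro!: pos_scaleR)
    show "(\<Sum>j\<in>K-{k}. c j *\<^sub>R x j) \<in> pos (x ` K)"
      using K c xC by (intro convex_cone_sum[OF convex_cone_pos]) auto
    show "c k *\<^sub>R x k + (\<Sum>j\<in>K-{k}. c j *\<^sub>R x j) \<in> F" using sum K k by (simp add: sum.remove)
  qed
  then have "(1 / c k) *\<^sub>R (c k *\<^sub>R x k) \<in> F"
    by (rule face_of_cone_scaleR[OF F convex_cone_pos]) (use k in auto)
  then show ?thesis using k by simp
qed

lemma face_of_pos_eq:
  assumes F: "F face_of pos (x ` K)" and K: "finite K" and ne: "F \<noteq> {}"
  shows "F = pos (x ` {k \<in> K. x k \<in> F})"
proof
  show "F \<subseteq> pos (x ` {k \<in> K. x k \<in> F})"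
  proof
    fix p assume p: "p \<in> F"
    then have "p \<in> pos (x ` K)" using F face_of_imp_subset by blast
    then obtain c where c: "p = (\<Sum>k\<in>K. c k *\<^sub>R x k)" "\<forall>k\<in>K. 0 \<le> c k" by (auto simp: pos_image_iff K)
    have "c k = 0" if "k \<in> K" "x k \<notin> F" for k
      using face_of_pos_generator[OF F K c(2), of k] p c that by force
    then have "p = (\<Sum>k\<in>{k \<in> K. x k \<in> F}. c k *\<^sub>R x k)"
      unfolding c(1) using K by (intro sum.mono_neutral_right) auto
    then show "p \<in> pos (x ` {k \<in> K. x k \<in> F})" using c(2) K by (auto simp: pos_image_iff)
  qed
  have "convex_cone F"
    unfolding convex_cone_def conic_def
    using ne F face_of_imp_convex face_of_cone_scaleR[OF F convex_cone_pos] by blast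
  then show "pos (x ` {k \<in> K. x k \<in> F}) \<subseteq> F" by (intro pos_minimal) auto
qed

definition ray_face :: "('i \<Rightarrow> 'a::euclidean_space) \<Rightarrow> 'i set \<Rightarrow> 'i set \<Rightarrow> bool" where
  "ray_face x K J \<longleftrightarrow> pos (x ` J) face_of pos (x ` K) \<and> aff_dim (pos (x ` J)) = 1 \<and>
     (\<forall>k\<in>K-J. x k \<notin> pos (x ` J))"

lemma f0_eq_card_ray_face:
  assumes K: "finite K"
  shows "f0 (conv_s (x ` K)) = card {J \<in> Pow K. ray_face x K J}"
proof -
  let ?\<F> = "{F. F face_of pos (x ` K) \<and> aff_dim F = 1}" and ?\<J> = "\<lambda>F. {k \<in> K. x k \<in> F}"
  have eq: "F = pos (x ` ?\<J> F)" if "F \<in> ?\<F>" for F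
    using that K by (intro face_of_pos_eq) auto
  have "inj_on ?\<J> ?\<F>"
  proof (rule inj_onI)
    fix F G assume F: "F \<in> ?\<F>" and G: "G \<in> ?\<F>" and J: "?\<J> F = ?\<J> G"
    show "F = G" using eq[OF F] eq[OF G] unfolding J by (rule trans[OF _ sym])
  qed
  moreover have "?\<J> ` ?\<F> = {J \<in> Pow K. ray_face x K J}"
  proof safe
    fix F assume F: "F face_of pos (x ` K)" "aff_dim F = 1"
    then have "F = pos (x ` ?\<J> F)" using eq by simp
    then show "ray_face x K (?\<J> F)" using F unfolding ray_face_def by auto
  next
    fix J assume J: "J \<subseteq> K" "ray_face x K J"
    then have "J = ?\<J> (pos (x ` J))"
      using subsetD[OF pos_superset, of _ "x ` J"] unfolding ray_face_def by auto
    then show "J \<in> ?\<J> ` ?\<F>" using J unfolding ray_face_def by blast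
  qed
  ultimately have "bij_betw ?\<J> ?\<F> {J \<in> Pow K. ray_face x K J}" by (simp add: bij_betw_def)
  then show ?thesis by (simp add: f0_def pos_conv_s bij_betw_same_card)
qed

lemma ray_face_iff:
  assumes K: "finite K" and J: "J \<subseteq> K"
  shows "ray_face x K J \<longleftrightarrow>
    (\<exists>j\<in>J. x j \<noteq> 0 \<and> (\<forall>i\<in>J. x i \<in> pos {x j, - x j})) \<and>
    (\<forall>k\<in>K-J. x k \<notin> pos (x ` J) \<and> - x k \<notin> pos (x ` K \<union> (\<lambda>j. - x j) ` J))"
proof -
  have J': "finite J" using K J finite_subset by blast
  let ?C = "pos (x ` K)" and ?F = "pos (x ` J)"
  have sub: "?F \<subseteq> ?C" using J by (intro pos_mono) auto
  have Un: "pos (x ` K \<union> (\<lambda>j. - x j) ` J) = {a - b | a b. a \<in> ?C \<and> b \<in> ?F}"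
  proof -
    have "pos ((\<lambda>j. - x j) ` J) = uminus ` ?F"
      using pos_linear_image[of uminus "x ` J"] by (simp add: image_image linear_uminus)
    then show ?thesis
      by (force simp: pos_eq_convex_cone_hull convex_cone_hull_Un)
  qed
  have face: "?F face_of ?C \<longleftrightarrow> (\<forall>k\<in>K-J. - x k \<notin> {a - b | a b. a \<in> ?C \<and> b \<in> ?F})"
    if out: "\<forall>k\<in>K-J. x k \<notin> ?F"
  proof safe
    fix k a b assume F: "?F face_of ?C" and k: "k \<in> K" "k \<notin> J" "- x k = a - b" "a \<in> ?C" "b \<in> ?F"
    have "x k + a = b" using k(3) by (simp add: algebra_simps)
    then have "x k \<in> ?F"
    proof (intro face_of_cone_add[OF F convex_cone_pos, of "x k" a])
      show "x k \<in> pos (x ` K)" using k by (intro subsetD[OF pos_superset]) auto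
    qed (use k in auto)
    then show False using out k by auto
  next
    assume *: "\<forall>k\<in>K-J. - x k \<notin> {a - b | a b. a \<in> ?C \<and> b \<in> ?F}"
    show "?F face_of ?C" unfolding face_of_def
    proof (intro conjI ballI impI sub)
      show "convex ?F" using convex_cone_pos[of "x ` J"] by (simp add: convex_cone_def)
      fix a b p assume a: "a \<in> ?C" and b: "b \<in> ?C" and p: "p \<in> ?F" and seg: "p \<in> open_segment a b"
      obtain u where u: "0 < u" "u < 1" "p = (1 - u) *\<^sub>R a + u *\<^sub>R b" using seg by (auto simp: in_segment)
      obtain \<alpha> where \<alpha>: "a = (\<Sum>k\<in>K. \<alpha> k *\<^sub>R x k)" "\<forall>k\<in>K. 0 \<le> \<alpha> k" using a by (auto simp: pos_image_iff K)
      obtain \<beta> where \<beta>: "b = (\<Sum>k\<in>K. \<beta> k *\<^sub>R x k)" "\<forall>k\<in>K. 0 \<le> \<beta> k" using b by (auto simp: pos_image_iff K)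
      define \<gamma> where "\<gamma> k = (1 - u) * \<alpha> k + u * \<beta> k" for k
      have p\<gamma>: "p = (\<Sum>k\<in>K. \<gamma> k *\<^sub>R x k)"
        by (simp add: u(3) \<alpha>(1) \<beta>(1) \<gamma>_def scaleR_add_left scaleR_sum_right sum.distrib)
      have \<gamma>: "\<forall>k\<in>K. 0 \<le> \<gamma> k" using u \<alpha> \<beta> by (auto simp: \<gamma>_def)
      have \<gamma>0: "\<gamma> k = 0" if k: "k \<in> K" "k \<notin> J" for k
      proof (rule ccontr)
        assume "\<gamma> k \<noteq> 0"
        then have g: "\<gamma> k > 0" using \<gamma> k by force
        have "p = \<gamma> k *\<^sub>R x k + (\<Sum>j\<in>K-{k}. \<gamma> j *\<^sub>R x j)" using k K by (simp add: p\<gamma> sum.remove)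
        then have "- x k = (1 / \<gamma> k) *\<^sub>R (\<Sum>j\<in>K-{k}. \<gamma> j *\<^sub>R x j) - (1 / \<gamma> k) *\<^sub>R p"
          using g by (simp add: scaleR_add_right)
        moreover have "(1 / \<gamma> k) *\<^sub>R (\<Sum>j\<in>K-{k}. \<gamma> j *\<^sub>R x j) \<in> ?C"
          using g \<gamma> K by (intro pos_scaleR convex_cone_sum[OF convex_cone_pos] subsetD[OF pos_superset])
              auto
        moreover have "(1 / \<gamma> k) *\<^sub>R p \<in> ?F" using g p by (intro pos_scaleR) auto
        ultimately show False using * k by blast
      qed
      have "\<alpha> k = 0 \<and> \<beta> k = 0" if k: "k \<in> K" "k \<notin> J" for k
      proof -
        have "(1 - u) * \<alpha> k \<ge> 0" "u * \<beta> k \<ge> 0" using u \<alpha> \<beta> k by auto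
        then have "(1 - u) * \<alpha> k = 0" "u * \<beta> k = 0" using \<gamma>0[OF k] unfolding \<gamma>_def by linarith+
        then show ?thesis using u by auto
      qed
      then have "a = (\<Sum>k\<in>J. \<alpha> k *\<^sub>R x k)" "b = (\<Sum>k\<in>J. \<beta> k *\<^sub>R x k)"
        unfolding \<alpha>(1) \<beta>(1) using J K by (auto intro!: sum.mono_neutral_right)
      then show "a \<in> ?F" "b \<in> ?F" using \<alpha>(2) \<beta>(2) J by (auto simp: pos_image_iff J')
    qed
  qed
  show ?thesis
    unfolding ray_face_def Un aff_dim_pos_eq_1_iff using face by auto
qed

lemma measurable_f0:
  fixes x :: "'i \<Rightarrow> 'w \<Rightarrow> 'a::euclidean_space"
  assumes K: "finite K" and [measurable]: "\<And>k. k \<in> K \<Longrightarrow> x k \<in> borel_measurable M"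
  shows "(\<lambda>w. real (f0 (conv_s ((\<lambda>k. x k w) ` K)))) \<in> borel_measurable M"
proof -
  have pred: "Measurable.pred M (\<lambda>w. ray_face (\<lambda>k. x k w) K J)" if J: "J \<in> Pow K" for J
  proof -
    have fin: "finite J" "finite (K - J)" using J K finite_subset by auto
    have [measurable]: "x j \<in> borel_measurable M" if "j \<in> J" for j using J that by auto
    have m1: "Measurable.pred M (\<lambda>w. x i w \<in> pos {x j w, - x j w})" if "i \<in> J" "j \<in> J" for i j
    proof -
      have "Measurable.pred M (\<lambda>w. x i w \<in> pos ((\<lambda>s. s *\<^sub>R x j w) ` {1, -1::real}))"
        using that J by (intro pred_pos) auto
      then show ?thesis by simp
    qed
    have m2: "Measurable.pred M (\<lambda>w. x k w \<in> pos ((\<lambda>j. x j w) ` J))" if "k \<in> K" for k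
      using that J fin by (intro pred_pos) auto
    have m3: "Measurable.pred M (\<lambda>w. - x k w \<in> pos ((\<lambda>k. x k w) ` K \<union> (\<lambda>j. - x j w) ` J))" if "k \<in> K" for k
    proof -
      let ?y = "\<lambda>i w. case i of Inl k \<Rightarrow> x k w | Inr j \<Rightarrow> - x j w"
      have "Measurable.pred M (\<lambda>w. - x k w \<in> pos ((\<lambda>i. ?y i w) ` (K <+> J)))"
        using that J K fin by (intro pred_pos) (auto split: sum.split)
      moreover have "(\<lambda>i. ?y i w) ` (K <+> J) = (\<lambda>k. x k w) ` K \<union> (\<lambda>j. - x j w) ` J" for w
        by (force simp: Plus_def image_Un image_image)
      ultimately show ?thesis by simp
    qed
    have m4: "Measurable.pred M (\<lambda>w. x j w \<noteq> 0)" if "j \<in> J" for j using that by measurable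
    have "Measurable.pred M (\<lambda>w.
      (\<exists>j\<in>J. x j w \<noteq> 0 \<and> (\<forall>i\<in>J. x i w \<in> pos {x j w, - x j w})) \<and>
      (\<forall>k\<in>K-J. x k w \<notin> pos ((\<lambda>k. x k w) ` J) \<and> - x k w \<notin> pos ((\<lambda>k. x k w) ` K \<union> (\<lambda>j. - x j w) ` J)))"
      using fin m1 m2 m3 m4
      by (intro pred_intros_logic pred_intros_finite) auto
    then show ?thesis using J K by (subst ray_face_iff) auto
  qed
  have "real (card {J \<in> Pow K. ray_face (\<lambda>k. x k w) K J}) = (\<Sum>J\<in>Pow K. of_bool (ray_face (\<lambda>k. x k w) K J))"
      for w
    using K by (simp add: sum_of_bool_eq Int_def)
  moreover have "(\<lambda>w. \<Sum>J\<in>Pow K. of_bool (ray_face (\<lambda>k. x k w) K J) :: real) \<in> borel_measurable M"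
    using pred by (intro borel_measurable_sum) (auto simp: of_bool_def intro!: measurable_If)
  ultimately show ?thesis by (simp add: f0_eq_card_ray_face[OF K])
qed

lemma f0_general_position:
  fixes x :: "'i \<Rightarrow> 'a::euclidean_space"
  assumes K: "finite K" and e: "\<And>k. k \<in> K \<Longrightarrow> x k \<bullet> e > 0"
    and gp: "\<And>j k. j \<in> K \<Longrightarrow> k \<in> K \<Longrightarrow> j \<noteq> k \<Longrightarrow> x j \<notin> span {x k}"
  shows "f0 (conv_s (x ` K)) = card {k \<in> K. x k \<notin> pos (x ` (K - {k}))}"
proof -
  have x0: "x k \<noteq> 0" if "k \<in> K" for k using e[OF that] by auto
  have "{J \<in> Pow K. ray_face x K J} = (\<lambda>k. {k}) ` {k \<in> K. x k \<notin> pos (x ` (K - {k}))}"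
  proof safe
    fix J assume J: "J \<subseteq> K" "ray_face x K J"
    then obtain k where k: "k \<in> J" "\<forall>i\<in>J. x i \<in> pos {x k, - x k}"
        unfolding ray_face_def aff_dim_pos_eq_1_iff by blast
    have "i = k" if "i \<in> J" for i using gp[of i k] k that J by (auto simp: pos_pair_uminus)
    with k(1) have Jk: "J = {k}" by blast
    have F: "pos (x ` {k}) face_of pos (x ` K)" and out: "\<And>j. j \<in> K - {k} \<Longrightarrow> x j \<notin> pos (x ` {k})"
      using J by (auto simp: ray_face_def Jk)
    have "x k \<notin> pos (x ` (K - {k}))"
    proof
      assume "x k \<in> pos (x ` (K - {k}))"
      then obtain c where c: "x k = (\<Sum>j\<in>K-{k}. c j *\<^sub>R x j)" "\<forall>j\<in>K-{k}. 0 \<le> c j"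
        by (auto simp: pos_image_iff K)
      have "\<exists>j\<in>K-{k}. c j \<noteq> 0"
      proof (rule ccontr)
        assume "\<not> ?thesis"
        then have "x k = 0" unfolding c(1) by (intro sum.neutral) auto
        then show False using x0 k J by auto
      qed
      then obtain j where j: "j \<in> K - {k}" "c j > 0" using c by force
      let ?c = "\<lambda>j. if j = k then 0 else c j"
      have "(\<Sum>j\<in>K. ?c j *\<^sub>R x j) = x k"
        unfolding c(1) using K by (intro sum.mono_neutral_cong_right) auto
      moreover have "x k \<in> pos (x ` {k})" by (rule subsetD[OF pos_superset]) simp
      ultimately have "(\<Sum>j\<in>K. ?c j *\<^sub>R x j) \<in> pos (x ` {k})" by (simp only:)
      then have "x j \<in> pos (x ` {k})"
        by (rule face_of_pos_generator[OF F K, of ?c, rotated]) (use j c in auto)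
      then show False using out j by auto
    qed
    then show "J \<in> (\<lambda>k. {k}) ` {k \<in> K. x k \<notin> pos (x ` (K - {k}))}" using Jk k J by auto
  next
    fix k assume k: "k \<in> K" "x k \<notin> pos (x ` (K - {k}))"
    have "- x j \<notin> pos (x ` K \<union> (\<lambda>j. - x j) ` {k})" if j: "j \<in> K - {k}" for j
    proof
      assume "- x j \<in> pos (x ` K \<union> (\<lambda>j. - x j) ` {k})"
      then obtain a b where ab: "- x j = a + b" "a \<in> pos (x ` K)" "b \<in> pos ({- x k})"
        unfolding pos_Un by auto
      obtain c where c: "a = (\<Sum>i\<in>K. c i *\<^sub>R x i)" "\<forall>i\<in>K. 0 \<le> c i"
          using ab(2) by (auto simp: pos_image_iff K)
      obtain s where s: "b = - (s *\<^sub>R x k)" "s \<ge> 0"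
        using ab(3) pos_image_iff[of "{k}" b "\<lambda>k. - x k"] by auto
      let ?d = "\<lambda>i. c i + (if i = j then 1 else 0)"
      have d: "(\<Sum>i\<in>K-{k}. ?d i *\<^sub>R x i) = (s - c k) *\<^sub>R x k"
      proof -
        have "(\<Sum>i\<in>K-{k}. ?d i *\<^sub>R x i) = (\<Sum>i\<in>K-{k}. c i *\<^sub>R x i) + x j"
          using j K by (simp add: scaleR_add_left sum.distrib if_distrib[of "\<lambda>c. c *\<^sub>R _"] cong: if_cong)
        also have "(\<Sum>i\<in>K-{k}. c i *\<^sub>R x i) = a - c k *\<^sub>R x k" using k K by (simp add: c(1) sum.remove)
        finally show ?thesis using ab(1) s(1) by (simp add: algebra_simps)
      qed
      have pos_sum: "0 < (\<Sum>i\<in>K-{k}. ?d i *\<^sub>R x i) \<bullet> e"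
      proof -
        have "x j \<bullet> e \<le> (\<Sum>i\<in>K-{k}. ?d i * (x i \<bullet> e))"
          using j K c e by (intro order.trans[OF _ member_le_sum[of j]]) (auto intro!: mult_nonneg_nonneg
              less_imp_le[OF e] simp: algebra_simps)
        then show ?thesis using e[of j] j by (simp add: inner_sum_left)
      qed
      then have "s - c k > 0" unfolding d using e[OF k(1)] by (simp add: zero_less_mult_iff)
      then have "x k = (1 / (s - c k)) *\<^sub>R (\<Sum>i\<in>K-{k}. ?d i *\<^sub>R x i)" unfolding d by simp
      also have "\<dots> \<in> pos (x ` (K - {k}))"
        using \<open>s - c k > 0\<close> K c by (intro pos_scaleR convex_cone_sum[OF convex_cone_pos] subsetD[OF
            pos_superset]) auto
      finally show False using k by blast
    qed
    moreover have "x j \<notin> pos {x k}" if "j \<in> K - {k}" for j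
      using gp[of j k] that k pos_subset_span[of "{x k}"] by auto
    ultimately show "ray_face x K {k}"
      using k x0 K by (subst ray_face_iff) (auto simp: pos_superset[THEN subsetD])
  qed
  then have "card {J \<in> Pow K. ray_face x K J} = card {k \<in> K. x k \<notin> pos (x ` (K - {k}))}"
    by (simp add: card_image)
  then show ?thesis by (simp add: f0_eq_card_ray_face[OF K])
qed

section \<open>Facets of cones in a halfspace\<close>

lemma farkas_pos:
  fixes A :: "'a::euclidean_space set"
  assumes "finite A" "v \<notin> pos A"
  obtains a where "a \<bullet> v < 0" "\<And>x. x \<in> A \<Longrightarrow> 0 \<le> a \<bullet> x"
proof -
  have "convex (pos A)" using convex_cone_pos[of A] by (simp add: convex_cone_def)
  then obtain a b where ab: "a \<bullet> v < b" "\<forall>x\<in>pos A. b < a \<bullet> x"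
    using separating_hyperplane_closed_point[of "pos A" v] closed_pos[OF assms(1)] assms(2) by blast
  have "b < 0" using ab(2) pos_zero by force
  moreover have "0 \<le> a \<bullet> x" if "x \<in> A" for x
  proof (rule ccontr)
    assume neg: "\<not> 0 \<le> a \<bullet> x"
    then have "(b / (a \<bullet> x)) *\<^sub>R x \<in> pos A"
      using that \<open>b < 0\<close> by (intro pos_scaleR subsetD[OF pos_superset]) (auto simp: divide_nonpos_neg)
    then show False using ab(2) neg by force
  qed
  ultimately show ?thesis using ab(1) that[of a] by force
qed

lemma caratheodory_pos:
  fixes y :: "'i \<Rightarrow> 'a::real_vector"
  assumes "finite J" "\<exists>l. v = (\<Sum>j\<in>J. l j *\<^sub>R y j) \<and> (\<forall>j\<in>J. 0 \<le> (l j :: real))"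
  shows "\<exists>I\<subseteq>J. (\<exists>l. v = (\<Sum>j\<in>I. l j *\<^sub>R y j) \<and> (\<forall>j\<in>I. 0 \<le> l j)) \<and>
    (\<forall>c. (\<Sum>i\<in>I. c i *\<^sub>R y i) = 0 \<longrightarrow> (\<forall>i\<in>I. c i = 0))"
  using assms
proof (induction J rule: finite_psubset_induct)
  case (psubset J)
  show ?case
  proof (cases "\<forall>c. (\<Sum>i\<in>J. c i *\<^sub>R y i) = 0 \<longrightarrow> (\<forall>i\<in>J. c i = 0)")
    case True
    then show ?thesis using psubset.prems by blast
  next
    case False
    then obtain c0 i0 where c0: "(\<Sum>i\<in>J. c0 i *\<^sub>R y i) = 0" "i0 \<in> J" "c0 i0 \<noteq> 0" by blast
    define c where "c i = (if c0 i0 > 0 then c0 i else - c0 i)" for i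
    have c: "(\<Sum>i\<in>J. c i *\<^sub>R y i) = 0" "c i0 > 0"
      using c0 by (cases "c0 i0 > 0"; simp add: c_def sum_negf)+
    obtain l where l: "v = (\<Sum>j\<in>J. l j *\<^sub>R y j)" "\<forall>j\<in>J. 0 \<le> l j" using psubset.prems by blast
    let ?P = "{i \<in> J. c i > 0}"
    have P: "finite ?P" "?P \<noteq> {}" using psubset.hyps c0 c by auto
    then obtain i1 where i1: "i1 \<in> ?P" "\<And>i. i \<in> ?P \<Longrightarrow> l i1 / c i1 \<le> l i / c i"
      using ex_min_if_finite[of "(\<lambda>i. l i / c i) ` ?P"]
          by (metis (mono_tags, lifting) arg_min_least arg_min_if_finite(1))
    define \<theta> where "\<theta> = l i1 / c i1"
    have \<theta>: "0 \<le> \<theta>" using i1(1) l(2) by (auto simp: \<theta>_def)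
    have nn: "0 \<le> l j - \<theta> * c j" if "j \<in> J" for j
    proof (cases "c j > 0")
      case True
      then have "\<theta> \<le> l j / c j" using i1(2)[of j] that by (simp add: \<theta>_def)
      then show ?thesis using True by (simp add: field_simps)
    next
      case False
      then have "\<theta> * c j \<le> 0" using \<theta> by (simp add: mult_nonneg_nonpos)
      then show ?thesis using l(2) that by force
    qed
    have i1z: "l i1 - \<theta> * c i1 = 0" using i1(1) by (simp add: \<theta>_def)
    have "v = (\<Sum>j\<in>J. (l j - \<theta> * c j) *\<^sub>R y j)"
    proof -
      have "(\<Sum>j\<in>J. (\<theta> * c j) *\<^sub>R y j) = \<theta> *\<^sub>R (\<Sum>j\<in>J. c j *\<^sub>R y j)"
        by (simp add: scaleR_sum_right)
      then show ?thesis using c(1) l(1) by (simp add: scaleR_diff_left sum_subtractf)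
    qed
    also have "\<dots> = (\<Sum>j\<in>J-{i1}. (l j - \<theta> * c j) *\<^sub>R y j)"
      using psubset.hyps i1z by (intro sum.mono_neutral_right) auto
    finally have "\<exists>I\<subseteq>J-{i1}. (\<exists>l. v = (\<Sum>j\<in>I. l j *\<^sub>R y j) \<and> (\<forall>j\<in>I. 0 \<le> l j)) \<and>
      (\<forall>c. (\<Sum>i\<in>I. c i *\<^sub>R y i) = 0 \<longrightarrow> (\<forall>i\<in>I. c i = 0))"
      using i1(1) nn by (intro psubset.IH) (auto intro!: exI[of _ "\<lambda>j. l j - \<theta> * c j"])
    then show ?thesis by blast
  qed
qed

lemma card_independent_family_le:
  fixes y :: "'i \<Rightarrow> 'a::euclidean_space"
  assumes I: "finite I" and ind: "\<And>c. (\<Sum>i\<in>I. c i *\<^sub>R y i) = 0 \<Longrightarrow> \<forall>i\<in>I. c i = 0"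
  shows "card I \<le> DIM('a)"
proof -
  have inj: "inj_on y I"
  proof (rule inj_onI, rule ccontr)
    fix i j assume ij: "i \<in> I" "j \<in> I" "y i = y j" "i \<noteq> j"
    let ?c = "\<lambda>k. (if k = i then 1 else 0) - (if k = j then 1 else 0 :: real)"
    have "(\<Sum>k\<in>I. ?c k *\<^sub>R y k) = 0"
      using I ij by (simp add: scaleR_diff_left sum_subtractf if_distrib[of "\<lambda>c. c *\<^sub>R _"] cong: if_cong)
    then show False using ind[of ?c] ij by auto
  qed
  have "independent (y ` I)"
  proof
    assume "dependent (y ` I)"
    then obtain u v where u: "v \<in> y ` I" "u v \<noteq> 0" "(\<Sum>v\<in>y ` I. u v *\<^sub>R v) = 0"
      using I by (auto simp: dependent_finite)
    then have "(\<Sum>i\<in>I. u (y i) *\<^sub>R y i) = 0" using inj by (simp add: sum.reindex)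
    then show False using ind[of "\<lambda>i. u (y i)"] u by auto
  qed
  then show ?thesis using independent_bound[of "y ` I"] inj by (simp add: card_image)
qed

definition facet_enum :: "'i set \<Rightarrow> 'm::finite \<Rightarrow> 'i" where
  "facet_enum I = (SOME \<beta>. bij_betw \<beta> UNIV I)"

definition facet_rows :: "('i \<Rightarrow> (real ^ 'm) \<times> real) \<Rightarrow> 'i set \<Rightarrow> real ^ 'm ^ 'm::finite" where
  "facet_rows z I = (\<chi> i. fst (z (facet_enum I i)))"

definition facet_normal :: "('i \<Rightarrow> (real ^ 'm) \<times> real) \<Rightarrow> 'i set \<Rightarrow> real ^ 'm::finite" where
  "facet_normal z I = row_solution (facet_rows z I) (\<chi> i. snd (z (facet_enum I i)))"

lemma bij_betw_facet_enum:
  assumes "finite I" "card I = CARD('m::finite)"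
  shows "bij_betw (facet_enum I :: 'm \<Rightarrow> 'i) UNIV I"
proof -
  have "\<exists>\<beta>. bij_betw \<beta> (UNIV :: 'm set) I"
    using assms by (intro finite_same_card_bij) auto
  then show ?thesis unfolding facet_enum_def by (rule someI_ex)
qed

lemma range_facet_rows:
  fixes z :: "'i \<Rightarrow> (real ^ 'm::finite) \<times> real"
  assumes "finite I" "card I = CARD('m)"
  shows "range (($) (facet_rows z I)) = (\<lambda>i. fst (z i)) ` I"
proof -
  have "facet_enum I ` (UNIV :: 'm set) = I"
    using bij_betw_facet_enum[OF assms] by (simp add: bij_betw_def)
  then have "(\<lambda>i. fst (z i)) ` I = (\<lambda>i. fst (z i)) ` facet_enum I ` (UNIV :: 'm set)" by simp
  then show ?thesis by (auto simp: facet_rows_def)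
qed

lemma facet_normal_iff:
  fixes z :: "'i \<Rightarrow> (real ^ 'm::finite) \<times> real"
  assumes I: "finite I" "card I = CARD('m)" and det: "det (facet_rows z I) \<noteq> 0"
  shows "facet_normal z I = a \<longleftrightarrow> (\<forall>i\<in>I. a \<bullet> fst (z i) = snd (z i))"
proof -
  have "facet_enum I ` (UNIV :: 'm set) = I"
    using bij_betw_facet_enum[OF I] by (simp add: bij_betw_def)
  then have "(\<forall>i\<in>I. a \<bullet> fst (z i) = snd (z i)) \<longleftrightarrow>
     (\<forall>i\<in>facet_enum I ` (UNIV :: 'm set). a \<bullet> fst (z i) = snd (z i))" by simp
  then show ?thesis
    unfolding facet_normal_def row_solution_iff[OF det] by (simp add: facet_rows_def)
qed

lemma det_facet_rows_nonzero:
  fixes z :: "'i \<Rightarrow> (real ^ 'm::finite) \<times> real"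
  assumes I: "finite I" "card I = CARD('m)"
    and ind: "\<And>c. (\<Sum>i\<in>I. c i *\<^sub>R fst (z i)) = 0 \<Longrightarrow> \<forall>i\<in>I. c i = 0"
  shows "det (facet_rows z I) \<noteq> 0"
proof
  let ?\<beta> = "facet_enum I :: 'm \<Rightarrow> 'i"
  note bij = bij_betw_facet_enum[OF I]
  assume "det (facet_rows z I) = 0"
  then obtain c where c: "c \<noteq> 0" "(\<Sum>i\<in>UNIV. c $ i *\<^sub>R fst (z (?\<beta> i))) = 0"
    by (auto simp: det_eq_0_iff_row_relation facet_rows_def)
  let ?c = "\<lambda>i. c $ inv_into UNIV ?\<beta> i"
  have inv: "inv_into UNIV ?\<beta> (?\<beta> i) = i" for i using bij by (auto simp: bij_betw_def)
  have "(\<Sum>i\<in>I. ?c i *\<^sub>R fst (z i)) = (\<Sum>i\<in>UNIV. ?c (?\<beta> i) *\<^sub>R fst (z (?\<beta> i)))"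
    by (rule sum.reindex_bij_betw[OF bij, symmetric])
  also have "\<dots> = 0" using c(2) by (simp add: inv)
  finally have *: "\<forall>i\<in>I. ?c i = 0" by (rule ind)
  have "c $ i = 0" for i
    using * bij_betwE[OF bij] inv[of i] by (metis UNIV_I)
  then have "c = 0" by (simp add: vec_eq_iff)
  with c(1) show False by simp
qed

text \<open>The facet below \<open>(y, t)\<close> is the set of constraints active at a maximiser of the linear
  functional \<open>y\<close> over the polytope \<open>{a. \<forall>k\<in>K. a \<bullet> fst (z k) \<le> snd (z k)}\<close>, which is bounded
  because no closed halfspace contains all of the points \<open>fst (z k)\<close>.\<close>
lemma exists_facet:
  fixes z :: "'i \<Rightarrow> (real ^ 'm::finite) \<times> real"
  assumes K: "finite K" and tpos: "\<And>k. k \<in> K \<Longrightarrow> 0 < snd (z k)"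
    and G: "\<And>b. b \<noteq> 0 \<Longrightarrow> \<exists>k\<in>K. b \<bullet> fst (z k) < 0"
    and t: "0 \<le> t" and out: "(y, t) \<notin> pos (z ` K)"
    and gen: "\<And>J. J \<subseteq> K \<Longrightarrow> card J < CARD('m) \<Longrightarrow> y \<notin> span ((\<lambda>k. fst (z k)) ` J)"
  obtains I where "I \<subseteq> K" "card I = CARD('m)" "det (facet_rows z I) \<noteq> 0"
    "\<And>k. k \<in> K \<Longrightarrow> facet_normal z I \<bullet> fst (z k) \<le> snd (z k)"
    "y \<in> pos ((\<lambda>k. fst (z k)) ` I)" "t < facet_normal z I \<bullet> y"
proof -
  let ?y = "\<lambda>k. fst (z k)"
  define D where "D = {a. \<forall>k\<in>K. a \<bullet> ?y k \<le> snd (z k)}"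
  have all: "v \<in> pos (?y ` K)" for v
  proof (rule ccontr)
    assume "v \<notin> pos (?y ` K)"
    then obtain a where a: "a \<bullet> v < 0" "\<And>x. x \<in> ?y ` K \<Longrightarrow> 0 \<le> a \<bullet> x"
      using farkas_pos[of "?y ` K" v] K by blast
    then have "a \<noteq> 0" by auto
    then show False using G[of a] a(2) by force
  qed
  have bound: "\<exists>M. \<forall>a\<in>D. a \<bullet> v \<le> M" for v
  proof -
    obtain c where c: "v = (\<Sum>k\<in>K. c k *\<^sub>R ?y k)" "\<forall>k\<in>K. 0 \<le> c k"
      using all[of v] by (auto simp: pos_image_iff K)
    have "a \<bullet> v \<le> (\<Sum>k\<in>K. c k * snd (z k))" if "a \<in> D" for a
      unfolding c(1) inner_sum_right inner_scaleR_right
      using that c(2) by (intro sum_mono mult_left_mono) (auto simp: D_def)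
    then show ?thesis by blast
  qed
  have "compact D"
  proof (rule compact_eq_bounded_closed[THEN iffD2], intro conjI)
    have "D = (\<Inter>k\<in>K. {a. ?y k \<bullet> a \<le> snd (z k)})" by (auto simp: D_def inner_commute)
    then show "closed D" by (auto intro: closed_halfspace_le)
    obtain M where M: "\<And>v a. a \<in> D \<Longrightarrow> a \<bullet> v \<le> M v" using bound by metis
    have "norm a \<le> (\<Sum>b\<in>Basis. max (M b) (M (- b)))" if "a \<in> D" for a
    proof (rule order.trans[OF norm_le_l1 sum_mono])
      fix b :: "real ^ 'm" assume "b \<in> Basis"
      show "\<bar>a \<bullet> b\<bar> \<le> max (M b) (M (- b))" using M[OF that, of b] M[OF that, of "-b"] by auto
    qed
    then show "bounded D" by (auto simp: bounded_iff)
  qed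
  obtain a0 where a0: "a0 \<in> D" "t < a0 \<bullet> y"
  proof -
    obtain pq where pq: "pq \<bullet> (y, t) < 0" "\<And>x. x \<in> z ` K \<Longrightarrow> 0 \<le> pq \<bullet> x"
      using farkas_pos[OF _ out] K by blast
    obtain p q where "pq = (p, q)" by (cases pq)
    with pq have p: "p \<bullet> y + q * t < 0" "\<And>k. k \<in> K \<Longrightarrow> 0 \<le> p \<bullet> ?y k + q * snd (z k)"
      by (auto simp: inner_prod_def)
    have "q > 0"
    proof (rule ccontr)
      assume "\<not> q > 0"
      then have qt: "q * snd (z k) \<le> 0" if "k \<in> K" for k
        using tpos[OF that] by (simp add: mult_nonpos_nonneg)
      have "p = 0"
      proof (rule ccontr)
        assume "p \<noteq> 0"
        from G[OF this] obtain k where "k \<in> K" "p \<bullet> ?y k < 0" by blast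
        with p(2) qt show False by force
      qed
      obtain k where k: "k \<in> K" using G[of "axis undefined 1"] by (auto simp: axis_eq_0_iff)
      have "q * t < 0" using p(1) \<open>p = 0\<close> by simp
      then have "q < 0" using t by (simp add: mult_less_0_iff)
      moreover have "0 \<le> q * snd (z k)" using p(2)[OF k] \<open>p = 0\<close> by simp
      ultimately show False using tpos[OF k] by (simp add: zero_le_mult_iff)
    qed
    show ?thesis
    proof (rule that[of "(- 1 / q) *\<^sub>R p"])
      have "- (p \<bullet> ?y k) \<le> snd (z k) * q" if "k \<in> K" for k using p(2)[OF that] by (simp add: mult.commute)
      then show "(- 1 / q) *\<^sub>R p \<in> D" using \<open>q > 0\<close> by (auto simp: D_def field_simps)
      show "t < ((- 1 / q) *\<^sub>R p) \<bullet> y" using \<open>q > 0\<close> p(1) by (simp add: field_simps)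
    qed
  qed
  have "continuous_on D (\<lambda>a. a \<bullet> y)" by (intro continuous_intros)
  then obtain a where a: "a \<in> D" "\<And>b. b \<in> D \<Longrightarrow> b \<bullet> y \<le> a \<bullet> y"
    using continuous_attains_sup[OF \<open>compact D\<close>] a0(1) by blast
  have ty: "t < a \<bullet> y" using a(2)[OF a0(1)] a0(2) by simp
  define J where "J = {k\<in>K. a \<bullet> ?y k = snd (z k)}"
  have J: "finite J" "J \<subseteq> K" using K by (auto simp: J_def)
  have "y \<in> pos (?y ` J)"
  proof (rule ccontr)
    assume "y \<notin> pos (?y ` J)"
    then obtain c where c: "c \<bullet> y < 0" "\<And>x. x \<in> ?y ` J \<Longrightarrow> 0 \<le> c \<bullet> x"
      using farkas_pos[of "?y ` J" y] J by blast
    have "\<forall>\<^sub>F s in at_right 0. \<forall>k\<in>K-J. (a - s *\<^sub>R c) \<bullet> ?y k < snd (z k)"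
    proof (intro eventually_ball_finite ballI)
      fix k assume "k \<in> K - J"
      then have "a \<bullet> ?y k < snd (z k)" using a(1) by (force simp: J_def D_def)
      moreover have "((\<lambda>s. (a - s *\<^sub>R c) \<bullet> ?y k) \<longlongrightarrow> (a - 0 *\<^sub>R c) \<bullet> ?y k) (at_right 0)"
        by (intro tendsto_intros)
      ultimately show "\<forall>\<^sub>F s in at_right 0. (a - s *\<^sub>R c) \<bullet> ?y k < snd (z k)"
        by (intro order_tendstoD) auto
    qed (use K in auto)
    then have "\<forall>\<^sub>F s in at_right (0::real). (\<forall>k\<in>K-J. (a - s *\<^sub>R c) \<bullet> ?y k < snd (z k)) \<and> s > 0"
      by (rule eventually_conj) (simp add: eventually_at_right_less)
    then obtain s where s: "\<forall>k\<in>K-J. (a - s *\<^sub>R c) \<bullet> ?y k < snd (z k)" "s > 0"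
      by (metis (no_types, lifting) eventually_happens trivial_limit_at_right_real)
    have "a - s *\<^sub>R c \<in> D" unfolding D_def
    proof (intro CollectI ballI)
      fix k assume k: "k \<in> K"
      show "(a - s *\<^sub>R c) \<bullet> ?y k \<le> snd (z k)"
      proof (cases "k \<in> J")
        case True
        then have "0 \<le> s * (c \<bullet> ?y k)" using c(2)[of "?y k"] s(2) by auto
        then show ?thesis using True by (simp add: J_def inner_diff_left)
      qed (use k s in force)
    qed
    from a(2)[OF this] have "0 \<le> s * (c \<bullet> y)" by (simp add: inner_diff_left)
    then show False using c(1) s(2) by (simp add: zero_le_mult_iff)
  qed
  then have "\<exists>l. y = (\<Sum>j\<in>J. l j *\<^sub>R ?y j) \<and> (\<forall>j\<in>J. 0 \<le> l j)" by (simp add: pos_image_iff J)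
  from caratheodory_pos[OF J(1) this] obtain I where I: "I \<subseteq> J"
    "\<exists>l. y = (\<Sum>j\<in>I. l j *\<^sub>R ?y j) \<and> (\<forall>j\<in>I. 0 \<le> l j)"
    "\<forall>c. (\<Sum>i\<in>I. c i *\<^sub>R ?y i) = 0 \<longrightarrow> (\<forall>i\<in>I. c i = 0)" by blast
  have ind: "\<And>c. (\<Sum>i\<in>I. c i *\<^sub>R ?y i) = 0 \<Longrightarrow> \<forall>i\<in>I. c i = 0" using I(3) by blast
  have finI: "finite I" using I(1) J(1) finite_subset by blast
  have yI: "y \<in> pos (?y ` I)" using I(2) by (simp add: pos_image_iff finI)
  then have "\<not> card I < CARD('m)" using gen[of I] I(1) J(2) pos_subset_span by blast
  moreover have "card I \<le> CARD('m)" using card_independent_family_le[where y = ?y, OF finI ind] by simp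
  ultimately have cardI: "card I = CARD('m)" by simp
  have det: "det (facet_rows z I) \<noteq> 0" by (rule det_facet_rows_nonzero[OF finI cardI ind])
  have "facet_normal z I = a"
    unfolding facet_normal_iff[OF finI cardI det] using I(1) by (auto simp: J_def)
  then show ?thesis
    using that[of I] I(1) J(2) cardI det yI ty a(1) by (auto simp: D_def)
qed

lemma not_in_pos_below_facet:
  fixes z :: "'i \<Rightarrow> (real ^ 'm::finite) \<times> real"
  assumes K: "finite K" and le: "\<And>k. k \<in> K \<Longrightarrow> a \<bullet> fst (z k) \<le> snd (z k)" and t: "t < a \<bullet> y"
  shows "(y, t) \<notin> pos (z ` K)"
proof
  assume "(y, t) \<in> pos (z ` K)"
  then obtain c where c: "(y, t) = (\<Sum>k\<in>K. c k *\<^sub>R z k)" "\<forall>k\<in>K. 0 \<le> c k" by (auto simp: pos_image_iff K)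
  have y: "y = (\<Sum>k\<in>K. c k *\<^sub>R fst (z k))" and s: "t = (\<Sum>k\<in>K. c k * snd (z k))"
    using arg_cong[OF c(1), of fst] arg_cong[OF c(1), of snd] by (simp_all add: fst_sum snd_sum)
  have "a \<bullet> y \<le> t"
    unfolding y s inner_sum_right inner_scaleR_right using le c(2) by (intro sum_mono mult_left_mono) auto
  then show False using t by simp
qed

lemma facet_unique:
  fixes z :: "'i \<Rightarrow> (real ^ 'm::finite) \<times> real"
  assumes K: "finite K" and IK: "I \<subseteq> K" "I' \<subseteq> K" "card I = CARD('m)" "card I' = CARD('m)"
    and a: "\<And>i. i \<in> I \<Longrightarrow> a \<bullet> fst (z i) = snd (z i)" "\<And>j. j \<in> K - I \<Longrightarrow> a \<bullet> fst (z j) < snd (z j)"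
    and a': "\<And>i. i \<in> I' \<Longrightarrow> a' \<bullet> fst (z i) = snd (z i)" "\<And>j. j \<in> K - I' \<Longrightarrow> a' \<bullet> fst (z j) < snd (z j)"
    and y: "y \<in> pos ((\<lambda>k. fst (z k)) ` I)" "y \<in> pos ((\<lambda>k. fst (z k)) ` I')"
    and gen: "\<And>J. J \<subseteq> K \<Longrightarrow> card J < CARD('m) \<Longrightarrow> y \<notin> span ((\<lambda>k. fst (z k)) ` J)"
  shows "I = I'"
proof (rule ccontr)
  assume ne: "I \<noteq> I'"
  have fin: "finite I" "finite I'" using K IK finite_subset by auto
  have le: "b \<bullet> y \<le> c \<bullet> y"
    if S: "y \<in> pos ((\<lambda>k. fst (z k)) ` S)" "finite S" "S \<subseteq> K"
      "\<And>i. i \<in> S \<Longrightarrow> c \<bullet> fst (z i) = snd (z i)" "\<And>i. i \<in> K \<Longrightarrow> b \<bullet> fst (z i) \<le> snd (z i)" for S b c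
  proof -
    obtain l where l: "y = (\<Sum>i\<in>S. l i *\<^sub>R fst (z i))" "\<forall>i\<in>S. 0 \<le> l i"
      using S(1) unfolding pos_image_iff[OF \<open>finite S\<close>] by blast
    show ?thesis unfolding l(1) inner_sum_right inner_scaleR_right
      using S l(2) by (intro sum_mono mult_left_mono) auto
  qed
  have ale: "a \<bullet> fst (z i) \<le> snd (z i)" if "i \<in> K" for i using a that by (cases "i \<in> I") force+
  have ale': "a' \<bullet> fst (z i) \<le> snd (z i)" if "i \<in> K" for i using a' that by (cases "i \<in> I'") force+
  have eq: "a \<bullet> y = a' \<bullet> y"
    using le[OF y(1) fin(1) IK(1) a(1) ale'] le[OF y(2) fin(2) IK(2) a'(1) ale] by simp
  obtain l where l: "y = (\<Sum>i\<in>I. l i *\<^sub>R fst (z i))" "\<forall>i\<in>I. 0 \<le> l i"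
    using y(1) by (auto simp: pos_image_iff fin)
  have "0 = a \<bullet> y - a' \<bullet> y" using eq by simp
  also have "\<dots> = (\<Sum>i\<in>I. l i * (snd (z i) - a' \<bullet> fst (z i)))"
    unfolding l(1) inner_sum_right inner_scaleR_right using a(1)
    by (simp add: sum_subtractf[symmetric] right_diff_distrib)
  finally have z0: "(\<Sum>i\<in>I. l i * (snd (z i) - a' \<bullet> fst (z i))) = 0" by simp
  have nn: "0 \<le> l i * (snd (z i) - a' \<bullet> fst (z i))" if "i \<in> I" for i
    using ale'[of i] IK l(2) that by (auto intro!: mult_nonneg_nonneg)
  have l0: "l i = 0" if "i \<in> I - I'" for i
  proof -
    have "l i * (snd (z i) - a' \<bullet> fst (z i)) = 0"
      using sum_nonneg_eq_0_iff[OF fin(1) nn] z0 that by auto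
    moreover have "a' \<bullet> fst (z i) < snd (z i)" using that IK a'(2) by auto
    ultimately show ?thesis by auto
  qed
  have "y = (\<Sum>i\<in>I \<inter> I'. l i *\<^sub>R fst (z i))"
    unfolding l(1) using fin l0 by (intro sum.mono_neutral_right) auto
  also have "\<dots> \<in> span ((\<lambda>k. fst (z k)) ` (I \<inter> I'))"
    by (intro span_sum span_scale span_base) auto
  finally have "y \<in> span ((\<lambda>k. fst (z k)) ` (I \<inter> I'))" .
  moreover have "card (I \<inter> I') < CARD('m)"
  proof -
    have "I \<inter> I' \<subset> I" using ne fin IK card_subset_eq[of I' I]
        by (metis Int_lower1 inf.absorb_iff1 inf.strict_order_iff inf_commute order_le_less)
    then show ?thesis using psubset_card_mono[OF fin(1)] IK by metis
  qed
  ultimately show False using gen[of "I \<inter> I'"] IK by blast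
qed

lemma AE_lborel_hyperplane:
  fixes a :: "'a::euclidean_space"
  assumes "a \<noteq> 0"
  shows "AE x in lborel. a \<bullet> x \<noteq> b"
proof -
  have "negligible {x. a \<bullet> x = b}" using assms by (intro negligible_hyperplane) simp
  then have "AE x in lebesgue. x \<notin> {x. a \<bullet> x = b}"
    unfolding negligible_iff_null_sets by (rule AE_not_in)
  moreover have "{x. a \<bullet> x = b} \<in> sets borel"
    by (intro borel_closed closed_hyperplane)
  ultimately show ?thesis by (simp add: AE_completion_iff)
qed

lemma AE_not_in_small_span:
  fixes z :: "'i \<Rightarrow> (real ^ 'm::finite) \<times> real"
  assumes K: "finite K"
  shows "AE x in (lborel :: ((real ^ 'm) \<times> real) measure).
    \<forall>J\<in>Pow K. card J < CARD('m) \<longrightarrow> fst x \<notin> span ((\<lambda>k. fst (z k)) ` J)"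
proof (rule AE_finite_allI)
  show "finite (Pow K)" using K by simp
  fix J assume J: "J \<in> Pow K"
  have finJ: "finite J" using J K finite_subset by auto
  show "AE x in (lborel :: ((real ^ 'm) \<times> real) measure).
     card J < CARD('m) \<longrightarrow> fst x \<notin> span ((\<lambda>k. fst (z k)) ` J)"
  proof (cases "card J < CARD('m)")
    case True
    have "dim ((\<lambda>k. fst (z k)) ` J) \<le> card J"
      using dim_le_card'[of "(\<lambda>k. fst (z k)) ` J"] card_image_le[OF finJ] finJ
          by (meson finite_imageI le_trans)
    then have "dim ((\<lambda>k. fst (z k)) ` J) < DIM(real ^ 'm)" using True by simp
    then obtain a :: "real ^ 'm" where a: "a \<noteq> 0" "span ((\<lambda>k. fst (z k)) ` J) \<subseteq> {x. a \<bullet> x = 0}"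
      using lowdim_subset_hyperplane by blast
    have "AE x in lborel. (a, 0::real) \<bullet> x \<noteq> 0"
      using a by (intro AE_lborel_hyperplane) (simp add: zero_prod_def)
    then show ?thesis using a(2) by (auto simp: inner_prod_def elim!: eventually_mono)
  qed auto
qed

section \<open>The uniform distribution on the half-ball\<close>

lemma borel_measurable_fst [measurable (raw)]:
  fixes f :: "'w \<Rightarrow> 'a::euclidean_space \<times> 'b::euclidean_space"
  assumes "f \<in> borel_measurable M"
  shows "(\<lambda>w. fst (f w)) \<in> borel_measurable M"
  by (rule measurable_compose[OF assms]) (intro borel_measurable_continuous_onI continuous_intros)

lemma borel_measurable_snd [measurable (raw)]:
  fixes f :: "'w \<Rightarrow> 'a::euclidean_space \<times> 'b::euclidean_space"
  assumes "f \<in> borel_measurable M"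
  shows "(\<lambda>w. snd (f w)) \<in> borel_measurable M"
  by (rule measurable_compose[OF assms]) (intro borel_measurable_continuous_onI continuous_intros)

lemma nn_integral_if_const:
  "(\<integral>\<^sup>+x. (if c then f x else 0) \<partial>M) = (if c then \<integral>\<^sup>+x. f x \<partial>M else 0)"
  by simp

definition half_ball :: "('a::euclidean_space \<times> real) set" where
  "half_ball = {x. norm x \<le> 1 \<and> 0 \<le> snd x}"

definition half_ball_density :: "('a::euclidean_space \<times> real) \<Rightarrow> ennreal" where
  "half_ball_density x = ennreal (2 / unit_ball_vol (real (DIM('a) + 1))) * indicator half_ball x"

definition uniform_half_ball :: "('a::euclidean_space \<times> real) measure" where
  "uniform_half_ball = density lborel half_ball_density"

lemma half_ball_borel [measurable]: "half_ball \<in> sets borel"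
proof -
  have "half_ball = {x::'a \<times> real. norm x \<le> 1} \<inter> {x. 0 \<le> snd x}" by (auto simp: half_ball_def)
  also have "\<dots> \<in> sets borel"
    by (intro sets.Int borel_closed closed_Collect_le continuous_intros)
  finally show ?thesis .
qed

lemma half_ball_density_borel [measurable]: "half_ball_density \<in> borel_measurable borel"
  unfolding half_ball_density_def [abs_def] by measurable

lemma sets_uniform_half_ball [measurable_cong, simp]: "sets uniform_half_ball = sets borel"
  and space_uniform_half_ball [simp]: "space uniform_half_ball = UNIV"
  by (simp_all add: uniform_half_ball_def)

lemma nn_integral_uniform_half_ball:
  "f \<in> borel_measurable borel \<Longrightarrow>
    (\<integral>\<^sup>+x. f x \<partial>uniform_half_ball) = (\<integral>\<^sup>+x. half_ball_density x * f x \<partial>lborel)"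
  unfolding uniform_half_ball_def by (rule nn_integral_density) auto

lemma emeasure_half_ball:
  "emeasure lborel (half_ball :: ('a::euclidean_space \<times> real) set)
      = ennreal (unit_ball_vol (real (DIM('a) + 1)) / 2)"
proof -
  let ?r = "\<lambda>x::'a \<times> real. (fst x, - snd x)"
  let ?H = "half_ball :: ('a \<times> real) set"
  have r: "linear ?r" "\<And>x. norm (?r x) = norm x"
    by (auto simp: linear_iff norm_Pair)
  have [measurable]: "?r \<in> borel_measurable borel" by (rule borel_measurable_linear[OF r(1)])
  have eq: "(\<integral>\<^sup>+x. indicator ?H (?r x) \<partial>lborel) = (\<integral>\<^sup>+x. indicator ?H x \<partial>lborel)"
    by (rule nn_integral_lborel_isometry) (use r in auto)
  have "AE x in lborel. (0::'a, 1::real) \<bullet> x \<noteq> 0" by (rule AE_lborel_hyperplane) (simp add: zero_prod_def)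
  then have "AE x in lborel. (indicator (cball 0 1) x :: ennreal) = indicator ?H x + indicator ?H (?r x)"
    by eventually_elim (auto simp: indicator_def half_ball_def inner_prod_def norm_Pair norm_prod_def)
  then have "(\<integral>\<^sup>+x. indicator (cball (0::'a \<times> real) 1) x \<partial>lborel)
      = (\<integral>\<^sup>+x. indicator ?H x + indicator ?H (?r x) \<partial>lborel)"
    by (rule nn_integral_cong_AE)
  also have "\<dots> = (\<integral>\<^sup>+x. indicator ?H x \<partial>lborel) + (\<integral>\<^sup>+x. indicator ?H x \<partial>lborel)"
    by (subst nn_integral_add) (auto simp: eq)
  finally have "emeasure lborel (cball (0::'a \<times> real) 1) = 2 * emeasure lborel ?H"
    by (simp add: mult_2)
  then have *: "2 * emeasure lborel ?H = ennreal (unit_ball_vol (real (DIM('a) + 1)))"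
    by (simp add: emeasure_cball)
  then have "emeasure lborel ?H \<noteq> \<infinity>" by (auto simp: ennreal_mult_eq_top_iff)
  then obtain h where h: "emeasure lborel ?H = ennreal h" "0 \<le> h"
    by (metis ennreal_cases infinity_ennreal_def)
  then have "ennreal (2 * h) = ennreal (unit_ball_vol (real (DIM('a) + 1)))"
      using * by (simp add: ennreal_mult)
  then have "2 * h = unit_ball_vol (real (DIM('a) + 1))" using h(2) by (subst (asm) ennreal_inj) auto
  then show ?thesis using h by (simp add: field_simps)
qed

lemma prob_space_uniform_half_ball: "prob_space uniform_half_ball"
proof
  let ?v = "unit_ball_vol (real (DIM('a) + 1))"
  have v: "?v > 0" by (rule unit_ball_vol_pos) simp
  have "0 < unit_ball_vol (1 + real DIM('a))" by (rule unit_ball_vol_pos) simp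
  then have v': "unit_ball_vol (1 + real DIM('a)) \<noteq> 0" by (rule less_imp_neq[THEN not_sym])
  have "emeasure uniform_half_ball (UNIV :: ('a \<times> real) set)
      = (\<integral>\<^sup>+x. half_ball_density (x :: 'a \<times> real) \<partial>lborel)"
    using nn_integral_uniform_half_ball[of "\<lambda>_. 1"] by simp
  also have "\<dots> = ennreal (2 / ?v) * ennreal (?v / 2)"
    by (simp add: half_ball_density_def[abs_def] nn_integral_cmult emeasure_half_ball)
  also have "\<dots> = 1" using v v' by (subst ennreal_mult[symmetric]) auto
  finally show "emeasure uniform_half_ball (space (uniform_half_ball :: ('a \<times> real) measure)) = 1" by simp
qed

lemma AE_uniform_half_ball:
  assumes "AE x in lborel. x \<in> half_ball \<longrightarrow> P x"
  shows "AE x in uniform_half_ball. P x"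
  unfolding uniform_half_ball_def using assms
  by (subst AE_density) (auto simp: half_ball_density_def indicator_def elim!: eventually_mono split:
      if_splits)

lemma AE_uniform_half_ball_snd_pos: "AE x in (uniform_half_ball :: ('a::euclidean_space \<times> real) measure). 0
    < snd x"
proof (rule AE_uniform_half_ball)
  have "AE x in lborel. (0::'a, 1::real) \<bullet> x \<noteq> 0" by (rule AE_lborel_hyperplane) (simp add: zero_prod_def)
  then show "AE x in lborel. x \<in> half_ball \<longrightarrow> 0 < snd (x :: 'a \<times> real)"
    by eventually_elim (auto simp: half_ball_def inner_prod_def)
qed

definition below_facet :: "real ^ 'm ^ 'm \<Rightarrow> real ^ 'm \<Rightarrow> ((real ^ 'm::finite) \<times> real) set" where
  "below_facet Y a = {x. fst x \<in> pos (range (($) Y)) \<and> snd x < a \<bullet> fst x}"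

lemma measurable_below_facet [measurable (raw)]:
  fixes Y :: "'w \<Rightarrow> real ^ 'm ^ 'm::finite"
  assumes [measurable]: "Y \<in> borel_measurable M" "a \<in> borel_measurable M" "x \<in> borel_measurable M"
  shows "Measurable.pred M (\<lambda>w. x w \<in> below_facet (Y w) (a w))"
proof -
  have [measurable]: "(\<lambda>w. Y w $ i) \<in> borel_measurable M" for i
    using measurable_compose[OF assms(1) measurable_vec_nth] by simp
  have [measurable]: "Measurable.pred M (\<lambda>w. fst (x w) \<in> pos ((\<lambda>i. Y w $ i) ` UNIV))"
    by (rule pred_pos) auto
  show ?thesis unfolding below_facet_def mem_Collect_eq by measurable
qed

lemma below_facet_borel [measurable]: "below_facet Y a \<in> sets borel"
  using measurable_below_facet[of "\<lambda>_. Y" borel "\<lambda>_. a" "\<lambda>x. x"] by (simp add: pred_def)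

definition missed :: "('i \<Rightarrow> (real ^ 'm::finite) \<times> real) \<Rightarrow> 'i set \<Rightarrow> ennreal" where
  "missed z K = emeasure uniform_half_ball {x. x \<notin> pos (z ` K)}"

definition facets_of :: "'m::finite itself \<Rightarrow> 'i set \<Rightarrow> 'i set set" where
  "facets_of _ K = {I. I \<subseteq> K \<and> card I = CARD('m)}"

definition meets_orthants :: "('i \<Rightarrow> (real ^ 'm::finite) \<times> real) \<Rightarrow> 'i set \<Rightarrow> bool" where
  "meets_orthants z K \<longleftrightarrow> (\<forall>\<epsilon>::'m \<Rightarrow> bool. \<exists>k\<in>K. \<forall>i. if \<epsilon> i then 0 < fst (z k) $ i else fst (z k) $ i < 0)"

lemma meets_orthants_imp:
  fixes z :: "'i \<Rightarrow> (real ^ 'm::finite) \<times> real"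
  assumes "meets_orthants z K" "b \<noteq> 0"
  shows "\<exists>k\<in>K. b \<bullet> fst (z k) < 0"
proof -
  obtain k where k: "k \<in> K" "\<And>i. if b $ i < 0 then 0 < fst (z k) $ i else fst (z k) $ i < 0"
    using assms(1)[unfolded meets_orthants_def, rule_format, of "\<lambda>i. b $ i < 0"] by blast
  obtain i where i: "b $ i \<noteq> 0" using assms(2) by (auto simp: vec_eq_iff)
  have "0 < (\<Sum>i\<in>UNIV. - (b $ i * fst (z k) $ i))"
  proof (rule sum_pos2)
    show "0 < - (b $ i * fst (z k) $ i)" using i k(2)[of i]
      by (auto split: if_splits simp: mult_less_0_iff)
    show "0 \<le> - (b $ j * fst (z k) $ j)" for j using k(2)[of j]
      by (auto split: if_splits simp: mult_le_0_iff)
  qed auto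
  also have "\<dots> = - (b \<bullet> fst (z k))" by (simp add: inner_vec_def sum_negf)
  finally show ?thesis using k(1) by auto
qed

lemma closed_pos_borel [measurable]: "finite K \<Longrightarrow> {x. x \<notin> pos (z ` K)}
    \<in> sets (borel :: 'a::euclidean_space measure)"
proof -
  assume "finite K"
  then have "- pos (z ` K) \<in> sets (borel :: 'a measure)" by (auto intro: borel_open closed_pos)
  then show ?thesis by (simp add: Compl_eq)
qed

lemma missed_le:
  fixes z :: "'i \<Rightarrow> (real ^ 'm::finite) \<times> real"
  assumes K: "finite K" and tpos: "\<And>k. k \<in> K \<Longrightarrow> 0 < snd (z k)"
  shows "missed z K \<le> (\<Sum>I\<in>facets_of TYPE('m) K.
      if det (facet_rows z I) \<noteq> 0 \<and> (\<forall>k\<in>K-I. facet_normal z I \<bullet> fst (z k) \<le> snd (z k))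
      then emeasure uniform_half_ball (below_facet (facet_rows z I) (facet_normal z I)) else 0)
    + (if meets_orthants z K then 0 else 1)"
proof (cases "meets_orthants z K")
  case True
  let ?c = "\<lambda>I. det (facet_rows z I) \<noteq> 0 \<and> (\<forall>k\<in>K-I. facet_normal z I \<bullet> fst (z k) \<le> snd (z k))"
  let ?B = "\<lambda>I. below_facet (facet_rows z I) (facet_normal z I)"
  have fin: "finite (facets_of TYPE('m) K)" using K by (auto simp: facets_of_def)
  have "AE x in uniform_half_ball. indicator {x. x \<notin> pos (z ` K)} x
      \<le> (\<Sum>I\<in>facets_of TYPE('m) K. if ?c I then indicator (?B I) x else 0 :: ennreal)"
  proof (rule AE_uniform_half_ball)
    show "AE x in lborel. x \<in> half_ball \<longrightarrow> indicator {x. x \<notin> pos (z ` K)} x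
      \<le> (\<Sum>I\<in>facets_of TYPE('m) K. if ?c I then indicator (?B I) x else 0 :: ennreal)"
      using AE_not_in_small_span[OF K, of z]
    proof (eventually_elim, intro impI)
      fix x :: "(real ^ 'm) \<times> real"
      assume gen: "\<forall>J\<in>Pow K. card J < CARD('m) \<longrightarrow> fst x \<notin> span ((\<lambda>k. fst (z k)) ` J)"
        and x: "x \<in> half_ball"
      show "indicator {x. x \<notin> pos (z ` K)} x
        \<le> (\<Sum>I\<in>facets_of TYPE('m) K. if ?c I then indicator (?B I) x else 0 :: ennreal)"
      proof (cases "x \<in> pos (z ` K)")
        case False
        have *: "(fst x, snd x) \<notin> pos (z ` K)" "0 \<le> snd x" using False x by (auto simp: half_ball_def)
        obtain I where I: "I \<subseteq> K" "card I = CARD('m)" "det (facet_rows z I) \<noteq> 0"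
          "\<And>k. k \<in> K \<Longrightarrow> facet_normal z I \<bullet> fst (z k) \<le> snd (z k)"
          "fst x \<in> pos ((\<lambda>k. fst (z k)) ` I)" "snd x < facet_normal z I \<bullet> fst x"
          using exists_facet[OF K tpos meets_orthants_imp[OF True] *(2) *(1)] gen by blast
        have finI: "finite I" using I(1) K finite_subset by blast
        have "x \<in> ?B I" using I(5,6) range_facet_rows[OF finI I(2), of z] by (simp add: below_facet_def)
        then have "indicator {x. x \<notin> pos (z ` K)} x = (if ?c I then indicator (?B I) x else 0 :: ennreal)"
          using I False by auto
        also have "\<dots> \<le> (\<Sum>I\<in>facets_of TYPE('m) K. if ?c I then indicator (?B I) x else 0 :: ennreal)"
          using I fin by (intro member_le_sum) (auto simp: facets_of_def)
        finally show ?thesis .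
      qed simp
    qed
  qed
  then have "(\<integral>\<^sup>+x. indicator {x. x \<notin> pos (z ` K)} x \<partial>uniform_half_ball)
     \<le> (\<integral>\<^sup>+x. (\<Sum>I\<in>facets_of TYPE('m) K. if ?c I then indicator (?B I) x else 0) \<partial>uniform_half_ball)"
    by (rule nn_integral_mono_AE)
  also have "\<dots> = (\<Sum>I\<in>facets_of TYPE('m) K. \<integral>\<^sup>+x. (if ?c I then indicator (?B I) x else 0)
      \<partial>uniform_half_ball)"
    by (rule nn_integral_sum) (auto intro!: measurable_If)
  also have "\<dots> = (\<Sum>I\<in>facets_of TYPE('m) K. if ?c I then emeasure uniform_half_ball (?B I) else 0)"
    unfolding nn_integral_if_const by (simp add: nn_integral_indicator cong: if_cong)
  finally show ?thesis using True K by (simp add: missed_def nn_integral_indicator)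
next
  case False
  interpret prob_space "uniform_half_ball :: ((real ^ 'm) \<times> real) measure"
      by (rule prob_space_uniform_half_ball)
  have "missed z K \<le> 1" unfolding missed_def by (rule emeasure_le_1)
  then show ?thesis using False by (auto intro: order.trans add_increasing)
qed

lemma missed_ge:
  fixes z :: "'i \<Rightarrow> (real ^ 'm::finite) \<times> real"
  assumes K: "finite K"
  shows "(\<Sum>I\<in>facets_of TYPE('m) K.
      if det (facet_rows z I) \<noteq> 0 \<and> (\<forall>k\<in>K-I. facet_normal z I \<bullet> fst (z k) < snd (z k))
      then emeasure uniform_half_ball (below_facet (facet_rows z I) (facet_normal z I)) else 0)
    \<le> missed z K"
proof -
  let ?c = "\<lambda>I. det (facet_rows z I) \<noteq> 0 \<and> (\<forall>k\<in>K-I. facet_normal z I \<bullet> fst (z k) < snd (z k))"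
  let ?B = "\<lambda>I. below_facet (facet_rows z I) (facet_normal z I)"
  have fin: "finite (facets_of TYPE('m) K)" using K by (auto simp: facets_of_def)
  have "(\<Sum>I\<in>facets_of TYPE('m) K. if ?c I then emeasure uniform_half_ball (?B I) else 0)
     = (\<Sum>I\<in>facets_of TYPE('m) K. \<integral>\<^sup>+x. (if ?c I then indicator (?B I) x else 0) \<partial>uniform_half_ball)"
    unfolding nn_integral_if_const by (simp add: nn_integral_indicator cong: if_cong)
  also have "\<dots> = (\<integral>\<^sup>+x. (\<Sum>I\<in>facets_of TYPE('m) K. if ?c I then indicator (?B I) x else 0)
      \<partial>uniform_half_ball)"
    by (rule nn_integral_sum[symmetric]) (auto intro!: measurable_If)
  also have "\<dots> \<le> (\<integral>\<^sup>+x. indicator {x. x \<notin> pos (z ` K)} x \<partial>uniform_half_ball)"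
  proof (intro nn_integral_mono_AE AE_uniform_half_ball)
    show "AE x in lborel. x \<in> half_ball \<longrightarrow> (\<Sum>I\<in>facets_of TYPE('m) K.
        if ?c I then indicator (?B I) x else 0 :: ennreal)
        \<le> indicator {x. x \<notin> pos (z ` K)} x"
      using AE_not_in_small_span[OF K, of z]
    proof (eventually_elim, intro impI)
      fix x :: "(real ^ 'm) \<times> real"
      assume gen: "\<forall>J\<in>Pow K. card J < CARD('m) \<longrightarrow> fst x \<notin> span ((\<lambda>k. fst (z k)) ` J)"
        and x: "x \<in> half_ball"
      let ?f = "\<lambda>I. if ?c I then indicator (?B I) x else 0 :: ennreal"
      show "sum ?f (facets_of TYPE('m) K) \<le> indicator {x. x \<notin> pos (z ` K)} x"
      proof (cases "\<exists>I\<in>facets_of TYPE('m) K. ?c I \<and> x \<in> ?B I")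
        case True
        then obtain I where I: "I \<in> facets_of TYPE('m) K" "?c I" "x \<in> ?B I" by blast
        have facet: "J \<subseteq> K" "card J = CARD('m)" "fst x \<in> pos ((\<lambda>k. fst (z k)) ` J)"
            "\<And>i. i \<in> J \<Longrightarrow> facet_normal z J \<bullet> fst (z i) = snd (z i)"
            "\<And>i. i \<in> K - J \<Longrightarrow> facet_normal z J \<bullet> fst (z i) < snd (z i)"
          if J: "J \<in> facets_of TYPE('m) K" "?c J" "x \<in> ?B J" for J
        proof -
          show JK: "J \<subseteq> K" "card J = CARD('m)" using J(1) by (auto simp: facets_of_def)
          then have finJ: "finite J" using K finite_subset by blast
          show "fst x \<in> pos ((\<lambda>k. fst (z k)) ` J)"
            using J(3) range_facet_rows[OF finJ JK(2), of z] by (simp add: below_facet_def)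
          show "facet_normal z J \<bullet> fst (z i) = snd (z i)" if "i \<in> J" for i
            using facet_normal_iff[OF finJ JK(2), of z "facet_normal z J"] J(2) that by blast
          show "facet_normal z J \<bullet> fst (z i) < snd (z i)" if "i \<in> K - J" for i using J(2) that by blast
        qed
        have "?f J = 0" if J: "J \<in> facets_of TYPE('m) K - {I}" for J
        proof (rule ccontr)
          assume "?f J \<noteq> 0"
          then have J': "J \<in> facets_of TYPE('m) K" "?c J" "x \<in> ?B J"
            using J by (auto split: if_splits simp: indicator_def)
          have "I = J"
            using facet_unique[OF K facet(1)[OF I] facet(1)[OF J'] facet(2)[OF I] facet(2)[OF J']
              facet(4)[OF I] facet(5)[OF I] facet(4)[OF J'] facet(5)[OF J'] facet(3)[OF I] facet(3)[OF J']]
                  gen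
            by blast
          then show False using J by simp
        qed
        then have "sum ?f (facets_of TYPE('m) K) = sum ?f {I}"
          using fin I(1) by (intro sum.mono_neutral_right) auto
        also have "\<dots> = 1" using I by simp
        also have "x \<notin> pos (z ` K)"
        proof -
          have "facet_normal z I \<bullet> fst (z k) \<le> snd (z k)" if "k \<in> K" for k
            using facet(4,5)[OF I, of k] that by (cases "k \<in> I") force+
          moreover have "snd x < facet_normal z I \<bullet> fst x" using I(3) by (simp add: below_facet_def)
          ultimately show ?thesis using not_in_pos_below_facet[OF K, of "facet_normal z I" z "snd x"
              "fst x"] by simp
        qed
        then have "1 = (indicator {x. x \<notin> pos (z ` K)} x :: ennreal)" by simp
        finally show ?thesis by simp
      next
        case False
        then have "sum ?f (facets_of TYPE('m) K) = 0" by (intro sum.neutral) auto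
        then show ?thesis by simp
      qed
    qed
  qed
  finally show ?thesis using K by (simp add: missed_def nn_integral_indicator)
qed

section \<open>Integration over facets\<close>

definition above_graph :: "bool \<Rightarrow> 'a::euclidean_space \<Rightarrow> ('a \<times> real) set" where
  "above_graph strict a = {x. if strict then a \<bullet> fst x < snd x else a \<bullet> fst x \<le> snd x}"

definition above_prob :: "'a::euclidean_space \<Rightarrow> ennreal" where
  "above_prob a = emeasure uniform_half_ball (above_graph False a)"

lemma measurable_above_graph [measurable (raw)]:
  assumes [measurable]: "a \<in> borel_measurable M" "x \<in> borel_measurable M"
  shows "Measurable.pred M (\<lambda>w. x w \<in> above_graph s (a w))"
  unfolding above_graph_def mem_Collect_eq by (cases s) (simp_all, measurable)

lemma above_graph_borel [measurable]: "above_graph s a \<in> sets borel"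
  using measurable_above_graph[of "\<lambda>_. a" borel "\<lambda>x. x" s] by (simp add: pred_def)

lemma emeasure_above_graph: "emeasure uniform_half_ball (above_graph s a) = above_prob a"
proof (cases s)
  case True
  have "AE x in lborel. (- a, 1::real) \<bullet> x \<noteq> 0" by (rule AE_lborel_hyperplane) (simp add: zero_prod_def)
  then have "AE x in lborel. x \<in> half_ball \<longrightarrow> (x \<in> above_graph True a \<longleftrightarrow> x \<in> above_graph False a)"
    by eventually_elim (auto simp: above_graph_def inner_prod_def)
  then have "AE x in uniform_half_ball. x \<in> above_graph True a \<longleftrightarrow> x \<in> above_graph False a"
    by (rule AE_uniform_half_ball)
  then show ?thesis unfolding above_prob_def using True by (auto intro!: emeasure_eq_AE)
qed (simp add: above_prob_def)

lemma measurable_emeasure_uniform_half_ball: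
  fixes S :: "'w \<Rightarrow> ('a::euclidean_space \<times> real) set"
  assumes "Measurable.pred (M \<Otimes>\<^sub>M borel) (\<lambda>w. snd w \<in> S (fst w))"
  shows "(\<lambda>w. emeasure uniform_half_ball (S w)) \<in> borel_measurable M"
proof -
  interpret prob_space "uniform_half_ball :: ('a \<times> real) measure" by (rule prob_space_uniform_half_ball)
  have m: "Measurable.pred (M \<Otimes>\<^sub>M uniform_half_ball) (\<lambda>w. snd w \<in> S (fst w))"
    using assms by (simp cong: measurable_cong_sets sets_pair_measure_cong)
  have "(\<lambda>w. \<integral>\<^sup>+x. indicator (S w) x \<partial>uniform_half_ball) \<in> borel_measurable M"
    using m by (intro borel_measurable_nn_integral) (simp add: case_prod_unfold)
  moreover have "(\<integral>\<^sup>+x. indicator (S w) x \<partial>uniform_half_ball) = emeasure uniform_half_ball (S w)"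
    if "w \<in> space M" for w
  proof (rule nn_integral_indicator)
    have "Measurable.pred borel ((\<lambda>v. snd v \<in> S (fst v)) \<circ> Pair w)"
      by (rule measurable_comp[OF _ assms]) (use that in measurable)
    then show "S w \<in> sets uniform_half_ball" by (simp add: pred_def)
  qed
  ultimately show ?thesis by (simp cong: measurable_cong)
qed

lemma borel_measurable_above_prob [measurable (raw)]:
  assumes [measurable]: "a \<in> borel_measurable M"
  shows "(\<lambda>w. above_prob (a w :: 'a::euclidean_space)) \<in> borel_measurable M"
  unfolding above_prob_def by (rule measurable_emeasure_uniform_half_ball) measurable

lemma borel_measurable_below_facet_prob [measurable (raw)]:
  fixes a :: "'w \<Rightarrow> real ^ 'm::finite"
  assumes [measurable]: "Y \<in> borel_measurable M" "a \<in> borel_measurable M"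
  shows "(\<lambda>w. emeasure uniform_half_ball (below_facet (Y w) (a w))) \<in> borel_measurable M"
  by (rule measurable_emeasure_uniform_half_ball) measurable

definition facet_density :: "real ^ 'm::finite \<Rightarrow> ennreal" where
  "facet_density a = (\<integral>\<^sup>+Y. ennreal \<bar>det Y\<bar> * (\<Prod>i\<in>UNIV. half_ball_density (Y $ i, a \<bullet> (Y $ i))) *
     emeasure uniform_half_ball (below_facet Y a) \<partial>(lborel :: (real ^ 'm ^ 'm) measure))"

definition facet_value :: "nat \<Rightarrow> real ^ 'm ^ 'm \<Rightarrow> real ^ 'm::finite \<Rightarrow> ennreal" where
  "facet_value n Y t = (if det Y \<noteq> 0 then emeasure uniform_half_ball (below_facet Y (row_solution Y t)) *
     above_prob (row_solution Y t) ^ n else 0)"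

lemma measurable_matrix_row [measurable (raw)]:
  fixes Y :: "'w \<Rightarrow> 'v::euclidean_space ^ 'm::finite"
  shows "Y \<in> borel_measurable M \<Longrightarrow> (\<lambda>w. Y w $ i) \<in> borel_measurable M"
  by (rule measurable_compose[OF _ measurable_vec_nth])

lemma borel_measurable_facet_value [measurable (raw)]:
  fixes Y :: "'w \<Rightarrow> real ^ 'm ^ 'm::finite"
  assumes [measurable]: "Y \<in> borel_measurable M" "t \<in> borel_measurable M"
  shows "(\<lambda>w. facet_value n (Y w) (t w)) \<in> borel_measurable M"
  unfolding facet_value_def by measurable

lemma nn_integral_lborel_unzip:
  fixes F :: "'v::euclidean_space ^ 'm::finite \<Rightarrow> real ^ 'm \<Rightarrow> ennreal"
  assumes [measurable]: "(\<lambda>x. F (fst x) (snd x)) \<in> borel_measurable borel"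
  shows "(\<integral>\<^sup>+Z. F (\<chi> i. fst (Z $ i)) (\<chi> i. snd (Z $ i)) \<partial>(lborel :: (('v \<times> real) ^ 'm) measure))
    = (\<integral>\<^sup>+Y. \<integral>\<^sup>+t. F Y t \<partial>lborel \<partial>lborel)"
proof -
  let ?u = "\<lambda>Z :: ('v \<times> real) ^ 'm. ((\<chi> i. fst (Z $ i)) :: 'v ^ 'm, (\<chi> i. snd (Z $ i)) :: real ^ 'm)"
  have lin: "linear ?u" by (auto simp: linear_iff vec_eq_iff)
  have "norm (?u Z) = norm Z" for Z
  proof -
    have "norm (?u Z)^2 = (\<Sum>i\<in>UNIV. norm (fst (Z $ i))^2) + (\<Sum>i\<in>UNIV. norm (snd (Z $ i))^2)"
      by (simp add: norm_Pair norm_vec_def L2_set_def sum_nonneg del: real_norm_def)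
    also have "\<dots> = norm Z ^ 2"
      by (simp add: norm_vec_def L2_set_def sum_nonneg norm_prod_def sum.distrib)
    finally show ?thesis by (simp add: power2_eq_iff_nonneg)
  qed
  moreover have "DIM(('v \<times> real) ^ 'm) = DIM(('v ^ 'm) \<times> (real ^ 'm))" by (simp add: algebra_simps)
  ultimately have "(\<integral>\<^sup>+Z. F (fst (?u Z)) (snd (?u Z)) \<partial>lborel) = (\<integral>\<^sup>+x. F (fst x) (snd x) \<partial>lborel)"
    using lin by (intro nn_integral_lborel_isometry[where F = "\<lambda>x. F (fst x) (snd x)"]) auto
  also have "\<dots> = (\<integral>\<^sup>+x. F (fst x) (snd x) \<partial>(lborel \<Otimes>\<^sub>M lborel))" by (simp add: lborel_prod)
  also have "\<dots> = (\<integral>\<^sup>+Y. \<integral>\<^sup>+t. F Y t \<partial>lborel \<partial>lborel)"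
    by (subst lborel.nn_integral_fst[symmetric]) (auto simp: lborel_prod)
  finally show ?thesis by simp
qed

lemma nn_integral_facet_value:
  "(\<integral>\<^sup>+Z. (\<Prod>i\<in>UNIV. half_ball_density (Z $ i)) *
       facet_value n (\<chi> i. fst (Z $ i)) (\<chi> i. snd (Z $ i)) \<partial>(lborel :: (((real ^ 'm::{finite,wellorder}) \<times>
           real) ^ 'm::_) measure))
    = (\<integral>\<^sup>+a. above_prob a ^ n * facet_density a \<partial>(lborel :: (real ^ 'm::_) measure))"
proof -
  let ?F = "\<lambda>(Y :: (real, 'm) vec ^ 'm::_) t. (\<Prod>i\<in>UNIV. half_ball_density (Y $ i, t $ i))
      * facet_value n Y t"
  let ?G = "\<lambda>(Y :: (real, 'm) vec ^ 'm::_) a. above_prob a ^ n * (ennreal \<bar>det Y\<bar> *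
     (\<Prod>i\<in>UNIV. half_ball_density (Y $ i, a \<bullet> (Y $ i))) * emeasure uniform_half_ball (below_facet Y a))"
  have "(\<integral>\<^sup>+Z. (\<Prod>i\<in>UNIV. half_ball_density (Z $ i)) *
       facet_value n (\<chi> i. fst (Z $ i)) (\<chi> i. snd (Z $ i)) \<partial>(lborel :: (((real, 'm) vec \<times> real) ^ 'm::_)
           measure))
    = (\<integral>\<^sup>+Z. ?F (\<chi> i. fst (Z $ i)) (\<chi> i. snd (Z $ i)) \<partial>lborel)"
    by simp
  also have "\<dots> = (\<integral>\<^sup>+Y. \<integral>\<^sup>+t. ?F Y t \<partial>lborel \<partial>lborel)"
    by (rule nn_integral_lborel_unzip) measurable
  also have "\<dots> = (\<integral>\<^sup>+Y. \<integral>\<^sup>+a. ?G Y a \<partial>lborel \<partial>lborel)"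
  proof (rule nn_integral_cong)
    fix Y :: "(real, 'm) vec ^ 'm::_"
    show "(\<integral>\<^sup>+t. ?F Y t \<partial>lborel) = (\<integral>\<^sup>+a. ?G Y a \<partial>lborel)"
    proof (cases "det Y = 0")
      case True
      then show ?thesis by (simp add: facet_value_def)
    next
      case False
      have sol: "row_solution Y (Y *v a) = a" for a
        unfolding row_solution_iff[OF False]
        by (simp add: matrix_vector_mult_def inner_vec_def mult.commute)
      have nth: "(Y *v a) $ i = a \<bullet> (Y $ i)" for a i
        by (simp add: matrix_vector_mult_def inner_vec_def mult.commute)
      have "(\<integral>\<^sup>+t. ?F Y t \<partial>lborel) = ennreal \<bar>det Y\<bar> * (\<integral>\<^sup>+a. ?F Y (Y *v a) \<partial>lborel)"
        by (rule nn_integral_matrix_vector_mult[OF False]) measurable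
      also have "\<dots> = (\<integral>\<^sup>+a. ennreal \<bar>det Y\<bar> * ?F Y (Y *v a) \<partial>lborel)"
      proof (rule nn_integral_cmult[symmetric])
        have [measurable]: "(*v) Y \<in> borel_measurable borel"
            by (rule borel_measurable_linear) (rule matrix_vector_mul_linear)
        show "(\<lambda>a. ?F Y (Y *v a)) \<in> borel_measurable lborel" by measurable
      qed
      also have "\<dots> = (\<integral>\<^sup>+a. ?G Y a \<partial>lborel)"
        using False by (intro nn_integral_cong) (simp add: sol nth facet_value_def mult_ac)
      finally show ?thesis .
    qed
  qed
  also have "\<dots> = (\<integral>\<^sup>+a. \<integral>\<^sup>+Y. ?G Y a \<partial>lborel \<partial>lborel)"
    by (rule lborel_pair.Fubini') measurable
  also have "\<dots> = (\<integral>\<^sup>+a. above_prob a ^ n * facet_density a \<partial>(lborel :: (real, 'm) vec measure))"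
  proof (rule nn_integral_cong)
    fix a :: "(real, 'm) vec"
    show "(\<integral>\<^sup>+Y. ?G Y a \<partial>lborel) = above_prob a ^ n * facet_density a"
      unfolding facet_density_def by (rule nn_integral_cmult) measurable
  qed
  finally show ?thesis .
qed

lemma nn_integral_facet:
  fixes K :: "'i set"
  assumes K: "finite K" and I: "I \<in> facets_of TYPE('m::{finite,wellorder}) K"
  shows "(\<integral>\<^sup>+z. (if det (facet_rows z I) \<noteq> 0 \<and> (\<forall>k\<in>K-I. z k \<in> above_graph s (facet_normal z I))
      then emeasure uniform_half_ball (below_facet (facet_rows z I) (facet_normal z I)) else 0)
      \<partial>Pi\<^sub>M K (\<lambda>_. uniform_half_ball :: ((real ^ 'm::_) \<times> real) measure))
    = (\<integral>\<^sup>+a. above_prob a ^ (card K - CARD('m)) * facet_density a \<partial>(lborel :: (real ^ 'm::_) measure))"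
proof -
  let ?U = "uniform_half_ball :: ((real, 'm) vec \<times> real) measure"
  interpret U: prob_space ?U by (rule prob_space_uniform_half_ball)
  interpret product_sigma_finite "\<lambda>_::'i. ?U" ..
  have IK: "I \<subseteq> K" "card I = CARD('m)" using I by (auto simp: facets_of_def)
  have fin: "finite I" "finite (K - I)" using K IK finite_subset by auto
  have KI: "I \<union> (K - I) = K" using IK by auto
  note bij = bij_betw_facet_enum[OF fin(1) IK(2)]
  have enum [measurable]: "(facet_enum I :: 'm \<Rightarrow> 'i) i \<in> I" for i using bij_betwE[OF bij] by auto
  then have enumK [measurable]: "(facet_enum I :: 'm \<Rightarrow> 'i) i \<in> K" for i using IK by auto
  have rows_cong: "facet_rows z I = facet_rows z' I" "facet_normal z I = facet_normal z' I"
    if "\<And>i. i \<in> I \<Longrightarrow> z i = z' i" for z z' :: "'i \<Rightarrow> (real, 'm) vec \<times> real"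
    using that enum by (simp_all add: facet_rows_def facet_normal_def)
  have rows_meas: "(\<lambda>z. facet_rows z I :: (real, 'm) vec ^ 'm::_) \<in> borel_measurable (Pi\<^sub>M L (\<lambda>_. borel))"
      "(\<lambda>z :: 'i \<Rightarrow> (real, 'm) vec \<times> real. (\<chi> i. snd (z (facet_enum I i))) :: (real, 'm) vec)
          \<in> borel_measurable (Pi\<^sub>M L (\<lambda>_. borel))"
    if "I \<subseteq> L" for L
  proof -
    have [measurable]: "(facet_enum I :: 'm \<Rightarrow> 'i) i \<in> L" for i using enum that by auto
    show "(\<lambda>z. facet_rows z I :: (real, 'm) vec ^ 'm::_) \<in> borel_measurable (Pi\<^sub>M L (\<lambda>_. borel))"
      unfolding facet_rows_def by (rule borel_measurable_vecI) simp
    show "(\<lambda>z :: 'i \<Rightarrow> (real, 'm) vec \<times> real. (\<chi> i. snd (z (facet_enum I i))) :: (real, 'm) vec)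
        \<in> borel_measurable (Pi\<^sub>M L (\<lambda>_. borel))"
      by (rule borel_measurable_vecI) simp
  qed
  note [measurable] = rows_meas[OF IK(1)] rows_meas[OF order_refl]
  have [measurable]: "(\<lambda>z. facet_normal z I :: (real, 'm) vec) \<in> borel_measurable (Pi\<^sub>M K (\<lambda>_. borel))"
    unfolding facet_normal_def by measurable
  let ?f = "\<lambda>z. if det (facet_rows z I) \<noteq> 0 \<and> (\<forall>k\<in>K-I. z k \<in> above_graph s (facet_normal z I))
      then emeasure ?U (below_facet (facet_rows z I) (facet_normal z I)) else 0"
  let ?h = "\<lambda>z :: 'i \<Rightarrow> (real, 'm) vec \<times> real. (\<chi> i. snd (z (facet_enum I i))) :: (real, 'm) vec"
  have "(\<lambda>z. \<forall>k\<in>K-I. z k \<in> above_graph s (facet_normal z I :: (real, 'm) vec))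
      \<in> Pi\<^sub>M K (\<lambda>_. borel) \<rightarrow>\<^sub>M count_space UNIV"
    using fin by (intro pred_intros_finite) (auto intro!: measurable_above_graph)
  then have [measurable]: "?f \<in> borel_measurable (Pi\<^sub>M K (\<lambda>_. borel))" by measurable
  have "integral\<^sup>N (Pi\<^sub>M K (\<lambda>_. ?U)) ?f
      = (\<integral>\<^sup>+x. \<integral>\<^sup>+y. ?f (merge I (K - I) (x, y)) \<partial>Pi\<^sub>M (K - I) (\<lambda>_. ?U) \<partial>Pi\<^sub>M I (\<lambda>_. ?U))"
  proof -
    have "?f \<in> borel_measurable (Pi\<^sub>M (I \<union> (K - I)) (\<lambda>_. ?U))"
      unfolding KI by measurable
    from product_nn_integral_fold[OF _ fin this] show ?thesis unfolding KI by simp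
  qed
  also have "\<dots> = (\<integral>\<^sup>+x. facet_value (card K - CARD('m)) (facet_rows x I) (?h x) \<partial>Pi\<^sub>M I (\<lambda>_. ?U))"
  proof (rule nn_integral_cong)
    fix x :: "'i \<Rightarrow> (real, 'm) vec \<times> real"
    let ?W = "if det (facet_rows x I) \<noteq> 0 then emeasure ?U (below_facet (facet_rows x I) (facet_normal x I))
        else 0"
    have "?f (merge I (K - I) (x, y)) = ?W * (\<Prod>k\<in>K-I. indicator (above_graph s (facet_normal x I)) (y k))"
        for y
    proof -
      have "facet_rows (merge I (K - I) (x, y)) I = facet_rows x I" "facet_normal (merge I (K - I) (x, y)) I
          = facet_normal x I"
        by (intro rows_cong; simp)+
      then show ?thesis using fin by (auto simp: indicator_def prod_zero_iff)
    qed
    then have "(\<integral>\<^sup>+y. ?f (merge I (K - I) (x, y)) \<partial>Pi\<^sub>M (K - I) (\<lambda>_. ?U))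
       = (\<integral>\<^sup>+y. ?W * (\<Prod>k\<in>K-I. indicator (above_graph s (facet_normal x I)) (y k)) \<partial>Pi\<^sub>M (K - I) (\<lambda>_. ?U))"
      by simp
    also have "\<dots> = ?W * (\<integral>\<^sup>+y. (\<Prod>k\<in>K-I. indicator (above_graph s (facet_normal x I)) (y k))
        \<partial>Pi\<^sub>M (K - I) (\<lambda>_. ?U))"
      by (rule nn_integral_cmult) measurable
    also have "(\<integral>\<^sup>+y. (\<Prod>k\<in>K-I. indicator (above_graph s (facet_normal x I)) (y k)) \<partial>Pi\<^sub>M (K - I) (\<lambda>_. ?U))
       = above_prob (facet_normal x I) ^ card (K - I)"
      using fin by (subst product_nn_integral_prod) (auto simp: nn_integral_indicator emeasure_above_graph)
    also have "card (K - I) = card K - CARD('m)" using IK fin by (simp add: card_Diff_subset)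
    finally show "(\<integral>\<^sup>+y. ?f (merge I (K - I) (x, y)) \<partial>Pi\<^sub>M (K - I) (\<lambda>_. ?U))
       = facet_value (card K - CARD('m)) (facet_rows x I) (?h x)"
      by (simp add: facet_value_def facet_normal_def)
  qed
  also have "\<dots> = (\<integral>\<^sup>+Z. (\<Prod>i\<in>UNIV. half_ball_density (Z $ i)) *
       facet_value (card K - CARD('m)) (facet_rows (\<lambda>i\<in>I. Z $ inv_into UNIV (facet_enum I) i) I)
         (?h (\<lambda>i\<in>I. Z $ inv_into UNIV (facet_enum I) i)) \<partial>(lborel :: (((real, 'm) vec \<times> real) ^ 'm::_)
             measure))"
  proof -
    have "(\<lambda>z. facet_value (card K - CARD('m)) (facet_rows z I :: (real, 'm) vec ^ 'm::_) (?h z))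
        \<in> borel_measurable (Pi\<^sub>M I (\<lambda>_. borel))"
      by (rule borel_measurable_facet_value) (rule rows_meas[OF order_refl])+
    moreover have "sigma_finite_measure (density lborel half_ball_density :: ((real,
        'm) vec \<times> real) measure)"
      using U.sigma_finite_measure_axioms by (simp add: uniform_half_ball_def)
    ultimately show ?thesis
      unfolding uniform_half_ball_def by (intro nn_integral_PiM_density_vec[OF bij]) auto
  qed
  also have "\<dots> = (\<integral>\<^sup>+Z. (\<Prod>i\<in>UNIV. half_ball_density (Z $ i)) *
       facet_value (card K - CARD('m)) (\<chi> i. fst (Z $ i)) (\<chi> i. snd (Z $ i)) \<partial>(lborel :: (((real, 'm) vec \<times>
           real) ^ 'm::_) measure))"
  proof -
    have inv: "inv_into UNIV (facet_enum I :: 'm \<Rightarrow> 'i) (facet_enum I i) = i" for i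
      using bij by (auto simp: bij_betw_def)
    show ?thesis using enum by (simp add: facet_rows_def inv)
  qed
  also have "\<dots> = (\<integral>\<^sup>+a. above_prob a ^ (card K - CARD('m)) * facet_density a
      \<partial>(lborel :: (real, 'm) vec measure))"
    by (rule nn_integral_facet_value)
  finally show ?thesis .
qed

definition orthant_cone :: "('m \<Rightarrow> bool) \<Rightarrow> ((real ^ 'm::finite) \<times> real) set" where
  "orthant_cone \<epsilon> = {x. \<forall>i. if \<epsilon> i then 0 < fst x $ i else fst x $ i < 0}"

lemma open_orthant_cone: "open (orthant_cone \<epsilon> :: ((real ^ 'm::finite) \<times> real) set)"
proof -
  have "orthant_cone \<epsilon> = (\<Inter>i. {x :: (real ^ 'm) \<times> real. if \<epsilon> i then 0 < fst x $ i else fst x $ i < 0})"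
    by (auto simp: orthant_cone_def)
  moreover have "open {x :: (real ^ 'm) \<times> real. if \<epsilon> i then 0 < fst x $ i else fst x $ i < 0}" for i
    by (cases "\<epsilon> i") (auto intro!: open_Collect_less continuous_intros)
  ultimately show ?thesis by (simp only:) (intro open_INT, auto)
qed

lemma orthant_cone_borel [measurable]: "orthant_cone \<epsilon> \<in> sets borel"
  by (rule borel_open[OF open_orthant_cone])

lemma measure_outside_orthant_cone_less_1:
  "measure uniform_half_ball (- orthant_cone \<epsilon> :: ((real ^ 'm::finite) \<times> real) set) < 1"
proof -
  let ?U = "uniform_half_ball :: ((real ^ 'm) \<times> real) measure"
  interpret prob_space ?U by (rule prob_space_uniform_half_ball)
  define S where "S = orthant_cone \<epsilon> \<inter> {x. norm x < 1} \<inter> {x :: (real ^ 'm) \<times> real. 0 < snd x}"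
  have openS: "open S"
    unfolding S_def by (intro open_Int open_orthant_cone open_Collect_less continuous_intros)
  define x where "x = ((\<chi> i. if \<epsilon> i then 1 else -1) :: real ^ 'm, 1::real)"
  define y where "y = (1 / (2 * norm x)) *\<^sub>R x"
  have nx: "norm x > 0" by (simp add: x_def zero_prod_def)
  then have "norm y = 1 / 2" by (simp add: y_def)
  moreover have "0 < snd y" using nx by (simp add: y_def x_def)
  moreover have "y \<in> orthant_cone \<epsilon>" using nx by (auto simp: y_def x_def orthant_cone_def)
  ultimately have "S \<noteq> {}" by (auto simp: S_def)
  then have pos: "emeasure lborel S > 0"
  proof -
    have "S \<notin> null_sets lborel"
      using open_not_negligible[OF openS \<open>S \<noteq> {}\<close>] openS
      by (auto simp: negligible_iff_null_sets null_sets_completionI)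
    then show ?thesis using openS by (auto simp: null_sets_def zero_less_iff_neq_zero)
  qed
  have Sb: "S \<in> sets borel" using openS by simp
  have "emeasure ?U S = (\<integral>\<^sup>+x. half_ball_density x * indicator S x \<partial>lborel)"
    unfolding uniform_half_ball_def using Sb by (subst emeasure_density) auto
  also have "\<dots> = (\<integral>\<^sup>+x. ennreal (2 / unit_ball_vol (real (CARD('m) + 1))) * indicator S x \<partial>lborel)"
    by (intro nn_integral_cong) (auto simp: half_ball_density_def indicator_def S_def half_ball_def)
  also have "\<dots> = ennreal (2 / unit_ball_vol (real (CARD('m) + 1))) * emeasure lborel S"
    using Sb by (simp add: nn_integral_cmult)
  also have "\<dots> > 0"
    using pos unit_ball_vol_pos[of "real (CARD('m) + 1)"]
        by (simp add: ennreal_zero_less_mult_iff del: of_nat_add of_nat_Suc)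
  finally have "prob S > 0" by (simp add: emeasure_eq_measure)
  moreover have "prob S \<le> prob (orthant_cone \<epsilon>)" by (intro finite_measure_mono) (auto simp: S_def)
  moreover have "prob (- orthant_cone \<epsilon>) = 1 - prob (orthant_cone \<epsilon>)"
    using prob_compl[of "orthant_cone \<epsilon>"] by (simp add: Compl_eq_Diff_UNIV)
  ultimately show ?thesis by linarith
qed

lemma nn_integral_not_meets_orthants_le:
  obtains C \<rho> :: real where "0 \<le> C" "0 \<le> \<rho>" "\<rho> < 1"
    "\<And>K :: 'i set. finite K \<Longrightarrow> (\<integral>\<^sup>+z. (if meets_orthants z K then 0 else 1)
       \<partial>Pi\<^sub>M K (\<lambda>_. uniform_half_ball :: ((real ^ 'm::finite) \<times> real) measure)) \<le> ennreal (C * \<rho> ^ card K)"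
proof -
  let ?U = "uniform_half_ball :: ((real ^ 'm) \<times> real) measure"
  interpret U: prob_space ?U by (rule prob_space_uniform_half_ball)
  interpret product_sigma_finite "\<lambda>_::'i. ?U" ..
  let ?m = "\<lambda>\<epsilon>. measure ?U (- orthant_cone \<epsilon>)"
  define \<rho> where "\<rho> = Max (range ?m)"
  define C where "C = real (card (UNIV :: ('m \<Rightarrow> bool) set))"
  have fin: "finite (range ?m)" by simp
  have le: "?m \<epsilon> \<le> \<rho>" for \<epsilon> unfolding \<rho>_def by (intro Max_ge fin) auto
  have "\<rho> \<in> range ?m" unfolding \<rho>_def by (intro Max_in fin) auto
  then have "\<rho> < 1" using measure_outside_orthant_cone_less_1 by auto
  have "0 \<le> \<rho>" using le[of undefined] by (rule order.trans[OF measure_nonneg])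
  show ?thesis
  proof (rule that[of C \<rho>])
    fix K :: "'i set" assume K: "finite K"
    have "(\<integral>\<^sup>+z. (if meets_orthants z K then 0 else 1) \<partial>Pi\<^sub>M K (\<lambda>_. ?U))
      \<le> (\<integral>\<^sup>+z. (\<Sum>\<epsilon>\<in>UNIV. \<Prod>k\<in>K. indicator (- orthant_cone \<epsilon>) (z k)) \<partial>Pi\<^sub>M K (\<lambda>_. ?U))"
    proof (rule nn_integral_mono)
      fix z :: "'i \<Rightarrow> (real ^ 'm) \<times> real"
      show "(if meets_orthants z K then 0 else 1)
          \<le> (\<Sum>\<epsilon>\<in>UNIV. \<Prod>k\<in>K. indicator (- orthant_cone \<epsilon>) (z k) :: ennreal)"
      proof (cases "meets_orthants z K")
        case False
        then obtain \<epsilon> where "\<forall>k\<in>K. z k \<notin> orthant_cone \<epsilon>" by (auto simp: meets_orthants_def orthant_cone_def)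
        then have "1 = (\<Prod>k\<in>K. indicator (- orthant_cone \<epsilon>) (z k) :: ennreal)" by simp
        also have "\<dots> \<le> (\<Sum>\<epsilon>\<in>UNIV. \<Prod>k\<in>K. indicator (- orthant_cone \<epsilon>) (z k))"
          by (rule member_le_sum) auto
        finally show ?thesis using False by simp
      qed simp
    qed
    also have "\<dots> = (\<Sum>\<epsilon>\<in>UNIV. \<integral>\<^sup>+z. (\<Prod>k\<in>K. indicator (- orthant_cone \<epsilon>) (z k)) \<partial>Pi\<^sub>M K (\<lambda>_. ?U))"
      by (rule nn_integral_sum) measurable
    also have "\<dots> = (\<Sum>\<epsilon>\<in>UNIV. ennreal (?m \<epsilon> ^ card K))"
    proof (rule sum.cong[OF refl])
      fix \<epsilon> :: "'m \<Rightarrow> bool"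
      have "(\<integral>\<^sup>+z. (\<Prod>k\<in>K. indicator (- orthant_cone \<epsilon>) (z k)) \<partial>Pi\<^sub>M K (\<lambda>_. ?U))
          = (\<Prod>k\<in>K. \<integral>\<^sup>+x. indicator (- orthant_cone \<epsilon>) x \<partial>?U)"
        using K by (intro product_nn_integral_prod) auto
      then show "(\<integral>\<^sup>+z. (\<Prod>k\<in>K. indicator (- orthant_cone \<epsilon>) (z k)) \<partial>Pi\<^sub>M K (\<lambda>_. ?U))
          = ennreal (?m \<epsilon> ^ card K)"
        by (simp add: U.emeasure_eq_measure ennreal_power)
    qed
    also have "\<dots> \<le> (\<Sum>\<epsilon>\<in>(UNIV :: ('m \<Rightarrow> bool) set). ennreal (\<rho> ^ card K))"
      by (intro sum_mono ennreal_leI power_mono le) auto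
    also have "\<dots> = ennreal (C * \<rho> ^ card K)"
      using \<open>0 \<le> \<rho>\<close> by (simp add: C_def ennreal_of_nat_eq_real_of_nat ennreal_mult)
    finally show "(\<integral>\<^sup>+z. (if meets_orthants z K then 0 else 1) \<partial>Pi\<^sub>M K (\<lambda>_. ?U)) \<le> ennreal (C * \<rho> ^ card K)"
        .
  qed (use \<open>\<rho> < 1\<close> \<open>0 \<le> \<rho>\<close> in \<open>auto simp: C_def\<close>)
qed

lemma measurable_meets_orthants:
  fixes K :: "'i set"
  assumes K: "finite K"
  shows "Measurable.pred (Pi\<^sub>M K (\<lambda>_. uniform_half_ball :: ((real ^ 'm::finite) \<times> real) measure)) (\<lambda>z.
      meets_orthants z K)"
proof -
  have "meets_orthants z K \<longleftrightarrow> (\<forall>\<epsilon>\<in>UNIV. \<exists>k\<in>K. z k \<in> orthant_cone \<epsilon>)" for z :: "'i \<Rightarrow> (real ^ 'm) \<times> real"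
    by (auto simp: meets_orthants_def orthant_cone_def)
  moreover have "Measurable.pred (Pi\<^sub>M K (\<lambda>_. uniform_half_ball))
     (\<lambda>z :: 'i \<Rightarrow> (real ^ 'm) \<times> real. \<forall>\<epsilon>\<in>UNIV. \<exists>k\<in>K. z k \<in> orthant_cone \<epsilon>)"
    using K by (intro pred_intros_finite) auto
  ultimately show ?thesis by presburger
qed

definition facet_mass :: "'m::{finite,wellorder} itself \<Rightarrow> nat \<Rightarrow> ennreal" where
  "facet_mass _ N = (\<integral>\<^sup>+a. above_prob a ^ N * facet_density a \<partial>(lborel :: (real ^ 'm::_) measure))"

lemma nn_integral_missed_bounds:
  fixes K :: "'i set"
  assumes K: "finite K"
  defines "S \<equiv> of_nat (card K choose CARD('m)) * facet_mass TYPE('m::{finite,wellorder}) (card K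
      - CARD('m))"
  shows "S \<le> (\<integral>\<^sup>+z. missed z K \<partial>Pi\<^sub>M K (\<lambda>_. uniform_half_ball :: ((real ^ 'm::_) \<times> real) measure))"
    and "(\<integral>\<^sup>+z. missed z K \<partial>Pi\<^sub>M K (\<lambda>_. uniform_half_ball :: ((real ^ 'm::_) \<times> real) measure))
      \<le> S + (\<integral>\<^sup>+z. (if meets_orthants z K then 0 else 1) \<partial>Pi\<^sub>M K (\<lambda>_. uniform_half_ball :: ((real ^ 'm::_) \<times>
          real) measure))"
proof -
  let ?U = "uniform_half_ball :: ((real, 'm) vec \<times> real) measure"
  let ?P = "Pi\<^sub>M K (\<lambda>_. ?U)"
  let ?f = "\<lambda>s z I. if det (facet_rows z I) \<noteq> 0 \<and> (\<forall>k\<in>K-I. z k \<in> above_graph s (facet_normal z I))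
      then emeasure ?U (below_facet (facet_rows z I) (facet_normal z I)) else 0"
  have fin: "finite (facets_of TYPE('m) K)" using K by (auto simp: facets_of_def)
  have card: "card (facets_of TYPE('m) K) = card K choose CARD('m)"
    using n_subsets[OF K] by (simp add: facets_of_def)
  have meas: "(\<lambda>z. ?f s z I) \<in> borel_measurable ?P" if I: "I \<in> facets_of TYPE('m) K" for s I
  proof -
    have IK: "I \<subseteq> K" "card I = CARD('m)" using I by (auto simp: facets_of_def)
    have finI: "finite I" "finite (K - I)" using K IK finite_subset by auto
    have [measurable]: "(facet_enum I :: 'm \<Rightarrow> 'i) i \<in> K" for i
      using bij_betwE[OF bij_betw_facet_enum[OF finI(1) IK(2)]] IK(1) by auto
    have [measurable]: "(\<lambda>z. facet_rows z I :: (real, 'm) vec ^ 'm::_) \<in> borel_measurable ?P"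
      unfolding facet_rows_def by (rule borel_measurable_vecI) simp
    have [measurable]: "(\<lambda>z :: 'i \<Rightarrow> (real, 'm) vec \<times> real. (\<chi> i. snd (z (facet_enum I i))) :: (real,
        'm) vec) \<in> borel_measurable ?P"
      by (rule borel_measurable_vecI) simp
    have [measurable]: "(\<lambda>z. facet_normal z I :: (real, 'm) vec) \<in> borel_measurable ?P"
      unfolding facet_normal_def by measurable
    have "Measurable.pred ?P (\<lambda>z. \<forall>k\<in>K-I. z k \<in> above_graph s (facet_normal z I :: (real, 'm) vec))"
      using finI by (intro pred_intros_finite) (auto intro!: measurable_above_graph)
    then show ?thesis by measurable
  qed
  have S: "(\<integral>\<^sup>+z. (\<Sum>I\<in>facets_of TYPE('m) K. ?f s z I) \<partial>?P) = S" for s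
  proof -
    have "(\<integral>\<^sup>+z. (\<Sum>I\<in>facets_of TYPE('m) K. ?f s z I) \<partial>?P) = (\<Sum>I\<in>facets_of TYPE('m) K. \<integral>\<^sup>+z. ?f s z I \<partial>?P)"
      by (rule nn_integral_sum[OF meas])
    also have "\<dots> = (\<Sum>I\<in>facets_of TYPE('m) K. facet_mass TYPE('m) (card K - CARD('m)))"
      unfolding facet_mass_def by (rule sum.cong[OF refl nn_integral_facet[OF K]])
    finally show ?thesis by (simp add: card S_def)
  qed
  have "S = (\<integral>\<^sup>+z. (\<Sum>I\<in>facets_of TYPE('m) K. ?f True z I) \<partial>?P)" by (rule S[symmetric])
  also have "\<dots> \<le> (\<integral>\<^sup>+z. missed z K \<partial>?P)"
    using missed_ge[OF K] by (intro nn_integral_mono) (simp add: above_graph_def)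
  finally show "S \<le> (\<integral>\<^sup>+z. missed z K \<partial>?P)" .
  have "AE z in ?P. \<forall>k\<in>K. 0 < snd (z k)"
    using K by (intro AE_finite_allI AE_PiM_component[of K "\<lambda>_. ?U" _ "\<lambda>x. 0 < snd x"]
        prob_space_uniform_half_ball AE_uniform_half_ball_snd_pos)
  then have "AE z in ?P. missed z K \<le> (\<Sum>I\<in>facets_of TYPE('m) K. ?f False z I)
      + (if meets_orthants z K then 0 else 1)"
  proof eventually_elim
    fix z :: "'i \<Rightarrow> (real, 'm) vec \<times> real" assume "\<forall>k\<in>K. 0 < snd (z k)"
    then show "missed z K \<le> (\<Sum>I\<in>facets_of TYPE('m) K. ?f False z I) + (if meets_orthants z K then 0 else 1)"
      using missed_le[OF K, of z] by (simp add: above_graph_def)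
  qed
  then have "(\<integral>\<^sup>+z. missed z K \<partial>?P)
     \<le> (\<integral>\<^sup>+z. (\<Sum>I\<in>facets_of TYPE('m) K. ?f False z I) + (if meets_orthants z K then 0 else 1) \<partial>?P)"
    by (rule nn_integral_mono_AE)
  also have "\<dots> = (\<integral>\<^sup>+z. (\<Sum>I\<in>facets_of TYPE('m) K. ?f False z I) \<partial>?P)
      + (\<integral>\<^sup>+z. (if meets_orthants z K then 0 else 1) \<partial>?P)"
  proof (rule nn_integral_add)
    show "(\<lambda>z. if meets_orthants z K then 0 else 1) \<in> borel_measurable ?P"
      using measurable_meets_orthants[OF K] by measurable
  qed (use meas in \<open>auto intro!: borel_measurable_sum\<close>)
  finally show "(\<integral>\<^sup>+z. missed z K \<partial>?P) \<le> S + (\<integral>\<^sup>+z. (if meets_orthants z K then 0 else 1) \<partial>?P)"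
    unfolding S .
qed

lemma facet_mass_0_le_1: "facet_mass TYPE('m::{finite,wellorder}) 0 \<le> 1"
proof -
  let ?U = "uniform_half_ball :: ((real, 'm) vec \<times> real) measure"
  interpret U: prob_space ?U by (rule prob_space_uniform_half_ball)
  define K where "K = {..<CARD('m)}"
  interpret P: prob_space "Pi\<^sub>M K (\<lambda>_. ?U)" by (intro prob_space_PiM U.prob_space_axioms)
  have K: "finite K" "K \<in> facets_of TYPE('m) K" by (auto simp: K_def facets_of_def)
  have "facet_mass TYPE('m) 0 = (\<integral>\<^sup>+z. (if det (facet_rows z K) \<noteq> 0 \<and> (\<forall>k\<in>K-K. z k
      \<in> above_graph False (facet_normal z K))
      then emeasure ?U (below_facet (facet_rows z K) (facet_normal z K)) else 0) \<partial>Pi\<^sub>M K (\<lambda>_. ?U))"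
    unfolding facet_mass_def by (subst nn_integral_facet[OF K]) (simp add: K_def)
  also have "\<dots> \<le> (\<integral>\<^sup>+z. 1 \<partial>Pi\<^sub>M K (\<lambda>_. ?U))"
    by (intro nn_integral_mono) (auto simp: U.emeasure_le_1)
  finally show ?thesis by (simp add: P.emeasure_space_1)
qed

section \<open>The mass above a hyperplane\<close>

lemma nn_integral_lborel_scale_coordinate:
  fixes F :: "'a::euclidean_space \<Rightarrow> ennreal"
  assumes b: "b \<in> Basis" and c: "c > 0" and [measurable]: "F \<in> borel_measurable borel"
  shows "(\<integral>\<^sup>+y. F y \<partial>lborel) = ennreal c * (\<integral>\<^sup>+y. F (y + ((c - 1) * (y \<bullet> b)) *\<^sub>R b) \<partial>lborel)"
proof -
  let ?c = "\<lambda>j. if j = b then c else 1"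
  let ?T = "\<lambda>x::'a. 0 + (\<Sum>j\<in>Basis. (?c j * (x \<bullet> j)) *\<^sub>R j)"
  have T: "?T x = x + ((c - 1) * (x \<bullet> b)) *\<^sub>R b" for x
  proof -
    have "?T x = (\<Sum>j\<in>Basis. (x \<bullet> j) *\<^sub>R j + (if j = b then ((c - 1) * (x \<bullet> b)) *\<^sub>R b else 0))"
      by (simp, intro sum.cong refl) (auto simp: algebra_simps)
    then show ?thesis using b by (simp add: sum.distrib euclidean_representation)
  qed
  have "(\<integral>\<^sup>+y. F y \<partial>lborel) = (\<integral>\<^sup>+y. F y \<partial>density (distr lborel borel ?T) (\<lambda>_. (\<Prod>j\<in>Basis. \<bar>?c j\<bar>)))"
    using lborel_affine_euclidean[of ?c 0] c by simp
  also have "(\<Prod>j\<in>Basis. \<bar>?c j\<bar>) = c"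
    using b c by (simp add: if_distrib[of abs] prod.delta cong: if_cong)
  also have "(\<integral>\<^sup>+y. F y \<partial>density (distr lborel borel ?T) (\<lambda>_. c)) = (\<integral>\<^sup>+y. ennreal c * F (?T y) \<partial>lborel)"
    by (subst nn_integral_density, simp, simp) (subst nn_integral_distr, auto)
  also have "\<dots> = ennreal c * (\<integral>\<^sup>+y. F (?T y) \<partial>lborel)" by (rule nn_integral_cmult) measurable
  finally show ?thesis unfolding T .
qed

lemma norm_add_component_sq:
  fixes y b :: "'a::euclidean_space"
  assumes "norm b = 1"
  shows "(norm (y + (k * (y \<bullet> b)) *\<^sub>R b))\<^sup>2 = (norm y)\<^sup>2 + (2 * k + k\<^sup>2) * (y \<bullet> b)\<^sup>2"
proof -
  have "b \<bullet> b = 1" using assms by (simp add: dot_square_norm)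
  then show ?thesis
    unfolding power2_norm_eq_inner
    by (simp add: inner_add_left inner_add_right inner_commute algebra_simps power2_eq_square)
qed

definition slope_moment :: "'a::euclidean_space \<Rightarrow> real \<Rightarrow> ennreal" where
  "slope_moment b \<rho> = (\<integral>\<^sup>+y. ennreal (y \<bullet> b) * indicator {y. (norm y)\<^sup>2 + (\<rho> * (y \<bullet> b))\<^sup>2 \<le> 1} y \<partial>lborel)"

lemma slope_moment_eq:
  fixes b :: "'a::euclidean_space"
  assumes b: "b \<in> Basis"
  shows "slope_moment b \<rho> = ennreal (1 / (1 + \<rho>\<^sup>2)) * slope_moment b 0"
proof -
  define q where "q = sqrt (1 + \<rho>\<^sup>2)"
  have q: "q > 0" "q\<^sup>2 = 1 + \<rho>\<^sup>2" by (auto simp: q_def add_pos_nonneg)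
  define c where "c = 1 / q"
  have c: "c > 0" "c\<^sup>2 = 1 / (1 + \<rho>\<^sup>2)" using q by (auto simp: c_def power_divide)
  have bb: "norm b = 1" "b \<bullet> b = 1" using b by auto
  have "slope_moment b \<rho> = ennreal c * (\<integral>\<^sup>+y. ennreal ((y + ((c - 1) * (y \<bullet> b)) *\<^sub>R b) \<bullet> b) *
      indicator {y. (norm y)\<^sup>2 + (\<rho> * (y \<bullet> b))\<^sup>2 \<le> 1} (y + ((c - 1) * (y \<bullet> b)) *\<^sub>R b) \<partial>lborel)"
    unfolding slope_moment_def by (rule nn_integral_lborel_scale_coordinate[OF b c(1)]) measurable
  also have "\<dots> = ennreal c * (\<integral>\<^sup>+y. ennreal c * (ennreal (y \<bullet> b) * indicator {y. (norm y)\<^sup>2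
      + (0 * (y \<bullet> b))\<^sup>2 \<le> 1} y) \<partial>lborel)"
  proof (intro arg_cong[where f = "\<lambda>x. ennreal c * x"] nn_integral_cong)
    fix y :: 'a
    have dot: "(y + ((c - 1) * (y \<bullet> b)) *\<^sub>R b) \<bullet> b = c * (y \<bullet> b)"
      using bb by (simp add: inner_add_left algebra_simps)
    have "(norm (y + ((c - 1) * (y \<bullet> b)) *\<^sub>R b))\<^sup>2 + (\<rho> * (c * (y \<bullet> b)))\<^sup>2
        = (norm y)\<^sup>2 + (c\<^sup>2 * (1 + \<rho>\<^sup>2) - 1) * (y \<bullet> b)\<^sup>2"
      unfolding norm_add_component_sq[OF bb(1)] by (simp add: algebra_simps power2_eq_square)
    also have "c\<^sup>2 * (1 + \<rho>\<^sup>2) = 1" using q by (simp add: c_def power_divide flip: q(2))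
    finally have nrm: "(norm (y + ((c - 1) * (y \<bullet> b)) *\<^sub>R b))\<^sup>2 + (\<rho> * (c * (y \<bullet> b)))\<^sup>2 = (norm y)\<^sup>2"
        by simp
    have "ennreal (c * (y \<bullet> b)) = ennreal c * ennreal (y \<bullet> b)" using c(1) by (simp add: ennreal_mult')
    then show "ennreal ((y + ((c - 1) * (y \<bullet> b)) *\<^sub>R b) \<bullet> b) *
      indicator {y. (norm y)\<^sup>2 + (\<rho> * (y \<bullet> b))\<^sup>2 \<le> 1} (y + ((c - 1) * (y \<bullet> b)) *\<^sub>R b)
      = ennreal c * (ennreal (y \<bullet> b) * indicator {y. (norm y)\<^sup>2 + (0 * (y \<bullet> b))\<^sup>2 \<le> 1} y)"
      unfolding indicator_def mem_Collect_eq dot nrm by (simp add: mult.assoc)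
  qed
  also have "\<dots> = ennreal c * ennreal c * slope_moment b 0"
    unfolding slope_moment_def by (subst nn_integral_cmult) (measurable, simp add: mult_ac)
  also have "ennreal c * ennreal c = ennreal (1 / (1 + \<rho>\<^sup>2))"
    using c by (simp add: ennreal_mult[symmetric] power2_eq_square)
  finally show ?thesis .
qed

lemma emeasure_slope_set:
  fixes b :: "'a::euclidean_space"
  assumes b: "b \<in> Basis" and A [measurable]: "A \<in> sets borel" and A0: "A \<subseteq> {0..}"
  shows "emeasure uniform_half_ball {x. 0 < fst x \<bullet> b \<and> snd x / (fst x \<bullet> b) \<in> A}
    = ennreal (2 / unit_ball_vol (real (DIM('a) + 1))) * slope_moment b 0 * (\<integral>\<^sup>+\<rho>. ennreal (1 / (1 + \<rho>\<^sup>2)) *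
        indicator A \<rho> \<partial>lborel)"
proof -
  let ?k = "ennreal (2 / unit_ball_vol (real (DIM('a) + 1)))"
  let ?S = "{x :: 'a \<times> real. 0 < fst x \<bullet> b \<and> snd x / (fst x \<bullet> b) \<in> A}"
  let ?D = "\<lambda>\<rho> y. indicator {y. (norm y)\<^sup>2 + (\<rho> * (y \<bullet> b))\<^sup>2 \<le> 1} y :: ennreal"
  have [measurable]: "?S \<in> sets borel"
  proof -
    have "Measurable.pred borel (\<lambda>x::'a \<times> real. 0 < fst x \<bullet> b \<and> snd x / (fst x \<bullet> b) \<in> A)" by measurable
    then show ?thesis by (simp add: pred_def)
  qed
  have "emeasure uniform_half_ball ?S = (\<integral>\<^sup>+x. half_ball_density x * indicator ?S x \<partial>lborel)"
    unfolding uniform_half_ball_def by (rule emeasure_density) auto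
  also have "\<dots> = (\<integral>\<^sup>+x. half_ball_density x * indicator ?S x \<partial>(lborel \<Otimes>\<^sub>M lborel))"
      by (simp add: lborel_prod)
  also have "\<dots> = (\<integral>\<^sup>+y. \<integral>\<^sup>+t. half_ball_density (y, t) * indicator ?S (y, t) \<partial>lborel \<partial>lborel)"
    by (subst lborel.nn_integral_fst[symmetric]) (auto simp: lborel_prod)
  also have "\<dots> = (\<integral>\<^sup>+y. \<integral>\<^sup>+\<rho>. ?k * (ennreal (y \<bullet> b) * ?D \<rho> y * indicator A \<rho>) \<partial>lborel \<partial>lborel)"
  proof (rule nn_integral_cong)
    fix y :: 'a
    show "(\<integral>\<^sup>+t. half_ball_density (y, t) * indicator ?S (y, t) \<partial>lborel)
       = (\<integral>\<^sup>+\<rho>. ?k * (ennreal (y \<bullet> b) * ?D \<rho> y * indicator A \<rho>) \<partial>lborel)"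
    proof (cases "0 < y \<bullet> b")
      case True
      let ?s = "y \<bullet> b"
      have "(\<integral>\<^sup>+t. half_ball_density (y, t) * indicator ?S (y, t) \<partial>lborel)
         = ennreal (?s ^ DIM(real)) * (\<integral>\<^sup>+\<rho>. half_ball_density (y, ?s *\<^sub>R \<rho>) * indicator ?S (y, ?s *\<^sub>R \<rho>)
             \<partial>lborel)"
        by (rule nn_integral_lborel_scaleR[OF True]) measurable
      also have "\<dots> = ennreal ?s * (\<integral>\<^sup>+\<rho>. ?k * (?D \<rho> y * indicator A \<rho>) \<partial>lborel)"
      proof -
        have n: "norm (y, ?s * \<rho>) \<le> 1 \<longleftrightarrow> (norm y)\<^sup>2 + (\<rho> * ?s)\<^sup>2 \<le> 1" for \<rho>
        proof -
          have "norm (y, ?s * \<rho>) \<le> 1 \<longleftrightarrow> (norm (y, ?s * \<rho>))\<^sup>2 \<le> 1\<^sup>2"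
            by (subst power2_le_iff_abs_le) auto
          then show ?thesis by (simp add: norm_prod_def mult.commute)
        qed
        have "half_ball_density (y, ?s *\<^sub>R \<rho>) * indicator ?S (y, ?s *\<^sub>R \<rho>) = ?k * (?D \<rho> y * indicator A \<rho>)"
            for \<rho>
          using True A0 by (auto simp: half_ball_density_def indicator_def half_ball_def n)
        then show ?thesis by simp
      qed
      also have "\<dots> = (\<integral>\<^sup>+\<rho>. ennreal ?s * (?k * (?D \<rho> y * indicator A \<rho>)) \<partial>lborel)"
        by (rule nn_integral_cmult[symmetric]) (simp add: indicator_def)
      finally show ?thesis by (simp add: mult_ac)
    next
      case False
      then show ?thesis by (simp add: ennreal_neg)
    qed
  qed
  also have "\<dots> = (\<integral>\<^sup>+\<rho>. \<integral>\<^sup>+y. ?k * (ennreal (y \<bullet> b) * ?D \<rho> y * indicator A \<rho>) \<partial>lborel \<partial>lborel)"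
    by (rule lborel_pair.Fubini') (simp add: indicator_def)
  also have "\<dots> = (\<integral>\<^sup>+\<rho>. (?k * slope_moment b 0) * (ennreal (1 / (1 + \<rho>\<^sup>2)) * indicator A \<rho>) \<partial>lborel)"
  proof (rule nn_integral_cong)
    fix \<rho> :: real
    have "(\<integral>\<^sup>+y. ?k * (ennreal (y \<bullet> b) * ?D \<rho> y * indicator A \<rho>) \<partial>lborel)
      = (\<integral>\<^sup>+y. (?k * indicator A \<rho>) * (ennreal (y \<bullet> b) * ?D \<rho> y) \<partial>lborel)" by (simp add: mult_ac)
    also have "\<dots> = (?k * indicator A \<rho>) * slope_moment b \<rho>"
      unfolding slope_moment_def by (rule nn_integral_cmult) (simp add: indicator_def)
    finally show "(\<integral>\<^sup>+y. ?k * (ennreal (y \<bullet> b) * ?D \<rho> y * indicator A \<rho>) \<partial>lborel)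
      = (?k * slope_moment b 0) * (ennreal (1 / (1 + \<rho>\<^sup>2)) * indicator A \<rho>)"
      by (subst (asm) slope_moment_eq[OF b]) (simp add: mult_ac)
  qed
  also have "\<dots> = ?k * slope_moment b 0 * (\<integral>\<^sup>+\<rho>. ennreal (1 / (1 + \<rho>\<^sup>2)) * indicator A \<rho> \<partial>lborel)"
    by (rule nn_integral_cmult) measurable
  finally show ?thesis .
qed

lemma nn_integral_arctan_deriv:
  assumes "0 \<le> r"
  shows "(\<integral>\<^sup>+\<rho>. ennreal (1 / (1 + \<rho>\<^sup>2)) * indicator {0..<r} \<rho> \<partial>lborel) = ennreal (arctan r)"
    and "(\<integral>\<^sup>+\<rho>. ennreal (1 / (1 + \<rho>\<^sup>2)) * indicator {0..} \<rho> \<partial>lborel) = ennreal (pi / 2)"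
proof -
  have deriv: "DERIV arctan x :> 1 / (1 + x\<^sup>2)" for x
    using DERIV_arctan[of x] by (simp add: divide_inverse)
  have "(\<integral>\<^sup>+\<rho>. ennreal (1 / (1 + \<rho>\<^sup>2)) * indicator {0..<r} \<rho> \<partial>lborel)
      = (\<integral>\<^sup>+\<rho>. ennreal (1 / (1 + \<rho>\<^sup>2)) * indicator {0..r} \<rho> \<partial>lborel)"
    using AE_lborel_singleton[of r] by (intro nn_integral_cong_AE) (auto simp: indicator_def elim!:
        eventually_mono)
  also have "\<dots> = ennreal (arctan r - arctan 0)"
    using assms deriv
    by (intro nn_integral_FTC_Icc)
       (auto intro!: add_nonneg_nonneg has_field_derivative_at_within simp flip:
           has_real_derivative_iff_has_vector_derivative)
  finally show "(\<integral>\<^sup>+\<rho>. ennreal (1 / (1 + \<rho>\<^sup>2)) * indicator {0..<r} \<rho> \<partial>lborel) = ennreal (arctan r)" by simp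
  have "(\<integral>\<^sup>+\<rho>. ennreal (1 / (1 + \<rho>\<^sup>2)) * indicator {0..} \<rho> \<partial>lborel) = ennreal (pi / 2 - arctan 0)"
    using deriv tendsto_arctan_at_top by (intro nn_integral_FTC_atLeast) (auto intro: add_nonneg_nonneg)
  then show "(\<integral>\<^sup>+\<rho>. ennreal (1 / (1 + \<rho>\<^sup>2)) * indicator {0..} \<rho> \<partial>lborel) = ennreal (pi / 2)" by simp
qed

lemma distr_uniform_half_ball:
  fixes f :: "'a::euclidean_space \<Rightarrow> 'a"
  assumes f: "linear f" "\<And>y. norm (f y) = norm y"
    and F: "F \<in> borel_measurable borel"
  shows "(\<integral>\<^sup>+x. F (f (fst x), snd x) \<partial>uniform_half_ball) = (\<integral>\<^sup>+x. F x \<partial>uniform_half_ball)"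
proof -
  let ?g = "\<lambda>x :: 'a \<times> real. (f (fst x), snd x)"
  have g: "linear ?g" "\<And>x. norm (?g x) = norm x"
    using f by (auto simp: linear_iff norm_prod_def)
  note [measurable] = F
  have [measurable]: "?g \<in> borel_measurable borel" by (rule borel_measurable_linear[OF g(1)])
  have "half_ball_density (?g x) = half_ball_density x" for x
    using g(2)[of x] by (simp add: half_ball_density_def indicator_def half_ball_def)
  then have "(\<integral>\<^sup>+x. F (?g x) \<partial>uniform_half_ball) = (\<integral>\<^sup>+x. half_ball_density (?g x) * F (?g x) \<partial>lborel)"
    by (subst nn_integral_uniform_half_ball) auto
  also have "\<dots> = (\<integral>\<^sup>+x. half_ball_density x * F x \<partial>lborel)"
    by (rule nn_integral_lborel_isometry[where f = ?g, OF g]) auto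
  also have "\<dots> = (\<integral>\<^sup>+x. F x \<partial>uniform_half_ball)" by (subst nn_integral_uniform_half_ball) auto
  finally show ?thesis .
qed

lemma emeasure_uniform_half_ball_halfspace:
  fixes b :: "'a::euclidean_space"
  assumes b: "b \<noteq> 0"
  shows "emeasure uniform_half_ball {x. 0 < fst x \<bullet> b} = ennreal (1 / 2)"
proof -
  let ?U = "uniform_half_ball :: ('a \<times> real) measure"
  interpret prob_space ?U by (rule prob_space_uniform_half_ball)
  have [measurable]: "{x :: 'a \<times> real. 0 < fst x \<bullet> b} \<in> sets borel" "{x :: 'a \<times> real. fst x \<bullet> b < 0}
      \<in> sets borel"
    by (intro borel_open open_Collect_less continuous_intros)+
  have "emeasure ?U {x. fst x \<bullet> b < 0} = (\<integral>\<^sup>+x. indicator {x. fst x \<bullet> b < 0} x \<partial>?U)"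
    by (rule nn_integral_indicator[symmetric]) simp
  also have "\<dots> = (\<integral>\<^sup>+x. indicator {x. 0 < fst x \<bullet> b} (- fst x, snd x) \<partial>?U)"
    by (rule nn_integral_cong) (simp add: indicator_def)
  also have "\<dots> = emeasure ?U {x. 0 < fst x \<bullet> b}"
    by (subst distr_uniform_half_ball[where f = uminus]) (auto simp: linear_uminus)
  finally have eq: "prob {x. fst x \<bullet> b < 0} = prob {x. 0 < fst x \<bullet> b}" by (simp add: measure_def)
  have "AE x in lborel. (b, 0::real) \<bullet> x \<noteq> 0"
      using b by (intro AE_lborel_hyperplane) (simp add: zero_prod_def)
  then have "AE x in ?U. x \<in> {x. fst x \<bullet> b < 0} \<union> {x. 0 < fst x \<bullet> b}"
    by (intro AE_uniform_half_ball) (auto simp: inner_prod_def inner_commute elim!: eventually_mono)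
  then have "prob ({x. fst x \<bullet> b < 0} \<union> {x. 0 < fst x \<bullet> b}) = 1"
    by (subst prob_eq_1) auto
  moreover have "prob ({x. fst x \<bullet> b < 0} \<union> {x. 0 < fst x \<bullet> b}) = prob {x. fst x \<bullet> b < 0} + prob {x. 0
      < fst x \<bullet> b}"
    by (rule finite_measure_Union) auto
  ultimately have "prob {x. 0 < fst x \<bullet> b} = 1 / 2" using eq by linarith
  then show ?thesis by (simp only: emeasure_eq_measure)
qed

lemma above_prob_eq:
  fixes a :: "real ^ 'm::finite"
  shows "above_prob a = ennreal (1 - arctan (norm a) / pi)"
proof (cases "a = 0")
  case True
  interpret prob_space "uniform_half_ball :: ((real ^ 'm) \<times> real) measure"
      by (rule prob_space_uniform_half_ball)
  have "AE x in uniform_half_ball. x \<in> above_graph False a"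
    using AE_uniform_half_ball_snd_pos by (auto simp: above_graph_def True elim!: eventually_mono)
  then have "prob (above_graph False a) = 1" by (subst prob_eq_1) auto
  then show ?thesis by (simp add: above_prob_def True emeasure_eq_measure)
next
  case False
  let ?U = "uniform_half_ball :: ((real ^ 'm) \<times> real) measure"
  interpret prob_space ?U by (rule prob_space_uniform_half_ball)
  let ?b = "axis undefined 1 :: real ^ 'm"
  have b: "?b \<in> Basis" "?b \<noteq> 0" by (auto simp: axis_in_Basis_iff axis_eq_0_iff)
  define r where "r = norm a"
  have r: "r > 0" using False by (simp add: r_def)
  obtain f where f: "orthogonal_transformation f" "f (r *\<^sub>R ?b) = a"
    using orthogonal_transformation_exists[of "r *\<^sub>R ?b" a] r by (auto simp: r_def)
  have f': "linear f" "\<And>y. norm (f y) = norm y"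
    using f(1) by (auto simp: orthogonal_transformation)
  have dot: "a \<bullet> f y = r * (y \<bullet> ?b)" for y
  proof -
    have "f (r *\<^sub>R ?b) \<bullet> f y = (r *\<^sub>R ?b) \<bullet> y" using f(1) unfolding orthogonal_transformation_def by blast
    then show ?thesis by (simp add: f(2) inner_commute)
  qed
  define m where "m = ennreal (2 / unit_ball_vol (real (DIM(real ^ 'm) + 1))) * slope_moment ?b 0"
  have "AE x in ?U. 0 < fst x \<bullet> ?b \<longleftrightarrow> (0 < fst x \<bullet> ?b \<and> snd x / (fst x \<bullet> ?b) \<in> {0..})"
    using AE_uniform_half_ball_snd_pos by eventually_elim auto
  then have "emeasure ?U {x. 0 < fst x \<bullet> ?b} = emeasure ?U {x. 0 < fst x \<bullet> ?b \<and> snd x / (fst x \<bullet> ?b)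
      \<in> {0..}}"
    by (intro emeasure_eq_AE) (auto intro!: borel_open open_Collect_less continuous_intros)
  then have "m * ennreal (pi / 2) = ennreal (1 / 2)"
    using emeasure_slope_set[OF b(1), of "{0..}"] nn_integral_arctan_deriv(2)[of 0]
      emeasure_uniform_half_ball_halfspace[OF b(2)] by (simp add: m_def)
  moreover have "ennreal (1 / 2) = ennreal (1 / pi) * ennreal (pi / 2)"
      by (subst ennreal_mult[symmetric]) auto
  ultimately have "ennreal (pi / 2) * m = ennreal (pi / 2) * ennreal (1 / pi)" by (simp only: mult.commute)
  then have m: "m = ennreal (1 / pi)" using pi_gt_zero
      by (auto simp: ennreal_mult_cancel_left ennreal_eq_0_iff simp del: pi_gt_zero)
  have mb: "above_graph False a \<in> events" by simp
  have "emeasure ?U (- above_graph False a) = (\<integral>\<^sup>+x. indicator (- above_graph False a) x \<partial>?U)" by simp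
  also have "\<dots> = (\<integral>\<^sup>+x. indicator (- above_graph False a) (f (fst x), snd x) \<partial>?U)"
    by (rule distr_uniform_half_ball[OF f', symmetric]) simp
  also have "\<dots> = (\<integral>\<^sup>+x. indicator {x. 0 < fst x \<bullet> ?b \<and> snd x / (fst x \<bullet> ?b) \<in> {0..<r}} x \<partial>?U)"
  proof (rule nn_integral_cong_AE)
    show "AE x in ?U. indicator (- above_graph False a) (f (fst x), snd x)
      = (indicator {x. 0 < fst x \<bullet> ?b \<and> snd x / (fst x \<bullet> ?b) \<in> {0..<r}} x :: ennreal)"
      using AE_uniform_half_ball_snd_pos
    proof eventually_elim
      fix x :: "(real ^ 'm) \<times> real" assume "0 < snd x"
      then have "snd x < r * (fst x \<bullet> ?b) \<longleftrightarrow> 0 < fst x \<bullet> ?b \<and> snd x / (fst x \<bullet> ?b) \<in> {0..<r}"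
      proof (cases "0 < fst x \<bullet> ?b")
        case True
        then show ?thesis using \<open>0 < snd x\<close> by (simp add: pos_divide_less_eq)
      next
        case False
        then have "r * (fst x \<bullet> ?b) \<le> 0" using r by (simp add: mult_nonneg_nonpos)
        then show ?thesis using False \<open>0 < snd x\<close> by simp
      qed
      then show "indicator (- above_graph False a) (f (fst x), snd x)
         = (indicator {x. 0 < fst x \<bullet> ?b \<and> snd x / (fst x \<bullet> ?b) \<in> {0..<r}} x :: ennreal)"
        by (auto simp: indicator_def above_graph_def dot)
    qed
  qed
  also have "\<dots> = emeasure ?U {x. 0 < fst x \<bullet> ?b \<and> snd x / (fst x \<bullet> ?b) \<in> {0..<r}}"
    by (rule nn_integral_indicator) measurable
  also have "\<dots> = m * ennreal (arctan r)"
  proof -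
    have "{0..<r} \<subseteq> {0..}" by auto
    then show ?thesis
      using r emeasure_slope_set[OF b(1), of "{0..<r}"] by (simp add: m_def nn_integral_arctan_deriv)
  qed
  also have "\<dots> = ennreal (arctan r / pi)"
    using r by (simp add: m ennreal_mult[symmetric] zero_le_arctan_iff)
  finally have "prob (- above_graph False a) = arctan r / pi"
    using r by (simp add: emeasure_eq_measure zero_le_arctan_iff)
  then show ?thesis
    using prob_compl[OF mb] by (simp add: above_prob_def emeasure_eq_measure r_def Compl_eq_Diff_UNIV)
qed

section \<open>The facet density near the boundary hyperplane\<close>

definition cone_moment :: "'a::euclidean_space \<Rightarrow> 'a set \<Rightarrow> ennreal" where
  "cone_moment e C = (\<integral>\<^sup>+y. ennreal (e \<bullet> y) * indicator (cball 0 1 \<inter> C) y \<partial>lborel)"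

definition facet_moment :: "real ^ 'm::finite \<Rightarrow> ennreal" where
  "facet_moment e = (\<integral>\<^sup>+Y. ennreal \<bar>det Y\<bar> * (\<Prod>i\<in>UNIV. indicator {y. norm y \<le> 1 \<and> 0 \<le> e \<bullet> y} (Y $ i)) *
     cone_moment e (pos (range (($) Y))) \<partial>(lborel :: (real ^ 'm ^ 'm) measure))"

definition half_ball_const :: "'a::euclidean_space itself \<Rightarrow> real" where
  "half_ball_const _ = 2 / unit_ball_vol (real (DIM('a) + 1))"

lemma half_ball_const_pos: "half_ball_const TYPE('a::euclidean_space) > 0"
  unfolding half_ball_const_def by (intro divide_pos_pos unit_ball_vol_pos) auto

lemma half_ball_density_Pair:
  "half_ball_density (y, t) = ennreal (half_ball_const TYPE('a::euclidean_space)) *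
     indicator {t. (norm (y::'a))\<^sup>2 + t\<^sup>2 \<le> 1 \<and> 0 \<le> t} t"
proof -
  have "norm (y, t) \<le> 1 \<longleftrightarrow> (norm y)\<^sup>2 + t\<^sup>2 \<le> 1"
    by (simp add: norm_prod_def)
  then show ?thesis by (simp add: half_ball_density_def half_ball_const_def indicator_def half_ball_def)
qed

lemma cball_borel [measurable]: "cball a r \<in> sets borel"
  by simp

lemma closed_pos_range: "closed (pos (range (($) (Y :: real ^ 'm ^ 'm::finite))))"
  by (rule closed_pos) simp

lemma pos_range_borel [measurable]: "pos (range (($) (Y :: real ^ 'm ^ 'm::finite))) \<in> sets borel"
  by (rule borel_closed[OF closed_pos_range])

lemma borel_measurable_cone_moment [measurable (raw)]:
  fixes Y :: "'w \<Rightarrow> real ^ 'm ^ 'm::finite"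
  assumes [measurable]: "Y \<in> borel_measurable M"
  shows "(\<lambda>w. cone_moment e (pos (range (($) (Y w))))) \<in> borel_measurable M"
  unfolding cone_moment_def
proof (rule lborel.borel_measurable_nn_integral)
  show "(\<lambda>(w, y). ennreal (e \<bullet> y) * indicator (cball 0 1 \<inter> pos (range (($) (Y w)))) y)
      \<in> borel_measurable (M \<Otimes>\<^sub>M lborel)"
    unfolding case_prod_unfold by measurable
qed

lemma emeasure_below_facet:
  fixes a :: "real ^ 'm::finite"
  shows "emeasure uniform_half_ball (below_facet Y a) = (\<integral>\<^sup>+y. ennreal (half_ball_const TYPE(real ^ 'm)) *
     (indicator (pos (range (($) Y))) y * emeasure lborel {t. (norm y)\<^sup>2 + t\<^sup>2 \<le> 1 \<and> 0 \<le> t \<and> t < a \<bullet> y})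
         \<partial>lborel)"
proof -
  have "emeasure uniform_half_ball (below_facet Y a)
      = (\<integral>\<^sup>+x. half_ball_density x * indicator (below_facet Y a) x \<partial>(lborel \<Otimes>\<^sub>M lborel))"
    unfolding uniform_half_ball_def by (subst emeasure_density) (auto simp: lborel_prod)
  also have "\<dots> = (\<integral>\<^sup>+y. \<integral>\<^sup>+t. half_ball_density (y, t) * indicator (below_facet Y a) (y, t) \<partial>lborel
      \<partial>lborel)"
    by (subst lborel.nn_integral_fst[symmetric]) (auto simp: lborel_prod)
  also have "\<dots> = (\<integral>\<^sup>+y. ennreal (half_ball_const TYPE(real ^ 'm)) *
     (indicator (pos (range (($) Y))) y * emeasure lborel {t. (norm y)\<^sup>2 + t\<^sup>2 \<le> 1 \<and> 0 \<le> t \<and> t < a \<bullet> y})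
         \<partial>lborel)"
  proof (rule nn_integral_cong)
    fix y
    let ?T = "{t. (norm y)\<^sup>2 + t\<^sup>2 \<le> 1 \<and> 0 \<le> t \<and> t < a \<bullet> y}"
    have [measurable]: "?T \<in> sets borel" by measurable
    have "(\<integral>\<^sup>+t. half_ball_density (y, t) * indicator (below_facet Y a) (y, t) \<partial>lborel)
       = (\<integral>\<^sup>+t. (ennreal (half_ball_const TYPE(real ^ 'm)) * indicator (pos (range (($) Y))) y) * indicator
           ?T t \<partial>lborel)"
      by (rule nn_integral_cong) (auto simp: half_ball_density_Pair indicator_def below_facet_def)
    also have "\<dots> = (ennreal (half_ball_const TYPE(real ^ 'm)) * indicator (pos (range (($) Y))) y)
        * emeasure lborel ?T"
      by (rule nn_integral_cmult_indicator) measurable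
    finally show "(\<integral>\<^sup>+t. half_ball_density (y, t) * indicator (below_facet Y a) (y, t) \<partial>lborel)
       = ennreal (half_ball_const TYPE(real ^ 'm)) * (indicator (pos (range (($) Y))) y * emeasure lborel
           ?T)"
      by (simp add: mult.assoc)
  qed
  finally show ?thesis .
qed

lemma emeasure_lborel_Ico_0: "emeasure lborel {0..<u::real} = ennreal u"
  by (cases "0 \<le> u") (auto simp: ennreal_neg)

lemma emeasure_below_facet_le:
  fixes e :: "real ^ 'm::finite"
  assumes r: "0 \<le> r"
  shows "emeasure uniform_half_ball (below_facet Y (r *\<^sub>R e))
    \<le> ennreal (half_ball_const TYPE(real ^ 'm) * r) * cone_moment e (pos (range (($) Y)))"
proof -
  let ?k = "half_ball_const TYPE(real ^ 'm)"
  have k: "?k \<ge> 0" using half_ball_const_pos by (rule less_imp_le)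
  have "emeasure uniform_half_ball (below_facet Y (r *\<^sub>R e))
     \<le> (\<integral>\<^sup>+y. ennreal (?k * r) * (ennreal (e \<bullet> y) * indicator (cball 0 1 \<inter> pos (range (($) Y))) y) \<partial>lborel)"
    unfolding emeasure_below_facet
  proof (rule nn_integral_mono)
    fix y :: "real ^ 'm"
    let ?T = "{t. (norm y)\<^sup>2 + t\<^sup>2 \<le> 1 \<and> 0 \<le> t \<and> t < (r *\<^sub>R e) \<bullet> y}"
    have "emeasure lborel ?T \<le> ennreal (r * (e \<bullet> y)) * indicator (cball 0 1) y"
    proof (cases "norm y \<le> 1")
      case True
      have "emeasure lborel ?T \<le> emeasure lborel {0..<r * (e \<bullet> y)}" by (intro emeasure_mono) auto
      then show ?thesis using True by (simp add: emeasure_lborel_Ico_0)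
    next
      case False
      then have "(norm y)\<^sup>2 > 1" by (simp add: one_less_power)
      then have "\<not> (norm y)\<^sup>2 + t\<^sup>2 \<le> 1" for t using zero_le_power2[of t] by linarith
      then have "?T = {}" by blast
      then show ?thesis by (simp only: emeasure_empty zero_le)
    qed
    then have "ennreal ?k * (indicator (pos (range (($) Y))) y * emeasure lborel ?T)
      \<le> ennreal ?k * (indicator (pos (range (($) Y))) y * (ennreal (r * (e \<bullet> y)) * indicator (cball 0 1)
          y))"
      by (intro mult_left_mono) auto
    also have "\<dots> = ennreal (?k * r) * (ennreal (e \<bullet> y) * indicator (cball 0 1 \<inter> pos (range (($) Y))) y)"
      using k r by (simp add: ennreal_mult' indicator_inter_arith mult_ac)
    finally show "ennreal ?k * (indicator (pos (range (($) Y))) y * emeasure lborel ?T)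
      \<le> ennreal (?k * r) * (ennreal (e \<bullet> y) * indicator (cball 0 1 \<inter> pos (range (($) Y))) y)" .
  qed
  also have "\<dots> = ennreal (?k * r) * cone_moment e (pos (range (($) Y)))"
    unfolding cone_moment_def by (rule nn_integral_cmult) measurable
  finally show ?thesis .
qed

lemma scaleR_in_pos_iff: "0 < s \<Longrightarrow> s *\<^sub>R y \<in> pos A \<longleftrightarrow> y \<in> pos A"
proof
  assume "0 < s" "s *\<^sub>R y \<in> pos A"
  then have "(1 / s) *\<^sub>R (s *\<^sub>R y) \<in> pos A" by (intro pos_scaleR[of "s *\<^sub>R y"]) auto
  then show "y \<in> pos A" using \<open>0 < s\<close> by simp
qed (simp add: pos_scaleR)

lemma emeasure_below_facet_ge:
  fixes e :: "real ^ 'm::finite"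
  assumes r: "0 \<le> r" and e: "norm e = 1"
  defines "s \<equiv> 1 / sqrt (1 + r\<^sup>2)"
  shows "ennreal (half_ball_const TYPE(real ^ 'm) * r * s ^ (CARD('m) + 1))
      * cone_moment e (pos (range (($) Y)))
    \<le> emeasure uniform_half_ball (below_facet Y (r *\<^sub>R e))"
proof -
  let ?k = "half_ball_const TYPE(real ^ 'm)" and ?P = "pos (range (($) Y))"
  have [measurable]: "?P \<in> sets borel" by (rule pos_range_borel)
  have k: "?k \<ge> 0" using half_ball_const_pos by (rule less_imp_le)
  have r1: "1 + r\<^sup>2 > 0" by (simp add: add_pos_nonneg)
  then have s: "s > 0" "s\<^sup>2 * (1 + r\<^sup>2) = 1" by (auto simp: s_def power_divide)
  have "ennreal (?k * r * s ^ (CARD('m) + 1)) * cone_moment e ?P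
     = ennreal (s ^ DIM(real ^ 'm)) * (\<integral>\<^sup>+y. ennreal (?k * r * s) * (ennreal (e \<bullet> y) * indicator (cball 0 1
         \<inter> ?P) y) \<partial>lborel)"
  proof -
    have "(\<integral>\<^sup>+y. ennreal (?k * r * s) * (ennreal (e \<bullet> y) * indicator (cball 0 1 \<inter> ?P) y) \<partial>lborel)
      = ennreal (?k * r * s) * cone_moment e ?P"
      unfolding cone_moment_def by (rule nn_integral_cmult) measurable
    then show ?thesis using k r s(1) by (simp add: ennreal_mult mult_ac)
  qed
  also have "\<dots> = ennreal (s ^ DIM(real ^ 'm)) * (\<integral>\<^sup>+y. ennreal ?k *
     (indicator ?P (s *\<^sub>R y) * (ennreal ((r *\<^sub>R e) \<bullet> (s *\<^sub>R y)) * indicator (cball 0 s) (s *\<^sub>R y)))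
         \<partial>lborel)"
  proof (intro arg_cong[where f = "\<lambda>x. ennreal (s ^ DIM(real ^ 'm)) * x"] nn_integral_cong)
    fix y :: "real ^ 'm"
    have i1: "indicator ?P (s *\<^sub>R y) = (indicator ?P y :: ennreal)"
      by (simp add: indicator_def scaleR_in_pos_iff[OF s(1)])
    have i2: "indicator (cball 0 s) (s *\<^sub>R y) = (indicator (cball 0 1) y :: ennreal)"
      using s(1) by (simp add: indicator_def)
    have "ennreal ((r *\<^sub>R e) \<bullet> (s *\<^sub>R y)) = ennreal (r * s) * ennreal (e \<bullet> y)"
      using r s(1) by (simp add: ennreal_mult'[symmetric] mult_ac)
    then show "ennreal (?k * r * s) * (ennreal (e \<bullet> y) * indicator (cball 0 1 \<inter> ?P) y) =
      ennreal ?k * (indicator ?P (s *\<^sub>R y) * (ennreal ((r *\<^sub>R e) \<bullet> (s *\<^sub>R y)) * indicator (cball 0 s) (s *\<^sub>R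
          y)))"
      unfolding i1 i2 using k r s(1) by (simp add: ennreal_mult indicator_inter_arith mult_ac)
  qed
  also have "\<dots> = (\<integral>\<^sup>+y. ennreal ?k * (indicator ?P y * (ennreal ((r *\<^sub>R e) \<bullet> y) * indicator (cball 0 s) y))
      \<partial>lborel)"
    by (rule nn_integral_lborel_scaleR[OF s(1), symmetric]) measurable
  also have "\<dots> \<le> emeasure uniform_half_ball (below_facet Y (r *\<^sub>R e))"
    unfolding emeasure_below_facet
  proof (intro nn_integral_mono mult_left_mono)
    fix y :: "real ^ 'm"
    let ?T = "{t. (norm y)\<^sup>2 + t\<^sup>2 \<le> 1 \<and> 0 \<le> t \<and> t < (r *\<^sub>R e) \<bullet> y}"
    show "ennreal ((r *\<^sub>R e) \<bullet> y) * indicator (cball 0 s) y \<le> emeasure lborel ?T"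
    proof (cases "norm y \<le> s")
      case True
      have "{0..<(r *\<^sub>R e) \<bullet> y} \<subseteq> ?T"
      proof
        fix t assume t: "t \<in> {0..<(r *\<^sub>R e) \<bullet> y}"
        then have "t \<le> r * norm y"
          using norm_cauchy_schwarz[of "r *\<^sub>R e" y] r e by auto
        then have "t\<^sup>2 \<le> (r * norm y)\<^sup>2" using t by (intro power_mono) auto
        then have "(norm y)\<^sup>2 + t\<^sup>2 \<le> (norm y)\<^sup>2 * (1 + r\<^sup>2)"
            by (simp add: power_mult_distrib algebra_simps)
        also have "\<dots> \<le> s\<^sup>2 * (1 + r\<^sup>2)" using True by (intro mult_right_mono power_mono) auto
        finally show "t \<in> ?T" using s(2) t by auto
      qed
      then have "emeasure lborel {0..<(r *\<^sub>R e) \<bullet> y} \<le> emeasure lborel ?T"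
          by (intro emeasure_mono) measurable
      then show ?thesis using True by (simp add: emeasure_lborel_Ico_0)
    qed simp
  qed auto
  finally show ?thesis .
qed

lemma facet_density_le:
  fixes e :: "real ^ 'm::finite"
  assumes r: "0 < r"
  shows "facet_density (r *\<^sub>R e) \<le> ennreal (half_ball_const TYPE(real ^ 'm) ^ (CARD('m) + 1) * r)
      * facet_moment e"
proof -
  let ?k = "half_ball_const TYPE(real ^ 'm)"
  have k: "?k \<ge> 0" using half_ball_const_pos by (rule less_imp_le)
  let ?H = "{y. norm y \<le> 1 \<and> 0 \<le> e \<bullet> y}"
  have [measurable]: "?H \<in> sets borel" by measurable
  have "facet_density (r *\<^sub>R e) \<le> (\<integral>\<^sup>+Y. ennreal (?k ^ (CARD('m) + 1) * r)
      * (ennreal \<bar>det Y\<bar> * (\<Prod>i\<in>UNIV. indicator ?H (Y $ i)) *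
     cone_moment e (pos (range (($) Y)))) \<partial>(lborel :: (real ^ 'm ^ 'm) measure))"
    unfolding facet_density_def
  proof (rule nn_integral_mono)
    fix Y :: "real ^ 'm ^ 'm"
    have "(\<Prod>i\<in>UNIV. half_ball_density (Y $ i, (r *\<^sub>R e) \<bullet> (Y $ i)))
        \<le> (\<Prod>i\<in>UNIV. ennreal ?k * indicator ?H (Y $ i))"
    proof (rule prod_mono_ennreal)
      fix i
      have "norm (Y $ i) \<le> 1" if "(norm (Y $ i))\<^sup>2 + x\<^sup>2 \<le> 1" for x :: real
      proof -
        have "(norm (Y $ i))\<^sup>2 \<le> 1" using that zero_le_power2[of x] by linarith
        then show ?thesis by (simp add: abs_square_le_1)
      qed
      then show "half_ball_density (Y $ i, (r *\<^sub>R e) \<bullet> (Y $ i)) \<le> ennreal ?k * indicator ?H (Y $ i)"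
        using r by (auto simp: half_ball_density_Pair indicator_def zero_le_mult_iff)
    qed
    also have "\<dots> = ennreal (?k ^ CARD('m)) * (\<Prod>i\<in>UNIV. indicator ?H (Y $ i))"
      using k by (simp add: prod.distrib ennreal_power)
    finally have "ennreal \<bar>det Y\<bar> * (\<Prod>i\<in>UNIV. half_ball_density (Y $ i, (r *\<^sub>R e) \<bullet> (Y $ i)))
        * emeasure uniform_half_ball (below_facet Y (r *\<^sub>R e))
      \<le> ennreal \<bar>det Y\<bar> * (ennreal (?k ^ CARD('m)) * (\<Prod>i\<in>UNIV. indicator ?H (Y $ i))) *
       (ennreal (?k * r) * cone_moment e (pos (range (($) Y))))"
      using r by (intro mult_mono emeasure_below_facet_le) auto
    also have "\<dots> = ennreal (?k ^ (CARD('m) + 1) * r) * (ennreal \<bar>det Y\<bar> * (\<Prod>i\<in>UNIV. indicator ?H (Y $ i)) *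
     cone_moment e (pos (range (($) Y))))"
      using k r by (simp add: ennreal_mult mult_ac)
    finally show "ennreal \<bar>det Y\<bar> * (\<Prod>i\<in>UNIV. half_ball_density (Y $ i, (r *\<^sub>R e) \<bullet> (Y $ i)))
        * emeasure uniform_half_ball (below_facet Y (r *\<^sub>R e))
      \<le> ennreal (?k ^ (CARD('m) + 1) * r) * (ennreal \<bar>det Y\<bar> * (\<Prod>i\<in>UNIV. indicator ?H (Y $ i)) *
     cone_moment e (pos (range (($) Y))))" .
  qed
  also have "\<dots> = ennreal (?k ^ (CARD('m) + 1) * r) * facet_moment e"
    unfolding facet_moment_def by (rule nn_integral_cmult) measurable
  finally show ?thesis .
qed

lemma det_scaleR: "det (s *\<^sub>R (Y :: real ^ 'm ^ 'm::finite)) = s ^ CARD('m) * det Y"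
proof -
  have "s *\<^sub>R Y = (\<chi> i. s *s (Y $ i))" by (simp add: vec_eq_iff)
  then show ?thesis using det_rows_mul[of "\<lambda>_. s" "\<lambda>i. Y $ i"] by simp
qed

lemma facet_density_ge:
  fixes e :: "real ^ 'm::finite"
  assumes r: "0 < r" and e: "norm e = 1"
  defines "s \<equiv> 1 / sqrt (1 + r\<^sup>2)"
  shows "ennreal (half_ball_const TYPE(real ^ 'm) ^ (CARD('m) + 1) * r * s ^ ((CARD('m) + 1)\<^sup>2))
      * facet_moment e
    \<le> facet_density (r *\<^sub>R e)"
proof -
  let ?k = "half_ball_const TYPE(real ^ 'm)" and ?d = "CARD('m)"
  have k: "?k \<ge> 0" using half_ball_const_pos by (rule less_imp_le)
  have r1: "1 + r\<^sup>2 > 0" by (simp add: add_pos_nonneg)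
  then have s: "s > 0" "s\<^sup>2 * (1 + r\<^sup>2) = 1" by (auto simp: s_def power_divide)
  let ?H = "\<lambda>s. {y. norm y \<le> s \<and> 0 \<le> e \<bullet> y}"
  have [measurable]: "?H s \<in> sets borel" for s by measurable
  have [measurable]: "pos (range (($) (Y :: real ^ 'm ^ 'm))) \<in> sets borel" for Y by (rule pos_range_borel)
  let ?G = "\<lambda>s Y. ennreal \<bar>det Y\<bar> * (\<Prod>i\<in>UNIV. indicator (?H s) (Y $ i))
      * cone_moment e (pos (range (($) Y)))"
  have fm: "facet_moment e = (\<integral>\<^sup>+Y. ?G 1 Y \<partial>lborel)" by (simp add: facet_moment_def)
  have "ennreal (?k ^ (?d + 1) * r * s ^ ((?d + 1)\<^sup>2)) * facet_moment e
    = ennreal (s ^ DIM(real ^ 'm ^ 'm)) * (ennreal (?k ^ (?d + 1) * r * s ^ (?d + 1) * s ^ ?d) * (\<integral>\<^sup>+Y. ?G 1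
        Y \<partial>lborel))"
  proof -
    have "s ^ ((?d + 1)\<^sup>2) = s ^ (?d * ?d) * (s ^ (?d + 1) * s ^ ?d)"
      by (simp add: power_add[symmetric] power2_eq_square algebra_simps)
    then have eq: "?k ^ (?d + 1) * r * s ^ ((?d + 1)\<^sup>2)
        = s ^ (?d * ?d) * (?k ^ (?d + 1) * r * s ^ (?d + 1) * s ^ ?d)"
      by (simp only: mult_ac)
    have en: "ennreal (s ^ (?d * ?d) * (?k ^ (?d + 1) * r * s ^ (?d + 1) * s ^ ?d))
       = ennreal (s ^ (?d * ?d)) * ennreal (?k ^ (?d + 1) * r * s ^ (?d + 1) * s ^ ?d)"
      using k r s(1) by (intro ennreal_mult) auto
    have dim: "DIM(real ^ 'm ^ 'm) = ?d * ?d" by simp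
    show ?thesis unfolding fm eq en dim by (simp only: mult.assoc)
  qed
  also have "\<dots> = ennreal (s ^ DIM(real ^ 'm ^ 'm)) * (\<integral>\<^sup>+Y. ennreal (?k ^ (?d + 1) * r * s ^ (?d + 1))
      * ?G s (s *\<^sub>R Y) \<partial>lborel)"
  proof (intro arg_cong[where f = "\<lambda>x. ennreal (s ^ DIM(real ^ 'm ^ 'm)) * x"])
    have "ennreal (?k ^ (?d + 1) * r * s ^ (?d + 1) * s ^ ?d) * (\<integral>\<^sup>+Y. ?G 1 Y \<partial>lborel)
      = (\<integral>\<^sup>+Y. ennreal (?k ^ (?d + 1) * r * s ^ (?d + 1) * s ^ ?d) * ?G 1 Y \<partial>lborel)"
      by (rule nn_integral_cmult[symmetric]) measurable
    also have "\<dots> = (\<integral>\<^sup>+Y. ennreal (?k ^ (?d + 1) * r * s ^ (?d + 1)) * ?G s (s *\<^sub>R Y) \<partial>lborel)"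
    proof (rule nn_integral_cong)
      fix Y :: "real ^ 'm ^ 'm"
      have "pos (range (($) (s *\<^sub>R Y))) = pos (range (($) Y))"
      proof (intro equalityI pos_minimal convex_cone_pos)
        show "range (($) (s *\<^sub>R Y)) \<subseteq> pos (range (($) Y))"
        proof safe
          fix i
          have "s *\<^sub>R (Y $ i) \<in> pos (range (($) Y))"
            using s(1) by (intro pos_scaleR[of "Y $ i"] subsetD[OF pos_superset]) auto
          then show "(s *\<^sub>R Y) $ i \<in> pos (range (($) Y))" by simp
        qed
        show "range (($) Y) \<subseteq> pos (range (($) (s *\<^sub>R Y)))"
        proof safe
          fix i
          have "s *\<^sub>R (Y $ i) \<in> pos (range (($) (s *\<^sub>R Y)))"
              by (rule subsetD[OF pos_superset]) (auto intro: range_eqI[of _ _ i])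
          then show "Y $ i \<in> pos (range (($) (s *\<^sub>R Y)))" using scaleR_in_pos_iff[OF s(1)] by blast
        qed
      qed
      moreover have "indicator (?H s) ((s *\<^sub>R Y) $ i) = (indicator (?H 1) (Y $ i) :: ennreal)" for i
        using s(1) by (simp add: indicator_def zero_le_mult_iff)
      moreover have "ennreal \<bar>det (s *\<^sub>R Y)\<bar> = ennreal (s ^ ?d) * ennreal \<bar>det Y\<bar>"
        using s(1) by (simp add: det_scaleR abs_mult ennreal_mult)
      ultimately show "ennreal (?k ^ (?d + 1) * r * s ^ (?d + 1) * s ^ ?d) * ?G 1 Y
         = ennreal (?k ^ (?d + 1) * r * s ^ (?d + 1)) * ?G s (s *\<^sub>R Y)"
        using k r s(1) by (simp only: ennreal_mult[of _ "s ^ ?d"] mult_nonneg_nonneg zero_le_power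
            less_imp_le) (simp add: mult_ac)
    qed
    finally show "ennreal (?k ^ (?d + 1) * r * s ^ (?d + 1) * s ^ ?d) * (\<integral>\<^sup>+Y. ?G 1 Y \<partial>lborel)
      = (\<integral>\<^sup>+Y. ennreal (?k ^ (?d + 1) * r * s ^ (?d + 1)) * ?G s (s *\<^sub>R Y) \<partial>lborel)" .
  qed
  also have "\<dots> = (\<integral>\<^sup>+Y. ennreal (?k ^ (?d + 1) * r * s ^ (?d + 1)) * ?G s Y \<partial>lborel)"
    by (rule nn_integral_lborel_scaleR[OF s(1), symmetric]) measurable
  also have "\<dots> \<le> facet_density (r *\<^sub>R e)"
    unfolding facet_density_def
  proof (rule nn_integral_mono)
    fix Y :: "real ^ 'm ^ 'm"
    have "ennreal (?k ^ ?d) * (\<Prod>i\<in>UNIV. indicator (?H s) (Y $ i))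
        = (\<Prod>i\<in>UNIV. ennreal ?k * indicator (?H s) (Y $ i))"
      using k by (simp add: prod.distrib ennreal_power)
    also have "\<dots> \<le> (\<Prod>i\<in>UNIV. half_ball_density (Y $ i, (r *\<^sub>R e) \<bullet> (Y $ i)))"
    proof (rule prod_mono_ennreal)
      fix i
      have "(norm (Y $ i))\<^sup>2 + (r * (e \<bullet> Y $ i))\<^sup>2 \<le> 1" if y: "norm (Y $ i) \<le> s"
      proof -
        have "\<bar>e \<bullet> Y $ i\<bar> \<le> norm (Y $ i)" using Cauchy_Schwarz_ineq2[of e "Y $ i"] e by simp
        then have "(e \<bullet> Y $ i)\<^sup>2 \<le> (norm (Y $ i))\<^sup>2" by (metis abs_le_square_iff abs_norm_cancel)
        then have "r\<^sup>2 * (e \<bullet> Y $ i)\<^sup>2 \<le> r\<^sup>2 * (norm (Y $ i))\<^sup>2" by (intro mult_left_mono) auto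
        then have "(norm (Y $ i))\<^sup>2 + (r * (e \<bullet> Y $ i))\<^sup>2 \<le> (norm (Y $ i))\<^sup>2 * (1 + r\<^sup>2)"
          by (simp add: power_mult_distrib algebra_simps)
        also have "\<dots> \<le> s\<^sup>2 * (1 + r\<^sup>2)" using y by (intro mult_right_mono power_mono) auto
        finally show ?thesis using s(2) by simp
      qed
      then show "ennreal ?k * indicator (?H s) (Y $ i) \<le> half_ball_density (Y $ i, (r *\<^sub>R e) \<bullet> (Y $ i))"
        using r by (auto simp: half_ball_density_Pair indicator_def)
    qed
    finally have "ennreal \<bar>det Y\<bar> * (ennreal (?k ^ ?d) * (\<Prod>i\<in>UNIV. indicator (?H s) (Y $ i))) *
       (ennreal (?k * r * s ^ (?d + 1)) * cone_moment e (pos (range (($) Y))))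
      \<le> ennreal \<bar>det Y\<bar> * (\<Prod>i\<in>UNIV. half_ball_density (Y $ i, (r *\<^sub>R e) \<bullet> (Y $ i))) * emeasure
          uniform_half_ball (below_facet Y (r *\<^sub>R e))"
      using r e unfolding s_def by (intro mult_mono emeasure_below_facet_ge) auto
    moreover have "ennreal (?k ^ (?d + 1) * r * s ^ (?d + 1))
        = ennreal (?k ^ ?d) * ennreal (?k * r * s ^ (?d + 1))"
      using k r s(1) by (subst ennreal_mult[symmetric]) (auto simp: mult_ac)
    ultimately show "ennreal (?k ^ (?d + 1) * r * s ^ (?d + 1)) * ?G s Y
      \<le> ennreal \<bar>det Y\<bar> * (\<Prod>i\<in>UNIV. half_ball_density (Y $ i, (r *\<^sub>R e) \<bullet> (Y $ i))) * emeasure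
          uniform_half_ball (below_facet Y (r *\<^sub>R e))"
      by (simp add: mult_ac)
  qed
  finally show ?thesis .
qed

lemma facet_moment_finite:
  fixes e :: "real ^ 'm::finite"
  assumes e: "norm e = 1"
  shows "facet_moment e < \<infinity>"
proof -
  let ?B = "{Y :: real ^ 'm ^ 'm. \<forall>i. norm (Y $ i) \<le> 1}"
  have "compact ?B"
  proof (rule compact_eq_bounded_closed[THEN iffD2], intro conjI)
    have "?B = (\<Inter>i. {Y. norm (Y $ i) \<le> 1})" by auto
    then show "closed ?B" by (simp only:) (intro closed_INT ballI closed_Collect_le continuous_intros)
    have "norm Y \<le> (\<Sum>i\<in>(UNIV :: 'm set). 1)" if "Y \<in> ?B" for Y
      unfolding norm_vec_def[of Y] by (rule order.trans[OF L2_set_le_sum sum_mono]) (use that in auto)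
    then show "bounded ?B" by (auto simp: bounded_iff)
  qed
  then have "bounded (det ` ?B)"
    by (intro compact_imp_bounded compact_continuous_image continuous_on_det)
  then obtain D where D: "\<And>Y. Y \<in> ?B \<Longrightarrow> \<bar>det Y\<bar> \<le> D" by (auto simp: bounded_iff)
  let ?v = "emeasure lborel (cball (0 :: real ^ 'm) 1)"
  have v: "?v < \<infinity>" by (simp add: emeasure_cball)
  have cm: "cone_moment e (pos (range (($) Y))) \<le> ?v" for Y
  proof -
    have "cone_moment e (pos (range (($) Y))) \<le> (\<integral>\<^sup>+y. indicator (cball (0 :: real ^ 'm) 1) y \<partial>lborel)"
      unfolding cone_moment_def
    proof (rule nn_integral_mono)
      fix y :: "real ^ 'm"
      have "e \<bullet> y \<le> norm y" using norm_cauchy_schwarz[of e y] e by simp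
      then have "ennreal (e \<bullet> y) \<le> 1" if "norm y \<le> 1" using that by (simp add: ennreal_le_1)
      then show "ennreal (e \<bullet> y) * indicator (cball 0 1 \<inter> pos (range (($) Y))) y \<le> indicator (cball 0 1) y"
        by (auto simp: indicator_def)
    qed
    then show ?thesis by simp
  qed
  have "facet_moment e \<le> (\<integral>\<^sup>+Y. (ennreal D * ?v) * (\<Prod>i\<in>UNIV. indicator (cball 0 1) (Y $ i))
      \<partial>(lborel :: (real ^ 'm ^ 'm) measure))"
    unfolding facet_moment_def
  proof (rule nn_integral_mono)
    fix Y :: "real ^ 'm ^ 'm"
    show "ennreal \<bar>det Y\<bar> * (\<Prod>i\<in>UNIV. indicator {y. norm y \<le> 1 \<and> 0
        \<le> e \<bullet> y} (Y $ i)) * cone_moment e (pos (range (($) Y)))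
      \<le> (ennreal D * ?v) * (\<Prod>i\<in>UNIV. indicator (cball 0 1) (Y $ i))"
    proof (cases "Y \<in> ?B")
      case True
      have "(\<Prod>i\<in>UNIV. indicator {y. norm y \<le> 1 \<and> 0 \<le> e \<bullet> y} (Y $ i) :: ennreal)
          \<le> (\<Prod>i\<in>UNIV. indicator (cball 0 1) (Y $ i))"
        by (intro prod_mono_ennreal) (auto simp: indicator_def)
      then have "ennreal \<bar>det Y\<bar> * (\<Prod>i\<in>UNIV. indicator {y. norm y \<le> 1 \<and> 0
          \<le> e \<bullet> y} (Y $ i)) * cone_moment e (pos (range (($) Y)))
        \<le> ennreal D * (\<Prod>i\<in>UNIV. indicator (cball 0 1) (Y $ i)) * ?v"
        using D[OF True] cm by (intro mult_mono ennreal_leI) auto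
      then show ?thesis by (simp add: mult_ac)
    next
      case False
      then have prod0: "(\<Prod>i\<in>UNIV. indicator {y. norm y \<le> 1 \<and> 0 \<le> e \<bullet> y} (Y $ i) :: ennreal) = 0"
        by (auto simp: prod_zero_iff indicator_def)
      show ?thesis unfolding prod0 by simp
    qed
  qed
  also have "\<dots> = (ennreal D * ?v) * (\<integral>\<^sup>+Y. (\<Prod>i\<in>UNIV. indicator (cball 0 1) (Y $ i))
      \<partial>(lborel :: (real ^ 'm ^ 'm) measure))"
    by (rule nn_integral_cmult) measurable
  also have "\<dots> = (ennreal D * ?v) * ?v ^ CARD('m)"
    by (subst nn_integral_lborel_vec_prod) auto
  also have "\<dots> < \<infinity>" using v by (simp add: ennreal_mult_less_top power_less_top_ennreal)
  finally show ?thesis .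
qed

lemma facet_moment_rotate:
  fixes f :: "real ^ 'm::finite \<Rightarrow> real ^ 'm"
  assumes f: "orthogonal_transformation f"
  shows "facet_moment (f e) = facet_moment e"
proof -
  have lin: "linear f" and nrm: "\<And>y. norm (f y) = norm y"
    using f by (auto simp: orthogonal_transformation)
  have inn: "f x \<bullet> f y = x \<bullet> y" for x y
    using f unfolding orthogonal_transformation_def by blast
  have inj: "inj f" using f orthogonal_transformation_inj by blast
  let ?r = "\<lambda>Y :: real ^ 'm ^ 'm. \<chi> i. f (Y $ i)"
  have r1: "linear ?r" using lin by (auto simp: linear_iff vec_eq_iff)
  have r2: "norm (?r Y) = norm Y" for Y
  proof -
    have "norm (?r Y) = L2_set (\<lambda>i. norm (f (Y $ i))) UNIV" by (simp add: norm_vec_def[of "?r Y"])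
    then show ?thesis by (simp only: nrm norm_vec_def[of Y])
  qed
  note r = r1 r2
  let ?G = "\<lambda>e Y. ennreal \<bar>det Y\<bar> * (\<Prod>i\<in>UNIV. indicator {y. norm y \<le> 1 \<and> 0 \<le> e \<bullet> y} (Y $ i)) *
     cone_moment e (pos (range (($) Y)))"
  have det: "\<bar>det (?r Y)\<bar> = \<bar>det Y\<bar>" for Y
  proof -
    have "?r Y = Y ** transpose (matrix f)"
    proof (subst vec_eq_iff, intro allI)
      fix i
      have "(Y ** transpose (matrix f)) $ i = matrix f *v (Y $ i)"
        by (simp add: vec_eq_iff matrix_matrix_mult_def matrix_vector_mult_def transpose_def mult.commute)
      then show "?r Y $ i = (Y ** transpose (matrix f)) $ i" using lin by (simp add: matrix_works)
    qed
    moreover have "\<bar>det (matrix f)\<bar> = 1"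
      using f det_orthogonal_matrix[of "matrix f"] orthogonal_transformation_matrix by force
    ultimately show ?thesis by (simp add: det_mul det_transpose abs_mult)
  qed
  have cm: "cone_moment (f e) (f ` C) = cone_moment e C" if "C \<in> sets borel" "f ` C \<in> sets borel" for C
  proof -
    have "cone_moment (f e) (f ` C) = (\<integral>\<^sup>+y. ennreal (f e \<bullet> f y) * indicator (cball 0 1 \<inter> f ` C) (f y)
        \<partial>lborel)"
      unfolding cone_moment_def
      by (rule nn_integral_lborel_isometry[where f = f, symmetric]) (use lin nrm that in auto)
    also have "\<dots> = cone_moment e C"
      unfolding cone_moment_def using inj
          by (intro nn_integral_cong) (auto simp: indicator_def inn nrm inj_def)
    finally show ?thesis .
  qed
  have "facet_moment (f e) = (\<integral>\<^sup>+Y. ?G (f e) (?r Y) \<partial>lborel)"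
    unfolding facet_moment_def
  proof (rule nn_integral_lborel_isometry[where f = ?r, symmetric])
    have [measurable]: "{y. norm y \<le> 1 \<and> 0 \<le> f e \<bullet> y} \<in> sets borel" by measurable
    show "?G (f e) \<in> borel_measurable borel" by measurable
  qed (use r in auto)
  also have "\<dots> = facet_moment e"
    unfolding facet_moment_def
  proof (rule nn_integral_cong)
    fix Y :: "real ^ 'm ^ 'm"
    have "range (($) (?r Y)) = f ` range (($) Y)" by auto
    then have p: "pos (range (($) (?r Y))) = f ` pos (range (($) Y))"
      using pos_linear_image[OF lin] by simp
    then have "cone_moment (f e) (pos (range (($) (?r Y)))) = cone_moment e (pos (range (($) Y)))"
      using cm[of "pos (range (($) Y))"] pos_range_borel[of "?r Y"] by simp
    then show "?G (f e) (?r Y) = ?G e Y"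
      by (simp add: det indicator_def nrm inn)
  qed
  finally show ?thesis .
qed

lemma facet_moment_unit:
  fixes e e' :: "real ^ 'm::finite"
  assumes "norm e = 1" "norm e' = 1"
  shows "facet_moment e = facet_moment e'"
proof -
  obtain f where "orthogonal_transformation f" "f e = e'"
    using orthogonal_transformation_exists[of e e'] assms by auto
  then show ?thesis using facet_moment_rotate[of f e] by simp
qed

section \<open>Polar coordinates and Beta integrals\<close>

lemma arctan_le_self:
  assumes "0 \<le> x"
  shows "arctan x \<le> x"
proof -
  have "0 - arctan 0 \<le> x - arctan x"
  proof (rule DERIV_nonneg_imp_nondecreasing[OF assms])
    fix y :: real
    have "((\<lambda>x. x - arctan x) has_real_derivative 1 - inverse (1 + y\<^sup>2)) (at y)"
      by (auto intro!: derivative_eq_intros)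
    moreover have "0 \<le> 1 - inverse (1 + y\<^sup>2)" by (simp add: inverse_le_1_iff)
    ultimately show "\<exists>D. ((\<lambda>x. x - arctan x) has_real_derivative D) (at y) \<and> 0 \<le> D" by blast
  qed
  then show ?thesis by simp
qed

lemma arctan_ge_cubic:
  assumes "0 \<le> x"
  shows "x - x ^ 3 / 3 \<le> arctan x"
proof -
  have "arctan 0 - 0 + 0 ^ 3 / 3 \<le> arctan x - x + x ^ 3 / 3"
  proof (rule DERIV_nonneg_imp_nondecreasing[OF assms])
    fix y :: real
    have "((\<lambda>x. arctan x - x + x ^ 3 / 3) has_real_derivative inverse (1 + y\<^sup>2) - 1 + y\<^sup>2) (at y)"
      by (auto intro!: derivative_eq_intros)
    moreover have "0 \<le> inverse (1 + y\<^sup>2) - 1 + y\<^sup>2"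
    proof -
      have "1 + y\<^sup>2 > 0" by (simp add: add_pos_nonneg)
      then have "inverse (1 + y\<^sup>2) - 1 + y\<^sup>2 = y ^ 4 / (1 + y\<^sup>2)"
          by (simp add: field_simps power2_eq_square power4_eq_xxxx)
      then show ?thesis by simp
    qed
    ultimately show "\<exists>D. ((\<lambda>x. arctan x - x + x ^ 3 / 3) has_real_derivative D) (at y) \<and> 0 \<le> D" by blast
  qed
  then show ?thesis by simp
qed

lemma tan_quarter_bounds:
  assumes "0 \<le> \<theta>" "\<theta> \<le> pi / 4"
  shows "0 \<le> tan \<theta>" "tan \<theta> \<le> 1" "\<theta> \<le> tan \<theta>" "tan \<theta> \<le> \<theta> * (1 + (tan \<theta>)\<^sup>2)" "(tan \<theta>)\<^sup>2 \<le> 4 * \<theta>\<^sup>2"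
proof -
  let ?x = "tan \<theta>"
  have at: "arctan ?x = \<theta>" using assms pi_gt_zero by (intro arctan_tan) linarith+
  show x0: "0 \<le> ?x" using assms at by (metis zero_le_arctan_iff)
  have "arctan ?x \<le> arctan 1" using assms at by (simp add: arctan_one)
  then show x1: "?x \<le> 1" unfolding arctan_le_iff .
  show "\<theta> \<le> ?x" using arctan_le_self[OF x0] at by simp
  have c: "?x * (1 - ?x\<^sup>2 / 3) \<le> \<theta>" using arctan_ge_cubic[OF x0] at
      by (simp add: algebra_simps power3_eq_cube power2_eq_square)
  have sq: "?x\<^sup>2 \<le> 1" using x0 x1 by (simp add: power_le_one)
  have "?x * 1 \<le> ?x * ((1 - ?x\<^sup>2 / 3) * (1 + ?x\<^sup>2))"
  proof (rule mult_left_mono[OF _ x0])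
    have "0 \<le> ?x\<^sup>2 * (2 - ?x\<^sup>2)" using sq by (intro mult_nonneg_nonneg) auto
    then show "1 \<le> (1 - ?x\<^sup>2 / 3) * (1 + ?x\<^sup>2)" by (simp add: algebra_simps)
  qed
  also have "\<dots> = ?x * (1 - ?x\<^sup>2 / 3) * (1 + ?x\<^sup>2)" by (simp only: mult.assoc)
  also have "\<dots> \<le> \<theta> * (1 + ?x\<^sup>2)" using c by (intro mult_right_mono) auto
  finally show le: "?x \<le> \<theta> * (1 + ?x\<^sup>2)" by simp
  also have "\<dots> \<le> \<theta> * 2" using sq assms by (intro mult_left_mono) auto
  finally have "?x\<^sup>2 \<le> (\<theta> * 2)\<^sup>2" using x0 by (intro power_mono) auto
  then show "?x\<^sup>2 \<le> 4 * \<theta>\<^sup>2" by (simp add: power_mult_distrib)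
qed

lemma one_plus_power_le:
  assumes "0 \<le> x" "x \<le> (1::real)"
  shows "(1 + x) ^ n \<le> 1 + 2 ^ n * x"
proof -
  have "(1 + x) ^ n \<le> 1 + (2 ^ n - 1) * x"
  proof (induction n)
    case (Suc n)
    have "(1 + x) ^ Suc n \<le> (1 + (2 ^ n - 1) * x) * (1 + x)"
      using Suc assms by (simp add: mult.commute mult_left_mono)
    also have "\<dots> = 1 + 2 ^ n * x + (2 ^ n - 1) * (x * x)" by (simp add: algebra_simps)
    also have "\<dots> \<le> 1 + 2 ^ n * x + (2 ^ n - 1) * x"
      using assms by (intro add_left_mono mult_left_mono) (auto simp: mult_left_le)
    finally show ?case by (simp add: algebra_simps)
  qed simp
  also have "\<dots> \<le> 1 + 2 ^ n * x" using assms by (intro add_left_mono mult_right_mono) auto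
  finally show ?thesis .
qed

lemma polar_profile_bounds:
  fixes d k :: nat
  obtains C where "0 \<le> C"
    "\<And>s. 0 \<le> s \<Longrightarrow> s \<le> 1 / 4 \<Longrightarrow> tan (pi * s) ^ d * (1 + (tan (pi * s))\<^sup>2) \<le> (pi * s) ^ d * (1 + C * s\<^sup>2)"
    "\<And>s. 0 \<le> s \<Longrightarrow> s \<le> 1 / 4 \<Longrightarrow> (pi * s) ^ d * (1 - C * s\<^sup>2) \<le>
       tan (pi * s) ^ d * (1 + (tan (pi * s))\<^sup>2) * (1 / sqrt (1 + (tan (pi * s))\<^sup>2)) ^ k"
proof -
  define C where "C = (2 ^ (d + 1) + real k) * 4 * pi\<^sup>2"
  have "0 \<le> C" by (simp add: C_def)
  moreover have "tan (pi * s) ^ d * (1 + (tan (pi * s))\<^sup>2) \<le> (pi * s) ^ d * (1 + C * s\<^sup>2) \<and>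
     (pi * s) ^ d * (1 - C * s\<^sup>2) \<le> tan (pi * s) ^ d * (1 + (tan (pi * s))\<^sup>2) * (1 / sqrt (1 + (tan (pi *
         s))\<^sup>2)) ^ k"
    if s: "0 \<le> s" "s \<le> 1 / 4" for s
  proof
    let ?t = "tan (pi * s)" and ?\<theta> = "pi * s"
    have th: "0 \<le> ?\<theta>" "?\<theta> \<le> pi / 4" using s by auto
    note b = tan_quarter_bounds[OF th]
    have t2: "0 \<le> ?t\<^sup>2" "?t\<^sup>2 \<le> 1" using b by (auto simp: power_le_one)
    have t2s: "?t\<^sup>2 \<le> 4 * pi\<^sup>2 * s\<^sup>2" using b(5) by (simp add: power_mult_distrib)
    have "?t ^ d * (1 + ?t\<^sup>2) \<le> (?\<theta> * (1 + ?t\<^sup>2)) ^ d * (1 + ?t\<^sup>2)"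
      using b by (intro mult_right_mono power_mono) auto
    also have "\<dots> = ?\<theta> ^ d * (1 + ?t\<^sup>2) ^ (d + 1)" by (simp add: power_mult_distrib)
    also have "\<dots> \<le> ?\<theta> ^ d * (1 + C * s\<^sup>2)"
    proof (rule mult_left_mono)
      have "(1 + ?t\<^sup>2) ^ (d + 1) \<le> 1 + 2 ^ (d + 1) * ?t\<^sup>2" by (rule one_plus_power_le[OF t2])
      also have "\<dots> \<le> 1 + (2 ^ (d + 1) + real k) * (4 * pi\<^sup>2 * s\<^sup>2)"
        using t2 t2s by (intro add_left_mono mult_mono) auto
      finally show "(1 + ?t\<^sup>2) ^ (d + 1) \<le> 1 + C * s\<^sup>2" unfolding C_def by (simp only: mult.assoc)
    qed (use th in auto)
    finally show "?t ^ d * (1 + ?t\<^sup>2) \<le> ?\<theta> ^ d * (1 + C * s\<^sup>2)" .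
    have "1 - C * s\<^sup>2 \<le> 1 - real k * ?t\<^sup>2"
    proof -
      have "real k * ?t\<^sup>2 \<le> (2 ^ (d + 1) + real k) * (4 * pi\<^sup>2 * s\<^sup>2)"
          using t2 t2s by (intro mult_mono) auto
      then have "real k * ?t\<^sup>2 \<le> C * s\<^sup>2" unfolding C_def by (simp only: mult.assoc)
      then show ?thesis by simp
    qed
    also have "\<dots> \<le> (1 - ?t\<^sup>2) ^ k" using Bernoulli_inequality[of "- (?t\<^sup>2)" k] t2 by simp
    also have "\<dots> \<le> (1 / sqrt (1 + ?t\<^sup>2)) ^ k"
    proof (rule power_mono)
      have s1: "0 < sqrt (1 + ?t\<^sup>2)" by (simp add: add_pos_nonneg)
      have "sqrt (1 + ?t\<^sup>2) \<le> 1 + ?t\<^sup>2" by (intro real_le_lsqrt self_le_power) auto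
      then have "(1 - ?t\<^sup>2) * sqrt (1 + ?t\<^sup>2) \<le> (1 - ?t\<^sup>2) * (1 + ?t\<^sup>2)"
          using t2 by (intro mult_left_mono) auto
      also have "\<dots> \<le> 1" by (simp add: algebra_simps)
      finally show "1 - ?t\<^sup>2 \<le> 1 / sqrt (1 + ?t\<^sup>2)" using s1 by (simp add: pos_le_divide_eq)
    qed (use t2 in auto)
    finally have A: "1 - C * s\<^sup>2 \<le> (1 / sqrt (1 + ?t\<^sup>2)) ^ k" .
    have "?\<theta> ^ d * (1 - C * s\<^sup>2) \<le> ?\<theta> ^ d * (1 / sqrt (1 + ?t\<^sup>2)) ^ k"
        using A th by (intro mult_left_mono) auto
    also have "\<dots> \<le> (?t ^ d * (1 + ?t\<^sup>2)) * (1 / sqrt (1 + ?t\<^sup>2)) ^ k"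
    proof (rule mult_right_mono)
      have "?\<theta> ^ d \<le> ?t ^ d" using b th by (intro power_mono) auto
      also have "\<dots> \<le> ?t ^ d * (1 + ?t\<^sup>2)" using b(1) t2 by (simp add: algebra_simps)
      finally show "?\<theta> ^ d \<le> ?t ^ d * (1 + ?t\<^sup>2)" .
    qed (use t2 in auto)
    finally show "?\<theta> ^ d * (1 - C * s\<^sup>2) \<le> ?t ^ d * (1 + ?t\<^sup>2) * (1 / sqrt (1 + ?t\<^sup>2)) ^ k" .
  qed
  ultimately show ?thesis using that by blast
qed

definition beta_nat :: "nat \<Rightarrow> nat \<Rightarrow> real" where
  "beta_nat j N = fact j * fact N / fact (j + N + 1)"

lemma beta_nat_nonneg: "0 \<le> beta_nat j N"
  by (simp add: beta_nat_def)

lemma nn_integral_beta_nat: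
  "(\<integral>\<^sup>+s. ennreal (s ^ j * (1 - s) ^ N) * indicator {0..1} s \<partial>lborel) = ennreal (beta_nat j N)"
proof -
  have "((\<lambda>t. t powr (real (j + 1) - 1) * (1 - t) powr (real (N + 1) - 1)) has_integral Beta (real (j
      + 1)) (real (N + 1))) {0..1}"
    by (rule has_integral_Beta_real) auto
  then have "((\<lambda>t. t ^ j * (1 - t) ^ N) has_integral Beta (real (j + 1)) (real (N + 1))) {0..1}"
    by (rule has_integral_spike[of "{0, 1}", rotated 2]) (auto simp: powr_realpow)
  moreover have "Beta (real (j + 1)) (real (N + 1)) = beta_nat j N"
  proof -
    have "Gamma (real (j + 1)) = fact j" "Gamma (real (N + 1)) = fact N"
      using Gamma_fact[of j, where 'a=real] Gamma_fact[of N, where 'a=real] by (simp_all add: add.commute)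
    moreover have "Gamma (real (j + 1) + real (N + 1)) = fact (j + N + 1)"
    proof -
      have "real (j + 1) + real (N + 1) = 1 + real (j + N + 1)" by simp
      then show ?thesis using Gamma_fact[of "j + N + 1", where 'a=real] by (simp only:)
    qed
    ultimately show ?thesis by (simp only: Beta_def beta_nat_def)
  qed
  ultimately have "((\<lambda>t. t ^ j * (1 - t) ^ N) has_integral beta_nat j N) {0..1}" by simp
  then have "(\<integral>\<^sup>+s. ennreal (indicator {0..1} s * (s ^ j * (1 - s) ^ N)) \<partial>lborel) = ennreal (beta_nat j N)"
    by (intro nn_integral_has_integral_lebesgue) auto
  moreover have "ennreal (indicator {0..1} s * (s ^ j * (1 - s) ^ N))
      = ennreal (s ^ j * (1 - s) ^ N) * indicator {0..1} s" for s :: real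
    by (simp add: indicator_def)
  ultimately show ?thesis by simp
qed

lemma omega_eq_unit_ball_vol: "0 < k \<Longrightarrow> omega k = real k * unit_ball_vol (real k)"
proof -
  assume "0 < k"
  then have pos: "real k / 2 > 0" by simp
  then have n: "real k / 2 \<notin> \<int>\<^sub>\<le>\<^sub>0" and g: "Gamma (real k / 2) > 0"
    using nonpos_Ints_nonpos[of "real k / 2"] by (linarith, intro Gamma_real_pos)
  then show ?thesis using g \<open>0 < k\<close>
    unfolding unit_ball_vol_def omega_def Gamma_plus1[OF n] by (simp add: divide_simps)
qed

lemma omega_pos: "0 < k \<Longrightarrow> 0 < omega k"
  by (simp add: omega_eq_unit_ball_vol)

lemma nn_integral_polar_arctan:
  fixes h :: "real \<Rightarrow> ennreal"
  assumes [measurable]: "h \<in> borel_measurable borel"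
  shows "(\<integral>\<^sup>+a. h (arctan (norm a) / pi) * indicator (cball 0 1) a \<partial>(lborel :: 'a::euclidean_space measure))
    = (\<integral>\<^sup>+s. ennreal (omega DIM('a) * pi * tan (pi * s) ^ (DIM('a) - 1) * (1 + (tan (pi * s))\<^sup>2)) *
        indicator {0..1/4} s * h s \<partial>lborel)"
proof -
  let ?D = "DIM('a)"
  define v where "v = unit_ball_vol (real ?D)"
  have v: "v > 0" unfolding v_def by (rule unit_ball_vol_pos) simp
  have om: "omega ?D = real ?D * v"
    by (simp add: omega_eq_unit_ball_vol v_def)
  let ?g = "\<lambda>s. omega ?D * pi * tan (pi * s) ^ (?D - 1) * (1 + (tan (pi * s))\<^sup>2)"
  have [measurable]: "tan \<in> borel_measurable (borel :: real measure)"
    unfolding tan_def[abs_def] by measurable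
  let ?\<phi> = "\<lambda>a::'a. arctan (norm a) / pi"
  have [measurable]: "?\<phi> \<in> borel_measurable borel" by measurable
  let ?M = "distr (density lborel (indicator (cball 0 1))) borel ?\<phi>"
  let ?N = "density lborel (\<lambda>s. ennreal (?g s) * indicator {0..1/4} s)"
  have rad: "arctan (norm a) / pi \<le> x \<longleftrightarrow> norm a \<le> tan (pi * x)" if "0 \<le> x" "x \<le> 1/4" for a :: 'a and x
  proof -
    have "arctan (tan (pi * x)) = pi * x"
      using that pi_gt_zero by (intro arctan_tan) (auto intro: less_le_trans[of _ 0] order.strict_trans1[of
          _ "pi * (1/4)"])
    then have "norm a \<le> tan (pi * x) \<longleftrightarrow> arctan (norm a) \<le> pi * x" by (metis arctan_le_iff)
    then show ?thesis by (simp add: field_simps)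
  qed
  have eM: "emeasure ?M {x<..} = emeasure lborel (cball 0 1 \<inter> {a. x < ?\<phi> a})" for x
  proof -
    have "{a. x < ?\<phi> a} \<in> sets borel" by measurable
    then show ?thesis by (subst emeasure_distr) (auto simp: emeasure_density vimage_def simp flip:
        indicator_inter_arith)
  qed
  have FTC: "(\<integral>\<^sup>+s. ennreal (?g s) * indicator {y..1/4} s \<partial>lborel) = ennreal (v - v * tan (pi * y) ^ ?D)"
    if y: "0 \<le> y" "y \<le> 1/4" for y
  proof -
    have "(\<integral>\<^sup>+s. ennreal (?g s) * indicator {y..1/4} s \<partial>lborel)
        = ennreal (v * tan (pi * (1/4)) ^ ?D - v * tan (pi * y) ^ ?D)"
    proof (rule nn_integral_FTC_Icc)
      fix s assume "s \<in> {y..1/4}"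
      then have s: "y \<le> s" "s \<le> 1/4" by auto
      have th: "0 \<le> pi * s" "pi * s \<le> pi / 4" using s y by auto
      have cos: "cos (pi * s) \<noteq> 0"
        using th pi_gt_zero by (intro less_imp_neq[THEN not_sym] cos_gt_zero_pi) linarith+
      have "((\<lambda>s. v * tan (pi * s) ^ ?D) has_real_derivative v * (real ?D * (inverse ((cos (pi * s))\<^sup>2)
          * pi) * tan (pi * s) ^ (?D - Suc 0))) (at s)"
        using cos by (auto intro!: derivative_eq_intros)
      moreover have "inverse ((cos (pi * s))\<^sup>2) = 1 + (tan (pi * s))\<^sup>2"
          using tan_sec[OF cos] by (simp add: power_inverse)
      ultimately show "((\<lambda>s. v * tan (pi * s) ^ ?D) has_real_derivative ?g s) (at s)"
        by (simp add: om mult_ac)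
      show "0 \<le> ?g s" using tan_quarter_bounds(1)[OF th] v by (simp add: om)
    qed (use y in auto)
    then show ?thesis by (simp add: tan_45)
  qed
  have eN: "emeasure ?N {x<..} = (\<integral>\<^sup>+s. ennreal (?g s) * indicator {max x 0..1/4} s \<partial>lborel)" for x
  proof -
    have "emeasure ?N {x<..} = (\<integral>\<^sup>+s. ennreal (?g s) * indicator {0..1/4} s * indicator {x<..} s \<partial>lborel)"
      by (rule emeasure_density) auto
    also have "\<dots> = (\<integral>\<^sup>+s. ennreal (?g s) * indicator {max x 0..1/4} s \<partial>lborel)"
      using AE_lborel_singleton[of x] by (intro nn_integral_cong_AE) (auto simp: indicator_def elim!:
          eventually_mono)
    finally show ?thesis .
  qed
  have vol: "emeasure lborel (cball (0::'a) r) = ennreal (v * r ^ ?D)" if "0 \<le> r" for r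
    using that by (simp add: emeasure_cball v_def)
  have "?M = ?N"
  proof (rule measure_eqI_lessThan)
    fix x :: real
    consider "x < 0" | "0 \<le> x" "x \<le> 1/4" | "1/4 < x" by linarith
    then show eq: "emeasure ?M {x<..} = emeasure ?N {x<..}"
    proof cases
      case 1
      then have "x < ?\<phi> a" for a
        by (rule order.strict_trans2) (simp add: zero_le_arctan_iff)
      then have "cball 0 1 \<inter> {a. x < ?\<phi> a} = cball 0 1" by auto
      then have "emeasure ?M {x<..} = ennreal v" by (simp add: eM vol)
      also have "\<dots> = emeasure ?N {x<..}"
        unfolding eN max_absorb2[OF less_imp_le[OF 1]] using FTC[of 0] by (simp add: zero_power)
      finally show ?thesis .
    next
      case 2
      have t: "0 \<le> tan (pi * x)" "tan (pi * x) \<le> 1" using tan_quarter_bounds[of "pi * x"] 2 by auto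
      have "cball 0 1 \<inter> {a. x < ?\<phi> a} = cball 0 1 - cball 0 (tan (pi * x))"
      proof -
        have "x < ?\<phi> a \<longleftrightarrow> tan (pi * x) < norm a" for a using rad[OF 2, of a] by linarith
        then show ?thesis by (simp only: set_eq_iff Int_iff Diff_iff mem_Collect_eq mem_cball_0 not_le) simp
      qed
      then have "emeasure ?M {x<..} = emeasure lborel (cball (0::'a) 1 - cball 0 (tan (pi * x)))"
        unfolding eM by (simp only:)
      also have "\<dots> = emeasure lborel (cball (0::'a) 1) - emeasure lborel (cball (0::'a) (tan (pi * x)))"
      proof (rule emeasure_Diff)
        show "emeasure lborel (cball (0::'a) (tan (pi * x))) \<noteq> \<infinity>" unfolding vol[OF t(1)] by simp
        show "cball (0::'a) (tan (pi * x)) \<subseteq> cball 0 1" by (rule subset_cball[OF t(2)])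
      qed auto
      also have "\<dots> = ennreal (v - v * tan (pi * x) ^ ?D)"
      proof -
        have "0 \<le> v * tan (pi * x) ^ ?D" using t(1) v by simp
        then show ?thesis unfolding vol[OF t(1)] vol[OF zero_le_one] by (simp add: ennreal_minus)
      qed
      also have "\<dots> = emeasure ?N {x<..}"
        unfolding eN max_absorb1[OF 2(1)] by (rule FTC[OF 2, symmetric])
      finally show ?thesis .
    next
      case 3
      have "\<not> x < ?\<phi> a" if "a \<in> cball 0 1" for a
      proof -
        have "arctan (norm a) \<le> arctan 1" unfolding arctan_le_iff using that by simp
        then have "arctan (norm a) / pi \<le> 1/4" by (simp add: arctan_one field_simps)
        then show ?thesis using 3 by linarith
      qed
      then have "cball 0 1 \<inter> {a. x < ?\<phi> a} = {}" by auto
      then have "emeasure ?M {x<..} = 0" unfolding eM by (simp only: emeasure_empty)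
      also have "\<dots> = emeasure ?N {x<..}"
      proof -
        have "{max x 0..1/4} = {}" using 3 by auto
        then show ?thesis unfolding eN by simp
      qed
      finally show ?thesis .
    qed
    have "emeasure ?M {x<..} \<le> emeasure lborel (cball (0::'a) 1)" unfolding eM by (intro emeasure_mono) auto
    also have "\<dots> < \<infinity>" by (simp add: vol)
    finally show "emeasure ?M {x<..} < \<infinity>" .
  qed simp_all
  then have "(\<integral>\<^sup>+s. h s \<partial>?M) = (\<integral>\<^sup>+s. h s \<partial>?N)" by simp
  then show ?thesis
    by (simp add: nn_integral_distr nn_integral_density mult_ac)
qed

text \<open>The limit of \<open>n\<close> times the probability that a random point misses the cone generated by
  \<open>n\<close> others.\<close>
definition mass_const :: "'m::{finite,wellorder} itself \<Rightarrow> real" where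
  "mass_const _ = half_ball_const TYPE(real ^ 'm::_) ^ (CARD('m) + 1)
      * enn2real (facet_moment (axis undefined 1 :: real ^ 'm::_))
     * omega CARD('m) * pi ^ (CARD('m) + 1)"

lemma omega_nonneg: "0 \<le> omega k"
  by (cases "k = 0") (auto simp: omega_def intro!: divide_nonneg_nonneg less_imp_le[OF Gamma_real_pos])

lemma mass_const_nonneg: "0 \<le> mass_const TYPE('m::{finite,wellorder})"
  using half_ball_const_pos[where 'a = "(real, 'm) vec"]
  by (auto simp: mass_const_def intro!: mult_nonneg_nonneg omega_nonneg)

lemma facet_moment_unit_eq:
  fixes e :: "real ^ 'm::finite"
  assumes "norm e = 1"
  shows "facet_moment e = ennreal (enn2real (facet_moment (axis undefined 1 :: real ^ 'm)))"
proof -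
  have a: "norm (axis undefined 1 :: real ^ 'm) = 1" by simp
  show ?thesis
    using facet_moment_unit[OF assms a] facet_moment_finite[OF a] by (simp add: ennreal_enn2real)
qed

text \<open>Radially the facet mass is an integral over \<open>s = arctan (norm a) / pi\<close>, the probability of
  a random point lying below the graph of \<open>a\<close>.\<close>
lemma inner_facet_mass_bounds:
  fixes N :: nat
  defines "A \<equiv> (\<integral>\<^sup>+a. above_prob a ^ N * facet_density a * indicator (cball 0 1) a
      \<partial>(lborel :: (real ^ 'm::{finite,wellorder}) measure))"
    and "w \<equiv> \<lambda>s. half_ball_const TYPE(real ^ 'm::_) ^ (CARD('m) + 1)
        * enn2real (facet_moment (axis undefined 1 :: real ^ 'm::_))
      * omega CARD('m) * pi * (1 - s) ^ N * (tan (pi * s) ^ CARD('m) * (1 + (tan (pi * s))\<^sup>2))"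
  shows "A \<le> (\<integral>\<^sup>+s. ennreal (w s) * indicator {0..1/4} s \<partial>lborel)"
    and "(\<integral>\<^sup>+s. ennreal (w s * (1 / sqrt (1 + (tan (pi * s))\<^sup>2)) ^ ((CARD('m) + 1)\<^sup>2))
        * indicator {0..1/4} s \<partial>lborel) \<le> A"
proof -
  let ?d = "CARD('m)" and ?k = "half_ball_const TYPE((real, 'm) vec)"
  define J where "J = enn2real (facet_moment (axis undefined 1 :: (real, 'm) vec))"
  have J: "0 \<le> J" by (simp add: J_def)
  have k: "0 \<le> ?k" using half_ball_const_pos by (rule less_imp_le)
  have d: "DIM((real, 'm) vec) = ?d" by simp
  have [measurable]: "tan \<in> borel_measurable (borel :: real measure)"
    unfolding tan_def[abs_def] by measurable
  let ?h = "\<lambda>s. ennreal (?k ^ (?d + 1) * J * (1 - s) ^ N * tan (pi * s))"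
  let ?l = "\<lambda>s. 1 / sqrt (1 + (tan (pi * s))\<^sup>2)"
  let ?h' = "\<lambda>s. ennreal (?k ^ (?d + 1) * J * (1 - s) ^ N * tan (pi * s) * ?l s ^ ((?d + 1)\<^sup>2))"
  have pointwise: "above_prob a ^ N * facet_density a * indicator (cball 0 1) a
      \<le> ?h (arctan (norm a) / pi) * indicator (cball 0 1) a"
      "?h' (arctan (norm a) / pi) * indicator (cball 0 1) a
          \<le> above_prob a ^ N * facet_density a * indicator (cball 0 1) a"
    if "a \<noteq> 0" for a :: "(real, 'm) vec"
  proof -
    define e where "e = (1 / norm a) *\<^sub>R a"
    have e: "norm e = 1" "a = norm a *\<^sub>R e" using that by (simp_all add: e_def)
    have r: "0 < norm a" using that by simp
    have t: "tan (pi * (arctan (norm a) / pi)) = norm a" by (simp add: tan_arctan)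
    have "arctan (norm a) \<le> pi" using arctan_ubound[of "norm a"] pi_gt_zero by linarith
    then have q: "0 \<le> 1 - arctan (norm a) / pi" by (simp add: field_simps)
    have fm: "facet_moment e = ennreal J" unfolding J_def by (rule facet_moment_unit_eq[OF e(1)])
    have "facet_density a \<le> ennreal (?k ^ (?d + 1) * norm a) * facet_moment e"
      using facet_density_le[OF r, of e] by (simp only: e(2)[symmetric])
    also have "\<dots> = ennreal (?k ^ (?d + 1) * norm a * J)" using k J r by (simp add: fm ennreal_mult)
    finally have "above_prob a ^ N * facet_density a
        \<le> above_prob a ^ N * ennreal (?k ^ (?d + 1) * norm a * J)"
      by (rule mult_left_mono) simp
    also have "\<dots> = ?h (arctan (norm a) / pi)"
      unfolding above_prob_eq t using q k J r by (simp add: ennreal_power ennreal_mult[symmetric] mult_ac)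
    finally show "above_prob a ^ N * facet_density a * indicator (cball 0 1) a
        \<le> ?h (arctan (norm a) / pi) * indicator (cball 0 1) a"
      by (rule mult_right_mono) simp
    have l: "0 \<le> 1 / sqrt (1 + (norm a)\<^sup>2)" by simp
    have "?h' (arctan (norm a) / pi) = above_prob a ^ N * ennreal (?k ^ (?d + 1) * norm a
        * (1 / sqrt (1 + (norm a)\<^sup>2)) ^ ((?d + 1)\<^sup>2) * J)"
      unfolding above_prob_eq t using q k J r by (simp add: ennreal_power ennreal_mult[symmetric] mult_ac)
    also have "\<dots> = above_prob a ^ N * (ennreal (?k ^ (?d + 1) * norm a
        * (1 / sqrt (1 + (norm a)\<^sup>2)) ^ ((?d + 1)\<^sup>2)) * facet_moment e)"
      using k J r l by (subst ennreal_mult) (auto simp: fm)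
    also have "\<dots> \<le> above_prob a ^ N * facet_density a"
      using facet_density_ge[OF r e(1)] by (intro mult_left_mono) (simp_all only: e(2)[symmetric] zero_le)
    finally show "?h' (arctan (norm a) / pi) * indicator (cball 0 1) a
        \<le> above_prob a ^ N * facet_density a * indicator (cball 0 1) a"
      by (rule mult_right_mono) simp
  qed
  have ne: "AE a in (lborel :: (real, 'm) vec measure). a \<noteq> 0" by (rule AE_lborel_singleton)
  have w: "ennreal (omega ?d * pi * tan (pi * s) ^ (?d - 1) * (1 + (tan (pi * s))\<^sup>2)) * indicator {0..1/4} s
      * ?h s
       = ennreal (w s) * indicator {0..1/4} s"
    "ennreal (omega ?d * pi * tan (pi * s) ^ (?d - 1) * (1 + (tan (pi * s))\<^sup>2)) * indicator {0..1/4} s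
        * ?h' s
       = ennreal (w s * ?l s ^ ((?d + 1)\<^sup>2)) * indicator {0..1/4} s" for s
  proof -
    have "0 < ?d" by simp
    then have pw: "tan (pi * s) ^ (?d - 1) * tan (pi * s) = tan (pi * s) ^ ?d" by (rule power_minus_mult)
    have eq: "omega ?d * pi * tan (pi * s) ^ (?d - 1) * (1 + (tan (pi * s))\<^sup>2) * (?k ^ (?d + 1) * J
        * (1 - s) ^ N * tan (pi * s)) = w s"
      unfolding w_def J_def pw[symmetric] by (simp only: mult_ac)
    have t: "0 \<le> tan (pi * s)" if "s \<in> {0..1/4}"
      using tan_quarter_bounds(1)[of "pi * s"] that by auto
    show "ennreal (omega ?d * pi * tan (pi * s) ^ (?d - 1) * (1 + (tan (pi * s))\<^sup>2)) * indicator {0..1/4} s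
        * ?h s
       = ennreal (w s) * indicator {0..1/4} s"
      unfolding eq[symmetric] using t k J omega_nonneg[of ?d]
      by (cases "s \<in> {0..1/4}") (auto simp: ennreal_mult)
    have eq': "omega ?d * pi * tan (pi * s) ^ (?d - 1) * (1 + (tan (pi * s))\<^sup>2) *
       (?k ^ (?d + 1) * J * (1 - s) ^ N * tan (pi * s) * ?l s ^ ((?d + 1)\<^sup>2)) = w s * ?l s ^ ((?d + 1)\<^sup>2)"
      unfolding eq[symmetric] by (simp only: mult_ac)
    show "ennreal (omega ?d * pi * tan (pi * s) ^ (?d - 1) * (1 + (tan (pi * s))\<^sup>2)) * indicator {0..1/4} s
        * ?h' s
       = ennreal (w s * ?l s ^ ((?d + 1)\<^sup>2)) * indicator {0..1/4} s"
    proof (cases "s \<in> {0..1/4}")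
      case True
      have "ennreal (omega ?d * pi * tan (pi * s) ^ (?d - 1) * (1 + (tan (pi * s))\<^sup>2)) * ?h' s
        = ennreal (omega ?d * pi * tan (pi * s) ^ (?d - 1) * (1 + (tan (pi * s))\<^sup>2) *
          (?k ^ (?d + 1) * J * (1 - s) ^ N * tan (pi * s) * ?l s ^ ((?d + 1)\<^sup>2)))"
        using t[OF True] k J omega_nonneg[of ?d] True
        by (intro ennreal_mult[symmetric] mult_nonneg_nonneg zero_le_power divide_nonneg_nonneg) auto
      then show ?thesis using True unfolding eq' by simp
    qed simp
  qed
  have "A \<le> (\<integral>\<^sup>+a. ?h (arctan (norm a) / pi) * indicator (cball 0 1) a \<partial>(lborel :: (real, 'm) vec measure))"
    unfolding A_def by (rule nn_integral_mono_AE) (rule eventually_mono[OF ne pointwise(1)])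
  also have "\<dots> = (\<integral>\<^sup>+s. ennreal (w s) * indicator {0..1/4} s \<partial>lborel)"
    by (subst nn_integral_polar_arctan[of ?h]) (measurable, simp only: d w(1))
  finally show "A \<le> (\<integral>\<^sup>+s. ennreal (w s) * indicator {0..1/4} s \<partial>lborel)" .
  have "(\<integral>\<^sup>+s. ennreal (w s * ?l s ^ ((?d + 1)\<^sup>2)) * indicator {0..1/4} s \<partial>lborel)
     = (\<integral>\<^sup>+a. ?h' (arctan (norm a) / pi) * indicator (cball 0 1) a \<partial>(lborel :: (real, 'm) vec measure))"
    by (subst nn_integral_polar_arctan[of ?h']) (measurable, simp only: d w(2))
  also have "\<dots> \<le> A"
    unfolding A_def by (rule nn_integral_mono_AE) (rule eventually_mono[OF ne pointwise(2)])
  finally show "(\<integral>\<^sup>+s. ennreal (w s * ?l s ^ ((?d + 1)\<^sup>2)) * indicator {0..1/4} s \<partial>lborel) \<le> A" .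
qed

lemma borel_measurable_facet_density [measurable]:
  "(facet_density :: real ^ 'm::finite \<Rightarrow> ennreal) \<in> borel_measurable borel"
  unfolding facet_density_def[abs_def]
  by (rule lborel.borel_measurable_nn_integral) measurable

lemma facet_mass_bounds:
  obtains C where "0 \<le> C"
    "\<And>N. facet_mass TYPE('m::{finite,wellorder}) N \<le> ennreal (mass_const TYPE('m) *
       (beta_nat CARD('m) N + C * beta_nat (CARD('m) + 2) N) + (3/4) ^ N)"
    "\<And>N. ennreal (mass_const TYPE('m) * beta_nat CARD('m) N) \<le> facet_mass TYPE('m) N +
       ennreal (mass_const TYPE('m) * (C * beta_nat (CARD('m) + 2) N + (3/4) ^ N))"
proof -
  let ?d = "CARD('m)" and ?K = "mass_const TYPE('m)"
  have K: "0 \<le> ?K" by (rule mass_const_nonneg)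
  obtain C where C: "0 \<le> C"
    "\<And>s. 0 \<le> s \<Longrightarrow> s \<le> 1 / 4 \<Longrightarrow> tan (pi * s) ^ ?d * (1 + (tan (pi * s))\<^sup>2) \<le> (pi * s) ^ ?d * (1 + C * s\<^sup>2)"
    "\<And>s. 0 \<le> s \<Longrightarrow> s \<le> 1 / 4 \<Longrightarrow> (pi * s) ^ ?d * (1 - C * s\<^sup>2) \<le>
       tan (pi * s) ^ ?d * (1 + (tan (pi * s))\<^sup>2) * (1 / sqrt (1 + (tan (pi * s))\<^sup>2)) ^ ((?d + 1)\<^sup>2)"
    using polar_profile_bounds[of ?d "(?d + 1)\<^sup>2"] by blast
  have bet: "(\<integral>\<^sup>+s. ennreal (c * (s ^ j * (1 - s) ^ N)) * indicator {0..1} s \<partial>lborel)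
      = ennreal (c * beta_nat j N)"
    if "0 \<le> c" for c :: real and j N
  proof -
    have "(\<integral>\<^sup>+s. ennreal (c * (s ^ j * (1 - s) ^ N)) * indicator {0..1} s \<partial>lborel)
        = (\<integral>\<^sup>+s. ennreal c * (ennreal (s ^ j * (1 - s) ^ N) * indicator {0..1} s) \<partial>lborel)"
      using that by (intro nn_integral_cong) (auto simp: ennreal_mult' mult.assoc)
    also have "\<dots> = ennreal c * ennreal (beta_nat j N)"
      by (subst nn_integral_cmult) (auto simp: nn_integral_beta_nat)
    finally show ?thesis using that beta_nat_nonneg[of j N] by (simp add: ennreal_mult)
  qed
  show ?thesis
  proof (rule that[OF C(1)])
    fix N :: nat
    define B where "B = half_ball_const TYPE((real, 'm) vec) ^ (?d + 1)
        * enn2real (facet_moment (axis undefined 1 :: (real, 'm) vec)) * omega ?d * pi"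
    have KB: "?K = B * pi ^ ?d" by (simp add: mass_const_def B_def)
    have B: "0 \<le> B"
      using half_ball_const_pos[where 'a = "(real, 'm) vec"]
      by (auto simp: B_def intro!: mult_nonneg_nonneg omega_nonneg)
    define A where "A = (\<integral>\<^sup>+a. above_prob a ^ N * facet_density a * indicator (cball 0 1) a
        \<partial>(lborel :: (real, 'm) vec measure))"
    define w where "w s = B * (1 - s) ^ N * (tan (pi * s) ^ ?d * (1 + (tan (pi * s))\<^sup>2))" for s
    note bounds = inner_facet_mass_bounds[of N, where 'm = 'm, folded A_def B_def, folded w_def]
    have "facet_mass TYPE('m) N \<le> (\<integral>\<^sup>+a. above_prob a ^ N * facet_density a * indicator (cball 0 1) a
        + ennreal ((3/4) ^ N) * facet_density a \<partial>(lborel :: (real, 'm) vec measure))"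
      unfolding facet_mass_def
    proof (rule nn_integral_mono)
      fix a :: "(real, 'm) vec"
      show "above_prob a ^ N * facet_density a
          \<le> above_prob a ^ N * facet_density a * indicator (cball 0 1) a
        + ennreal ((3/4) ^ N) * facet_density a"
      proof (cases "norm a \<le> 1")
        case False
        then have "arctan 1 \<le> arctan (norm a)" unfolding arctan_le_iff by simp
        then have "pi / 4 \<le> arctan (norm a)" by (simp add: arctan_one)
        then have q: "1 - arctan (norm a) / pi \<le> 3/4" by (simp add: field_simps)
        have "arctan (norm a) \<le> pi" using arctan_ubound[of "norm a"] pi_gt_zero by linarith
        then have q0: "0 \<le> 1 - arctan (norm a) / pi" by (simp add: field_simps)
        have "above_prob a ^ N \<le> ennreal ((3/4) ^ N)"
          unfolding above_prob_eq using q q0 by (subst ennreal_power) (auto intro!: ennreal_leI power_mono)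
        then show ?thesis using False by (simp add: mult_right_mono)
      qed (simp add: add_increasing2)
    qed
    also have "\<dots> = A + ennreal ((3/4) ^ N) * facet_mass TYPE('m) 0"
      unfolding A_def facet_mass_def by (subst nn_integral_add) (measurable, simp add: nn_integral_cmult)
    also have "\<dots> \<le> A + ennreal ((3/4) ^ N)"
      using facet_mass_0_le_1[where 'm = 'm] mult_left_mono[of "facet_mass TYPE('m) 0" 1
          "ennreal ((3/4) ^ N)"]
      by (intro add_left_mono) simp
    finally have up: "facet_mass TYPE('m) N \<le> A + ennreal ((3/4) ^ N)" .
    have "A \<le> (\<integral>\<^sup>+s. ennreal (w s) * indicator {0..1/4} s \<partial>lborel)" by (rule bounds(1))
    also have "\<dots> \<le> (\<integral>\<^sup>+s. ennreal (?K * (s ^ ?d * (1 - s) ^ N)) * indicator {0..1} s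
        + ennreal (?K * C * (s ^ (?d + 2) * (1 - s) ^ N)) * indicator {0..1} s \<partial>lborel)"
    proof (rule nn_integral_mono)
      fix s :: real
      show "ennreal (w s) * indicator {0..1/4} s
          \<le> ennreal (?K * (s ^ ?d * (1 - s) ^ N)) * indicator {0..1} s
        + ennreal (?K * C * (s ^ (?d + 2) * (1 - s) ^ N)) * indicator {0..1} s"
      proof (cases "s \<in> {0..1/4}")
        case True
        have "w s \<le> B * (1 - s) ^ N * ((pi * s) ^ ?d * (1 + C * s\<^sup>2))"
          unfolding w_def using True B C(2)[of s] by (intro mult_left_mono) auto
        also have "\<dots> = ?K * (s ^ ?d * (1 - s) ^ N) + ?K * C * (s ^ (?d + 2) * (1 - s) ^ N)"
          unfolding KB by (simp add: algebra_simps power_add power_mult_distrib power2_eq_square)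
        finally have "ennreal (w s) \<le> ennreal (?K * (s ^ ?d * (1 - s) ^ N) + ?K * C
            * (s ^ (?d + 2) * (1 - s) ^ N))"
          by (rule ennreal_leI)
        then show ?thesis using True K C(1) by (simp add: ennreal_plus[symmetric] del: ennreal_plus)
      qed simp
    qed
    also have "\<dots> = ennreal (?K * beta_nat ?d N) + ennreal (?K * C * beta_nat (?d + 2) N)"
      using K C(1) bet[of ?K ?d N] bet[of "?K * C" "?d + 2" N] by (subst nn_integral_add) auto
    also have "\<dots> = ennreal (?K * (beta_nat ?d N + C * beta_nat (?d + 2) N))"
      using K C(1) beta_nat_nonneg[of ?d N] beta_nat_nonneg[of "?d + 2" N]
      by (subst ennreal_plus[symmetric]) (auto simp: algebra_simps)
    finally have "A \<le> ennreal (?K * (beta_nat ?d N + C * beta_nat (?d + 2) N))" .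
    then have "A + ennreal ((3/4) ^ N) \<le> ennreal (?K * (beta_nat ?d N + C * beta_nat (?d + 2) N))
        + ennreal ((3/4) ^ N)"
      by (rule add_right_mono)
    also have "\<dots> = ennreal (?K * (beta_nat ?d N + C * beta_nat (?d + 2) N) + (3/4) ^ N)"
      using K C(1) beta_nat_nonneg[of ?d N] beta_nat_nonneg[of "?d + 2" N]
      by (intro ennreal_plus[symmetric]) auto
    finally show "facet_mass TYPE('m) N \<le> ennreal (?K * (beta_nat ?d N + C * beta_nat (?d + 2) N)
        + (3/4) ^ N)"
      using up by (rule order.trans[rotated])
    let ?l = "\<lambda>s. (1 / sqrt (1 + (tan (pi * s))\<^sup>2)) ^ ((?d + 1)\<^sup>2)"
    have [measurable]: "tan \<in> borel_measurable (borel :: real measure)"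
      unfolding tan_def[abs_def] by measurable
    have "ennreal (?K * beta_nat ?d N) = (\<integral>\<^sup>+s. ennreal (?K * (s ^ ?d * (1 - s) ^ N)) * indicator {0..1} s
        \<partial>lborel)"
      by (rule bet[OF K, symmetric])
    also have "\<dots> \<le> (\<integral>\<^sup>+s. ennreal (w s * ?l s) * indicator {0..1/4} s +
       (ennreal (?K * C * (s ^ (?d + 2) * (1 - s) ^ N)) * indicator {0..1} s + ennreal (?K * (3/4) ^ N) *
           indicator {0..1} s) \<partial>lborel)"
    proof (rule nn_integral_mono)
      fix s :: real
      show "ennreal (?K * (s ^ ?d * (1 - s) ^ N)) * indicator {0..1} s
          \<le> ennreal (w s * ?l s) * indicator {0..1/4} s +
       (ennreal (?K * C * (s ^ (?d + 2) * (1 - s) ^ N)) * indicator {0..1} s + ennreal (?K * (3/4) ^ N) *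
           indicator {0..1} s)"
      proof (cases "s \<in> {0..1}")
        case s: True
        show ?thesis
        proof (cases "s \<le> 1/4")
          case True
          have "B * (1 - s) ^ N * ((pi * s) ^ ?d * (1 - C * s\<^sup>2))
              \<le> B * (1 - s) ^ N * (tan (pi * s) ^ ?d * (1 + (tan (pi * s))\<^sup>2) * ?l s)"
            using True s B C(3)[of s] by (intro mult_left_mono) auto
          also have "\<dots> = w s * ?l s" by (simp add: w_def mult.assoc)
          also have "B * (1 - s) ^ N * ((pi * s) ^ ?d * (1 - C * s\<^sup>2))
              = ?K * (s ^ ?d * (1 - s) ^ N) - ?K * C * (s ^ (?d + 2) * (1 - s) ^ N)"
            unfolding KB by (simp add: algebra_simps power_add power_mult_distrib power2_eq_square)
          finally have le: "?K * (s ^ ?d * (1 - s) ^ N)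
              \<le> w s * ?l s + ?K * C * (s ^ (?d + 2) * (1 - s) ^ N)" by simp
          have t: "0 \<le> tan (pi * s)" using tan_quarter_bounds(1)[of "pi * s"] True s by auto
          have w0: "0 \<le> w s * ?l s" unfolding w_def using t B s
              by (intro mult_nonneg_nonneg zero_le_power divide_nonneg_nonneg) auto
          have "ennreal (?K * (s ^ ?d * (1 - s) ^ N))
              \<le> ennreal (w s * ?l s) + ennreal (?K * C * (s ^ (?d + 2) * (1 - s) ^ N))"
            using ennreal_leI[OF le] w0 K C(1) s by (subst (asm) ennreal_plus) auto
          also have "\<dots> \<le> ennreal (w s * ?l s) + (ennreal (?K * C * (s ^ (?d + 2) * (1 - s) ^ N))
              + ennreal (?K * (3/4) ^ N))"
            by (intro add_left_mono) (simp add: add_increasing2)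
          finally show ?thesis using True s by simp
        next
          case False
          have "s ^ ?d * (1 - s) ^ N \<le> 1 * (3/4) ^ N"
            using s False by (intro mult_mono power_mono power_le_one) auto
          then have "ennreal (?K * (s ^ ?d * (1 - s) ^ N)) \<le> ennreal (?K * (3/4) ^ N)"
            using K by (intro ennreal_leI mult_left_mono) auto
          then show ?thesis using s False by (simp add: add_increasing)
        qed
      qed simp
    qed
    also have "\<dots> = (\<integral>\<^sup>+s. ennreal (w s * ?l s) * indicator {0..1/4} s \<partial>lborel) +
       ((\<integral>\<^sup>+s. ennreal (?K * C * (s ^ (?d + 2) * (1 - s) ^ N)) * indicator {0..1} s \<partial>lborel) + (\<integral>\<^sup>+s.
           ennreal (?K * (3/4) ^ N) * indicator {0..1::real} s \<partial>lborel))"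
      unfolding w_def by (subst nn_integral_add, measurable, subst nn_integral_add, measurable)
    also have "\<dots> \<le> A + (ennreal (?K * C * beta_nat (?d + 2) N) + ennreal (?K * (3/4) ^ N))"
    proof -
      have e1: "(\<integral>\<^sup>+s. ennreal (?K * C * (s ^ (?d + 2) * (1 - s) ^ N)) * indicator {0..1} s \<partial>lborel)
          = ennreal (?K * C * beta_nat (?d + 2) N)"
        by (rule bet) (use K C(1) in auto)
      have e2: "(\<integral>\<^sup>+s. ennreal (?K * (3/4) ^ N) * indicator {0..1::real} s \<partial>lborel)
          = ennreal (?K * (3/4) ^ N)"
        by (simp add: nn_integral_cmult_indicator)
      show ?thesis unfolding e1 e2 using bounds(2) by (rule add_right_mono)
    qed
    also have "\<dots> = A + ennreal (?K * (C * beta_nat (?d + 2) N + (3/4) ^ N))"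
      using K C(1) beta_nat_nonneg[of "?d + 2" N]
          by (subst ennreal_plus[symmetric]) (auto simp: algebra_simps)
    also have "A \<le> facet_mass TYPE('m) N"
      unfolding A_def facet_mass_def by (intro nn_integral_mono) (auto simp: indicator_def)
    finally show "ennreal (?K * beta_nat ?d N)
        \<le> facet_mass TYPE('m) N + ennreal (?K * (C * beta_nat (?d + 2) N + (3/4) ^ N))"
      by (simp add: add_right_mono)
  qed
qed

section \<open>The constant of the theorem in coordinates\<close>

text \<open>With the second density the factors \<open>norm (Y $ i)\<close> combine with the
  determinant of the normalised rows to \<open>det Y\<close>.\<close>
lemma distr_sgn_radial_weight:
  fixes k :: nat
  assumes k: "k = DIM('a::euclidean_space)"
  shows "distr (density lborel (\<lambda>x::'a. of_nat k * indicator (cball 0 1) x)) borel sgn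
    = distr (density lborel (\<lambda>x. ennreal (real (k + 1) * norm x) * indicator (cball 0 1) x)) borel sgn"
proof (rule measure_eqI)
  fix A assume "A \<in> sets (distr (density lborel (\<lambda>x::'a. of_nat k * indicator (cball 0 1) x)) borel sgn)"
  then have A: "A \<in> sets borel" by simp
  define S where "S = (sgn :: 'a \<Rightarrow> 'a) -` A"
  have S [measurable]: "S \<in> sets borel"
    using measurable_sets[OF measurable_sgn_borel A] by (simp add: S_def)
  have scale: "c *\<^sub>R x \<in> S \<longleftrightarrow> x \<in> S" if "0 < c" for c x
    using that by (simp add: S_def sgn_scaleR)
  let ?cap = "emeasure lborel (cball 0 1 \<inter> S)"
  have fin: "?cap < \<infinity>"
    by (rule le_less_trans[OF emeasure_mono[of _ "cball 0 1"]]) (auto simp: emeasure_cball)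
  have ball: "emeasure lborel (cball 0 u \<inter> S) = ennreal (u ^ k) * ?cap" if u: "0 < u" for u
  proof -
    have "emeasure lborel (cball 0 u \<inter> S) = (\<integral>\<^sup>+x. indicator (cball 0 u \<inter> S) x \<partial>lborel)" by simp
    also have "\<dots> = ennreal (u ^ k) * (\<integral>\<^sup>+x. indicator (cball 0 u \<inter> S) (u *\<^sub>R x) \<partial>lborel)"
      unfolding k by (rule nn_integral_lborel_scaleR[OF u]) simp
    also have "(\<integral>\<^sup>+x. indicator (cball 0 u \<inter> S) (u *\<^sub>R x) \<partial>lborel)
        = (\<integral>\<^sup>+x. indicator (cball 0 1 \<inter> S) x \<partial>lborel)"
      using u by (intro nn_integral_cong) (auto simp: indicator_def scale)
    finally show ?thesis by simp
  qed
  have "(\<integral>\<^sup>+x. ennreal (norm x) * indicator (cball 0 1 \<inter> S) x \<partial>lborel)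
      = (\<integral>\<^sup>+x. \<integral>\<^sup>+u. indicator {0..<norm x} u * indicator (cball 0 1 \<inter> S) x \<partial>lborel \<partial>lborel)"
    by (intro nn_integral_cong) (auto simp: emeasure_lborel_Ico_0 nn_integral_multc)
  also have "\<dots> = (\<integral>\<^sup>+u. \<integral>\<^sup>+x. indicator {0..<norm x} u * indicator (cball 0 1 \<inter> S) x \<partial>lborel \<partial>lborel)"
  proof (rule lborel_pair.Fubini')
    have "Measurable.pred (borel \<Otimes>\<^sub>M borel) (\<lambda>z :: real \<times> 'a. fst z \<in> {0..<norm (snd z)})"
      unfolding atLeastLessThan_iff by measurable
    then show "(\<lambda>(u, x). indicator {0..<norm x} u * indicator (cball 0 1 \<inter> S) x :: ennreal)
        \<in> borel_measurable (lborel \<Otimes>\<^sub>M lborel)"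
      unfolding case_prod_unfold by measurable
  qed
  also have "\<dots> = (\<integral>\<^sup>+u. ?cap * (ennreal (1 - u ^ k) * indicator {0..1} u) \<partial>lborel)"
  proof (rule nn_integral_cong_AE)
    have "AE u in lborel. u \<noteq> (0::real)" by (rule AE_lborel_singleton)
    then show "AE u in lborel. (\<integral>\<^sup>+x. indicator {0..<norm x} u * indicator (cball 0 1 \<inter> S) x \<partial>lborel)
       = ?cap * (ennreal (1 - u ^ k) * indicator {0..1} u)"
    proof eventually_elim
      fix u :: real assume "u \<noteq> 0"
      consider "u < 0" | "0 < u" "u \<le> 1" | "1 < u" using \<open>u \<noteq> 0\<close> by linarith
      then show "(\<integral>\<^sup>+x. indicator {0..<norm x} u * indicator (cball 0 1 \<inter> S) x \<partial>lborel)
       = ?cap * (ennreal (1 - u ^ k) * indicator {0..1} u)"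
      proof cases
        case 2
        have "(\<integral>\<^sup>+x. indicator {0..<norm x} u * indicator (cball 0 1 \<inter> S) x \<partial>lborel)
           = (\<integral>\<^sup>+x. indicator ((cball 0 1 \<inter> S) - (cball 0 u \<inter> S)) x \<partial>lborel)"
          using 2 by (intro nn_integral_cong) (auto simp: indicator_def)
        also have "\<dots> = emeasure lborel ((cball 0 1 \<inter> S) - (cball 0 u \<inter> S))" by simp
        also have "\<dots> = ?cap - emeasure lborel (cball 0 u \<inter> S)"
        proof (rule emeasure_Diff)
          show "emeasure lborel (cball 0 u \<inter> S) \<noteq> \<infinity>"
            unfolding ball[OF 2(1)] using fin by (simp add: ennreal_mult_eq_top_iff)
          show "cball 0 u \<inter> S \<subseteq> cball 0 1 \<inter> S" using 2 by auto
        qed auto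
        also have "\<dots> = ?cap * ennreal (1 - u ^ k)"
        proof -
          obtain l where l: "?cap = ennreal l" "0 \<le> l" using fin by (cases ?cap rule: ennreal_cases) auto
          have "0 \<le> u ^ k * l" "u ^ k \<le> 1" using 2 l by (auto simp: power_le_one)
          then show ?thesis unfolding ball[OF 2(1)] l(1) using l(2) 2
            by (simp add: ennreal_mult[symmetric] ennreal_minus algebra_simps)
        qed
        finally show ?thesis using 2 by simp
      next
        case 3
        then have "(\<integral>\<^sup>+x. indicator {0..<norm x} u * indicator (cball 0 1 \<inter> S) x \<partial>lborel)
            = (\<integral>\<^sup>+x. 0 \<partial>(lborel :: 'a measure))"
          by (intro nn_integral_cong) (auto simp: indicator_def)
        then show ?thesis using 3 by simp
      qed auto
    qed
  qed
  also have "\<dots> = ?cap * (\<integral>\<^sup>+u. ennreal (1 - u ^ k) * indicator {0..1} u \<partial>lborel)"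
    by (rule nn_integral_cmult) measurable
  also have "(\<integral>\<^sup>+u. ennreal (1 - u ^ k) * indicator {0..1} u \<partial>lborel) = ennreal (real k / real (k + 1))"
  proof -
    have "(\<integral>\<^sup>+u. ennreal (1 - u ^ k) * indicator {0..1} u \<partial>lborel)
       = ennreal ((1 - 1 ^ (k + 1) / real (k + 1)) - (0 - 0 ^ (k + 1) / real (k + 1)))"
    proof (rule nn_integral_FTC_Icc)
      fix x :: real assume "x \<in> {0..1}"
      then show "0 \<le> 1 - x ^ k" by (simp add: power_le_one)
      have "((\<lambda>x. x ^ (k + 1)) has_real_derivative real (k + 1) * x ^ k) (at x)"
        using DERIV_pow[of "k + 1" x] by simp
      from DERIV_diff[OF DERIV_ident DERIV_cdivide[OF this, of "real (k + 1)"]]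
      show "((\<lambda>x. x - x ^ (k + 1) / real (k + 1)) has_real_derivative 1 - x ^ k) (at x)"
        by simp
    qed auto
    also have "(1 - 1 ^ (k + 1) / real (k + 1)) - (0 - 0 ^ (k + 1) / real (k + 1)) = real k / real (k + 1)"
      by (simp add: field_simps)
    finally show ?thesis .
  qed
  finally have main: "(\<integral>\<^sup>+x. ennreal (norm x) * indicator (cball 0 1 \<inter> S) x \<partial>lborel)
      = ?cap * ennreal (real k / real (k + 1))" .
  have "emeasure (distr (density lborel (\<lambda>x::'a. of_nat k * indicator (cball 0 1) x)) borel sgn) A
     = (\<integral>\<^sup>+x. of_nat k * indicator (cball 0 1 \<inter> S) x \<partial>lborel)"
    using A S by (subst emeasure_distr) (auto simp: emeasure_density S_def[symmetric] indicator_inter_arith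
        mult.assoc)
  also have "\<dots> = of_nat k * ?cap" by (subst nn_integral_cmult) auto
  also have "\<dots> = ennreal (real (k + 1)) * (?cap * ennreal (real k / real (k + 1)))"
  proof -
    have "ennreal (real (k + 1)) * ennreal (real k / real (k + 1)) = ennreal (real k)"
      by (subst ennreal_mult[symmetric]) auto
    then show ?thesis by (metis ennreal_of_nat_eq_real_of_nat mult.assoc mult.commute)
  qed
  also have "\<dots> = (\<integral>\<^sup>+x. ennreal (real (k + 1)) * (ennreal (norm x) * indicator (cball 0 1 \<inter> S) x) \<partial>lborel)"
    unfolding main[symmetric] by (rule nn_integral_cmult[symmetric]) measurable
  also have "\<dots> = emeasure (distr (density lborel (\<lambda>x. ennreal (real (k + 1) * norm x)
      * indicator (cball 0 1) x)) borel sgn) A"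
    using A S by (subst emeasure_distr)
      (auto simp: emeasure_density S_def[symmetric] indicator_inter_arith ennreal_mult mult.assoc)
  finally show "emeasure (distr (density lborel (\<lambda>x::'a. of_nat k * indicator (cball 0 1) x)) borel sgn) A
    = emeasure (distr (density lborel (\<lambda>x. ennreal (real (k + 1) * norm x) * indicator (cball 0 1) x)) borel
        sgn) A" .
qed simp

lemma sgn_isometry:
  fixes f :: "'a::euclidean_space \<Rightarrow> 'b::euclidean_space"
  assumes "linear f" "\<And>x. norm (f x) = norm x"
  shows "sgn (f x) = f (sgn x)"
  using assms by (simp add: sgn_div_norm linear_cmul)

lemma inner_isometry:
  fixes f :: "'a::euclidean_space \<Rightarrow> 'b::euclidean_space"
  assumes "linear f" "\<And>x. norm (f x) = norm x"
  shows "f x \<bullet> f y = x \<bullet> y"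
  by (simp add: dot_norm assms(2) linear_add[OF assms(1), symmetric])

lemma subspace_lborel_isometry:
  fixes \<iota> :: "real ^ 'm::finite \<Rightarrow> 'a::euclidean_space"
  assumes L: "subspace L" and \<iota>: "linear \<iota>" "\<And>x. norm (\<iota> x) = norm x" "range \<iota> = L"
  shows "subspace_lborel L = distr lborel borel \<iota>"
proof -
  let ?B = "orthonormal_basis L"
  note B = orthonormal_basis[OF L]
  have "0 \<notin> ?B" using B(2)[of 0] by auto
  then have ind: "independent ?B" using B(1) pairwise_orthogonal_independent by blast
  have finB: "finite ?B" using ind independent_bound by blast
  have inj: "inj \<iota>" using \<iota> by (metis linear_injective_0 norm_eq_zero)
  have "card ?B = dim L" using ind B(3) by (metis dim_eq_card_independent dim_span)
  also have "dim L = CARD('m)"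
    using dim_image_eq[OF \<iota>(1), of UNIV] inj \<iota>(3) by (simp add: dim_UNIV span_UNIV)
  finally have card: "card ?B = CARD('m)" .
  obtain \<beta> where \<beta>: "bij_betw \<beta> (UNIV :: 'm set) ?B"
    using finite_same_card_bij[of "UNIV :: 'm set" ?B] finB card by auto
  have inv: "inv_into UNIV \<beta> (\<beta> i) = i" for i using \<beta> by (auto simp: bij_betw_def)
  have \<beta>B: "\<beta> i \<in> ?B" for i using \<beta> by (auto simp: bij_betw_def)
  let ?T = "\<lambda>y :: real ^ 'm. \<Sum>i\<in>UNIV. (y $ i) *\<^sub>R \<beta> i"
  have T: "linear ?T" by (auto simp: linear_iff scaleR_add_left sum.distrib scaleR_sum_right)
  have [measurable]: "?T \<in> borel_measurable borel" by (rule borel_measurable_linear[OF T])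
  have normT: "norm (?T y) = norm y" for y
  proof -
    have orth: "\<beta> i \<bullet> \<beta> j = (if i = j then 1 else 0)" for i j
    proof (cases "i = j")
      case True
      then show ?thesis using B(2)[OF \<beta>B[of i]] by (simp add: dot_square_norm)
    next
      case False
      then have "\<beta> i \<noteq> \<beta> j" using inv by metis
      then show ?thesis using B(1) \<beta>B False by (auto simp: pairwise_def orthogonal_def)
    qed
    have "?T y \<bullet> ?T y = (\<Sum>i\<in>UNIV. \<Sum>j\<in>UNIV. (y $ i * y $ j) * (\<beta> j \<bullet> \<beta> i))"
      by (simp only: inner_sum_left inner_sum_right inner_scaleR_left inner_scaleR_right sum_distrib_left
          mult.assoc)
    also have "\<dots> = y \<bullet> y" by (simp add: orth inner_vec_def if_distrib cong: if_cong)
    finally show ?thesis by (simp add: norm_eq_sqrt_inner)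
  qed
  have rangeT: "?T y \<in> L" for y
    using B(3) \<beta>B by (metis (no_types, lifting) span_base span_scale span_sum)
  have sf: "sigma_finite_measure (density lborel (\<lambda>_::real. 1))"
      by (simp add: density_1 sigma_finite_lborel)
  have "subspace_lborel L = distr lborel borel ?T"
  proof (rule measure_eqI)
    fix A assume "A \<in> sets (subspace_lborel L)"
    then have A [measurable]: "A \<in> sets borel" by (simp add: subspace_lborel_def)
    have m [measurable]: "(\<lambda>f. \<Sum>b\<in>?B. f b *\<^sub>R b) \<in> Pi\<^sub>M ?B (\<lambda>_. borel) \<rightarrow>\<^sub>M borel" by measurable
    then have m': "(\<lambda>f. \<Sum>b\<in>?B. f b *\<^sub>R b) \<in> Pi\<^sub>M ?B (\<lambda>_. lborel) \<rightarrow>\<^sub>M borel"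
      by (simp cong: measurable_cong_sets sets_PiM_cong)
    have "emeasure (subspace_lborel L) A = (\<integral>\<^sup>+x. indicator A x \<partial>subspace_lborel L)"
      by (rule nn_integral_indicator[symmetric]) (simp add: subspace_lborel_def)
    also have "\<dots> = (\<integral>\<^sup>+f. indicator A (\<Sum>b\<in>?B. f b *\<^sub>R b) \<partial>Pi\<^sub>M ?B (\<lambda>_. lborel))"
      unfolding subspace_lborel_def by (rule nn_integral_distr[OF m']) simp
    also have "\<dots> = (\<integral>\<^sup>+f. indicator A (\<Sum>b\<in>?B. f b *\<^sub>R b) \<partial>Pi\<^sub>M ?B (\<lambda>_. density lborel (\<lambda>_. 1)))"
      by (simp add: density_1)
    also have "\<dots> = (\<integral>\<^sup>+Y. (\<Prod>i\<in>(UNIV :: 'm set). 1) * indicator A (\<Sum>b\<in>?B. (\<lambda>i\<in>?B. Y $ inv_into UNIV \<beta> i) b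
        *\<^sub>R b) \<partial>(lborel :: (real ^ 'm) measure))"
      by (rule nn_integral_PiM_density_vec[OF \<beta> _ sf,
          where F = "\<lambda>f. indicator A (\<Sum>b\<in>?B. f b *\<^sub>R b)"]) measurable
    also have "\<dots> = (\<integral>\<^sup>+Y. indicator A (?T Y) \<partial>lborel)"
    proof (rule nn_integral_cong)
      fix Y :: "real ^ 'm"
      have "(\<Sum>b\<in>?B. (\<lambda>i\<in>?B. Y $ inv_into UNIV \<beta> i) b *\<^sub>R b) = (\<Sum>b\<in>?B. Y $ inv_into UNIV \<beta> b *\<^sub>R b)" by simp
      also have "\<dots> = ?T Y"
        by (subst sum.reindex_bij_betw[OF \<beta>, symmetric]) (simp add: inv)
      finally show "(\<Prod>i\<in>(UNIV :: 'm set). 1) * indicator A (\<Sum>b\<in>?B. (\<lambda>i\<in>?B. Y $ inv_into UNIV \<beta> i) b *\<^sub>R b)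
          = (indicator A (?T Y) :: ennreal)"
        by simp
    qed
    also have "\<dots> = emeasure (distr lborel borel ?T) A"
      by (subst nn_integral_distr[symmetric, of ?T lborel borel]) auto
    finally show "emeasure (subspace_lborel L) A = emeasure (distr lborel borel ?T) A" .
  qed (simp add: subspace_lborel_def)
  also have "distr lborel borel ?T = distr lborel borel \<iota>"
  proof -
    obtain g where g: "linear g" "\<And>x. g (\<iota> x) = x"
      using linear_injective_left_inverse[OF \<iota>(1) inj] by (auto simp: fun_eq_iff)
    have \<iota>g: "\<iota> (g x) = x" if "x \<in> L" for x using that g(2) \<iota>(3) by (metis imageE)
    have gT: "linear (\<lambda>y. g (?T y))" using linear_compose[OF T g(1)] by (simp add: o_def)
    have ngT: "norm (g (?T y)) = norm y" for y
      using \<iota>(2)[of "g (?T y)"] \<iota>g[OF rangeT] normT by metis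
    have [measurable]: "\<iota> \<in> borel_measurable borel" "(\<lambda>y. g (?T y)) \<in> borel_measurable borel"
      using borel_measurable_linear[OF \<iota>(1)] borel_measurable_linear[OF gT] by auto
    have "distr lborel borel \<iota> = distr (distr lborel borel (\<lambda>y. g (?T y))) borel \<iota>"
      using lborel_isometry[OF gT ngT] by simp
    also have "\<dots> = distr lborel borel ?T"
      by (subst distr_distr) (auto simp: o_def \<iota>g[OF rangeT])
    finally show ?thesis by simp
  qed
  finally show ?thesis .
qed

lemma subsphere_measure_isometry:
  fixes \<iota> :: "real ^ 'm::finite \<Rightarrow> 'a::euclidean_space"
  assumes L: "subspace L" and \<iota>: "linear \<iota>" "\<And>x. norm (\<iota> x) = norm x" "range \<iota> = L"
  shows "subsphere_measure L = distr (density lborel (\<lambda>x. ennreal (real (CARD('m) + 1) * norm x)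
      * indicator (cball 0 1) x))
     borel (\<lambda>x. \<iota> (sgn x))"
proof -
  have [measurable]: "\<iota> \<in> borel_measurable borel" by (rule borel_measurable_linear[OF \<iota>(1)])
  have inj: "inj \<iota>" using \<iota> by (metis linear_injective_0 norm_eq_zero)
  have dim: "dim L = DIM(real ^ 'm)"
    using dim_image_eq[OF \<iota>(1), of UNIV] inj \<iota>(3) by (simp add: dim_UNIV span_UNIV)
  have "subsphere_measure L = distr (density (distr lborel borel \<iota>) (\<lambda>x. of_nat (dim L)
      * indicator (cball 0 1) x)) borel sgn"
    by (simp add: subsphere_measure_def spherical_part_def subspace_lborel_isometry[OF L \<iota>])
  also have "\<dots> = distr (distr (density lborel (\<lambda>x. of_nat (dim L) * indicator (cball 0 1) (\<iota> x))) borel \<iota>)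
      borel sgn"
    by (subst density_distr) auto
  also have "\<dots> = distr (density lborel (\<lambda>x. of_nat (dim L) * indicator (cball 0 1) x)) borel (\<lambda>x.
      \<iota> (sgn x))"
    by (subst distr_distr) (auto simp: o_def sgn_isometry[OF \<iota>(1,2)] indicator_def \<iota>(2))
  also have "\<dots> = distr (distr (density lborel (\<lambda>x. of_nat (dim L) * indicator (cball 0 1) x)) borel sgn)
      borel \<iota>"
    by (subst distr_distr) (auto simp: o_def)
  also have "\<dots> = distr (distr (density lborel (\<lambda>x. ennreal (real (dim L + 1) * norm x)
      * indicator (cball 0 1) x)) borel sgn) borel \<iota>"
    by (subst distr_sgn_radial_weight[OF dim]) simp
  also have "\<dots> = distr (density lborel (\<lambda>x. ennreal (real (CARD('m) + 1) * norm x)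
      * indicator (cball 0 1) x)) borel (\<lambda>x. \<iota> (sgn x))"
    by (subst distr_distr) (auto simp: o_def dim)
  finally show ?thesis .
qed

lemma nabla_isometry:
  fixes \<iota> :: "real ^ 'm::{finite,wellorder} \<Rightarrow> 'a::euclidean_space"
  assumes L: "subspace L" and \<iota>: "linear \<iota>" "\<And>x. norm (\<iota> x) = norm x" "range \<iota> = L"
    and \<beta>: "bij_betw \<beta> (UNIV :: 'm set) {1..d}" and u: "\<And>i. u (\<beta> i) = \<iota> (Y $ i)"
  shows "nabla L d u = \<bar>det (Y :: real ^ 'm::_ ^ 'm::_)\<bar>"
proof -
  have [measurable]: "\<iota> \<in> borel_measurable borel" by (rule borel_measurable_linear[OF \<iota>(1)])
  have inj: "inj \<iota>" using \<iota> by (metis linear_injective_0 norm_eq_zero)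
  define P where "P = (*v) (transpose Y) ` cbox 0 (\<chi> i. 1)"
  have lin: "linear ((*v) (transpose Y))" by (rule matrix_vector_mul_linear)
  have Tsum: "transpose Y *v t = (\<Sum>i\<in>UNIV. t $ i *\<^sub>R Y $ i)" for t
    by (simp add: vec_eq_iff matrix_vector_mult_def transpose_def mult.commute)
  have "parallelepiped d u = \<iota> ` P"
  proof (intro equalityI subsetI)
    fix p assume "p \<in> parallelepiped d u"
    then obtain t where t: "p = (\<Sum>i=1..d. t i *\<^sub>R u i)" "\<forall>i\<in>{1..d}. 0 \<le> t i \<and> t i \<le> 1"
      by (auto simp: parallelepiped_def)
    have "p = (\<Sum>i\<in>UNIV. t (\<beta> i) *\<^sub>R u (\<beta> i))" unfolding t(1) by (rule sum.reindex_bij_betw[OF \<beta>, symmetric])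
    also have "\<dots> = \<iota> (transpose Y *v (\<chi> i. t (\<beta> i)))"
      unfolding Tsum by (simp add: u linear_sum[OF \<iota>(1)] linear_cmul[OF \<iota>(1)])
    finally show "p \<in> \<iota> ` P"
      using t(2) bij_betwE[OF \<beta>] by (auto simp: P_def mem_box_cart intro!: imageI)
  next
    fix p assume "p \<in> \<iota> ` P"
    then obtain t where t: "p = \<iota> (transpose Y *v t)" "t \<in> cbox 0 (\<chi> i. 1)" by (auto simp: P_def)
    have inv: "inv_into UNIV \<beta> (\<beta> i) = i" for i using \<beta> by (auto simp: bij_betw_def)
    have "p = (\<Sum>i\<in>UNIV. t $ (inv_into UNIV \<beta> (\<beta> i)) *\<^sub>R u (\<beta> i))"
      unfolding t(1) Tsum by (simp add: u linear_sum[OF \<iota>(1)] linear_cmul[OF \<iota>(1)] inv)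
    also have "\<dots> = (\<Sum>i=1..d. t $ (inv_into UNIV \<beta> i) *\<^sub>R u i)" by (rule sum.reindex_bij_betw[OF \<beta>])
    finally show "p \<in> parallelepiped d u"
      using t(2) by (auto simp: parallelepiped_def mem_box_cart intro!: exI[of _
          "\<lambda>i. t $ inv_into UNIV \<beta> i"])
  qed
  moreover have "compact P"
    unfolding P_def by (intro compact_continuous_image compact_cbox linear_continuous_on
        linear_conv_bounded_linear[THEN iffD1] lin)
  then have "compact (\<iota> ` P)" "P \<in> sets borel"
    using \<iota>(1) by (auto intro!: compact_continuous_image linear_continuous_on borel_compact simp:
        linear_conv_bounded_linear)
  moreover have "\<iota> -` (\<iota> ` P) = P" using inj by (simp add: inj_vimage_image_eq)
  ultimately have "nabla L d u = measure lborel P"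
    unfolding nabla_def subspace_lborel_isometry[OF L \<iota>]
        by (subst measure_distr) (auto intro: borel_compact)
  also have "\<dots> = measure lebesgue P" using \<open>P \<in> sets borel\<close> by simp
  also have "\<dots> = \<bar>det (matrix ((*v) (transpose Y)))\<bar> * measure lebesgue (cbox 0 (\<chi> i. (1::real)) :: (real,
      'm) vec set)"
    unfolding P_def by (rule measure_linear_image[OF lin]) auto
  also have "measure lebesgue (cbox 0 (\<chi> i. (1::real)) :: (real, 'm) vec set) = 1"
    by (simp add: content_cbox_cart interval_ne_empty_cart)
  finally show ?thesis unfolding matrix_of_matrix_vector_mul det_transpose by simp
qed

lemma cone_moment_le_ball:
  fixes e :: "'a::euclidean_space"
  assumes e: "norm e = 1"
  shows "cone_moment e C \<le> emeasure lborel (cball (0 :: 'a) 1)"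
proof -
  have "cone_moment e C \<le> (\<integral>\<^sup>+y. indicator (cball (0 :: 'a) 1) y \<partial>lborel)"
    unfolding cone_moment_def
  proof (rule nn_integral_mono)
    fix y :: 'a
    have "e \<bullet> y \<le> norm y" using norm_cauchy_schwarz[of e y] e by simp
    then have "ennreal (e \<bullet> y) \<le> 1" if "norm y \<le> 1" using that by (simp add: ennreal_le_1)
    then show "ennreal (e \<bullet> y) * indicator (cball 0 1 \<inter> C) y \<le> indicator (cball 0 1) y"
      by (auto simp: indicator_def)
  qed
  then show ?thesis by simp
qed

lemma sgn_in_pos_iff: "sgn x \<in> pos A \<longleftrightarrow> x \<in> pos A"
proof (cases "x = 0")
  case False
  then show ?thesis unfolding sgn_div_norm by (intro scaleR_in_pos_iff) simp
qed simp

lemma pos_sgn: "pos (sgn ` A) = pos A"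
proof (intro equalityI pos_minimal convex_cone_pos)
  show "sgn ` A \<subseteq> pos A" using pos_superset[of A] by (auto simp: sgn_in_pos_iff)
  have "x \<in> pos (sgn ` A)" if "x \<in> A" for x
    using that pos_superset[of "sgn ` A"] sgn_in_pos_iff[of x "sgn ` A"] by auto
  then show "A \<subseteq> pos (sgn ` A)" by blast
qed

lemma set_integral_conv_s_isometry:
  fixes \<iota> :: "real ^ 'm::finite \<Rightarrow> 'a::euclidean_space"
  assumes L: "subspace L" and \<iota>: "linear \<iota>" "\<And>x. norm (\<iota> x) = norm x" "range \<iota> = L"
    and e: "norm e = 1" and Y: "\<And>i. 0 \<le> e \<bullet> Y $ i"
  shows "(LINT x : conv_s (\<iota> ` range (($) Y)) | subsphere_measure L. x \<bullet> \<iota> e)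
    = real (CARD('m) + 1) * enn2real (cone_moment e (pos (range (($) (Y :: real ^ 'm ^ 'm)))))"
proof -
  let ?P = "pos (range (($) Y))" and ?C = "conv_s (\<iota> ` range (($) Y))"
  let ?w = "\<lambda>x :: real ^ 'm. ennreal (real (CARD('m) + 1) * norm x) * indicator (cball 0 1) x"
  have [measurable]: "\<iota> \<in> borel_measurable borel" by (rule borel_measurable_linear[OF \<iota>(1)])
  note inn = inner_isometry[OF \<iota>(1,2)]
  have inj: "inj \<iota>" using \<iota> by (metis linear_injective_0 norm_eq_zero)
  have N: "subsphere_measure L = distr (density lborel ?w) borel (\<lambda>x. \<iota> (sgn x))"
    by (rule subsphere_measure_isometry[OF L \<iota>])
  have posC: "pos (\<iota> ` range (($) Y)) = \<iota> ` ?P" by (rule pos_linear_image[OF \<iota>(1)])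
  have closedC: "closed ?C"
    unfolding conv_s_def by (intro closed_Int closed_sphere closed_pos) simp
  then have [measurable]: "?C \<in> sets borel" by simp
  have "?P \<subseteq> {x. 0 \<le> e \<bullet> x}" using Y by (intro pos_minimal convex_cone_halfspace_ge) auto
  then have nonneg: "0 \<le> indicator ?C x *\<^sub>R (x \<bullet> \<iota> e)" for x
    by (cases "x \<in> ?C") (auto simp: conv_s_def posC inn inner_commute)
  have "(LINT x : ?C | subsphere_measure L. x \<bullet> \<iota> e)
      = enn2real (\<integral>\<^sup>+x. ennreal (indicator ?C x *\<^sub>R (x \<bullet> \<iota> e)) \<partial>subsphere_measure L)"
    unfolding set_lebesgue_integral_def using nonneg by (intro integral_eq_nn_integral) (auto simp: N)
  also have "(\<integral>\<^sup>+x. ennreal (indicator ?C x *\<^sub>R (x \<bullet> \<iota> e)) \<partial>subsphere_measure L)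
     = (\<integral>\<^sup>+y. ?w y * ennreal (indicator ?C (\<iota> (sgn y)) *\<^sub>R (\<iota> (sgn y) \<bullet> \<iota> e)) \<partial>lborel)"
    unfolding N by (subst nn_integral_distr) (simp_all add: nn_integral_density)
  also have "\<dots> = (\<integral>\<^sup>+y. ennreal (real (CARD('m) + 1)) * (ennreal (e \<bullet> y) * indicator (cball 0 1 \<inter> ?P) y)
      \<partial>lborel)"
  proof (rule nn_integral_cong)
    fix y :: "real ^ 'm"
    show "?w y * ennreal (indicator ?C (\<iota> (sgn y)) *\<^sub>R (\<iota> (sgn y) \<bullet> \<iota> e))
       = ennreal (real (CARD('m) + 1)) * (ennreal (e \<bullet> y) * indicator (cball 0 1 \<inter> ?P) y)"
    proof (cases "y = 0")
      case False
      have "\<iota> (sgn y) \<in> ?C \<longleftrightarrow> sgn y \<in> ?P"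
        using inj False by (auto simp: conv_s_def posC \<iota>(2) norm_sgn inj_def)
      also have "\<dots> \<longleftrightarrow> y \<in> ?P" by (rule sgn_in_pos_iff)
      finally have mem: "\<iota> (sgn y) \<in> ?C \<longleftrightarrow> y \<in> ?P" .
      have "real (CARD('m) + 1) * norm y * (sgn y \<bullet> e) = real (CARD('m) + 1) * (e \<bullet> y)"
        using False by (simp add: sgn_div_norm inner_commute)
      moreover have "ennreal (real (CARD('m) + 1) * norm y) * ennreal (sgn y \<bullet> e)
          = ennreal (real (CARD('m) + 1) * norm y * (sgn y \<bullet> e))"
        by (rule ennreal_mult'[symmetric]) simp
      moreover have "ennreal (real (CARD('m) + 1)) * ennreal (e \<bullet> y)
          = ennreal (real (CARD('m) + 1) * (e \<bullet> y))"
        by (rule ennreal_mult'[symmetric]) simp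
      ultimately have "ennreal (real (CARD('m) + 1) * norm y) * ennreal (sgn y \<bullet> e)
          = ennreal (real (CARD('m) + 1)) * ennreal (e \<bullet> y)"
        by (simp only:)
      then show ?thesis by (simp add: indicator_def mem inn del: of_nat_add)
    qed simp
  qed
  also have "\<dots> = ennreal (real (CARD('m) + 1)) * cone_moment e ?P"
    unfolding cone_moment_def by (rule nn_integral_cmult) measurable
  finally show ?thesis by (simp add: enn2real_mult)
qed

lemma C_const_eq:
  fixes e ebar :: "'a::euclidean_space"
  assumes dim: "DIM('a) = CARD('m::{finite,wellorder}) + 1"
    and e: "norm e = 1" "norm ebar = 1" "ebar \<bullet> e = 0"
  shows "C_const CARD('m) e ebar = real (CARD('m) + 1) ^ (CARD('m) + 1)
      * enn2real (facet_moment (axis undefined 1 :: real ^ 'm::_))"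
proof -
  let ?d = "CARD('m)" and ?L = "hyperplane e"
  have "e \<noteq> 0" using e by auto
  have Leq: "?L = {x. e \<bullet> x = 0}" by (auto simp: hyperplane_def inner_commute)
  have L: "subspace ?L" unfolding Leq by (rule subspace_hyperplane)
  have dimL: "dim ?L = ?d" unfolding Leq using dim_hyperplane[OF \<open>e \<noteq> 0\<close>] dim by simp
  have "dim (UNIV :: (real, 'm) vec set) = dim ?L" by (simp add: dimL dim_UNIV)
  from isometries_subspaces[OF subspace_UNIV L this] obtain \<iota> :: "(real, 'm) vec \<Rightarrow> 'a" and g
    where iso: "linear \<iota>" "linear g" "range \<iota> = ?L" "\<And>x. norm (\<iota> x) = norm x" "\<And>x. g (\<iota> x) = x" "\<And>x. x \<in> ?L
        \<Longrightarrow> \<iota> (g x) = x"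
    by (metis UNIV_I)
  note \<iota> = iso(1,4,3)
  have [measurable]: "\<iota> \<in> borel_measurable borel" "g \<in> borel_measurable borel"
    by (rule borel_measurable_linear[OF iso(1)], rule borel_measurable_linear[OF iso(2)])
  note inn = inner_isometry[OF \<iota>(1,2)]
  define v where "v = g ebar"
  have ebarL: "ebar \<in> ?L" using e by (simp add: hyperplane_def)
  have v: "\<iota> v = ebar" "norm v = 1" using iso(6)[OF ebarL] iso(4)[of v] e by (simp_all add: v_def)
  obtain \<beta> where \<beta>: "bij_betw \<beta> (UNIV :: 'm set) {1..?d}"
    using finite_same_card_bij[of "UNIV :: 'm set" "{1..?d}"] by auto
  have inv: "inv_into UNIV \<beta> (\<beta> i) = i" for i using \<beta> by (auto simp: bij_betw_def)
  have \<beta>I [measurable]: "\<beta> i \<in> {1..?d}" for i using bij_betwE[OF \<beta>] by auto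
  have range\<beta>: "range \<beta> = {1..?d}" using \<beta> by (simp add: bij_betw_def)
  let ?w = "\<lambda>x :: (real, 'm) vec. ennreal (real (?d + 1) * norm x) * indicator (cball 0 1) x"
  let ?N = "subsphere_measure ?L"
  have N: "?N = distr (density lborel ?w) borel (\<lambda>x. \<iota> (sgn x))"
      by (rule subsphere_measure_isometry[OF L \<iota>])
  have fin: "finite_measure (density lborel ?w)"
  proof
    have "emeasure (density lborel ?w) (space (density lborel ?w)) = (\<integral>\<^sup>+x. ?w x \<partial>lborel)"
      by (simp add: emeasure_density)
    also have "\<dots> \<le> (\<integral>\<^sup>+x. ennreal (real (?d + 1)) * indicator (cball 0 1) x
        \<partial>(lborel :: (real, 'm) vec measure))"
    proof (rule nn_integral_mono)
      fix x :: "(real, 'm) vec"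
      have "ennreal (real (?d + 1) * norm x) \<le> ennreal (real (?d + 1))" if "norm x \<le> 1"
        by (rule ennreal_leI) (rule mult_left_le[OF that], simp)
      then show "?w x \<le> ennreal (real (?d + 1)) * indicator (cball 0 1) x"
        by (auto simp: indicator_def)
    qed
    also have "\<dots> = ennreal (real (?d + 1)) * emeasure lborel (cball (0 :: (real, 'm) vec) 1)"
      by (rule nn_integral_cmult_indicator) simp
    also have "\<dots> < \<infinity>" by (simp add: emeasure_cball ennreal_mult_less_top)
    finally show "emeasure (density lborel ?w) (space (density lborel ?w)) \<noteq> \<infinity>" by simp
  qed
  then have finN: "finite_measure ?N" unfolding N by (rule finite_measure.finite_measure_distr) simp
  have sf: "sigma_finite_measure (density lborel ?w)" "sigma_finite_measure ?N"
    using fin finN by (simp_all add: finite_measure_def)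
  have PiN: "Pi\<^sub>M {1..?d} (\<lambda>_. ?N) = distr (Pi\<^sub>M {1..?d} (\<lambda>_. density lborel ?w)) (Pi\<^sub>M {1..?d} (\<lambda>_.
      borel)) (\<lambda>z. \<lambda>i\<in>{1..?d}. \<iota> (sgn (z i)))"
    unfolding N by (rule distr_PiM_map[OF _ _ sf(1) sf(2)[unfolded N], symmetric]) auto
  define R where "R u = (\<chi> i. g (u (\<beta> i)))" for u :: "nat \<Rightarrow> 'a"
  define \<Phi> where "\<Phi> u = (if \<forall>i\<in>{1..?d}. u i \<in> ?L \<inter> halfsphere ebar then
     \<bar>det (R u :: (real, 'm) vec ^ 'm::_)\<bar> * (real (?d + 1) * enn2real (cone_moment v (pos (range (($) (R
         u)))))) else 0)" for u
  have closed_dom: "closed (?L \<inter> halfsphere ebar)"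
  proof -
    have "?L \<inter> halfsphere ebar = {x. x \<bullet> e = 0} \<inter> (sphere 0 1 \<inter> {x. 0 \<le> x \<bullet> ebar})"
      by (auto simp: hyperplane_def halfsphere_def)
    moreover have "closed {x. x \<bullet> e = 0}" "closed {x. 0 \<le> x \<bullet> ebar}"
      by (auto intro!: closed_Collect_eq closed_Collect_le continuous_intros)
    ultimately show ?thesis by (simp only:) (intro closed_Int closed_sphere)
  qed
  have R [measurable]: "R \<in> borel_measurable (Pi\<^sub>M {1..?d} (\<lambda>_. borel))"
    unfolding R_def[abs_def]
  proof (rule borel_measurable_vecI)
    fix i
    have "(\<lambda>u. u (\<beta> i)) \<in> borel_measurable (Pi\<^sub>M {1..?d} (\<lambda>_. borel :: 'a measure))"
      by (rule measurable_component_singleton[OF \<beta>I])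
    then have "(\<lambda>u. g (u (\<beta> i))) \<in> borel_measurable (Pi\<^sub>M {1..?d} (\<lambda>_. borel))"
      by (rule measurable_compose[OF _ borel_measurable_linear[OF iso(2)]])
    then show "(\<lambda>u. (\<chi> i. g (u (\<beta> i))) $ i) \<in> borel_measurable (Pi\<^sub>M {1..?d} (\<lambda>_. borel))"
      by (simp only: vec_lambda_beta)
  qed
  have \<Phi>m [measurable]: "\<Phi> \<in> borel_measurable (Pi\<^sub>M {1..?d} (\<lambda>_. borel))"
  proof -
    have [measurable]: "?L \<inter> halfsphere ebar \<in> sets borel" using closed_dom by simp
    have "Measurable.pred (Pi\<^sub>M {1..?d} (\<lambda>_. borel)) (\<lambda>u. \<forall>i\<in>{1..?d}. u i \<in> ?L \<inter> halfsphere ebar)"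
      by (intro pred_intros_finite(3) pred_sets2[OF \<open>?L \<inter> halfsphere ebar \<in> sets borel\<close>]
          measurable_component_singleton) auto
    moreover have "(\<lambda>u. cone_moment v (pos (range (($) (R u)))))
        \<in> borel_measurable (Pi\<^sub>M {1..?d} (\<lambda>_. borel))"
      by (rule borel_measurable_cone_moment[OF R])
    moreover have "(\<lambda>u. det (R u)) \<in> borel_measurable (Pi\<^sub>M {1..?d} (\<lambda>_. borel))"
      by (rule borel_measurable_det) (rule measurable_matrix_row[OF R])
    ultimately show ?thesis unfolding \<Phi>_def[abs_def] by measurable
  qed
  have \<Phi>m': "\<Phi> \<in> borel_measurable (distr M (Pi\<^sub>M {1..?d} (\<lambda>_. borel)) f)"
      for M :: "(nat \<Rightarrow> (real, 'm) vec) measure" and f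
    unfolding measurable_distr_eq1 by (rule \<Phi>m)
  have \<Psi>: "(\<lambda>z. \<lambda>i\<in>{1..?d}. \<iota> (sgn (z i))) \<in> Pi\<^sub>M {1..?d} (\<lambda>_. M) \<rightarrow>\<^sub>M Pi\<^sub>M {1..?d} (\<lambda>_. borel)"
    if "sets M = sets borel" for M
  proof (rule measurable_restrict)
    fix i assume "i \<in> {1..?d}"
    then have "(\<lambda>z. z i) \<in> Pi\<^sub>M {1..?d} (\<lambda>_. M) \<rightarrow>\<^sub>M M" by (rule measurable_component_singleton)
    then have "(\<lambda>z. z i) \<in> Pi\<^sub>M {1..?d} (\<lambda>_. M) \<rightarrow>\<^sub>M borel" using measurable_cong_sets[OF refl that] by blast
    then show "(\<lambda>z. \<iota> (sgn (z i))) \<in> Pi\<^sub>M {1..?d} (\<lambda>_. M) \<rightarrow>\<^sub>M borel"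
      by (rule measurable_compose) measurable
  qed
  have \<Phi>0: "0 \<le> \<Phi> u" for u by (simp add: \<Phi>_def)
  have "C_const ?d e ebar = (LINT u | Pi\<^sub>M {1..?d} (\<lambda>_. ?N). \<Phi> u)"
    unfolding C_const_def set_lebesgue_integral_def[of "Pi\<^sub>M {1..?d} (\<lambda>_. ?N)"]
  proof (rule Bochner_Integration.integral_cong[OF refl])
    fix u assume "u \<in> space (Pi\<^sub>M {1..?d} (\<lambda>_. ?N))"
    then have ext: "u \<in> extensional {1..?d}" by (simp add: space_PiM PiE_def)
    show "indicator (Pi\<^sub>E {1..?d} (\<lambda>_. ?L \<inter> halfsphere ebar)) u *\<^sub>R
       (nabla ?L ?d u * set_lebesgue_integral ?N (conv_s (u ` {1..?d})) (\<lambda>x. x \<bullet> ebar)) = \<Phi> u"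
    proof (cases "\<forall>i\<in>{1..?d}. u i \<in> ?L \<inter> halfsphere ebar")
      case True
      have uR: "u (\<beta> i) = \<iota> (R u $ i)" for i
        using True \<beta>I[of i] by (simp add: R_def iso(6))
      have nab: "nabla ?L ?d u = \<bar>det (R u)\<bar>" by (rule nabla_isometry[OF L \<iota> \<beta> uR])
      have "u ` {1..?d} = \<iota> ` range (($) (R u))"
        unfolding range\<beta>[symmetric] image_image by (simp only: uR)
      moreover have "0 \<le> v \<bullet> R u $ i" for i
      proof -
        have "0 \<le> u (\<beta> i) \<bullet> ebar" using True \<beta>I[of i] unfolding halfsphere_def by blast
        then show ?thesis unfolding uR v(1)[symmetric] inn by (simp only: inner_commute)
      qed
      ultimately have "set_lebesgue_integral ?N (conv_s (u ` {1..?d})) (\<lambda>x. x \<bullet> ebar)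
          = real (?d + 1) * enn2real (cone_moment v (pos (range (($) (R u)))))"
        using set_integral_conv_s_isometry[OF L \<iota> v(2), of "R u"] by (simp add: v(1))
      then show ?thesis using True ext by (simp add: \<Phi>_def nab PiE_def Pi_def)
    next
      case False
      then have "u \<notin> Pi\<^sub>E {1..?d} (\<lambda>_. ?L \<inter> halfsphere ebar)" by (auto simp: PiE_def Pi_def)
      then show ?thesis using False by (auto simp: \<Phi>_def)
    qed
  qed
  also have "\<dots> = enn2real (\<integral>\<^sup>+u. ennreal (\<Phi> u) \<partial>Pi\<^sub>M {1..?d} (\<lambda>_. ?N))"
  proof (rule integral_eq_nn_integral)
    have "sets (Pi\<^sub>M {1..?d} (\<lambda>_. ?N)) = sets (Pi\<^sub>M {1..?d} (\<lambda>_. borel :: 'a measure))"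
      by (rule sets_PiM_cong) (simp_all add: N)
    from measurable_cong_sets[OF this refl] show "\<Phi> \<in> borel_measurable (Pi\<^sub>M {1..?d} (\<lambda>_. ?N))"
      by (rule ssubst) (rule \<Phi>m)
  qed (use \<Phi>0 in auto)
  also have "(\<integral>\<^sup>+u. ennreal (\<Phi> u) \<partial>Pi\<^sub>M {1..?d} (\<lambda>_. ?N))
     = (\<integral>\<^sup>+z. ennreal (\<Phi> (\<lambda>i\<in>{1..?d}. \<iota> (sgn (z i)))) \<partial>Pi\<^sub>M {1..?d} (\<lambda>_. density lborel ?w))"
    unfolding PiN
  proof (rule nn_integral_distr[OF _ measurable_compose[OF \<Phi>m' measurable_ennreal]])
    show "(\<lambda>z. \<lambda>i\<in>{1..?d}. \<iota> (sgn (z i))) \<in> Pi\<^sub>M {1..?d} (\<lambda>_. density lborel ?w) \<rightarrow>\<^sub>M Pi\<^sub>M {1..?d} (\<lambda>_.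
        borel)"
      by (rule \<Psi>) simp
  qed
  also have "\<dots> = (\<integral>\<^sup>+Y. (\<Prod>i\<in>UNIV. ?w (Y $ i))
      * ennreal (\<Phi> (\<lambda>i\<in>{1..?d}. \<iota> (sgn ((\<lambda>i\<in>{1..?d}. Y $ inv_into UNIV \<beta> i) i)))) \<partial>(lborel :: ((real, 'm)
      vec ^ 'm::_) measure))"
    by (rule nn_integral_PiM_density_vec[OF \<beta> _ sf(1) measurable_compose[OF measurable_compose[OF \<Psi> \<Phi>m]
        measurable_ennreal]]) simp_all
  also have "\<dots> = (\<integral>\<^sup>+Y. ennreal (real (?d + 1) ^ (?d + 1)) * (ennreal \<bar>det Y\<bar> * (\<Prod>i\<in>UNIV. indicator {y.
      norm y \<le> 1 \<and> 0 \<le> v \<bullet> y} (Y $ i)) *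
     cone_moment v (pos (range (($) Y)))) \<partial>(lborel :: ((real, 'm) vec ^ 'm::_) measure))"
  proof (rule nn_integral_cong)
    fix Y :: "(real, 'm) vec ^ 'm::_"
    let ?u = "\<lambda>i\<in>{1..?d}. \<iota> (sgn ((\<lambda>i\<in>{1..?d}. Y $ inv_into UNIV \<beta> i) i))"
    have u\<beta>: "?u (\<beta> i) = \<iota> (sgn (Y $ i))" for i using \<beta>I[of i] by (simp add: inv)
    then have Ru: "R ?u = (\<chi> i. sgn (Y $ i))" by (simp only: R_def iso(5))
    let ?H = "{y. norm y \<le> 1 \<and> 0 \<le> v \<bullet> y}"
    show "(\<Prod>i\<in>UNIV. ?w (Y $ i)) * ennreal (\<Phi> ?u)
        = ennreal (real (?d + 1) ^ (?d + 1)) * (ennreal \<bar>det Y\<bar> * (\<Prod>i\<in>UNIV. indicator ?H (Y $ i)) *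
       cone_moment v (pos (range (($) Y))))"
    proof (cases "\<exists>i. Y $ i = 0")
      case True
      then obtain i where i: "Y $ i = 0" by blast
      have "(\<Sum>j\<in>UNIV. axis i 1 $ j *\<^sub>R Y $ j) = 0"
        by (rule sum.neutral) (auto simp: axis_def i)
      then have det0: "det Y = 0" unfolding det_eq_0_iff_row_relation
          by (intro exI[of _ "axis i 1"]) (simp add: axis_eq_0_iff)
      have "?w (Y $ i) = 0" by (simp add: i)
      then have "(\<Prod>i\<in>UNIV. ?w (Y $ i)) = 0" by (intro prod_zero) auto
      then show ?thesis by (simp only: det0) simp
    next
      case nz: False
      have dom: "(\<forall>i\<in>{1..?d}. ?u i \<in> ?L \<inter> halfsphere ebar) \<longleftrightarrow> (\<forall>i. 0 \<le> v \<bullet> Y $ i)"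
      proof -
        have "(\<forall>i\<in>{1..?d}. ?u i \<in> ?L \<inter> halfsphere ebar) \<longleftrightarrow> (\<forall>i. ?u (\<beta> i) \<in> ?L \<inter> halfsphere ebar)"
          unfolding range\<beta>[symmetric] by blast
        also have "\<dots> \<longleftrightarrow> (\<forall>i. 0 \<le> v \<bullet> Y $ i)"
        proof (intro iff_allI)
          fix i
          have "\<iota> (sgn (Y $ i)) \<in> ?L" using iso(3) by blast
          moreover have "norm (\<iota> (sgn (Y $ i))) = 1" using nz by (simp add: iso(4) norm_sgn)
          moreover have "\<iota> (sgn (Y $ i)) \<bullet> ebar = (v \<bullet> Y $ i) / norm (Y $ i)"
            unfolding v(1)[symmetric] inn
                by (simp add: sgn_div_norm inner_commute divide_inverse mult.commute)
          moreover have "norm (Y $ i) > 0" using nz by simp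
          ultimately show "?u (\<beta> i) \<in> ?L \<inter> halfsphere ebar \<longleftrightarrow> 0 \<le> v \<bullet> Y $ i"
            unfolding u\<beta> by (simp add: halfsphere_def zero_le_divide_iff)
        qed
        finally show ?thesis .
      qed
      show ?thesis
      proof (cases "\<forall>i. Y $ i \<in> ?H")
        case True
        have cm: "cone_moment v (pos (range (($) Y)))
            = ennreal (enn2real (cone_moment v (pos (range (($) Y)))))"
        proof -
          have "cone_moment v (pos (range (($) Y))) < \<infinity>"
            by (rule le_less_trans[OF cone_moment_le_ball[OF v(2)]]) (simp add: emeasure_cball)
          then show ?thesis by (simp add: ennreal_enn2real)
        qed
        have p: "(\<Prod>i\<in>UNIV. ?w (Y $ i)) = ennreal (real (?d + 1) ^ ?d * (\<Prod>i\<in>UNIV. norm (Y $ i)))"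
          using True by (simp add: prod_ennreal prod.distrib)
        have "range (($) (R ?u)) = sgn ` range (($) Y)" unfolding Ru by auto
        then have posR: "pos (range (($) (R ?u))) = pos (range (($) Y))" by (simp only: pos_sgn)
        have "det Y = (\<Prod>i\<in>UNIV. norm (Y $ i)) * det (R ?u)"
        proof -
          have "Y = (\<chi> i. norm (Y $ i) *s (\<chi> i. sgn (Y $ i)) $ i)"
            using nz by (simp add: vec_eq_iff sgn_div_norm)
          then have "det Y = det (\<chi> i. norm (Y $ i) *s (\<chi> i. sgn (Y $ i)) $ i)" by simp
          also have "\<dots> = (\<Prod>i\<in>UNIV. norm (Y $ i)) * det (\<chi> i. (\<chi> i. sgn (Y $ i)) $ i)"
            by (rule det_rows_mul)
          finally show ?thesis unfolding Ru by simp
        qed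
        then have det: "\<bar>det Y\<bar> = (\<Prod>i\<in>UNIV. norm (Y $ i)) * \<bar>det (R ?u)\<bar>"
          by (simp add: abs_mult prod_nonneg)
        have \<Phi>u: "\<Phi> ?u = \<bar>det (R ?u)\<bar> * (real (?d + 1) * enn2real (cone_moment v (pos (range (($) Y)))))"
          unfolding \<Phi>_def using True dom posR by auto
        have pH: "(\<Prod>i\<in>UNIV. indicator ?H (Y $ i) :: ennreal) = 1" using True by simp
        have pn: "0 \<le> (\<Prod>i\<in>UNIV. norm (Y $ i))" by (simp add: prod_nonneg)
        have "(\<Prod>i\<in>UNIV. ?w (Y $ i)) * ennreal (\<Phi> ?u)
          = ennreal (real (?d + 1) ^ ?d * (\<Prod>i\<in>UNIV. norm (Y $ i)) * (\<bar>det (R ?u)\<bar> * (real (?d + 1) *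
              enn2real (cone_moment v (pos (range (($) Y)))))))"
          unfolding p \<Phi>u using pn by (intro ennreal_mult[symmetric]) auto
        also have "real (?d + 1) ^ ?d * (\<Prod>i\<in>UNIV. norm (Y $ i))
            * (\<bar>det (R ?u)\<bar> * (real (?d + 1) * enn2real (cone_moment v (pos (range (($) Y))))))
          = real (?d + 1) ^ (?d + 1) * (\<bar>det Y\<bar> * enn2real (cone_moment v (pos (range (($) Y)))))"
          unfolding det power_add power_one_right by (simp only: mult_ac)
        also have "ennreal \<dots> = ennreal (real (?d + 1) ^ (?d + 1))
            * (ennreal \<bar>det Y\<bar> * ennreal (enn2real (cone_moment v (pos (range (($) Y))))))"
          by (subst ennreal_mult, simp, simp, subst ennreal_mult, auto)
        finally show ?thesis unfolding pH cm[symmetric] mult_1_right .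
      next
        case False
        then have pH: "(\<Prod>i\<in>UNIV. indicator ?H (Y $ i) :: ennreal) = 0"
            by (auto simp: prod_zero_iff indicator_def)
        have "(\<Prod>i\<in>UNIV. ?w (Y $ i)) * ennreal (\<Phi> ?u) = 0"
        proof (cases "\<forall>i. 0 \<le> v \<bullet> Y $ i")
          case True
          then obtain i where "\<not> norm (Y $ i) \<le> 1" using False by auto
          then have "?w (Y $ i) = 0" by simp
          then have "(\<Prod>i\<in>UNIV. ?w (Y $ i)) = 0" by (intro prod_zero) auto
          then show ?thesis by (simp only: mult_zero_left)
        next
          case False
          then have "\<Phi> ?u = 0" unfolding \<Phi>_def dom by (simp only: if_False)
          then show ?thesis by (simp only: ennreal_0 mult_zero_right)
        qed
        then show ?thesis unfolding pH by simp
      qed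
    qed
  qed
  also have "\<dots> = ennreal (real (?d + 1) ^ (?d + 1)) * facet_moment v"
    unfolding facet_moment_def
  proof (rule nn_integral_cmult)
    have [measurable]: "{y. norm y \<le> 1 \<and> 0 \<le> v \<bullet> y} \<in> sets borel" by measurable
    show "(\<lambda>Y. ennreal \<bar>det Y\<bar> * (\<Prod>i\<in>UNIV. indicator {y. norm y \<le> 1 \<and> 0 \<le> v \<bullet> y} (Y $ i)) *
       cone_moment v (pos (range (($) Y)))) \<in> borel_measurable (lborel :: ((real, 'm) vec ^ 'm::_) measure)"
      by measurable
  qed
  also have "facet_moment v = facet_moment (axis undefined 1 :: (real, 'm) vec)"
    by (rule facet_moment_unit[OF v(2)]) simp
  finally show ?thesis by (simp add: enn2real_mult)
qed

section \<open>Asymptotics of the missing probability\<close>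

lemma power_times_geometric_bounded:
  fixes \<rho> :: real
  assumes "0 \<le> \<rho>" "\<rho> < 1"
  shows "\<exists>D\<ge>0. \<forall>n. real n ^ j * \<rho> ^ n \<le> D"
  using assms
proof (induction j arbitrary: \<rho>)
  case 0
  then show ?case by (intro exI[of _ 1]) (auto simp: power_le_one)
next
  case (Suc j)
  define \<sigma> where "\<sigma> = sqrt \<rho>"
  have \<sigma>: "0 \<le> \<sigma>" "\<sigma> < 1" "\<sigma> * \<sigma> = \<rho>" using Suc.prems by (auto simp: \<sigma>_def)
  obtain D where D: "0 \<le> D" "\<And>n. real n ^ j * \<sigma> ^ n \<le> D" using Suc.IH[OF \<sigma>(1,2)] by blast
  have "(\<lambda>n. real n * \<sigma> ^ n) \<longlonglongrightarrow> 0" using \<sigma> by (intro powser_times_n_limit_0) auto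
  then have "Bseq (\<lambda>n. real n * \<sigma> ^ n)" by (rule convergent_imp_Bseq[OF convergentI])
  then obtain E where E: "0 < E" "\<And>n. norm (real n * \<sigma> ^ n) \<le> E" by (auto simp: Bseq_def)
  have "real n ^ Suc j * \<rho> ^ n \<le> E * D" for n
  proof -
    have "real n ^ Suc j * \<rho> ^ n = (real n * \<sigma> ^ n) * (real n ^ j * \<sigma> ^ n)"
      by (simp add: \<sigma>(3)[symmetric] power_mult_distrib mult_ac)
    also have "\<dots> \<le> E * D" using E(2)[of n] E(1) D(2)[of n] \<sigma>(1) by (intro mult_mono) auto
    finally show ?thesis .
  qed
  then show ?case using D(1) E(1) by (intro exI[of _ "E * D"]) auto
qed

lemma binomial_beta_nat:
  assumes "d \<le> n"
  shows "real (n choose d) * beta_nat d (n - d) = 1 / (real n + 1)"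
    and "real (n choose d) * beta_nat (d + 2) (n - d)
        = (real d + 1) * (real d + 2) / ((real n + 1) * (real n + 2) * (real n + 3))"
proof -
  have b: "real (n choose d) = fact n / (fact d * fact (n - d))" by (rule binomial_fact[OF assms])
  have n1: "d + (n - d) + 1 = Suc n" "d + 2 + (n - d) + 1 = Suc (Suc (Suc n))" using assms by auto
  show "real (n choose d) * beta_nat d (n - d) = 1 / (real n + 1)"
    unfolding b beta_nat_def n1 by (simp add: add.commute)
  have "fact (d + 2) = (real d + 1) * (real d + 2) * fact d" by (simp add: algebra_simps)
  moreover have "fact (Suc (Suc (Suc n))) = (real n + 1) * (real n + 2) * (real n + 3) * fact n"
      by (simp add: algebra_simps)
  ultimately show "real (n choose d) * beta_nat (d + 2) (n - d)
      = (real d + 1) * (real d + 2) / ((real n + 1) * (real n + 2) * (real n + 3))"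
    unfolding b beta_nat_def n1 by simp
qed

lemma binomial_geometric_bounded:
  fixes \<rho> :: real
  assumes "0 < \<rho>" "\<rho> < 1" "0 < d"
  shows "\<exists>D\<ge>0. \<forall>n\<ge>d. real (n choose d) * \<rho> ^ (n - d) \<le> D / (real n)\<^sup>2"
proof -
  obtain D where D: "0 \<le> D" "\<And>n. real n ^ (d + 2) * \<rho> ^ n \<le> D"
    using power_times_geometric_bounded[of \<rho> "d + 2"] assms by auto
  have "real (n choose d) * \<rho> ^ (n - d) \<le> (D / \<rho> ^ d) / (real n)\<^sup>2" if "d \<le> n" for n
  proof (cases "n = 0")
    case False
    have "real (n choose d) \<le> real n ^ d"
      using binomial_le_pow[OF that] by (metis of_nat_le_iff of_nat_power)
    then have "real (n choose d) * \<rho> ^ (n - d) \<le> real n ^ d * \<rho> ^ (n - d)"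
        using assms by (intro mult_right_mono) auto
    also have "real n ^ d * \<rho> ^ (n - d) = real n ^ d * (\<rho> ^ n / \<rho> ^ d)"
        using assms that by (simp add: power_diff)
    also have "real n ^ d * (\<rho> ^ n / \<rho> ^ d) = (real n ^ (d + 2) * \<rho> ^ n) / \<rho> ^ d / (real n)\<^sup>2"
      using False by (simp add: power_add power2_eq_square)
    also have "\<dots> \<le> D / \<rho> ^ d / (real n)\<^sup>2" using D(2)[of n] assms by (intro divide_right_mono) auto
    finally show ?thesis .
  qed (use that assms D in auto)
  then show ?thesis using D(1) assms by (intro exI[of _ "D / \<rho> ^ d"]) auto
qed

definition missed_prob :: "'i set \<Rightarrow> 'm::{finite,wellorder} itself \<Rightarrow> ennreal" where
  "missed_prob K _ = (\<integral>\<^sup>+z. missed z K \<partial>Pi\<^sub>M K (\<lambda>_. uniform_half_ball :: ((real ^ 'm::_) \<times> real) measure))"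

lemma missed_prob_asymp:
  obtains C where "0 \<le> C"
    "\<And>K :: 'i set. finite K \<Longrightarrow> CARD('m) \<le> card K \<Longrightarrow>
      \<bar>enn2real (missed_prob K TYPE('m::{finite,wellorder})) - mass_const TYPE('m) / (real (card K) + 1)\<bar> \<le>
          C / (real (card K))\<^sup>2"
proof -
  let ?d = "CARD('m)" and ?K0 = "mass_const TYPE('m)"
  have K0: "0 \<le> ?K0" by (rule mass_const_nonneg)
  obtain c \<rho> :: real where c: "0 \<le> c" and \<rho>: "0 \<le> \<rho>" "\<rho> < 1" and orth:
    "\<And>K :: 'i set. finite K \<Longrightarrow> (\<integral>\<^sup>+z. (if meets_orthants z K then 0 else 1)
       \<partial>Pi\<^sub>M K (\<lambda>_. uniform_half_ball :: ((real, 'm) vec \<times> real) measure)) \<le> ennreal (c * \<rho> ^ card K)"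
    using nn_integral_not_meets_orthants_le[where 'i = 'i and 'm = 'm] by metis
  obtain C where C: "0 \<le> C"
    "\<And>N. facet_mass TYPE('m) N \<le> ennreal (?K0 * (beta_nat ?d N + C * beta_nat (?d + 2) N) + (3/4) ^ N)"
    "\<And>N. ennreal (?K0 * beta_nat ?d N) \<le> facet_mass TYPE('m) N + ennreal (?K0 * (C * beta_nat (?d + 2) N
        + (3/4) ^ N))"
    using facet_mass_bounds[where 'm = 'm] by blast
  obtain D1 where D1: "0 \<le> D1" "\<And>n. ?d \<le> n \<Longrightarrow> real (n choose ?d) * (3/4) ^ (n - ?d) \<le> D1 / (real n)\<^sup>2"
    using binomial_geometric_bounded[of "3/4" ?d] by auto
  obtain D2 where D2: "0 \<le> D2" "\<And>n. real n ^ 2 * \<rho> ^ n \<le> D2"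
    using power_times_geometric_bounded[OF \<rho>, of 2] by blast
  define E where "E = ?K0 * C * ((real ?d + 1) * (real ?d + 2))"
  have E: "0 \<le> E" using K0 C(1) by (simp add: E_def)
  define G where "G = E + (1 + ?K0) * D1 + c * D2"
  have "0 \<le> G" using E K0 D1 D2 c by (simp add: G_def)
  moreover have "\<bar>enn2real (missed_prob K TYPE('m)) - ?K0 / (real (card K) + 1)\<bar> \<le> G / (real (card K))\<^sup>2"
    if K: "finite K" "?d \<le> card K" for K :: "'i set"
  proof -
    define n where "n = card K"
    have n: "?d \<le> n" using K(2) by (simp add: n_def)
    then have n0: "0 < n" by (rule less_le_trans[rotated]) simp
    define N where "N = n - ?d"
    define b where "b = real (n choose ?d)"
    have b: "0 \<le> b" by (simp add: b_def)
    define F where "F = enn2real (facet_mass TYPE('m) N)"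
    have "facet_mass TYPE('m) N < \<infinity>" using C(2)[of N] by (rule le_less_trans) simp
    then have F: "facet_mass TYPE('m) N = ennreal F" "0 \<le> F" by (simp_all add: F_def ennreal_enn2real)
    have bd: "0 \<le> beta_nat ?d N" "0 \<le> beta_nat (?d + 2) N" by (rule beta_nat_nonneg)+
    have Fu: "F \<le> ?K0 * (beta_nat ?d N + C * beta_nat (?d + 2) N) + (3/4) ^ N"
      using C(2)[of N] unfolding F(1) by (subst (asm) ennreal_le_iff) (use K0 C(1) bd in auto)
    have Fl: "?K0 * beta_nat ?d N \<le> F + ?K0 * (C * beta_nat (?d + 2) N + (3/4) ^ N)"
    proof -
      have nn: "0 \<le> ?K0 * (C * beta_nat (?d + 2) N + (3/4) ^ N)" using K0 C(1) bd by auto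
      have "ennreal (?K0 * beta_nat ?d N) \<le> ennreal (F + ?K0 * (C * beta_nat (?d + 2) N + (3/4) ^ N))"
        using C(3)[of N] unfolding F(1) ennreal_plus[OF F(2) nn] .
      then show ?thesis using F(2) nn by (subst (asm) ennreal_le_iff) auto
    qed
    have S: "of_nat (card K choose ?d) * facet_mass TYPE('m) (card K - ?d) = ennreal (b * F)"
      using b F by (simp add: b_def n_def[symmetric] N_def[symmetric] ennreal_mult
          ennreal_of_nat_eq_real_of_nat)
    note bounds = nn_integral_missed_bounds[OF K(1), where 'm = 'm, unfolded S]
    have lo: "ennreal (b * F) \<le> missed_prob K TYPE('m)" unfolding missed_prob_def by (rule bounds(1))
    have "missed_prob K TYPE('m) \<le> ennreal (b * F) + ennreal (c * \<rho> ^ n)"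
      unfolding missed_prob_def n_def by (rule order.trans[OF bounds(2) add_left_mono[OF orth[OF K(1)]]])
    also have "\<dots> = ennreal (b * F + c * \<rho> ^ n)" using b F c \<rho> by (subst ennreal_plus) auto
    finally have up: "missed_prob K TYPE('m) \<le> ennreal (b * F + c * \<rho> ^ n)" .
    define p where "p = enn2real (missed_prob K TYPE('m))"
    have "missed_prob K TYPE('m) < \<infinity>" using up by (rule le_less_trans) simp
    then have p: "missed_prob K TYPE('m) = ennreal p" "0 \<le> p" by (simp_all add: p_def ennreal_enn2real)
    have pu: "p \<le> b * F + c * \<rho> ^ n" using up unfolding p(1)
        by (subst (asm) ennreal_le_iff) (use b F c \<rho> in auto)
    have pl: "b * F \<le> p" using lo unfolding p(1) by (subst (asm) ennreal_le_iff) (use p in auto)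
    have b1: "b * beta_nat ?d N = 1 / (real n + 1)"
        unfolding b_def N_def by (rule binomial_beta_nat(1)[OF n])
    have b2: "b * beta_nat (?d + 2) N \<le> (real ?d + 1) * (real ?d + 2) / (real n)\<^sup>2"
    proof -
      have "(real n)\<^sup>2 \<le> (real n + 1) * (real n + 2) * (real n + 3)"
      proof -
        have "(real n)\<^sup>2 * 1 \<le> ((real n + 1) * (real n + 2)) * (real n + 3)"
          by (intro mult_mono) (auto simp: power2_eq_square algebra_simps)
        then show ?thesis by simp
      qed
      then have "(real ?d + 1) * (real ?d + 2) / ((real n + 1) * (real n + 2) * (real n + 3))
          \<le> (real ?d + 1) * (real ?d + 2) / (real n)\<^sup>2"
        using n0 by (intro divide_left_mono mult_pos_pos) auto
      then show ?thesis unfolding b_def N_def binomial_beta_nat(2)[OF n] .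
    qed
    have b3: "b * (3/4) ^ N \<le> D1 / (real n)\<^sup>2" unfolding b_def N_def by (rule D1(2)[OF n])
    have r: "c * \<rho> ^ n \<le> c * D2 / (real n)\<^sup>2"
    proof -
      have "\<rho> ^ n \<le> D2 / (real n)\<^sup>2" using D2(2)[of n] n0 by (simp add: pos_le_divide_eq mult.commute)
      then show ?thesis using c mult_left_mono[of "\<rho> ^ n" "D2 / (real n)\<^sup>2" c] by simp
    qed
    have KC: "?K0 * C * (b * beta_nat (?d + 2) N) \<le> E / (real n)\<^sup>2"
      using mult_left_mono[OF b2, of "?K0 * C"] K0 C(1) by (simp add: E_def)
    have Kb3: "?K0 * (b * (3/4) ^ N) \<le> ?K0 * D1 / (real n)\<^sup>2"
      using mult_left_mono[OF b3 K0] by simp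
    have Geq: "G / (real n)\<^sup>2 = E / (real n)\<^sup>2 + D1 / (real n)\<^sup>2 + ?K0 * D1 / (real n)\<^sup>2 + c * D2
        / (real n)\<^sup>2"
      by (simp add: G_def add_divide_distrib algebra_simps)
    have nonneg: "0 \<le> E / (real n)\<^sup>2" "0 \<le> D1 / (real n)\<^sup>2" "0 \<le> ?K0 * D1 / (real n)\<^sup>2" "0
        \<le> c * D2 / (real n)\<^sup>2"
      using E D1 D2 K0 c by auto
    have K1: "?K0 * (b * beta_nat ?d N) = ?K0 / (real n + 1)" unfolding b1 by simp
    have "b * F \<le> b * (?K0 * (beta_nat ?d N + C * beta_nat (?d + 2) N) + (3/4) ^ N)"
        using Fu b by (rule mult_left_mono)
    also have "\<dots> = ?K0 * (b * beta_nat ?d N) + ?K0 * C * (b * beta_nat (?d + 2) N) + b * (3/4) ^ N"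
        by (simp add: algebra_simps)
    finally have bFu: "b * F \<le> ?K0 / (real n + 1) + E / (real n)\<^sup>2 + D1 / (real n)\<^sup>2"
        using KC b3 K1 by linarith
    have "b * (?K0 * beta_nat ?d N) \<le> b * (F + ?K0 * (C * beta_nat (?d + 2) N + (3/4) ^ N))"
        using Fl b by (rule mult_left_mono)
    also have "\<dots> = b * F + ?K0 * C * (b * beta_nat (?d + 2) N) + ?K0 * (b * (3/4) ^ N)"
        by (simp add: algebra_simps)
    also have "b * (?K0 * beta_nat ?d N) = ?K0 * (b * beta_nat ?d N)" by (simp only: mult_ac)
    finally have bFl: "?K0 / (real n + 1) \<le> b * F + E / (real n)\<^sup>2 + ?K0 * D1 / (real n)\<^sup>2"
        using KC Kb3 K1 by linarith
    have "\<bar>p - ?K0 / (real n + 1)\<bar> \<le> G / (real n)\<^sup>2"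
      unfolding Geq using pu pl bFu bFl r nonneg by linarith
    then show ?thesis by (simp add: p_def n_def)
  qed
  ultimately show ?thesis using that by blast
qed

section \<open>Transfer to the halfsphere\<close>

text \<open>An index type for coordinates of the hyperplane orthogonal to a unit vector of \<open>'a\<close>;
  \<open>max\<close> only keeps the type nonempty if \<open>DIM('a) = 1\<close>.\<close>
typedef (overloaded) ('a::euclidean_space) coord = "{..<max 1 (DIM('a) - 1)} :: nat set"
  by (intro exI[of _ 0]) auto

instantiation coord :: (euclidean_space) wellorder
begin

definition less_eq_coord :: "'a coord \<Rightarrow> 'a coord \<Rightarrow> bool" where
  "less_eq_coord x y \<longleftrightarrow> Rep_coord x \<le> Rep_coord y"

definition less_coord :: "'a coord \<Rightarrow> 'a coord \<Rightarrow> bool" where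
  "less_coord x y \<longleftrightarrow> Rep_coord x < Rep_coord y"

instance
proof
  fix P :: "'a coord \<Rightarrow> bool" and a :: "'a coord"
  assume step: "\<And>x. (\<And>y. y < x \<Longrightarrow> P y) \<Longrightarrow> P x"
  show "P a"
    by (induction "Rep_coord a" arbitrary: a rule: less_induct) (auto intro: step simp: less_coord_def)
qed (auto simp: less_eq_coord_def less_coord_def Rep_coord_inject[symmetric])

end

instance coord :: (euclidean_space) finite
proof
  have "finite (Abs_coord ` {..<max 1 (DIM('a) - 1)} :: 'a coord set)" by simp
  then show "finite (UNIV :: 'a coord set)"
    by (simp add: type_definition.univ[OF type_definition_coord])
qed

lemma CARD_coord: "CARD('a::euclidean_space coord) = max 1 (DIM('a) - 1)"
  using type_definition.card[OF type_definition_coord] by simp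

lemma sets_sphere_measure [measurable_cong, simp]: "sets sphere_measure = sets borel"
  and space_sphere_measure [simp]: "space sphere_measure = UNIV"
  by (simp_all add: sphere_measure_def spherical_part_def)

lemma sets_halfsphere_uniform [measurable_cong, simp]: "sets (halfsphere_uniform e) = sets borel"
  and space_halfsphere_uniform [simp]: "space (halfsphere_uniform e) = UNIV"
  by (simp_all add: halfsphere_uniform_def)

lemma halfsphere_borel [measurable]: "halfsphere e \<in> sets borel"
proof -
  have "halfsphere e = sphere 0 1 \<inter> {u. 0 \<le> u \<bullet> e}" by (auto simp: halfsphere_def)
  also have "closed \<dots>" by (intro closed_Int closed_sphere closed_Collect_le continuous_intros)
  finally show ?thesis by simp
qed

lemma emeasure_halfsphere_uniform:
  assumes [measurable]: "A \<in> sets borel"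
  shows "emeasure (halfsphere_uniform (e :: 'a::euclidean_space)) A
      = ennreal (2 / omega DIM('a)) * emeasure sphere_measure (halfsphere e \<inter> A)"
proof -
  have "emeasure (halfsphere_uniform e) A
      = (\<integral>\<^sup>+x. ennreal (2 / omega DIM('a)) * indicator (halfsphere e) x * indicator A x \<partial>sphere_measure)"
    unfolding halfsphere_uniform_def by (subst emeasure_density) simp_all
  also have "\<dots> = (\<integral>\<^sup>+x. ennreal (2 / omega DIM('a)) * indicator (halfsphere e \<inter> A) x \<partial>sphere_measure)"
    by (rule nn_integral_cong) (auto simp: indicator_def)
  also have "\<dots> = ennreal (2 / omega DIM('a)) * emeasure sphere_measure (halfsphere e \<inter> A)"
    by (rule nn_integral_cmult_indicator) simp
  finally show ?thesis .
qed

lemma nn_integral_sphere_measure: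
  assumes [measurable]: "f \<in> borel_measurable borel"
  shows "(\<integral>\<^sup>+x. f x \<partial>(sphere_measure :: 'a::euclidean_space measure))
    = (\<integral>\<^sup>+x. of_nat DIM('a) * indicator (cball 0 1) x * f (sgn x) \<partial>lborel)"
  unfolding sphere_measure_def spherical_part_def
  by (subst nn_integral_distr, simp_all, subst nn_integral_density) simp_all

lemma halfspace_isometry:
  fixes e :: "'a::euclidean_space"
  assumes dim: "DIM('a) = CARD('m::finite) + 1" and e: "norm e = 1"
  obtains \<Phi> :: "(real ^ 'm) \<times> real \<Rightarrow> 'a" where "linear \<Phi>" "\<And>x. norm (\<Phi> x) = norm x" "\<And>x. \<Phi> x \<bullet> e = snd x"
proof -
  have "e \<noteq> 0" using e by auto
  let ?L = "{x. e \<bullet> x = 0}"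
  have "dim (UNIV :: (real ^ 'm) set) = dim ?L" using dim_hyperplane[OF \<open>e \<noteq> 0\<close>] dim by (simp add: dim_UNIV)
  from isometries_subspaces[OF subspace_UNIV subspace_hyperplane this] obtain \<iota> :: "real ^ 'm \<Rightarrow> 'a"
    where \<iota>: "linear \<iota>" "range \<iota> = ?L" "\<And>x. norm (\<iota> x) = norm x" by (metis UNIV_I)
  have orth: "e \<bullet> \<iota> y = 0" "\<iota> y \<bullet> e = 0" for y using \<iota>(2) by (auto simp: inner_commute)
  have ee: "e \<bullet> e = 1" using e by (simp add: dot_square_norm)
  let ?\<Phi> = "\<lambda>x. \<iota> (fst x) + snd x *\<^sub>R e"
  show ?thesis
  proof
    show "linear ?\<Phi>"
      by (rule linearI) (simp_all add: linear_add[OF \<iota>(1)] linear_scale[OF \<iota>(1)] algebra_simps)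
    fix x :: "(real ^ 'm) \<times> real"
    have "(norm (?\<Phi> x))\<^sup>2 = (norm (\<iota> (fst x)))\<^sup>2 + (snd x)\<^sup>2"
      unfolding power2_norm_eq_inner by (simp add: inner_add_left inner_add_right orth ee power2_eq_square)
    also have "\<dots> = (norm x)\<^sup>2" by (simp add: \<iota>(3) norm_prod_def)
    finally show "norm (?\<Phi> x) = norm x" by (metis norm_ge_zero power2_eq_iff_nonneg)
    show "?\<Phi> x \<bullet> e = snd x" by (simp add: inner_add_left orth ee)
  qed
qed

lemma halfsphere_uniform_eq_distr:
  fixes e :: "'a::euclidean_space" and \<Phi> :: "(real ^ 'm::finite) \<times> real \<Rightarrow> 'a"
  assumes dim: "DIM('a) = CARD('m) + 1"
    and \<Phi>: "linear \<Phi>" "\<And>x. norm (\<Phi> x) = norm x" and e: "\<And>x. \<Phi> x \<bullet> e = snd x"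
  shows "halfsphere_uniform e = distr uniform_half_ball borel (\<lambda>x. sgn (\<Phi> x))"
proof (rule measure_eqI)
  have [measurable]: "\<Phi> \<in> borel_measurable borel" by (rule borel_measurable_linear[OF \<Phi>(1)])
  fix A assume "A \<in> sets (halfsphere_uniform e)"
  then have [measurable]: "A \<in> sets borel" by simp
  let ?k = "2 / unit_ball_vol (real (CARD('m) + 1))"
  have "ennreal (2 / omega DIM('a)) * of_nat DIM('a) = ennreal (2 / omega DIM('a) * real DIM('a))"
    using omega_pos[of "DIM('a)"] by (subst ennreal_mult) (auto simp: ennreal_of_nat_eq_real_of_nat
        less_imp_le)
  also have "2 / omega DIM('a) * real DIM('a) = ?k"
    by (simp add: omega_eq_unit_ball_vol dim del: of_nat_add of_nat_Suc)
  finally have k: "ennreal (2 / omega DIM('a)) * of_nat DIM('a) = ennreal ?k" .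
  have "emeasure (halfsphere_uniform e) A
      = ennreal (2 / omega DIM('a)) * (\<integral>\<^sup>+x. indicator (halfsphere e \<inter> A) x \<partial>sphere_measure)"
    by (simp add: emeasure_halfsphere_uniform)
  also have "\<dots> = ennreal (2 / omega DIM('a)) * (\<integral>\<^sup>+x. of_nat DIM('a) * indicator (cball 0 1) x
      * indicator (halfsphere e \<inter> A) (sgn x) \<partial>lborel)"
    by (subst nn_integral_sphere_measure) simp_all
  also have "\<dots> = (\<integral>\<^sup>+x. ennreal (2 / omega DIM('a)) * (of_nat DIM('a) * indicator (cball 0 1) x
      * indicator (halfsphere e \<inter> A) (sgn x)) \<partial>lborel)"
    by (rule nn_integral_cmult[symmetric]) simp
  also have "\<dots> = (\<integral>\<^sup>+x. ennreal ?k * (indicator (cball 0 1) x * indicator (halfsphere e \<inter> A) (sgn x))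
      \<partial>lborel)"
    unfolding k[symmetric] by (simp only: mult_ac)
  also have "\<dots> = (\<integral>\<^sup>+x. ennreal ?k * (indicator (cball 0 1) (\<Phi> x)
      * indicator (halfsphere e \<inter> A) (sgn (\<Phi> x))) \<partial>lborel)"
    by (rule nn_integral_lborel_isometry[OF \<Phi>, symmetric]) (simp_all add: dim)
  also have "\<dots> = (\<integral>\<^sup>+x. half_ball_density x * indicator A (sgn (\<Phi> x)) \<partial>lborel)"
  proof (rule nn_integral_cong_AE)
    have "AE x in (lborel :: ((real ^ 'm) \<times> real) measure). x \<noteq> 0" by (rule AE_lborel_singleton)
    then show "AE x in lborel. ennreal ?k * (indicator (cball 0 1) (\<Phi> x)
        * indicator (halfsphere e \<inter> A) (sgn (\<Phi> x)))
        = half_ball_density x * indicator A (sgn (\<Phi> x))"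
    proof eventually_elim
      fix x :: "(real ^ 'm) \<times> real" assume "x \<noteq> 0"
      then have "\<Phi> x \<noteq> 0" "0 < norm x" using \<Phi>(2)[of x] by auto
      then have "sgn (\<Phi> x) \<in> halfsphere e \<longleftrightarrow> 0 \<le> snd x"
        by (simp add: halfsphere_def norm_sgn sgn_div_norm \<Phi>(2) e zero_le_divide_iff zero_le_mult_iff)
      then show "ennreal ?k * (indicator (cball 0 1) (\<Phi> x) * indicator (halfsphere e \<inter> A) (sgn (\<Phi> x)))
        = half_ball_density x * indicator A (sgn (\<Phi> x))"
        by (simp add: half_ball_density_def half_ball_def \<Phi>(2) indicator_def)
    qed
  qed
  also have "\<dots> = (\<integral>\<^sup>+x. indicator A (sgn (\<Phi> x)) \<partial>uniform_half_ball)"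
    by (rule nn_integral_uniform_half_ball[symmetric]) simp
  also have "\<dots> = (\<integral>\<^sup>+x. indicator A x \<partial>distr uniform_half_ball borel (\<lambda>x. sgn (\<Phi> x)))"
    by (rule nn_integral_distr[symmetric]) simp_all
  finally show "emeasure (halfsphere_uniform e) A
      = emeasure (distr uniform_half_ball borel (\<lambda>x. sgn (\<Phi> x))) A" by simp
qed simp

lemma measurable_emeasure_missed:
  fixes N :: "'a::euclidean_space measure"
  assumes K: "finite K" and N: "prob_space N" and sets_N [simp, measurable_cong]: "sets N = sets borel"
  shows "(\<lambda>u. emeasure N {x. x \<notin> pos (u ` K)}) \<in> borel_measurable (Pi\<^sub>M K (\<lambda>_. borel))"
proof -
  interpret prob_space N by (rule N)
  have [measurable]: "Measurable.pred (Pi\<^sub>M K (\<lambda>_. borel) \<Otimes>\<^sub>M N) (\<lambda>w. snd w \<in> pos ((\<lambda>k. fst w k) ` K))"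
    by (rule pred_pos[OF K]) measurable
  have "(\<lambda>u. \<integral>\<^sup>+x. indicator {x. x \<notin> pos (u ` K)} x \<partial>N) \<in> borel_measurable (Pi\<^sub>M K (\<lambda>_. borel))"
    by (intro borel_measurable_nn_integral) (simp add: case_prod_unfold)
  moreover have "(\<integral>\<^sup>+x. indicator {x. x \<notin> pos (u ` K)} x \<partial>N) = emeasure N {x. x \<notin> pos (u ` K)}" for u
    by (rule nn_integral_indicator) (simp only: sets_N closed_pos_borel[OF K])
  ultimately show ?thesis by (simp only:)
qed

context
  fixes e :: "'a::euclidean_space"
  assumes dim: "DIM('a) = CARD('m::{finite,wellorder}) + 1" and e: "norm e = 1"
begin

lemma prob_space_halfsphere_uniform: "prob_space (halfsphere_uniform e)"
proof -
  obtain \<Phi> :: "(real ^ 'm::_) \<times> real \<Rightarrow> 'a"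
    where \<Phi>: "linear \<Phi>" "\<And>x. norm (\<Phi> x) = norm x" "\<And>x. \<Phi> x \<bullet> e = snd x"
    using halfspace_isometry[OF dim e] by metis
  have [measurable]: "\<Phi> \<in> borel_measurable borel" by (rule borel_measurable_linear[OF \<Phi>(1)])
  show ?thesis unfolding halfsphere_uniform_eq_distr[OF dim \<Phi>]
    by (rule prob_space.prob_space_distr[OF prob_space_uniform_half_ball]) measurable
qed

lemma nn_integral_emeasure_missed:
  fixes K :: "'i set"
  assumes K: "finite K"
  shows "(\<integral>\<^sup>+u. emeasure (halfsphere_uniform e) {x. x \<notin> pos (u ` K)} \<partial>Pi\<^sub>M K (\<lambda>_. halfsphere_uniform e))
      = missed_prob K TYPE('m)"
proof -
  obtain \<Phi> :: "(real ^ 'm::_) \<times> real \<Rightarrow> 'a"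
    where \<Phi>: "linear \<Phi>" "\<And>x. norm (\<Phi> x) = norm x" "\<And>x. \<Phi> x \<bullet> e = snd x"
    using halfspace_isometry[OF dim e] by metis
  let ?T = "\<lambda>x. sgn (\<Phi> x)" and ?U = "uniform_half_ball :: ((real ^ 'm::_) \<times> real) measure"
  have [measurable]: "\<Phi> \<in> borel_measurable borel" by (rule borel_measurable_linear[OF \<Phi>(1)])
  have inj: "inj \<Phi>" using \<Phi> by (metis linear_injective_0 norm_eq_zero)
  interpret H: prob_space "halfsphere_uniform e" by (rule prob_space_halfsphere_uniform)
  interpret U: prob_space ?U by (rule prob_space_uniform_half_ball)
  have H: "halfsphere_uniform e = distr ?U borel ?T" by (rule halfsphere_uniform_eq_distr[OF dim \<Phi>])
  have T: "?T \<in> ?U \<rightarrow>\<^sub>M borel" by measurable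
  have PiH: "Pi\<^sub>M K (\<lambda>_. halfsphere_uniform e)
      = distr (Pi\<^sub>M K (\<lambda>_. ?U)) (Pi\<^sub>M K (\<lambda>_. borel)) (\<lambda>z. \<lambda>k\<in>K. ?T (z k))"
    unfolding H
    by (rule distr_PiM_map[OF K T U.sigma_finite_measure_axioms H.sigma_finite_measure_axioms[unfolded H],
        symmetric])
  have "(\<integral>\<^sup>+u. emeasure (halfsphere_uniform e) {x. x \<notin> pos (u ` K)} \<partial>Pi\<^sub>M K (\<lambda>_. halfsphere_uniform e))
      = (\<integral>\<^sup>+z. emeasure (halfsphere_uniform e) {x. x \<notin> pos ((\<lambda>k\<in>K. ?T (z k)) ` K)} \<partial>Pi\<^sub>M K (\<lambda>_. ?U))"
    unfolding PiH
  proof (rule nn_integral_distr)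
    show "(\<lambda>z. \<lambda>k\<in>K. ?T (z k)) \<in> Pi\<^sub>M K (\<lambda>_. ?U) \<rightarrow>\<^sub>M Pi\<^sub>M K (\<lambda>_. borel)" by measurable
    show "(\<lambda>u. emeasure (halfsphere_uniform e) {x. x \<notin> pos (u ` K)})
       \<in> borel_measurable (distr (Pi\<^sub>M K (\<lambda>_. ?U)) (Pi\<^sub>M K (\<lambda>_. borel)) (\<lambda>z. \<lambda>k\<in>K. ?T (z k)))"
      unfolding measurable_distr_eq1
      by (rule measurable_emeasure_missed[OF K H.prob_space_axioms sets_halfsphere_uniform])
  qed
  also have "\<dots> = (\<integral>\<^sup>+z. missed z K \<partial>Pi\<^sub>M K (\<lambda>_. ?U))"
  proof (rule nn_integral_cong)
    fix z :: "'i \<Rightarrow> (real ^ 'm::_) \<times> real"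
    let ?A = "{x. x \<notin> pos ((\<lambda>k\<in>K. ?T (z k)) ` K)}"
    have "(\<lambda>k\<in>K. ?T (z k)) ` K = sgn ` \<Phi> ` z ` K" by auto
    then have P: "pos ((\<lambda>k\<in>K. ?T (z k)) ` K) = \<Phi> ` pos (z ` K)"
      by (simp only: pos_sgn pos_linear_image[OF \<Phi>(1)])
    have A: "?A \<in> sets borel" by (rule closed_pos_borel[OF K])
    have "?T x \<in> pos ((\<lambda>k\<in>K. ?T (z k)) ` K) \<longleftrightarrow> x \<in> pos (z ` K)" for x
      unfolding sgn_in_pos_iff unfolding P using inj by (auto dest: injD)
    then have "?T -` ?A \<inter> space ?U = {x. x \<notin> pos (z ` K)}" by auto
    then show "emeasure (halfsphere_uniform e) ?A = missed z K"
      unfolding missed_def by (subst H, subst emeasure_distr[OF T A]) simp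
  qed
  finally show ?thesis unfolding missed_prob_def .
qed

end

lemma AE_halfsphere_uniform_inner:
  fixes a e :: "'a::euclidean_space"
  assumes "a \<noteq> 0"
  shows "AE x in halfsphere_uniform e. a \<bullet> x \<noteq> 0"
proof -
  have "AE x in lborel. a \<bullet> sgn x \<noteq> 0"
    using AE_lborel_hyperplane[OF assms, of 0] AE_lborel_singleton[of 0]
    by eventually_elim (simp add: sgn_div_norm)
  then have "AE x in density lborel (\<lambda>x::'a. of_nat DIM('a) * indicator (cball 0 1) x). a \<bullet> sgn x \<noteq> 0"
    by (subst AE_density) (auto elim: eventually_mono)
  then have "AE x in sphere_measure. a \<bullet> x \<noteq> 0"
    unfolding sphere_measure_def spherical_part_def by (subst AE_distr_iff) (simp_all)
  then show ?thesis unfolding halfsphere_uniform_def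
    by (subst AE_density) (auto elim: eventually_mono)
qed

lemma AE_halfsphere_uniform_pos:
  assumes "norm e = 1"
  shows "AE x in halfsphere_uniform e. 0 < x \<bullet> e"
proof -
  have "e \<noteq> 0" using assms by auto
  have "AE x in halfsphere_uniform e. x \<in> halfsphere e"
    unfolding halfsphere_uniform_def by (subst AE_density) (auto simp: indicator_def)
  with AE_halfsphere_uniform_inner[OF \<open>e \<noteq> 0\<close>, of e] show ?thesis
    by eventually_elim (auto simp: halfsphere_def inner_commute)
qed

lemma AE_halfsphere_uniform_not_in_span:
  fixes e v :: "'a::euclidean_space"
  assumes "2 \<le> DIM('a)"
  shows "AE x in halfsphere_uniform e. x \<notin> span {v}"
proof -
  have "dim {v} < DIM('a)" using dim_le_card'[of "{v}"] assms by simp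
  then obtain a where "a \<noteq> 0" and a: "span {v} \<subseteq> {x. a \<bullet> x = 0}" using lowdim_subset_hyperplane by blast
  then show ?thesis using AE_halfsphere_uniform_inner[OF \<open>a \<noteq> 0\<close>, of e] by (auto elim: eventually_mono)
qed

lemma measure_halfsphere_minus_conv_s:
  fixes e :: "'a::euclidean_space"
  assumes K: "finite K"
  shows "measure sphere_measure (halfsphere e - conv_s (u ` K)) =
    omega DIM('a) / 2 * measure (halfsphere_uniform e) {x. x \<notin> pos (u ` K)}"
proof -
  have "halfsphere e - conv_s (u ` K) = halfsphere e \<inter> {x. x \<notin> pos (u ` K)}"
    by (auto simp: halfsphere_def conv_s_def)
  then have "emeasure (halfsphere_uniform e) {x. x \<notin> pos (u ` K)} =
      ennreal (2 / omega DIM('a)) * emeasure sphere_measure (halfsphere e - conv_s (u ` K))"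
    using emeasure_halfsphere_uniform[OF closed_pos_borel[OF K], of e u] by simp
  then have "measure (halfsphere_uniform e) {x. x \<notin> pos (u ` K)} =
      2 / omega DIM('a) * measure sphere_measure (halfsphere e - conv_s (u ` K))"
    using omega_pos[of "DIM('a)"] by (simp add: measure_def enn2real_mult)
  then show ?thesis using omega_pos[of "DIM('a)"] by simp
qed

context
  fixes e :: "'a::euclidean_space" and M :: "'w measure" and X :: "'i \<Rightarrow> 'w \<Rightarrow> 'a" and I :: "'i set"
  assumes dim: "DIM('a) = CARD('m::{finite,wellorder}) + 1" and e: "norm e = 1"
    and M: "prob_space M" and I: "finite I" "I \<noteq> {}"
    and indep: "prob_space.indep_vars M (\<lambda>_. borel) X I"
    and distr_X: "\<And>i. i \<in> I \<Longrightarrow> distr M borel (X i) = halfsphere_uniform e"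
begin

lemma expectation_random_points:
  fixes g :: "('i \<Rightarrow> 'a) \<Rightarrow> real"
  assumes g: "g \<in> borel_measurable (Pi\<^sub>M I (\<lambda>_. borel))"
  shows "(LINT w | M. g (\<lambda>i\<in>I. X i w)) = (LINT u | Pi\<^sub>M I (\<lambda>_. halfsphere_uniform e). g u)"
proof -
  interpret prob_space M by (rule M)
  have X: "X i \<in> borel_measurable M" if "i \<in> I" for i
    using indep that by (simp add: indep_vars_def)
  have "distr M (Pi\<^sub>M I (\<lambda>_. borel)) (\<lambda>w. \<lambda>i\<in>I. X i w) = Pi\<^sub>M I (\<lambda>i. distr M borel (X i))"
    using indep_vars_iff_distr_eq_PiM'[OF I(2), of X "\<lambda>_. borel"] X indep by simp
  also have "\<dots> = Pi\<^sub>M I (\<lambda>_. halfsphere_uniform e)"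
    by (rule PiM_cong) (simp_all add: distr_X)
  finally have "(LINT u | Pi\<^sub>M I (\<lambda>_. halfsphere_uniform e). g u) =
      (LINT u | distr M (Pi\<^sub>M I (\<lambda>_. borel)) (\<lambda>w. \<lambda>i\<in>I. X i w). g u)" by simp
  also have "\<dots> = (LINT w | M. g (\<lambda>i\<in>I. X i w))"
    by (rule integral_distr[OF measurable_restrict[OF X] g])
  finally show ?thesis ..
qed

lemma expectation_missed_volume:
  "(LINT w | M. measure sphere_measure (halfsphere e - conv_s ((\<lambda>i. X i w) ` I))) =
    omega DIM('a) / 2 * enn2real (missed_prob I TYPE('m))"
proof -
  interpret H: prob_space "halfsphere_uniform e" by (rule prob_space_halfsphere_uniform[OF dim e])
  let ?p = "\<lambda>u. measure (halfsphere_uniform e) {x. x \<notin> pos (u ` I)}"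
  have em: "(\<lambda>u. emeasure (halfsphere_uniform e) {x. x \<notin> pos (u ` I)})
      \<in> borel_measurable (Pi\<^sub>M I (\<lambda>_. borel))"
    by (rule measurable_emeasure_missed[OF I(1) H.prob_space_axioms sets_halfsphere_uniform])
  have sets_eq: "sets (Pi\<^sub>M I (\<lambda>_. halfsphere_uniform e)) = sets (Pi\<^sub>M I (\<lambda>_. borel))"
    by (rule sets_PiM_cong) simp_all
  have p [measurable]: "?p \<in> borel_measurable (Pi\<^sub>M I (\<lambda>_. borel))"
    unfolding measure_def by (rule measurable_compose[OF em]) simp
  have "(LINT w | M. measure sphere_measure (halfsphere e - conv_s ((\<lambda>i. X i w) ` I))) =
      (LINT w | M. omega DIM('a) / 2 * ?p (\<lambda>i\<in>I. X i w))"
    by (rule Bochner_Integration.integral_cong[OF refl]) (simp add: measure_halfsphere_minus_conv_s[OF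
        I(1)])
  also have "\<dots> = (LINT u | Pi\<^sub>M I (\<lambda>_. halfsphere_uniform e). omega DIM('a) / 2 * ?p u)"
    by (rule expectation_random_points) measurable
  also have "\<dots> = omega DIM('a) / 2 * (LINT u | Pi\<^sub>M I (\<lambda>_. halfsphere_uniform e). ?p u)"
    by simp
  also have "(LINT u | Pi\<^sub>M I (\<lambda>_. halfsphere_uniform e). ?p u) =
      enn2real (\<integral>\<^sup>+u. ennreal (?p u) \<partial>Pi\<^sub>M I (\<lambda>_. halfsphere_uniform e))"
    using p measurable_cong_sets[OF sets_eq refl, of "borel :: real measure"]
    by (intro integral_eq_nn_integral) auto
  also have "\<dots> = enn2real (missed_prob I TYPE('m))"
    unfolding H.emeasure_eq_measure[symmetric] nn_integral_emeasure_missed[OF dim e I(1)] ..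
  finally show ?thesis .
qed

lemma AE_halfsphere_points_general_position:
  "AE u in Pi\<^sub>M I (\<lambda>_. halfsphere_uniform e). (\<forall>k\<in>I. 0 < u k \<bullet> e) \<and> (\<forall>j\<in>I. \<forall>k\<in>I. j \<noteq> k \<longrightarrow> u j \<notin> span {u k})"
proof -
  interpret H: prob_space "halfsphere_uniform e" by (rule prob_space_halfsphere_uniform[OF dim e])
  interpret product_sigma_finite "\<lambda>_::'i. halfsphere_uniform e"
    using H.sigma_finite_measure_axioms by (simp add: product_sigma_finite_def)
  have pos: "AE u in Pi\<^sub>M I (\<lambda>_. halfsphere_uniform e). 0 < u k \<bullet> e" if "k \<in> I" for k
    using that by (intro AE_PiM_component AE_halfsphere_uniform_pos e H.prob_space_axioms)
  have span: "AE u in Pi\<^sub>M I (\<lambda>_. halfsphere_uniform e). u j \<notin> span {u k}"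
    if jk: "j \<in> I" "k \<in> I" "j \<noteq> k" for j k
  proof -
    let ?PI = "Pi\<^sub>M I (\<lambda>_. halfsphere_uniform e)"
    have span_eq: "span {v} = pos ((\<lambda>b. if b then v else - v) ` UNIV)" for v :: 'a
      by (simp add: pos_pair_uminus[symmetric] UNIV_bool insert_commute)
    have comp [measurable]: "(\<lambda>u. u i) \<in> borel_measurable ?PI" if "i \<in> I" for i
      using measurable_component_singleton[OF that, of "\<lambda>_. halfsphere_uniform e"]
      by (simp add: measurable_cong_sets[OF refl sets_halfsphere_uniform])
    have [measurable]: "Measurable.pred ?PI (\<lambda>u. u j \<in> span {u k})"
      unfolding span_eq
    proof (rule pred_pos)
      fix b
      show "(\<lambda>u. if b then u k else - u k) \<in> borel_measurable ?PI"
        using comp[OF jk(2)] by (cases b) simp_all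
    qed (simp_all add: comp jk)
    have I': "insert j (I - {j}) = I" "finite (I - {j})" "j \<notin> I - {j}" using jk I by auto
    let ?f = "\<lambda>u. if u j \<in> span {u k} then 1 else 0 :: ennreal"
    have f: "?f \<in> borel_measurable ?PI" by measurable
    have "(\<integral>\<^sup>+u. ?f u \<partial>?PI) = (\<integral>\<^sup>+u. (\<integral>\<^sup>+x. ?f (u(j := x)) \<partial>halfsphere_uniform e) \<partial>Pi\<^sub>M (I - {j}) (\<lambda>_.
        halfsphere_uniform e))"
      using product_nn_integral_insert[OF I'(2,3), of ?f] f unfolding I'(1) by blast
    also have "\<dots> = (\<integral>\<^sup>+u. 0 \<partial>Pi\<^sub>M (I - {j}) (\<lambda>_. halfsphere_uniform e))"
    proof (rule nn_integral_cong)
      fix u :: "'i \<Rightarrow> 'a"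
      have "AE x in halfsphere_uniform e. x \<notin> span {u k}"
        by (rule AE_halfsphere_uniform_not_in_span) (simp add: dim)
      then have "AE x in halfsphere_uniform e. ?f (u(j := x)) = 0"
        by eventually_elim (use jk in simp)
      then show "(\<integral>\<^sup>+x. ?f (u(j := x)) \<partial>halfsphere_uniform e) = 0"
        by (subst nn_integral_cong_AE[where v = "\<lambda>_. 0"]) simp_all
    qed
    finally have "(\<integral>\<^sup>+u. ?f u \<partial>?PI) = 0" by simp
    then have "AE u in ?PI. ?f u = 0" unfolding nn_integral_0_iff_AE[OF f] .
    then show ?thesis by eventually_elim (simp split: if_splits)
  qed
  have "AE u in Pi\<^sub>M I (\<lambda>_. halfsphere_uniform e). \<forall>k\<in>I. 0 < u k \<bullet> e"
    using pos I(1) by (intro AE_finite_allI) auto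
  moreover have "AE u in Pi\<^sub>M I (\<lambda>_. halfsphere_uniform e). \<forall>j\<in>I. \<forall>k\<in>I. j \<noteq> k \<longrightarrow> u j \<notin> span {u k}"
  proof (intro AE_finite_allI I(1))
    fix j k assume "j \<in> I" "k \<in> I"
    then show "AE u in Pi\<^sub>M I (\<lambda>_. halfsphere_uniform e). j \<noteq> k \<longrightarrow> u j \<notin> span {u k}"
      using span by (cases "j = k") auto
  qed
  ultimately show ?thesis by eventually_elim blast
qed

lemma expectation_f0:
  "(LINT w | M. real (f0 (conv_s ((\<lambda>i. X i w) ` I)))) = (\<Sum>k\<in>I. enn2real (missed_prob (I - {k}) TYPE('m)))"
proof -
  interpret H: prob_space "halfsphere_uniform e" by (rule prob_space_halfsphere_uniform[OF dim e])
  interpret product_sigma_finite "\<lambda>_::'i. halfsphere_uniform e"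
    using H.sigma_finite_measure_axioms by (simp add: product_sigma_finite_def)
  let ?PI = "Pi\<^sub>M I (\<lambda>_. halfsphere_uniform e)"
  interpret PI: prob_space ?PI by (rule prob_space_PiM) (rule H.prob_space_axioms)
  have sets_eq: "sets ?PI = sets (Pi\<^sub>M I (\<lambda>_. borel))" by (rule sets_PiM_cong) simp_all
  have comp: "(\<lambda>u. u i) \<in> borel_measurable (Pi\<^sub>M I (\<lambda>_. borel :: 'a measure))" if "i \<in> I" for i
    by (rule measurable_component_singleton[OF that])
  have f0m: "(\<lambda>u. real (f0 (conv_s (u ` I)))) \<in> borel_measurable (Pi\<^sub>M I (\<lambda>_. borel :: 'a measure))"
    by (rule measurable_f0[OF I(1), of "\<lambda>k u. u k"]) (rule comp)
  define V where "V k u = (if u k \<notin> pos (u ` (I - {k})) then 1 else 0 :: real)" for k and u :: "'i \<Rightarrow> 'a"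
  have Vm: "V k \<in> borel_measurable ?PI" if "k \<in> I" for k
  proof -
    have [measurable]: "Measurable.pred (Pi\<^sub>M I (\<lambda>_. borel)) (\<lambda>u. u k \<in> pos ((\<lambda>i. u i) ` (I - {k})))"
      using that I(1) comp by (intro pred_pos) auto
    have "V k \<in> borel_measurable (Pi\<^sub>M I (\<lambda>_. borel))" unfolding V_def[abs_def] by measurable
    then show ?thesis using measurable_cong_sets[OF sets_eq refl, of "borel :: real measure"] by blast
  qed
  have V01: "0 \<le> V k u" "V k u \<le> 1" for k u by (simp_all add: V_def)
  have V_int: "integrable ?PI (V k)" if "k \<in> I" for k
    using V01 by (intro PI.integrable_const_bound[where B = 1] Vm[OF that]) auto
  have EV: "(LINT u | ?PI. V k u) = enn2real (missed_prob (I - {k}) TYPE('m))" if k: "k \<in> I" for k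
  proof -
    have I': "insert k (I - {k}) = I" "finite (I - {k})" "k \<notin> I - {k}" using k I by auto
    have "(LINT u | ?PI. V k u) = enn2real (\<integral>\<^sup>+u. ennreal (V k u) \<partial>?PI)"
      using V01 by (intro integral_eq_nn_integral Vm[OF k]) auto
    also have "(\<integral>\<^sup>+u. ennreal (V k u) \<partial>?PI) =
        (\<integral>\<^sup>+u. (\<integral>\<^sup>+x. ennreal (V k (u(k := x))) \<partial>halfsphere_uniform e) \<partial>Pi\<^sub>M (I - {k}) (\<lambda>_.
            halfsphere_uniform e))"
      using product_nn_integral_insert[OF I'(2,3), of "\<lambda>u. ennreal (V k u)"] measurable_compose[OF Vm[OF k]
          measurable_ennreal]
      unfolding I'(1) by blast
    also have "\<dots> = (\<integral>\<^sup>+u. emeasure (halfsphere_uniform e) {x. x \<notin> pos (u ` (I - {k}))} \<partial>Pi\<^sub>M (I - {k}) (\<lambda>_.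
        halfsphere_uniform e))"
    proof (rule nn_integral_cong)
      fix u :: "'i \<Rightarrow> 'a"
      let ?A = "{x. x \<notin> pos (u ` (I - {k}))}"
      have "u(k := x) ` (I - {k}) = u ` (I - {k})" for x by auto
      then have "ennreal (V k (u(k := x))) = indicator ?A x" for x by (simp add: V_def)
      moreover have "?A \<in> sets (halfsphere_uniform e)" using closed_pos_borel[OF I'(2)] by simp
      ultimately show "(\<integral>\<^sup>+x. ennreal (V k (u(k := x))) \<partial>halfsphere_uniform e)
          = emeasure (halfsphere_uniform e) ?A"
        by simp
    qed
    also have "\<dots> = missed_prob (I - {k}) TYPE('m)" by (rule nn_integral_emeasure_missed[OF dim e I'(2)])
    finally show ?thesis .
  qed
  have "(LINT w | M. real (f0 (conv_s ((\<lambda>i. X i w) ` I)))) =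
      (LINT w | M. real (f0 (conv_s ((\<lambda>i\<in>I. X i w) ` I))))"
    by (rule Bochner_Integration.integral_cong[OF refl]) simp
  also have "\<dots> = (LINT u | ?PI. real (f0 (conv_s (u ` I))))"
    by (rule expectation_random_points[OF f0m])
  also have "\<dots> = (LINT u | ?PI. (\<Sum>k\<in>I. V k u))"
  proof (rule integral_cong_AE)
    show "(\<lambda>u. real (f0 (conv_s (u ` I)))) \<in> borel_measurable ?PI"
      using f0m measurable_cong_sets[OF sets_eq refl, of "borel :: real measure"] by blast
    show "(\<lambda>u. \<Sum>k\<in>I. V k u) \<in> borel_measurable ?PI" by (rule borel_measurable_sum) (rule Vm)
    show "AE u in ?PI. real (f0 (conv_s (u ` I))) = (\<Sum>k\<in>I. V k u)"
      using AE_halfsphere_points_general_position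
    proof eventually_elim
      fix u assume "(\<forall>k\<in>I. 0 < u k \<bullet> e) \<and> (\<forall>j\<in>I. \<forall>k\<in>I. j \<noteq> k \<longrightarrow> u j \<notin> span {u k})"
      then have "f0 (conv_s (u ` I)) = card {k \<in> I. u k \<notin> pos (u ` (I - {k}))}"
        using I(1) by (intro f0_general_position[where e = e]) auto
      then show "real (f0 (conv_s (u ` I))) = (\<Sum>k\<in>I. V k u)"
        using I(1) by (simp add: V_def sum.If_cases Int_def)
    qed
  qed
  also have "\<dots> = (\<Sum>k\<in>I. (LINT u | ?PI. V k u))" by (rule Bochner_Integration.integral_sum) (rule V_int)
  also have "\<dots> = (\<Sum>k\<in>I. enn2real (missed_prob (I - {k}) TYPE('m)))" by (rule sum.cong[OF refl EV])
  finally show ?thesis .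
qed

end

lemma mass_const_eq_C_const:
  fixes e ebar :: "'a::euclidean_space"
  assumes dim: "DIM('a) = CARD('m::{finite,wellorder}) + 1"
    and e: "norm e = 1" "norm ebar = 1" "ebar \<bullet> e = 0"
  shows "mass_const TYPE('m) = C_const CARD('m) e ebar * pi ^ (CARD('m) + 1)
      * (2 / omega (CARD('m) + 1)) ^ (CARD('m) + 1) * omega CARD('m)"
proof -
  have "half_ball_const TYPE(real ^ 'm::_) = real (CARD('m) + 1) * (2 / omega (CARD('m) + 1))"
    by (simp add: half_ball_const_def omega_eq_unit_ball_vol del: of_nat_add of_nat_Suc)
  then have "half_ball_const TYPE(real ^ 'm::_) ^ (CARD('m) + 1) =
      real (CARD('m) + 1) ^ (CARD('m) + 1) * (2 / omega (CARD('m) + 1)) ^ (CARD('m) + 1)"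
    by (simp only: power_mult_distrib)
  then show ?thesis unfolding mass_const_def C_const_eq[OF dim e] by (simp only: mult_ac)
qed

theorem theorem7p1:
  fixes d :: nat
    and e ebar :: "'a::euclidean_space"
    and M :: "nat \<Rightarrow> 'w measure"
    and X :: "nat \<Rightarrow> nat \<Rightarrow> 'w \<Rightarrow> 'a"
  assumes "2 \<le> d" and "DIM('a) = d + 1"
    and "norm e = 1" and "norm ebar = 1" and "ebar \<bullet> e = 0"
    and "\<And>n. d + 1 \<le> n \<Longrightarrow> prob_space (M n)"
    and "\<And>n. d + 1 \<le> n \<Longrightarrow> prob_space.indep_vars (M n) (\<lambda>_. borel) (X n) {1..n}"
    and "\<And>n i. d + 1 \<le> n \<Longrightarrow> i \<in> {1..n} \<Longrightarrow> distr (M n) borel (X n i) = halfsphere_uniform e"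
  shows "(\<lambda>n. (LINT w | M n. measure sphere_measure (halfsphere e - conv_s ((\<lambda>i. X n i w) ` {1..n})))
             - C_const d e ebar * pi ^ (d + 1) * (2 / omega (d + 1)) ^ d * omega d * (1 / real n))
           \<in> O(\<lambda>n. 1 / real n ^ 2)
      \<and> (\<lambda>n. LINT w | M n. real (f0 (conv_s ((\<lambda>i. X n i w) ` {1..n}))))
           \<longlonglongrightarrow> C_const d e ebar * pi ^ (d + 1) * (2 / omega (d + 1)) ^ (d + 1) * omega d
      \<and> (\<forall>e' ebar' :: 'b::euclidean_space.
           DIM('b) = d + 1 \<longrightarrow> norm e' = 1 \<longrightarrow> norm ebar' = 1 \<longrightarrow> ebar' \<bullet> e' = 0 \<longrightarrow>
           C_const d e' ebar' = C_const d e ebar)"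
proof (intro conjI allI impI)
  have d: "CARD('a coord) = d" using assms(1,2) by (simp add: CARD_coord)
  have dim: "DIM('a) = CARD('a coord) + 1" by (simp only: d assms(2))
  note e = assms(3-5)
  let ?K0 = "mass_const TYPE('a coord)" and ?p = "\<lambda>K :: nat set. enn2real (missed_prob K TYPE('a coord))"
  have K0: "?K0 = C_const d e ebar * pi ^ (d + 1) * (2 / omega (d + 1)) ^ (d + 1) * omega d"
    using mass_const_eq_C_const[OF dim e] by (simp only: d)
  have K0_nonneg: "0 \<le> ?K0" by (rule mass_const_nonneg)
  have \<omega>: "0 < omega (d + 1)" by (rule omega_pos) simp
  obtain C where C: "0 \<le> C"
    and asymp: "\<And>K :: nat set. finite K \<Longrightarrow> d \<le> card K \<Longrightarrow> \<bar>?p K - ?K0 / (real (card K) + 1)\<bar>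
        \<le> C / (real (card K))\<^sup>2"
    using missed_prob_asymp[where 'm = "'a coord" and 'i = nat] unfolding d by metis
  show "(\<lambda>n. (LINT w | M n. measure sphere_measure (halfsphere e - conv_s ((\<lambda>i. X n i w) ` {1..n})))
      - C_const d e ebar * pi ^ (d + 1) * (2 / omega (d + 1)) ^ d * omega d * (1 / real n)) \<in> O(\<lambda>n. 1 / real
          n ^ 2)"
  proof (rule bigoI[where c = "omega (d + 1) / 2 * (C + ?K0)"])
    show "\<forall>\<^sub>F n in sequentially. norm ((LINT w | M n. measure sphere_measure (halfsphere e
        - conv_s ((\<lambda>i. X n i w) ` {1..n})))
        - C_const d e ebar * pi ^ (d + 1) * (2 / omega (d + 1)) ^ d * omega d * (1 / real n))
      \<le> omega (d + 1) / 2 * (C + ?K0) * norm (1 / real n ^ 2)"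
      using eventually_ge_at_top[of "d + 1"]
    proof eventually_elim
      fix n assume n: "d + 1 \<le> n"
      then have n0: "0 < real n" by simp
      have vol: "(LINT w | M n. measure sphere_measure (halfsphere e - conv_s ((\<lambda>i. X n i w) ` {1..n})))
          = omega (d + 1) / 2 * ?p {1..n}"
        using expectation_missed_volume[OF dim e(1) assms(6)[OF n] _ _ assms(7)[OF n] assms(8)[OF n]] n
        by (simp only: assms(2)) simp
      have K0': "C_const d e ebar * pi ^ (d + 1) * (2 / omega (d + 1)) ^ d * omega d
          = omega (d + 1) / 2 * ?K0"
        unfolding K0 using \<omega> by simp
      have eq: "(LINT w | M n. measure sphere_measure (halfsphere e - conv_s ((\<lambda>i. X n i w) ` {1..n})))
          - C_const d e ebar * pi ^ (d + 1) * (2 / omega (d + 1)) ^ d * omega d * (1 / real n)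
        = omega (d + 1) / 2 * (?p {1..n} - ?K0 / real n)"
        unfolding vol K0' by (simp add: right_diff_distrib)
      have bound: "\<bar>?p {1..n} - ?K0 / real n\<bar> \<le> (C + ?K0) / (real n)\<^sup>2"
      proof -
        have "?K0 / real n - ?K0 / (real n + 1) = ?K0 / (real n * (real n + 1))"
          using n0 by (simp add: field_simps)
        also have "\<dots> \<le> ?K0 / (real n)\<^sup>2"
          using n0 K0_nonneg by (intro divide_left_mono) (auto simp: power2_eq_square)
        finally have "?K0 / real n - ?K0 / (real n + 1) \<le> ?K0 / (real n)\<^sup>2" .
        moreover have "?K0 / (real n + 1) \<le> ?K0 / real n"
          using n0 K0_nonneg by (intro divide_left_mono) auto
        moreover have "\<bar>?p {1..n} - ?K0 / (real n + 1)\<bar> \<le> C / (real n)\<^sup>2"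
          using asymp[of "{1..n}"] n by simp
        ultimately show ?thesis unfolding add_divide_distrib by linarith
      qed
      show "norm ((LINT w | M n. measure sphere_measure (halfsphere e - conv_s ((\<lambda>i. X n i w) ` {1..n})))
          - C_const d e ebar * pi ^ (d + 1) * (2 / omega (d + 1)) ^ d * omega d * (1 / real n))
        \<le> omega (d + 1) / 2 * (C + ?K0) * norm (1 / real n ^ 2)"
        unfolding eq using mult_left_mono[OF bound, of "omega (d + 1) / 2"] \<omega> by (simp add: abs_mult)
    qed
  qed
  show "(\<lambda>n. LINT w | M n. real (f0 (conv_s ((\<lambda>i. X n i w) ` {1..n}))))
      \<longlonglongrightarrow> C_const d e ebar * pi ^ (d + 1) * (2 / omega (d + 1)) ^ (d + 1) * omega d"
    unfolding K0[symmetric]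
  proof (rule LIM_zero_cancel, rule Lim_null_comparison)
    show "(\<lambda>n. 4 * C / real n) \<longlonglongrightarrow> 0" by (rule lim_const_over_n)
    show "\<forall>\<^sub>F n in sequentially. norm ((LINT w | M n. real (f0 (conv_s ((\<lambda>i. X n i w) ` {1..n})))) - ?K0)
        \<le> 4 * C / real n"
      using eventually_ge_at_top[of "d + 1"]
    proof eventually_elim
      fix n assume n: "d + 1 \<le> n"
      then have n2: "2 \<le> n" "0 < real n" using assms(1) by auto
      have card_n: "card ({1..n} - {k}) = n - 1" if "k \<in> {1..n}" for k using that by simp
      have "(LINT w | M n. real (f0 (conv_s ((\<lambda>i. X n i w) ` {1..n})))) = (\<Sum>k\<in>{1..n}. ?p ({1..n} - {k}))"
        using expectation_f0[OF dim e(1) assms(6)[OF n] _ _ assms(7)[OF n] assms(8)[OF n]] n by simp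
      also have "\<dots> - ?K0 = (\<Sum>k\<in>{1..n}. ?p ({1..n} - {k}) - ?K0 / real n)"
        using n2 by (simp add: sum_subtractf)
      also have "\<bar>\<dots>\<bar> \<le> (\<Sum>k\<in>{1..n}. C / (real (n - 1))\<^sup>2)"
      proof (rule order.trans[OF sum_abs sum_mono])
        fix k assume k: "k \<in> {1..n}"
        have "real (n - 1) + 1 = real n" using n2 by simp
        then show "\<bar>?p ({1..n} - {k}) - ?K0 / real n\<bar> \<le> C / (real (n - 1))\<^sup>2"
          using asymp[of "{1..n} - {k}"] n unfolding card_n[OF k] by simp
      qed
      also have "\<dots> = C * (real n / (real (n - 1))\<^sup>2)"
        using n2 by (simp add: of_nat_diff mult.commute)
      also have "\<dots> \<le> C * (4 / real n)"
      proof (rule mult_left_mono[OF _ C])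
        have "real n \<le> 2 * real (n - 1)" using n2 by simp
        then have "(real n)\<^sup>2 \<le> (2 * real (n - 1))\<^sup>2" by (intro power_mono) auto
        then show "real n / (real (n - 1))\<^sup>2 \<le> 4 / real n"
          using n2 by (simp add: divide_simps power2_eq_square algebra_simps)
      qed
      finally show "norm ((LINT w | M n. real (f0 (conv_s ((\<lambda>i. X n i w) ` {1..n})))) - ?K0)
          \<le> 4 * C / real n"
        by (simp add: mult.commute)
    qed
  qed
  fix e' ebar' :: 'b
  assume b: "DIM('b) = d + 1" and e': "norm e' = 1" "norm ebar' = 1" "ebar' \<bullet> e' = 0"
  have "DIM('b) = CARD('a coord) + 1" by (simp only: b d)
  then show "C_const d e' ebar' = C_const d e ebar"
    using C_const_eq[OF _ e', where 'm = "'a coord"] C_const_eq[OF dim e] by (simp only: d)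
qed

end
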